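(* Let $\mathbf P$ be a finite poset, $A=\Bbbk[\mathbf P]$, $I$ an interval of $\mathbf P$, and $M\in\operatorname{mod}A$. Fix total orders on $\mathrm{sc}(I)$ and $\mathrm{sk}(I)$, choice maps $\mathbf c\colon\mathrm{sc}({\Uparrow}I)\to\mathrm{sc}(I)$ and $\mathbf d\colon\mathrm{sk}({\Downarrow}I)\to\mathrm{sk}(I)$, and a pair $(b_*,a_* )\in\mathrm{sk}(I)\times\mathrm{sc}(I)$ with $b_*\ge a_*$, and let $\boldsymbol g_1,\boldsymbol g_2,\boldsymbol g_3$ be the associated morphisms in $\bigoplus A$ (defined in the context). (1) If $M$ has a projective presentation $$\mathsf P(y)\xrightarrow{\mathsf P(\alpha)}\mathsf P(x)\to M\to0$$ for some morphism $\alpha\colon x=(x_i)_{i\in[m]}\to y=(y_j)_{j\in[n]}$ in $\bigoplus A$, then $$d_M(V_I)=\operatorname{rank}\begin{bmatrix}\mathsf P'(\boldsymbol g_1)(x)&\mathbf 0&\mathsf P'(\mathrm{sc}_1(I)\oplus\mathrm{sc}({\Uparrow}I))(\alpha)&\mathbf 0\\\mathsf P'(\boldsymbol g_3)(x)&\mathsf P'(\boldsymbol g_2)(x)&\mathbf 0&\mathsf P'(\mathrm{sk}(I))(\alpha)\end{bmatrix}-\operatorname{rank}\begin{bmatrix}\mathsf P'(\boldsymbol g_1)(x)&\mathbf 0&\mathsf P'(\mathrm{sc}_1(I)\oplus\mathrm{sc}({\Uparrow}I))(\alpha)&\mathbf 0\\\mathbf 0&\mathsf P'(\boldsymbol g_2)(x)&\mathbf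 0&\mathsf P'(\mathrm{sk}(I))(\alpha)\end{bmatrix}.$$ If $\mathbf P$ is a 2D-grid, then $\mathrm{sc}_1(I)$ may be replaced by $\mathrm{sc}_1^\circ(I)$ (with $\boldsymbol g_1$ modified accordingly). (2) Dually, if $M$ has an injective copresentation $$0\to M\to\mathsf Q(x')\xrightarrow{\mathsf Q(\alpha')}\mathsf Q(y')$$ for some morphism $\alpha'\colon y'=(y'_j)_{j\in[n']}\to x'=(x'_i)_{i\in[m']}$ in $\bigoplus A$, then $$d_M(V_I)=\operatorname{rank}\begin{bmatrix}\mathsf P(\boldsymbol g_1)(x')&\mathsf P(\boldsymbol g_3)(x')&\mathsf P(\mathrm{sc}(I))(\alpha')&\mathbf 0\\\mathbf 0&\mathsf P(\boldsymbol g_2)(x')&\mathbf 0&\mathsf P(\mathrm{sk}({\Downarrow}I)\oplus\mathrm{sk}_1(I))(\alpha')\end{bmatrix}-\operatorname{rank}\begin{bmatrix}\mathsf P(\boldsymbol g_1)(x')&\mathbf 0&\mathsf P(\mathrm{sc}(I))(\alpha')&\mathbf 0\\\mathbf 0&\mathsf P(\boldsymbol g_2)(x')&\mathbf 0&\mathsf P(\mathrm{sk}({\Downarrow}I)\oplus\mathrm{sk}_1(I))(\alpha')\end{bmatrix}.$$ If $\mathbf P$ is a 2D-grid, then $\mathrm{sk}_1(I)$ may be replaced by $\mathrm{sk}_1^\circ(I)$ (with $\boldsymbol g_2$ modified accordingly).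
   Context: $\Bbbk$ is a field. The finite poset $\mathbf P$ is a category with exactly one morphism $p_{y,x}\colon x\to y$ when $x\le y$; $A=\Bbbk[\mathbf P]$ is its $\Bbbk$-linearization ($A(x,y)=\Bbbk p_{y,x}$ if $x\le y$, $0$ otherwise). $\operatorname{mod}A$ (resp. $\operatorname{mod}A^{\mathrm{op}}$) is the category of covariant (resp. contravariant) $\Bbbk$-linear functors from $A$ to finite-dimensional vector spaces, and $D=\operatorname{Hom}_\Bbbk(-,\Bbbk)$. Intervals: nonempty connected convex full subposets $I\subseteq\mathbf P$. $V_I$: $V_I(x)=\Bbbk$ for $x\in I$, $0$ otherwise, identity structure maps inside $I$, zero otherwise. $d_M(V_I)$ is the multiplicity of the indecomposable $V_I$ in a decomposition of $M$ into indecomposables. For $U\subseteq\mathbf P$, $\mathrm{sc}(U),\mathrm{sk}(U)$ are the sets of minimal, maximal elements. ${\uparrow}x=\{y:y\ge x\}$, ${\downarrow}x=\{y:y\le x\}$, ${\uparrow}I=\bigcup_{x\in I}{\uparrow}x$, ${\downarrow}I=\bigcup_{x\in I}{\downarrow}x$, ${\Uparrow}I={\uparrow}I\setminus I$, ${\Downarrow}I={\downarrow}I\setminus I$. For a two-element subset $\mathbf a$ of a totally ordered set, $\underline{\mathbf a}=\min\mathbf a$, $\overline{\mathbf a}=\max\mathbf a$. $\mathrm{sc}_1(I)=\{\mathbf a_c=(\mathbf a,c)\mid\mathbf a\subseteq\mathrm{sc}(I),|\mathbf a|=2,c\in\mathrm{sc}({\uparrow}\underline{\mathbf a}\cap{\uparrow}\overline{\mathbf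 a})\}$, $\mathrm{sk}_1(I)=\{\mathbf b_d=(\mathbf b,d)\mid\mathbf b\subseteq\mathrm{sk}(I),|\mathbf b|=2,d\in\mathrm{sk}({\downarrow}\underline{\mathbf b}\cap{\downarrow}\overline{\mathbf b})\}$. A choice map $\mathbf c$ is any map $\mathrm{sc}({\Uparrow}I)\to\mathrm{sc}(I)$ with $\mathbf c(a')\le a'$; a choice map $\mathbf d$ is any map $\mathrm{sk}({\Downarrow}I)\to\mathrm{sk}(I)$ with $\mathbf d(b')\ge b'$. 2D-grid: $\mathbf P=G_{m,n}=\{1,\dots,m\}\times\{1,\dots,n\}$ with the product order; writing $\mathrm{sc}(I)=\{a_1,\dots,a_k\}$, $\mathrm{sk}(I)=\{b_1,\dots,b_l\}$ with increasing second coordinates, $\mathrm{sc}_1^\circ(I)=\{a_i\vee a_{i+1}\mid 1\le i<k\}$ and $\mathrm{sk}_1^\circ(I)=\{b_i\wedge b_{i+1}\mid1\le i<l\}$, regarded as the subsets of $\mathrm{sc}_1(I)$, $\mathrm{sk}_1(I)$ with $\mathbf a=\{a_i,a_{i+1}\}$, $\mathbf b=\{b_i,b_{i+1}\}$. "Modified accordingly" means only the rows of $\boldsymbol g_1$ (resp. columns of $\boldsymbol g_2$) with these indices are kept from those indexed by $\mathrm{sc}_1(I)$ (resp. $\mathrm{sk}_1(I)$). Formal additive hull $\bigoplus A$: objects are finite (possibly empty) sequences of elements of $\mathbf P$; a morphism $(x_i)_{i\in[m]}\to(y_j)_{j\in[n]}$ is a matrix $[\alpha_{ji}]_{(j,i)\in[n]\times[m]}$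 with $\alpha_{ji}\in A(x_i,y_j)$ (possibly empty); composition is matrix multiplication; $\oplus$ of objects is concatenation. Finite sets such as $\mathrm{sc}(I)$, $\mathrm{sc}_1(I)$ are viewed as objects by listing them in a fixed order (with $\mathbf a_c$ standing for $c$ and $\mathbf b_d$ for $d$). $P_x=A(x,-)$, $P'_x=A(-,x)$. $\mathsf P\colon(\bigoplus A)^{\mathrm{op}}\to\operatorname{mod}A$ sends $(x_i)_i$ to $\bigoplus_iP_{x_i}$ and a morphism to the one induced by precomposition; $\mathsf P'\colon\bigoplus A\to\operatorname{mod}A^{\mathrm{op}}$ sends $(x_i)_i$ to $\bigoplus_iP'_{x_i}$ and a morphism to the one induced by postcomposition; $\mathsf Q=D\mathsf P'$ (contravariant), so $\mathsf Q((x_i)_i)=\bigoplus_iD(A(-,x_i))$. A (co- or contravariant) functor $C$ on $A$ is extended additively to $\bigoplus A$: $C((x_i)_i)=\bigoplus_iC(x_i)$ and $C(\alpha)$ is the induced matrix of linear maps. Thus $\mathsf P'(u)(v)=\bigoplus_{k,l}A(v_l,u_k)$; for $\boldsymbol g\colon u\to w$ the map $\mathsf P'(\boldsymbol g)(v)\colon\mathsf P'(u)(v)\to\mathsf P'(w)(v)$ is postcomposition with $\boldsymbol g$; for $\alpha\colon x\to y$ the map $\mathsf P'(u)(\alpha)\colon\mathsf P'(u)(y)\to\mathsf P'(u)(x)$ is precomposition with $\alpha$. Similarly $\mathsf P(u)(v)=\bigoplus_{k,l}A(u_k,v_l)$, $\mathsf P(\boldsymbol g)(v)\colon\mathsf P(w)(v)\to\mathsf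 P(u)(v)$ is precomposition with $\boldsymbol g\colon u\to w$, and $\mathsf P(u)(\alpha)\colon\mathsf P(u)(x)\to\mathsf P(u)(y)$ is postcomposition with $\alpha\colon x\to y$. The morphisms: $\boldsymbol g_1\colon\mathrm{sc}(I)\to\mathrm{sc}_1(I)\oplus\mathrm{sc}({\Uparrow}I)$ has $(\mathbf a_c,a)$-entry $p_{c,a}$ if $a=\underline{\mathbf a}$, $-p_{c,a}$ if $a=\overline{\mathbf a}$, $0$ if $a\notin\mathbf a$, and $(a',a)$-entry $\delta_{a,\mathbf c(a')}p_{a',\mathbf c(a')}$. $\boldsymbol g_2\colon\mathrm{sk}({\Downarrow}I)\oplus\mathrm{sk}_1(I)\to\mathrm{sk}(I)$ has $(b,b')$-entry $\delta_{b,\mathbf d(b')}p_{\mathbf d(b'),b'}$ and $(b,\mathbf b_d)$-entry $p_{b,d}$ if $b=\underline{\mathbf b}$, $-p_{b,d}$ if $b=\overline{\mathbf b}$, $0$ if $b\notin\mathbf b$. $\boldsymbol g_3\colon\mathrm{sc}(I)\to\mathrm{sk}(I)$ has $(b_*,a_* )$-entry $p_{b_*,a_*}$ and all other entries $0$. Empty blocks are omitted. *)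

theory Defs
  imports "Jordan_Normal_Form.VS_Connect"
begin

text \<open>
  The field is a type \<open>'k\<close> of class \<^class>\<open>field\<close>, viewed as a ring by \<^const>\<open>class_ring\<close>; the
  finite poset is a type \<open>'p\<close> of classes \<^class>\<open>finite\<close> and \<^class>\<open>order\<close>. Vector spaces are module
  records over \<^const>\<open>class_ring\<close>, so subspaces and spaces of differing dimension may share a type.
\<close>

section \<open>Vector spaces\<close>

text \<open>The field itself if the condition holds, and the zero space otherwise.\<close>

definition line :: "bool \<Rightarrow> ('k::field, 'k) module" where
  "line b = \<lparr>carrier = (if b then UNIV else {0}), mult = (*), one = 1, zero = 0, add = (+),
             smult = (*)\<rparr>"

definition dual_space :: "('k::field, 'v) module \<Rightarrow> ('k, 'v \<Rightarrow> 'k) module" where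
  "dual_space V =
     \<lparr>carrier = {\<phi> \<in> extensional (carrier V). linear_map class_ring V (line True) \<phi>},
      mult = undefined, one = undefined,
      zero = (\<lambda>v\<in>carrier V. 0),
      add = (\<lambda>\<phi> \<psi>. \<lambda>v\<in>carrier V. \<phi> v + \<psi> v),
      smult = (\<lambda>c \<phi>. \<lambda>v\<in>carrier V. c * \<phi> v)\<rparr>"

text \<open>The transpose of a linear map with source \<open>V\<close>.\<close>

definition dual_map :: "('k::field, 'v) module \<Rightarrow> ('v \<Rightarrow> 'w) \<Rightarrow> ('w \<Rightarrow> 'k) \<Rightarrow> 'v \<Rightarrow> 'k" where
  "dual_map V f \<phi> = (\<lambda>v\<in>carrier V. \<phi> (f v))"

definition dsum :: "('k::field, 'v) module list \<Rightarrow> ('k, 'v list) module" where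
  "dsum Vs =
     \<lparr>carrier = {vs. length vs = length Vs \<and> (\<forall>i<length Vs. vs ! i \<in> carrier (Vs ! i))},
      mult = undefined, one = undefined,
      zero = map zero Vs,
      add = (\<lambda>vs ws. map (\<lambda>i. vs ! i \<oplus>\<^bsub>Vs ! i\<^esub> ws ! i) [0..<length Vs]),
      smult = (\<lambda>c vs. map (\<lambda>i. c \<odot>\<^bsub>Vs ! i\<^esub> vs ! i) [0..<length Vs])\<rparr>"

definition lin_rank :: "('k::field, 'v) module \<Rightarrow> ('k, 'w) module \<Rightarrow> ('v \<Rightarrow> 'w) \<Rightarrow> nat" where
  "lin_rank V W T = vectorspace.dim class_ring (W\<lparr>carrier := T ` carrier V\<rparr>)"

text \<open>The map given by a matrix of linear maps (a list of rows); \<open>Ws\<close> are the summands of the target.\<close>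

definition block_map ::
  "('k::field, 'w) module list \<Rightarrow> ('v \<Rightarrow> 'w) list list \<Rightarrow> 'v list \<Rightarrow> 'w list" where
  "block_map Ws T vs =
     map2 (\<lambda>W row. foldr (\<lambda>(f, v) w. f v \<oplus>\<^bsub>W\<^esub> w) (zip row vs) \<zero>\<^bsub>W\<^esub>) Ws T"

definition block_rank ::
  "('k::field, 'v) module list \<Rightarrow> ('k, 'w) module list \<Rightarrow> ('v \<Rightarrow> 'w) list list \<Rightarrow> nat" where
  "block_rank Vs Ws T = lin_rank (dsum Vs) (dsum Ws) (block_map Ws T)"

definition zero_map :: "('k, 'w) module \<Rightarrow> 'v \<Rightarrow> 'w" where
  "zero_map W v = \<zero>\<^bsub>W\<^esub>"


section \<open>The linearization of the poset and its formal additive hull\<close>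

text \<open>
  The morphism \<open>c p\<^bsub>y,x\<^esub>\<close> of the linearization is represented by the scalar \<open>c\<close>; composition is
  then multiplication of scalars.
\<close>

definition A_hom :: "'p::order \<Rightarrow> 'p \<Rightarrow> ('k::field) set" where
  "A_hom x y = carrier (line (x \<le> y))"

text \<open>The scalar representing \<open>p\<^bsub>y,x\<^esub>\<close>, which exists if \<open>x \<le> y\<close>.\<close>

definition p_gen :: "'p::order \<Rightarrow> 'p \<Rightarrow> 'k::field" where
  "p_gen y x = (if x \<le> y then 1 else 0)"

text \<open>
  The additive hull has the lists of poset elements as objects and the following matrices as
  morphisms \<open>x \<rightarrow> y\<close>; composition is the matrix product \<open>\<beta> * \<alpha>\<close>.
\<close>

definition hull_hom :: "'p::order list \<Rightarrow> 'p list \<Rightarrow> ('k::field) mat set" where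
  "hull_hom x y = {\<alpha> \<in> carrier_mat (length y) (length x).
     \<forall>j<length y. \<forall>i<length x. \<alpha> $$ (j, i) \<in> A_hom (x ! i) (y ! j)}"

definition hull_space :: "'p::order list \<Rightarrow> 'p list \<Rightarrow> ('k::field, 'k mat) module" where
  "hull_space x y = (module_mat TYPE('k) (length y) (length x))\<lparr>carrier := hull_hom x y\<rparr>"

definition single :: "'k \<Rightarrow> 'k mat" where
  "single a = mat 1 1 (\<lambda>_. a)"

text \<open>
  \<open>P_space u v\<close> is \<open>P(u)(v) = \<Oplus> A(u\<^sub>k, v\<^sub>l)\<close> and \<open>P'_space u v\<close> is \<open>P'(u)(v) = \<Oplus> A(v\<^sub>l, u\<^sub>k)\<close>, both
  realised as spaces of matrices. \<open>P_trans g\<close> is \<open>P(g)(v)\<close> and \<open>P_act \<alpha>\<close> is \<open>P(u)(\<alpha>)\<close>; the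
  formulas do not depend on \<open>v\<close> and \<open>u\<close>. Likewise for \<open>P'\<close>.
\<close>

definition P_space :: "'p::order list \<Rightarrow> 'p list \<Rightarrow> ('k::field, 'k mat) module" where
  "P_space u v = hull_space u v"

definition P_trans :: "'k::field mat \<Rightarrow> 'k mat \<Rightarrow> 'k mat" where
  "P_trans g \<beta> = \<beta> * g"

definition P_act :: "'k::field mat \<Rightarrow> 'k mat \<Rightarrow> 'k mat" where
  "P_act \<alpha> \<beta> = \<alpha> * \<beta>"

definition P'_space :: "'p::order list \<Rightarrow> 'p list \<Rightarrow> ('k::field, 'k mat) module" where
  "P'_space u v = hull_space v u"

definition P'_trans :: "'k::field mat \<Rightarrow> 'k mat \<Rightarrow> 'k mat" where
  "P'_trans g \<beta> = g * \<beta>"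

definition P'_act :: "'k::field mat \<Rightarrow> 'k mat \<Rightarrow> 'k mat" where
  "P'_act \<alpha> \<beta> = \<beta> * \<alpha>"


section \<open>Modules over the linearization\<close>

text \<open>
  A functor \<open>M\<close> on the linearization consists of spaces \<open>ob M x\<close> and, for \<open>a \<in> A(x, y)\<close>, a map
  \<open>act M x y a\<close>, which goes from \<open>ob M x\<close> to \<open>ob M y\<close> in the covariant and from \<open>ob M y\<close> to
  \<open>ob M x\<close> in the contravariant case.
\<close>

record ('p, 'k, 'v) rep =
  ob :: "'p \<Rightarrow> ('k, 'v) module"
  act :: "'p \<Rightarrow> 'p \<Rightarrow> 'k \<Rightarrow> 'v \<Rightarrow> 'v"

definition A_module :: "('p::order, 'k::field, 'v) rep \<Rightarrow> bool" where
  "A_module M \<longleftrightarrow>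
     (\<forall>x. vectorspace class_ring (ob M x) \<and> vectorspace.fin_dim class_ring (ob M x)) \<and>
     (\<forall>x y. \<forall>a\<in>A_hom x y. linear_map class_ring (ob M x) (ob M y) (act M x y a)) \<and>
     (\<forall>x. \<forall>v\<in>carrier (ob M x). act M x x 1 v = v) \<and>
     (\<forall>x y z. \<forall>a\<in>A_hom x y. \<forall>b\<in>A_hom y z. \<forall>v\<in>carrier (ob M x).
        act M x z (b * a) v = act M y z b (act M x y a v)) \<and>
     (\<forall>x y. \<forall>a\<in>A_hom x y. \<forall>b\<in>A_hom x y. \<forall>v\<in>carrier (ob M x).
        act M x y (a + b) v = act M x y a v \<oplus>\<^bsub>ob M y\<^esub> act M x y b v) \<and>
     (\<forall>x y c. \<forall>a\<in>A_hom x y. \<forall>v\<in>carrier (ob M x).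
        act M x y (c * a) v = c \<odot>\<^bsub>ob M y\<^esub> act M x y a v)"

definition rep_hom ::
  "('p::order, 'k::field, 'v) rep \<Rightarrow> ('p, 'k, 'w) rep \<Rightarrow> ('p \<Rightarrow> 'v \<Rightarrow> 'w) \<Rightarrow> bool" where
  "rep_hom M N f \<longleftrightarrow>
     (\<forall>x. linear_map class_ring (ob M x) (ob N x) (f x)) \<and>
     (\<forall>x y. \<forall>a\<in>A_hom x y. \<forall>v\<in>carrier (ob M x). f y (act M x y a v) = act N x y a (f x v))"

definition rep_iso :: "('p::order, 'k::field, 'v) rep \<Rightarrow> ('p, 'k, 'w) rep \<Rightarrow> bool" where
  "rep_iso M N \<longleftrightarrow>
     (\<exists>f. rep_hom M N f \<and> (\<forall>x. bij_betw (f x) (carrier (ob M x)) (carrier (ob N x))))"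

definition rep_zero :: "('p, 'k, 'v) rep \<Rightarrow> bool" where
  "rep_zero M \<longleftrightarrow> (\<forall>x. carrier (ob M x) = {\<zero>\<^bsub>ob M x\<^esub>})"

definition rep_dsum :: "('p, 'k::field, 'v) rep list \<Rightarrow> ('p, 'k, 'v list) rep" where
  "rep_dsum Ns =
     \<lparr>ob = (\<lambda>x. dsum (map (\<lambda>N. ob N x) Ns)),
      act = (\<lambda>x y a vs. map2 (\<lambda>N v. act N x y a v) Ns vs)\<rparr>"

text \<open>
  Since every direct summand of \<open>M\<close> is isomorphic to a submodule of \<open>M\<close>, it is enough to consider
  summands with the same underlying type as \<open>M\<close>, here and in \<open>mult_in\<close>.
\<close>

definition indecomposable :: "('p::order, 'k::field, 'v) rep \<Rightarrow> bool" where
  "indecomposable M \<longleftrightarrow> A_module M \<and> \<not> rep_zero M \<and>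
     (\<forall>N\<^sub>1 N\<^sub>2 :: ('p, 'k, 'v) rep. A_module N\<^sub>1 \<and> A_module N\<^sub>2 \<and> rep_iso M (rep_dsum [N\<^sub>1, N\<^sub>2])
        \<longrightarrow> rep_zero N\<^sub>1 \<or> rep_zero N\<^sub>2)"

text \<open>
  \<open>mult_in M L\<close> is \<open>d\<^sub>M(L)\<close>; a decomposition into indecomposables exists and, by the Krull-Schmidt
  theorem, the number does not depend on it.
\<close>

definition mult_in :: "('p::order, 'k::field, 'v) rep \<Rightarrow> ('p, 'k, 'w) rep \<Rightarrow> nat" where
  "mult_in M L =
     (THE d. \<exists>Ns :: ('p, 'k, 'v) rep list. (\<forall>N\<in>set Ns. indecomposable N) \<and>
        rep_iso M (rep_dsum Ns) \<and> d = length (filter (\<lambda>N. rep_iso N L) Ns))"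

definition interval_rep :: "'p set \<Rightarrow> ('p, 'k::field, 'k) rep" where
  "interval_rep I =
     \<lparr>ob = (\<lambda>x. line (x \<in> I)), act = (\<lambda>x y a v. if x \<in> I \<and> y \<in> I then a * v else 0)\<rparr>"

definition P_rep :: "'p::order list \<Rightarrow> ('p, 'k::field, 'k mat) rep" where
  "P_rep u = \<lparr>ob = (\<lambda>v. P_space u [v]), act = (\<lambda>v w a. P_act (single a))\<rparr>"

definition P'_rep :: "'p::order list \<Rightarrow> ('p, 'k::field, 'k mat) rep" where
  "P'_rep u = \<lparr>ob = (\<lambda>v. P'_space u [v]), act = (\<lambda>v w a. P'_act (single a))\<rparr>"

text \<open>The dual of a contravariant functor.\<close>

definition dual_rep :: "('p, 'k::field, 'v) rep \<Rightarrow> ('p, 'k, 'v \<Rightarrow> 'k) rep" where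
  "dual_rep N =
     \<lparr>ob = (\<lambda>x. dual_space (ob N x)), act = (\<lambda>x y a. dual_map (ob N y) (act N x y a))\<rparr>"

definition Q_rep :: "'p::order list \<Rightarrow> ('p, 'k::field, 'k mat \<Rightarrow> 'k) rep" where
  "Q_rep u = dual_rep (P'_rep u)"

text \<open>\<open>Q(g)(v)\<close> for a morphism \<open>g\<close> with source \<open>u\<close>.\<close>

definition Q_trans ::
  "'p::order list \<Rightarrow> 'k::field mat \<Rightarrow> 'p \<Rightarrow> ('k mat \<Rightarrow> 'k) \<Rightarrow> 'k mat \<Rightarrow> 'k" where
  "Q_trans u g v = dual_map (ob (P'_rep u) v) (P'_trans g)"

text \<open>Exactness of \<open>P(y) \<rightarrow> P(x) \<rightarrow> M \<rightarrow> 0\<close>, the first map being \<open>P(\<alpha>)\<close> for \<open>\<alpha>: x \<rightarrow> y\<close>.\<close>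

definition proj_presentation ::
  "('p::order, 'k::field, 'v) rep \<Rightarrow> 'p list \<Rightarrow> 'p list \<Rightarrow> 'k mat \<Rightarrow> bool" where
  "proj_presentation M x y \<alpha> \<longleftrightarrow> \<alpha> \<in> hull_hom x y \<and>
     (\<exists>\<pi>. rep_hom (P_rep x) M \<pi> \<and>
        (\<forall>v. P_trans \<alpha> ` carrier (ob (P_rep y :: ('p, 'k, 'k mat) rep) v)
               = {\<beta> \<in> carrier (ob (P_rep x) v). \<pi> v \<beta> = \<zero>\<^bsub>ob M v\<^esub>} \<and>
             \<pi> v ` carrier (ob (P_rep x) v) = carrier (ob M v)))"

text \<open>Exactness of \<open>0 \<rightarrow> M \<rightarrow> Q(x) \<rightarrow> Q(y)\<close>, the last map being \<open>Q(\<alpha>)\<close> for \<open>\<alpha>: y \<rightarrow> x\<close>.\<close>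

definition inj_copresentation ::
  "('p::order, 'k::field, 'v) rep \<Rightarrow> 'p list \<Rightarrow> 'p list \<Rightarrow> 'k mat \<Rightarrow> bool" where
  "inj_copresentation M x y \<alpha> \<longleftrightarrow> \<alpha> \<in> hull_hom y x \<and>
     (\<exists>\<iota>. rep_hom M (Q_rep x) \<iota> \<and>
        (\<forall>v. inj_on (\<iota> v) (carrier (ob M v)) \<and>
             \<iota> v ` carrier (ob M v)
               = {\<phi> \<in> carrier (ob (Q_rep x) v). Q_trans y \<alpha> v \<phi> = \<zero>\<^bsub>ob (Q_rep y) v\<^esub>}))"


section \<open>Combinatorics of intervals\<close>

definition interval :: "'p::order set \<Rightarrow> bool" where
  "interval I \<longleftrightarrow> I \<noteq> {} \<and>
     (\<forall>x\<in>I. \<forall>z\<in>I. \<forall>y. x \<le> y \<and> y \<le> z \<longrightarrow> y \<in> I) \<and>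
     (\<forall>x\<in>I. \<forall>y\<in>I. (x, y) \<in> {(u, v). u \<in> I \<and> v \<in> I \<and> (u \<le> v \<or> v \<le> u)}\<^sup>*)"

definition sc :: "'p::order set \<Rightarrow> 'p set" where
  "sc U = {x \<in> U. \<forall>y\<in>U. y \<le> x \<longrightarrow> y = x}"

definition sk :: "'p::order set \<Rightarrow> 'p set" where
  "sk U = {x \<in> U. \<forall>y\<in>U. x \<le> y \<longrightarrow> y = x}"

definition up :: "'p::order \<Rightarrow> 'p set" where "up x = {y. x \<le> y}"

definition down :: "'p::order \<Rightarrow> 'p set" where "down x = {y. y \<le> x}"

definition Up_out :: "'p::order set \<Rightarrow> 'p set" where
  "Up_out I = (\<Union>x\<in>I. up x) - I"

definition Down_out :: "'p::order set \<Rightarrow> 'p set" where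
  "Down_out I = (\<Union>x\<in>I. down x) - I"

text \<open>Minimum and maximum of a finite set with respect to a total order \<open>r\<close> unrelated to \<open>\<le>\<close>.\<close>

definition lo :: "('p \<times> 'p) set \<Rightarrow> 'p set \<Rightarrow> 'p" where
  "lo r a = (THE m. m \<in> a \<and> (\<forall>z\<in>a. (m, z) \<in> r))"

definition hi :: "('p \<times> 'p) set \<Rightarrow> 'p set \<Rightarrow> 'p" where
  "hi r a = (THE m. m \<in> a \<and> (\<forall>z\<in>a. (z, m) \<in> r))"

definition sc1 :: "('p::order \<times> 'p) set \<Rightarrow> 'p set \<Rightarrow> ('p set \<times> 'p) set" where
  "sc1 r I = {(a, c). a \<subseteq> sc I \<and> card a = 2 \<and> c \<in> sc (up (lo r a) \<inter> up (hi r a))}"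

definition sk1 :: "('p::order \<times> 'p) set \<Rightarrow> 'p set \<Rightarrow> ('p set \<times> 'p) set" where
  "sk1 r I = {(b, d). b \<subseteq> sk I \<and> card b = 2 \<and> d \<in> sk (down (lo r b) \<inter> down (hi r b))}"

text \<open>An isomorphism of the poset with the \<open>m\<close> by \<open>n\<close> grid.\<close>

definition grid_chart :: "nat \<Rightarrow> nat \<Rightarrow> ('p::order \<Rightarrow> nat \<times> nat) \<Rightarrow> bool" where
  "grid_chart m n \<phi> \<longleftrightarrow> bij_betw \<phi> UNIV ({1..m} \<times> {1..n}) \<and>
     (\<forall>x y. x \<le> y \<longleftrightarrow> fst (\<phi> x) \<le> fst (\<phi> y) \<and> snd (\<phi> x) \<le> snd (\<phi> y))"

definition join :: "'p::order \<Rightarrow> 'p \<Rightarrow> 'p" where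
  "join a b = (THE c. a \<le> c \<and> b \<le> c \<and> (\<forall>z. a \<le> z \<and> b \<le> z \<longrightarrow> c \<le> z))"

definition meet :: "'p::order \<Rightarrow> 'p \<Rightarrow> 'p" where
  "meet a b = (THE c. c \<le> a \<and> c \<le> b \<and> (\<forall>z. z \<le> a \<and> z \<le> b \<longrightarrow> z \<le> c))"

text \<open>\<open>b\<close> follows \<open>a\<close> immediately when \<open>S\<close> is listed with increasing second coordinates.\<close>

definition consecutive :: "('p \<Rightarrow> nat \<times> nat) \<Rightarrow> 'p set \<Rightarrow> 'p \<Rightarrow> 'p \<Rightarrow> bool" where
  "consecutive \<phi> S a b \<longleftrightarrow> a \<in> S \<and> b \<in> S \<and> snd (\<phi> a) < snd (\<phi> b) \<and>
     \<not> (\<exists>e\<in>S. snd (\<phi> a) < snd (\<phi> e) \<and> snd (\<phi> e) < snd (\<phi> b))"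

definition sc1_circ :: "('p::order \<Rightarrow> nat \<times> nat) \<Rightarrow> 'p set \<Rightarrow> ('p set \<times> 'p) set" where
  "sc1_circ \<phi> I = {({a, a'}, join a a') |a a'. consecutive \<phi> (sc I) a a'}"

definition sk1_circ :: "('p::order \<Rightarrow> nat \<times> nat) \<Rightarrow> 'p set \<Rightarrow> ('p set \<times> 'p) set" where
  "sk1_circ \<phi> I = {({b, b'}, meet b b') |b b'. consecutive \<phi> (sk I) b b'}"

definition choice_up :: "'p::order set \<Rightarrow> ('p \<Rightarrow> 'p) \<Rightarrow> bool" where
  "choice_up I c \<longleftrightarrow> (\<forall>a\<in>sc (Up_out I). c a \<in> sc I \<and> c a \<le> a)"

definition choice_down :: "'p::order set \<Rightarrow> ('p \<Rightarrow> 'p) \<Rightarrow> bool" where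
  "choice_down I d \<longleftrightarrow> (\<forall>b\<in>sk (Down_out I). d b \<in> sk I \<and> b \<le> d b)"

definition lists_set :: "'a list \<Rightarrow> 'a set \<Rightarrow> bool" where
  "lists_set l S \<longleftrightarrow> distinct l \<and> set l = S"


section \<open>The morphisms and the block matrices\<close>

text \<open>
  In the following, the lists \<open>S\<close>, \<open>S1\<close>, \<open>SU\<close> enumerate \<open>sc I\<close>, \<open>sc1 r I\<close> (or \<open>sc1_circ \<phi> I\<close>) and
  \<open>sc (Up_out I)\<close>, and the lists \<open>K\<close>, \<open>K1\<close>, \<open>KD\<close> enumerate \<open>sk I\<close>, \<open>sk1 r I\<close> (or \<open>sk1_circ \<phi> I\<close>) and
  \<open>sk (Down_out I)\<close>. The object belonging to \<open>S1\<close> is \<open>map snd S1\<close>. In every matrix the index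
  \<open>(i, j)\<close> consists of a position in the target and a position in the source.
\<close>

definition g1 ::
  "('p::order \<times> 'p) set \<Rightarrow> ('p \<Rightarrow> 'p) \<Rightarrow> 'p list \<Rightarrow> ('p set \<times> 'p) list \<Rightarrow> 'p list \<Rightarrow> 'k::field mat" where
  "g1 r c S S1 SU = mat (length S1 + length SU) (length S) (\<lambda>(i, j).
     let a = S ! j in
     if i < length S1 then
       (let (aa, c') = S1 ! i in
        if a = lo r aa then p_gen c' a else if a = hi r aa then - p_gen c' a else 0)
     else
       (let a' = SU ! (i - length S1) in if a = c a' then p_gen a' (c a') else 0))"

definition g2 ::
  "('p::order \<times> 'p) set \<Rightarrow> ('p \<Rightarrow> 'p) \<Rightarrow> 'p list \<Rightarrow> ('p set \<times> 'p) list \<Rightarrow> 'p list \<Rightarrow> 'k::field mat" where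
  "g2 r d KD K1 K = mat (length K) (length KD + length K1) (\<lambda>(i, j).
     let b = K ! i in
     if j < length KD then
       (let b' = KD ! j in if b = d b' then p_gen (d b') b' else 0)
     else
       (let (bb, d') = K1 ! (j - length KD) in
        if b = lo r bb then p_gen b d' else if b = hi r bb then - p_gen b d' else 0))"

definition g3 :: "'p::order \<Rightarrow> 'p \<Rightarrow> 'p list \<Rightarrow> 'p list \<Rightarrow> 'k::field mat" where
  "g3 b\<^sub>0 a\<^sub>0 S K = mat (length K) (length S)
     (\<lambda>(i, j). if K ! i = b\<^sub>0 \<and> S ! j = a\<^sub>0 then p_gen b\<^sub>0 a\<^sub>0 else 0)"

text \<open>
  The ranks of the block matrices for \<open>g: s \<rightarrow> t\<close>, \<open>h: d \<rightarrow> e\<close> with an arbitrary block \<open>T\<close> at the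
  position of \<open>P'(g3)(x)\<close> and \<open>P(g3)(x)\<close>, respectively.
\<close>

definition rank_proj ::
  "'p::order list \<Rightarrow> 'p list \<Rightarrow> 'p list \<Rightarrow> 'p list \<Rightarrow> 'p list \<Rightarrow> 'p list \<Rightarrow> 'k::field mat \<Rightarrow>
   'k mat \<Rightarrow> ('k mat \<Rightarrow> 'k mat) \<Rightarrow> 'k mat \<Rightarrow> nat" where
  "rank_proj s t d e x y \<alpha> g T h =
     (let Z\<^sub>1 = zero_map (P'_space t x :: ('k, 'k mat) module);
          Z\<^sub>2 = zero_map (P'_space e x :: ('k, 'k mat) module) in
      block_rank
        [P'_space s x, P'_space d x, P'_space t y, P'_space e y]
        [P'_space t x, P'_space e x]
        [[P'_trans g, Z\<^sub>1,         P'_act \<alpha>, Z\<^sub>1],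
         [T,          P'_trans h, Z\<^sub>2,       P'_act \<alpha>]])"

definition rank_inj ::
  "'p::order list \<Rightarrow> 'p list \<Rightarrow> 'p list \<Rightarrow> 'p list \<Rightarrow> 'p list \<Rightarrow> 'p list \<Rightarrow> 'k::field mat \<Rightarrow>
   'k mat \<Rightarrow> ('k mat \<Rightarrow> 'k mat) \<Rightarrow> 'k mat \<Rightarrow> nat" where
  "rank_inj s t d e x y \<alpha> g T h =
     (let Z\<^sub>1 = zero_map (P_space s x :: ('k, 'k mat) module);
          Z\<^sub>2 = zero_map (P_space d x :: ('k, 'k mat) module) in
      block_rank
        [P_space t x, P_space e x, P_space s y, P_space d y]
        [P_space s x, P_space d x]
        [[P_trans g, T,         P_act \<alpha>, Z\<^sub>1],
         [Z\<^sub>2,        P_trans h, Z\<^sub>2,      P_act \<alpha>]])"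

end

theory Submission
  imports Defs
begin

text \<open>
  The multiplicity of \<open>V\<^sub>I\<close> in \<open>M\<close> is the rank of the pairing \<open>Hom(V\<^sub>I, M) \<times> Hom(M, V\<^sub>I) \<rightarrow> k\<close> given by
  composition and evaluation at any point of \<open>I\<close>: the pairing is additive on direct sums, has rank
  \<open>1\<close> on \<open>V\<^sub>I\<close>, and vanishes on every other indecomposable, because a nonzero value splits off a copy of
  \<open>V\<^sub>I\<close>. In particular the multiplicity is well defined without the Krull-Schmidt theorem.

  A morphism \<open>V\<^sub>I \<rightarrow> M\<close> is a family of vectors of \<open>M\<close> on \<open>sc(I)\<close> that \<open>M(g\<^sub>1)\<close> kills, and a
  morphism \<open>M \<rightarrow> V\<^sub>I\<close> is a family of functionals on \<open>sk(I)\<close> that vanishes on the image of \<open>M(g\<^sub>2)\<close>.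
  The images of the two block matrices have the same projection to one of the two rows, so the
  difference of the ranks is the difference of the dimensions of the parts lying over \<open>0\<close>. For a
  projective presentation the larger one consists of the \<open>g\<^sub>3\<close>-images of lifts of the first kind of
  families, modulo the image of \<open>g\<^sub>2\<close>; the second kind of families are the functionals that vanish on
  the smaller one, and together they compute the rank of the pairing. For an injective copresentation
  the two kinds exchange their roles.
\<close>

section \<open>Vector spaces\<close>

abbreviation vspace :: "('k::field, 'v) module \<Rightarrow> bool" where
  "vspace V \<equiv> vectorspace class_ring V"

text \<open>Locale facts over \<open>class_ring\<close>, restated with the operations of the field
  so that several spaces can occur in one proof without interpretations. Items 2 to 6 (closure and
  the laws for regrouping) act together as normalization of sums, hence the frequent
  \<open>(2-6)\<close>.\<close>

lemma vs_facts:
  fixes V :: "('k::field, 'v) module"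
  assumes "vspace V"
  shows vs_zero: "\<zero>\<^bsub>V\<^esub> \<in> carrier V"
    and vs_add: "\<And>u v. u \<in> carrier V \<Longrightarrow> v \<in> carrier V \<Longrightarrow> u \<oplus>\<^bsub>V\<^esub> v \<in> carrier V"
    and vs_smult: "\<And>c v. v \<in> carrier V \<Longrightarrow> c \<odot>\<^bsub>V\<^esub> v \<in> carrier V"
    and vs_assoc: "\<And>u v w. u \<in> carrier V \<Longrightarrow> v \<in> carrier V \<Longrightarrow> w \<in> carrier V \<Longrightarrow>
      (u \<oplus>\<^bsub>V\<^esub> v) \<oplus>\<^bsub>V\<^esub> w = u \<oplus>\<^bsub>V\<^esub> (v \<oplus>\<^bsub>V\<^esub> w)"
    and vs_comm: "\<And>u v. u \<in> carrier V \<Longrightarrow> v \<in> carrier V \<Longrightarrow> u \<oplus>\<^bsub>V\<^esub> v = v \<oplus>\<^bsub>V\<^esub> u"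
    and vs_lcomm: "\<And>u v w. u \<in> carrier V \<Longrightarrow> v \<in> carrier V \<Longrightarrow> w \<in> carrier V \<Longrightarrow>
      u \<oplus>\<^bsub>V\<^esub> (v \<oplus>\<^bsub>V\<^esub> w) = v \<oplus>\<^bsub>V\<^esub> (u \<oplus>\<^bsub>V\<^esub> w)"
    and vs_l_zero: "\<And>u. u \<in> carrier V \<Longrightarrow> \<zero>\<^bsub>V\<^esub> \<oplus>\<^bsub>V\<^esub> u = u"
    and vs_r_zero: "\<And>u. u \<in> carrier V \<Longrightarrow> u \<oplus>\<^bsub>V\<^esub> \<zero>\<^bsub>V\<^esub> = u"
    and vs_ldistr: "\<And>a b v. v \<in> carrier V \<Longrightarrow> (a + b) \<odot>\<^bsub>V\<^esub> v = a \<odot>\<^bsub>V\<^esub> v \<oplus>\<^bsub>V\<^esub> b \<odot>\<^bsub>V\<^esub> v"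
    and vs_rdistr: "\<And>a u v. u \<in> carrier V \<Longrightarrow> v \<in> carrier V \<Longrightarrow>
      a \<odot>\<^bsub>V\<^esub> (u \<oplus>\<^bsub>V\<^esub> v) = a \<odot>\<^bsub>V\<^esub> u \<oplus>\<^bsub>V\<^esub> a \<odot>\<^bsub>V\<^esub> v"
    and vs_smult_smult: "\<And>a b v. v \<in> carrier V \<Longrightarrow> a \<odot>\<^bsub>V\<^esub> (b \<odot>\<^bsub>V\<^esub> v) = (a * b) \<odot>\<^bsub>V\<^esub> v"
    and vs_one: "\<And>v. v \<in> carrier V \<Longrightarrow> 1 \<odot>\<^bsub>V\<^esub> v = v"
    and vs_zero_smult: "\<And>v. v \<in> carrier V \<Longrightarrow> 0 \<odot>\<^bsub>V\<^esub> v = \<zero>\<^bsub>V\<^esub>"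
    and vs_smult_zero: "\<And>a. a \<odot>\<^bsub>V\<^esub> \<zero>\<^bsub>V\<^esub> = \<zero>\<^bsub>V\<^esub>"
proof -
  interpret vectorspace class_ring V by fact
  show "\<zero>\<^bsub>V\<^esub> \<in> carrier V" by simp
  show "\<And>u v. u \<in> carrier V \<Longrightarrow> v \<in> carrier V \<Longrightarrow> u \<oplus>\<^bsub>V\<^esub> v \<in> carrier V" by simp
  show "\<And>c v. v \<in> carrier V \<Longrightarrow> c \<odot>\<^bsub>V\<^esub> v \<in> carrier V" by (simp add: smult_closed)
  show "\<And>u v w. u \<in> carrier V \<Longrightarrow> v \<in> carrier V \<Longrightarrow> w \<in> carrier V \<Longrightarrow>
      (u \<oplus>\<^bsub>V\<^esub> v) \<oplus>\<^bsub>V\<^esub> w = u \<oplus>\<^bsub>V\<^esub> (v \<oplus>\<^bsub>V\<^esub> w)" by (simp add: M.a_assoc)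
  show "\<And>u v. u \<in> carrier V \<Longrightarrow> v \<in> carrier V \<Longrightarrow> u \<oplus>\<^bsub>V\<^esub> v = v \<oplus>\<^bsub>V\<^esub> u" by (simp add: M.a_comm)
  show "\<And>u v w. u \<in> carrier V \<Longrightarrow> v \<in> carrier V \<Longrightarrow> w \<in> carrier V \<Longrightarrow>
      u \<oplus>\<^bsub>V\<^esub> (v \<oplus>\<^bsub>V\<^esub> w) = v \<oplus>\<^bsub>V\<^esub> (u \<oplus>\<^bsub>V\<^esub> w)" by (simp add: M.a_lcomm)
  show "\<And>u. u \<in> carrier V \<Longrightarrow> \<zero>\<^bsub>V\<^esub> \<oplus>\<^bsub>V\<^esub> u = u" by simp
  show "\<And>u. u \<in> carrier V \<Longrightarrow> u \<oplus>\<^bsub>V\<^esub> \<zero>\<^bsub>V\<^esub> = u" by simp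
  show "\<And>a b v. v \<in> carrier V \<Longrightarrow> (a + b) \<odot>\<^bsub>V\<^esub> v = a \<odot>\<^bsub>V\<^esub> v \<oplus>\<^bsub>V\<^esub> b \<odot>\<^bsub>V\<^esub> v"
    using smult_l_distr by simp
  show "\<And>a u v. u \<in> carrier V \<Longrightarrow> v \<in> carrier V \<Longrightarrow>
      a \<odot>\<^bsub>V\<^esub> (u \<oplus>\<^bsub>V\<^esub> v) = a \<odot>\<^bsub>V\<^esub> u \<oplus>\<^bsub>V\<^esub> a \<odot>\<^bsub>V\<^esub> v"
    using smult_r_distr by simp
  show "\<And>a b v. v \<in> carrier V \<Longrightarrow> a \<odot>\<^bsub>V\<^esub> (b \<odot>\<^bsub>V\<^esub> v) = (a * b) \<odot>\<^bsub>V\<^esub> v"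
    using smult_assoc1 by simp
  show "\<And>v. v \<in> carrier V \<Longrightarrow> 1 \<odot>\<^bsub>V\<^esub> v = v"
    using smult_one by simp
  show "\<And>v. v \<in> carrier V \<Longrightarrow> 0 \<odot>\<^bsub>V\<^esub> v = \<zero>\<^bsub>V\<^esub>"
    using lmult_0 by simp
  show "\<And>a. a \<odot>\<^bsub>V\<^esub> \<zero>\<^bsub>V\<^esub> = \<zero>\<^bsub>V\<^esub>"
    using rmult_0 by simp
qed

text \<open>Additive inverses are supplied by (-1) v, through distributivity and the last two
  assumptions.\<close>

lemma vsI:
  fixes V :: "('k::field, 'v) module"
  assumes "\<zero>\<^bsub>V\<^esub> \<in> carrier V"
    and "\<And>u v. u \<in> carrier V \<Longrightarrow> v \<in> carrier V \<Longrightarrow> u \<oplus>\<^bsub>V\<^esub> v \<in> carrier V"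
    and "\<And>c v. v \<in> carrier V \<Longrightarrow> c \<odot>\<^bsub>V\<^esub> v \<in> carrier V"
    and "\<And>u v w. u \<in> carrier V \<Longrightarrow> v \<in> carrier V \<Longrightarrow> w \<in> carrier V \<Longrightarrow>
      (u \<oplus>\<^bsub>V\<^esub> v) \<oplus>\<^bsub>V\<^esub> w = u \<oplus>\<^bsub>V\<^esub> (v \<oplus>\<^bsub>V\<^esub> w)"
    and "\<And>u v. u \<in> carrier V \<Longrightarrow> v \<in> carrier V \<Longrightarrow> u \<oplus>\<^bsub>V\<^esub> v = v \<oplus>\<^bsub>V\<^esub> u"
    and "\<And>u. u \<in> carrier V \<Longrightarrow> \<zero>\<^bsub>V\<^esub> \<oplus>\<^bsub>V\<^esub> u = u"
    and "\<And>a b v. v \<in> carrier V \<Longrightarrow> (a + b) \<odot>\<^bsub>V\<^esub> v = a \<odot>\<^bsub>V\<^esub> v \<oplus>\<^bsub>V\<^esub> b \<odot>\<^bsub>V\<^esub> v"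
    and "\<And>a u v. u \<in> carrier V \<Longrightarrow> v \<in> carrier V \<Longrightarrow>
      a \<odot>\<^bsub>V\<^esub> (u \<oplus>\<^bsub>V\<^esub> v) = a \<odot>\<^bsub>V\<^esub> u \<oplus>\<^bsub>V\<^esub> a \<odot>\<^bsub>V\<^esub> v"
    and "\<And>a b v. v \<in> carrier V \<Longrightarrow> a \<odot>\<^bsub>V\<^esub> (b \<odot>\<^bsub>V\<^esub> v) = (a * b) \<odot>\<^bsub>V\<^esub> v"
    and "\<And>v. v \<in> carrier V \<Longrightarrow> 1 \<odot>\<^bsub>V\<^esub> v = v"
    and "\<And>v. v \<in> carrier V \<Longrightarrow> 0 \<odot>\<^bsub>V\<^esub> v = \<zero>\<^bsub>V\<^esub>"
  shows "vspace V"
proof (rule vs_criteria, rule class_field)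
  show "\<forall>v\<in>carrier V. \<exists>neg_v\<in>carrier V. v \<oplus>\<^bsub>V\<^esub> neg_v = \<zero>\<^bsub>V\<^esub>"
  proof
    fix v assume v: "v \<in> carrier V"
    have "v \<oplus>\<^bsub>V\<^esub> (- 1) \<odot>\<^bsub>V\<^esub> v = (1 + - 1) \<odot>\<^bsub>V\<^esub> v"
      by (subst assms(7)) (use v assms(10) in auto)
    then show "\<exists>neg_v\<in>carrier V. v \<oplus>\<^bsub>V\<^esub> neg_v = \<zero>\<^bsub>V\<^esub>"
      using assms(3,11) v by auto
  qed
qed (use assms in auto)

text \<open>Values outside the carrier are left free, in contrast to \<open>dual_space\<close>;
  hence the same function serves as a functional on every subspace.\<close>

definition lf :: "('k::field, 'v) module \<Rightarrow> ('v \<Rightarrow> 'k) \<Rightarrow> bool" where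
  "lf V \<phi> \<longleftrightarrow> (\<forall>u\<in>carrier V. \<forall>v\<in>carrier V. \<phi> (u \<oplus>\<^bsub>V\<^esub> v) = \<phi> u + \<phi> v) \<and>
     (\<forall>c. \<forall>v\<in>carrier V. \<phi> (c \<odot>\<^bsub>V\<^esub> v) = c * \<phi> v)"

definition sub :: "'v set \<Rightarrow> ('k::field, 'v) module \<Rightarrow> bool" where
  "sub U V \<longleftrightarrow> U \<subseteq> carrier V \<and> \<zero>\<^bsub>V\<^esub> \<in> U \<and> (\<forall>u\<in>U. \<forall>v\<in>U. u \<oplus>\<^bsub>V\<^esub> v \<in> U) \<and>
     (\<forall>c. \<forall>u\<in>U. c \<odot>\<^bsub>V\<^esub> u \<in> U)"

lemma lf_add: "lf V \<phi> \<Longrightarrow> u \<in> carrier V \<Longrightarrow> v \<in> carrier V \<Longrightarrow> \<phi> (u \<oplus>\<^bsub>V\<^esub> v) = \<phi> u + \<phi> v"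
  and lf_smult: "lf V \<phi> \<Longrightarrow> v \<in> carrier V \<Longrightarrow> \<phi> (c \<odot>\<^bsub>V\<^esub> v) = c * \<phi> v"
  by (auto simp: lf_def)

lemma lf_zero:
  assumes "vspace V" "lf V \<phi>" shows "\<phi> \<zero>\<^bsub>V\<^esub> = 0"
  using lf_smult[OF assms(2) vs_zero[OF assms(1)], of 0] vs_smult_zero[OF assms(1)] by simp

lemma subD:
  assumes "sub U V"
  shows sub_carrier: "\<And>u. u \<in> U \<Longrightarrow> u \<in> carrier V"
    and sub_zero: "\<zero>\<^bsub>V\<^esub> \<in> U"
    and sub_add: "\<And>u v. u \<in> U \<Longrightarrow> v \<in> U \<Longrightarrow> u \<oplus>\<^bsub>V\<^esub> v \<in> U"
    and sub_smult: "\<And>c u. u \<in> U \<Longrightarrow> c \<odot>\<^bsub>V\<^esub> u \<in> U"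
  using assms unfolding sub_def by auto

lemma vs_sub:
  assumes "vspace V" "sub U V" shows "vspace (V\<lparr>carrier := U\<rparr>)"
proof -
  note facts = vs_facts[OF assms(1)]
  have *: "u \<in> carrier V" if "u \<in> U" for u using that assms(2) by (auto simp: sub_def)
  show ?thesis
    by (rule vsI) (use assms(2) in \<open>auto simp: sub_def facts *\<close>)
qed

lemma lf_sub: "lf V \<phi> \<Longrightarrow> sub U V \<Longrightarrow> lf (V\<lparr>carrier := U\<rparr>) \<phi>"
  by (simp add: lf_def sub_def subset_iff)

lemma sub_ker:
  assumes "vspace V" "sub U V" "lf V \<phi>" shows "sub {u \<in> U. \<phi> u = 0} V"
  using assms(2) lf_zero[OF assms(1,3)] lf_add[OF assms(3)] lf_smult[OF assms(3)]
  by (auto simp: sub_def subset_iff)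

lemma sub_self: "vspace V \<Longrightarrow> sub (carrier V) V"
  by (auto simp: sub_def vs_facts)

text \<open>For \<open>\<phi> r = 1\<close> this is the projection onto the kernel of
  \<open>\<phi>\<close> along \<open>r\<close>. It is not normalized by \<phi> r, so that the
  formula \<psi> (proj v) = \<psi> v - \<phi> v * \<psi> r holds for every \<open>r\<close>.\<close>

definition proj :: "('k::field, 'v) module \<Rightarrow> ('v \<Rightarrow> 'k) \<Rightarrow> 'v \<Rightarrow> 'v \<Rightarrow> 'v" where
  "proj V \<phi> r v = v \<oplus>\<^bsub>V\<^esub> (- \<phi> v) \<odot>\<^bsub>V\<^esub> r"

lemma proj_facts:
  fixes V :: "('k::field, 'v) module"
  assumes V: "vspace V" and r: "r \<in> carrier V"
  shows proj_in: "v \<in> carrier V \<Longrightarrow> proj V \<phi> r v \<in> carrier V"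
    and proj_add: "lf V \<phi> \<Longrightarrow> u \<in> carrier V \<Longrightarrow> v \<in> carrier V \<Longrightarrow>
      proj V \<phi> r (u \<oplus>\<^bsub>V\<^esub> v) = proj V \<phi> r u \<oplus>\<^bsub>V\<^esub> proj V \<phi> r v"
    and proj_smult: "lf V \<phi> \<Longrightarrow> v \<in> carrier V \<Longrightarrow> proj V \<phi> r (c \<odot>\<^bsub>V\<^esub> v) = c \<odot>\<^bsub>V\<^esub> proj V \<phi> r v"
    and proj_ker: "v \<in> carrier V \<Longrightarrow> \<phi> v = 0 \<Longrightarrow> proj V \<phi> r v = v"
    and proj_lf: "lf V \<psi> \<Longrightarrow> v \<in> carrier V \<Longrightarrow> \<psi> (proj V \<phi> r v) = \<psi> v - \<phi> v * \<psi> r"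
    and proj_inv: "v \<in> carrier V \<Longrightarrow> proj V \<phi> r v \<oplus>\<^bsub>V\<^esub> \<phi> v \<odot>\<^bsub>V\<^esub> r = v"
proof -
  note f = vs_facts[OF V] and r = r
  have m: "(- (a + b)) \<odot>\<^bsub>V\<^esub> r = (- a) \<odot>\<^bsub>V\<^esub> r \<oplus>\<^bsub>V\<^esub> (- b) \<odot>\<^bsub>V\<^esub> r" for a b
    using vs_ldistr[OF V r, of "- a" "- b"] by simp
  show "v \<in> carrier V \<Longrightarrow> proj V \<phi> r v \<in> carrier V"
    using r by (simp add: proj_def f)
  show "lf V \<phi> \<Longrightarrow> u \<in> carrier V \<Longrightarrow> v \<in> carrier V \<Longrightarrow>
      proj V \<phi> r (u \<oplus>\<^bsub>V\<^esub> v) = proj V \<phi> r u \<oplus>\<^bsub>V\<^esub> proj V \<phi> r v"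
    unfolding proj_def lf_add m using r by (simp add: f(2-6))
  show "lf V \<phi> \<Longrightarrow> v \<in> carrier V \<Longrightarrow> proj V \<phi> r (c \<odot>\<^bsub>V\<^esub> v) = c \<odot>\<^bsub>V\<^esub> proj V \<phi> r v"
    using r by (simp add: proj_def lf_smult f)
  show "v \<in> carrier V \<Longrightarrow> \<phi> v = 0 \<Longrightarrow> proj V \<phi> r v = v"
    using r by (simp add: proj_def f)
  show "lf V \<psi> \<Longrightarrow> v \<in> carrier V \<Longrightarrow> \<psi> (proj V \<phi> r v) = \<psi> v - \<phi> v * \<psi> r"
    using r by (simp add: proj_def lf_add lf_smult f)
  show "v \<in> carrier V \<Longrightarrow> proj V \<phi> r v \<oplus>\<^bsub>V\<^esub> \<phi> v \<odot>\<^bsub>V\<^esub> r = v"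
    using r by (simp add: proj_def f(2-4) vs_ldistr[OF V r, symmetric]) (simp add: f)
qed

lemma proj_sub: 
  assumes "vspace V" "sub U V" "r \<in> U" "v \<in> U" shows "proj V \<phi> r v \<in> U"
  using assms by (auto simp: proj_def sub_def)

text \<open>The dual basis replaces linear combinations of vectors by identities between scalars.\<close>

definition frame :: "('k::field, 'v) module \<Rightarrow> nat \<Rightarrow> (nat \<Rightarrow> 'v) \<Rightarrow> (nat \<Rightarrow> 'v \<Rightarrow> 'k) \<Rightarrow> bool" where
  "frame V n b \<beta> \<longleftrightarrow> (\<forall>i<n. b i \<in> carrier V \<and> lf V (\<beta> i)) \<and>
     (\<forall>i<n. \<forall>j<n. \<beta> i (b j) = (if i = j then 1 else 0)) \<and>
     (\<forall>v\<in>carrier V. (\<forall>i<n. \<beta> i v = 0) \<longrightarrow> v = \<zero>\<^bsub>V\<^esub>)"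

definition has_dim :: "('k::field, 'v) module \<Rightarrow> nat \<Rightarrow> bool" where
  "has_dim V n \<longleftrightarrow> (\<exists>b \<beta>. frame V n b \<beta>)"

lemma has_dim_0: "vspace V \<Longrightarrow> has_dim V 0 \<longleftrightarrow> carrier V = {\<zero>\<^bsub>V\<^esub>}"
proof -
  assume V: "vspace V"
  have "frame V 0 b \<beta> \<longleftrightarrow> (\<forall>v\<in>carrier V. v = \<zero>\<^bsub>V\<^esub>)" for b \<beta>
    by (simp add: frame_def)
  then show ?thesis using vs_zero[OF V] by (simp add: has_dim_def) blast
qed

text \<open>V is the kernel of \<open>\<phi>\<close> plus the line of \<open>r\<close>. The
  functionals of the kernel's frame extend to V by precomposition with the projection along
  \<open>r\<close>, so they vanish at \<open>r\<close>, and \<open>\<phi>\<close> itself becomes the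
  last coordinate.\<close>

lemma has_dim_step:
  assumes V: "vspace V" and \<phi>: "lf V \<phi>" and r: "r \<in> carrier V" "\<phi> r = 1"
    and K: "has_dim (V\<lparr>carrier := {v \<in> carrier V. \<phi> v = 0}\<rparr>) n"
  shows "has_dim V (Suc n)"
proof -
  let ?K = "V\<lparr>carrier := {v \<in> carrier V. \<phi> v = 0}\<rparr>"
  obtain b \<beta> where f: "frame ?K n b \<beta>" using K by (auto simp: has_dim_def)
  let ?b = "\<lambda>i. if i = n then r else b i"
  let ?\<beta> = "\<lambda>i v. if i = n then \<phi> v else \<beta> i (proj V \<phi> r v)"
  have pK: "proj V \<phi> r v \<in> carrier ?K" if "v \<in> carrier V" for v
    using that by (simp add: proj_in[OF V r(1)] proj_lf[OF V r(1) \<phi>] r)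
  have lf: "lf V (\<lambda>v. \<beta> i (proj V \<phi> r v))" if "i < n" for i
  proof -
    have "lf ?K (\<beta> i)" using f that by (auto simp: frame_def)
    then show ?thesis
      using pK by (auto simp: lf_def proj_add[OF V r(1) \<phi>] proj_smult[OF V r(1) \<phi>])
  qed
  have bi: "b i \<in> carrier V" "\<phi> (b i) = 0" if "i < n" for i
    using f that by (auto simp: frame_def)
  have pb: "proj V \<phi> r (b i) = b i" if "i < n" for i
    by (rule proj_ker[OF V r(1)]) (use bi that in auto)
  have pr: "\<beta> i (proj V \<phi> r r) = 0" if i: "i < n" for i
  proof -
    have "proj V \<phi> r r = \<zero>\<^bsub>V\<^esub>"
      using vs_ldistr[OF V r(1), of 1 "-1"] r by (simp add: proj_def vs_facts[OF V])
    moreover have "\<beta> i \<zero>\<^bsub>?K\<^esub> = 0"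
      by (rule lf_zero[OF vs_sub[OF V sub_ker[OF V sub_self[OF V] \<phi>]]])
         (use f i in \<open>auto simp: frame_def\<close>)
    ultimately show ?thesis by simp
  qed
  have "v = \<zero>\<^bsub>V\<^esub>" if v: "v \<in> carrier V" and z: "\<forall>i<Suc n. ?\<beta> i v = 0" for v
  proof -
    have 0: "\<phi> v = 0" using z by auto
    then have "proj V \<phi> r v = v" using proj_ker[OF V r(1)] v by auto
    then have "\<forall>i<n. \<beta> i v = 0" using z by (metis less_SucI nat_neq_iff)
    then show ?thesis using f v 0 by (auto simp: frame_def)
  qed
  then have "frame V (Suc n) ?b ?\<beta>"
    unfolding frame_def using f lf r bi pb pr \<phi>
    by (auto simp: less_Suc_eq frame_def)
  then show ?thesis unfolding has_dim_def by blast
qed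

text \<open>By duality the first n vectors lie in the kernel of the last coordinate. This is the cut
  by which the following inductions lower the dimension.\<close>

lemma frame_ker:
  assumes V: "vspace V" and f: "frame V (Suc n) b \<beta>"
  shows "frame (V\<lparr>carrier := {v \<in> carrier V. \<beta> n v = 0}\<rparr>) n b \<beta>"
  using f unfolding frame_def
  by (auto simp: less_Suc_eq lf_def)

text \<open>Cut with the last coordinate: U meets the hyperplane in a space of dimension m at most
  n, and either U lies in the hyperplane or one rescaled vector of U outside it adds 1.\<close>

lemma has_dim_sub:
  assumes "vspace V" "has_dim V n" "sub U V"
  shows "\<exists>m\<le>n. has_dim (V\<lparr>carrier := U\<rparr>) m"
  using assms
proof (induction n arbitrary: V U)
  case 0
  then have "carrier V = {\<zero>\<^bsub>V\<^esub>}"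
    by (simp add: has_dim_0)
  then have "frame (V\<lparr>carrier := U\<rparr>) 0 undefined undefined"
    using 0 by (auto simp: frame_def sub_def)
  then show ?case by (auto simp: has_dim_def)
next
  case (Suc n)
  obtain b \<beta> where f: "frame V (Suc n) b \<beta>" using Suc.prems by (auto simp: has_dim_def)
  let ?\<phi> = "\<beta> n"
  let ?V = "V\<lparr>carrier := {v \<in> carrier V. ?\<phi> v = 0}\<rparr>"
  let ?U = "{u \<in> U. ?\<phi> u = 0}"
  have \<phi>: "lf V ?\<phi>" using f by (auto simp: frame_def)
  have V': "vspace ?V" by (intro vs_sub sub_ker sub_self Suc.prems \<phi>)
  have d: "has_dim ?V n" using frame_ker[OF Suc.prems(1) f] by (auto simp: has_dim_def)
  have U': "sub ?U V" by (intro sub_ker Suc.prems \<phi>)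
  then have "sub ?U ?V" by (auto simp: sub_def)
  then obtain m where m: "m \<le> n" "has_dim (V\<lparr>carrier := ?U\<rparr>) m"
    using Suc.IH[OF V' d] by auto
  show ?case
  proof (cases "?U = U")
    case True then show ?thesis using m by (auto intro: exI[of _ m])
  next
    case False
    then obtain u where u: "u \<in> U" "?\<phi> u \<noteq> 0" by auto
    let ?r = "(1 / ?\<phi> u) \<odot>\<^bsub>V\<^esub> u"
    have uV: "u \<in> carrier V" using u Suc.prems by (auto simp: sub_def)
    have r: "?r \<in> U" "?\<phi> ?r = 1"
      using u uV sub_smult[OF Suc.prems(3)] lf_smult[OF \<phi>] by auto
    have "has_dim (V\<lparr>carrier := U\<rparr>) (Suc m)"
      by (rule has_dim_step[where \<phi> = "?\<phi>" and r = "?r"])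
         (use m r Suc.prems \<phi> in \<open>auto intro: vs_sub lf_sub\<close>)
    then show ?thesis using m by auto
  qed
qed

text \<open>Induction on the dimension: project to the kernel of the last coordinate, separate
  there, and precompose with the projection. The vector along which to project has to be chosen so
  that U is preserved and v stays outside U.\<close>

lemma separation:
  assumes "vspace V" "has_dim V n" "sub U V" "v \<in> carrier V" "v \<notin> U"
  shows "\<exists>\<phi>. lf V \<phi> \<and> (\<forall>u\<in>U. \<phi> u = 0) \<and> \<phi> v = 1"
  using assms
proof (induction n arbitrary: V U v)
  case 0
  then have "carrier V = {\<zero>\<^bsub>V\<^esub>}"
    by (simp add: has_dim_0)
  then show ?case using 0 by (auto simp: sub_def)
next
  case (Suc n)
  note V = Suc.prems(1) and U = Suc.prems(3) and v = Suc.prems(4,5)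
  obtain b \<beta> where f: "frame V (Suc n) b \<beta>" using Suc.prems by (auto simp: has_dim_def)
  let ?\<phi> = "\<beta> n"
  let ?V = "V\<lparr>carrier := {v \<in> carrier V. ?\<phi> v = 0}\<rparr>"
  let ?U = "{u \<in> U. ?\<phi> u = 0}"
  have \<phi>: "lf V ?\<phi>" using f by (auto simp: frame_def)
  have V': "vspace ?V" by (intro vs_sub sub_ker sub_self Suc.prems \<phi>)
  have d: "has_dim ?V n" using frame_ker[OF Suc.prems(1) f] by (auto simp: has_dim_def)
  have U': "sub ?U V" by (intro sub_ker Suc.prems \<phi>)
  then have U'': "sub ?U ?V" by (auto simp: sub_def)
  show ?case
  proof (cases "(\<forall>u\<in>U. ?\<phi> u = 0) \<and> ?\<phi> v \<noteq> 0")
    case True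
    then have "lf V (\<lambda>w. ?\<phi> w / ?\<phi> v) \<and> (\<forall>u\<in>U. ?\<phi> u / ?\<phi> v = 0) \<and> ?\<phi> v / ?\<phi> v = 1"
      using \<phi> by (auto simp: lf_def add_divide_distrib)
    then show ?thesis by blast
  next
    case False
    \<comment> \<open>\<open>r\<close> is taken inside U as soon as the coordinate is nonzero
      somewhere on U. Otherwise the coordinate vanishes on U and, by the excluded case, also at v,
      so that the projection fixes U and v.\<close>
    obtain r where r: "r \<in> carrier V" "?\<phi> r = 1" and rU: "\<not> (\<forall>u\<in>U. ?\<phi> u = 0) \<Longrightarrow> r \<in> U"
    proof (cases "\<forall>u\<in>U. ?\<phi> u = 0")
      case True
      then show ?thesis using f by (intro that[of "b n"]) (auto simp: frame_def)
    next
      case False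
      then obtain u where u: "u \<in> U" "?\<phi> u \<noteq> 0" by auto
      let ?r = "(1 / ?\<phi> u) \<odot>\<^bsub>V\<^esub> u"
      have uV: "u \<in> carrier V" using u Suc.prems by (auto simp: sub_def)
      have "?r \<in> U" "?\<phi> ?r = 1"
        using u uV sub_smult[OF U] lf_smult[OF \<phi>] by auto
      then show ?thesis using that U by (auto simp: sub_def)
    qed
    let ?p = "proj V ?\<phi> r"
    have pV: "?p w \<in> carrier ?V" if "w \<in> carrier V" for w
      using that by (simp add: proj_in[OF V r(1)] proj_lf[OF V r(1) \<phi>] r)
    have pU: "?p w \<in> ?U" if "w \<in> U" for w
    proof (cases "\<forall>u\<in>U. ?\<phi> u = 0")
      case True
      then have "?p w = w" "?\<phi> w = 0"
        using that proj_ker[OF V r(1) sub_carrier[OF U that], of ?\<phi>] by auto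
      then show ?thesis using that by simp
    next
      case False
      then have "?p w \<in> U" by (intro proj_sub[OF V U _ that] rU)
      then show ?thesis using pV[OF sub_carrier[OF U that]] by simp
    qed
    have "?p v \<notin> U"
    proof
      assume p: "?p v \<in> U"
      show False
      proof (cases "\<forall>u\<in>U. ?\<phi> u = 0")
        case True
        then have "?p v = v" using False proj_ker[OF V r(1) v(1)] by auto
        then show False using p v(2) by simp
      next
        case F: False
        then have "?p v \<oplus>\<^bsub>V\<^esub> ?\<phi> v \<odot>\<^bsub>V\<^esub> r \<in> U"
          by (intro sub_add[OF U p] sub_smult[OF U] rU)
        then show False using proj_inv[OF V r(1) v(1)] v(2) by simp
      qed
    qed
    then obtain \<psi> where \<psi>: "lf ?V \<psi>" "\<forall>u\<in>?U. \<psi> u = 0" "\<psi> (?p v) = 1"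
      using Suc.IH[OF V' d U'', of "?p v"] pV[OF v(1)] by auto
    have "lf V (\<lambda>w. \<psi> (?p w))"
      using pV \<psi>(1) by (auto simp: lf_def proj_add[OF V r(1) \<phi>] proj_smult[OF V r(1) \<phi>])
    moreover have "\<forall>u\<in>U. \<psi> (?p u) = 0" using pU \<psi>(2) by blast
    ultimately show ?thesis using \<psi>(3) by blast
  qed
qed

section \<open>Linear maps, and the comparison of frames with the library's dimension\<close>

lemma linear_mapI:
  fixes V :: "('k::field, 'v) module" and W :: "('k, 'w) module"
  assumes "vspace V" "vspace W" "\<And>v. v \<in> carrier V \<Longrightarrow> f v \<in> carrier W"
    and "\<And>u v. u \<in> carrier V \<Longrightarrow> v \<in> carrier V \<Longrightarrow> f (u \<oplus>\<^bsub>V\<^esub> v) = f u \<oplus>\<^bsub>W\<^esub> f v"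
    and "\<And>c v. v \<in> carrier V \<Longrightarrow> f (c \<odot>\<^bsub>V\<^esub> v) = c \<odot>\<^bsub>W\<^esub> f v"
  shows "linear_map class_ring V W f"
  unfolding linear_map_def mod_hom_def mod_hom_axioms_def LinearCombinations.module_hom_def
  using assms by (auto simp: vectorspace_def)

lemma linear_mapD:
  fixes V :: "('k::field, 'v) module" and W :: "('k, 'w) module"
  assumes "linear_map class_ring V W f"
  shows linear_map_source: "vspace V" and linear_map_target: "vspace W"
    and linear_map_in: "\<And>v. v \<in> carrier V \<Longrightarrow> f v \<in> carrier W"
    and linear_map_add: "\<And>u v. u \<in> carrier V \<Longrightarrow> v \<in> carrier V \<Longrightarrow> f (u \<oplus>\<^bsub>V\<^esub> v) = f u \<oplus>\<^bsub>W\<^esub> f v"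
    and linear_map_smult: "\<And>c v. v \<in> carrier V \<Longrightarrow> f (c \<odot>\<^bsub>V\<^esub> v) = c \<odot>\<^bsub>W\<^esub> f v"
  using assms
  unfolding linear_map_def mod_hom_def mod_hom_axioms_def LinearCombinations.module_hom_def
  by auto

lemma linear_map_zero:
  fixes V :: "('k::field, 'v) module" and W :: "('k, 'w) module"
  assumes "linear_map class_ring V W f" shows "f \<zero>\<^bsub>V\<^esub> = \<zero>\<^bsub>W\<^esub>"
  using linear_map_smult[OF assms vs_zero[OF linear_map_source[OF assms]], of 0]
  by (simp add: vs_smult_zero[OF linear_map_source[OF assms]] vs_zero_smult[OF linear_map_target[OF assms]]
      linear_map_in[OF assms] vs_zero[OF linear_map_source[OF assms]])

lemma linear_map_lf:
  fixes V :: "('k::field, 'v) module" and W :: "('k, 'w) module"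
  assumes "linear_map class_ring V W f" "lf W \<phi>" shows "lf V (\<lambda>v. \<phi> (f v))"
  using linear_mapD[OF assms(1)] lf_add[OF assms(2)] lf_smult[OF assms(2)] by (simp add: lf_def)

lemma lf_sum: "(\<And>i. i < n \<Longrightarrow> lf V (\<phi> i)) \<Longrightarrow> lf V (\<lambda>v. \<Sum>i<n::nat. \<phi> i v)"
  by (simp add: lf_def sum.distrib sum_distrib_left)

lemma lf_scale: "lf V \<phi> \<Longrightarrow> lf V (\<lambda>v. c * \<phi> v)"
  by (simp add: lf_def algebra_simps)

text \<open>Sums of vectors by recursion, so that \<open>lc_lf\<close> turns them into ordinary sums
  of scalars by a plain induction.\<close>

primrec lc :: "('k::field, 'v) module \<Rightarrow> (nat \<Rightarrow> 'v) \<Rightarrow> (nat \<Rightarrow> 'k) \<Rightarrow> nat \<Rightarrow> 'v" where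
  "lc V b c 0 = \<zero>\<^bsub>V\<^esub>"
| "lc V b c (Suc n) = lc V b c n \<oplus>\<^bsub>V\<^esub> c n \<odot>\<^bsub>V\<^esub> b n"

lemma lc_in:
  assumes "vspace V" "\<And>i. i < n \<Longrightarrow> b i \<in> carrier V" shows "lc V b c n \<in> carrier V"
  using assms(2) by (induction n) (auto simp: vs_facts[OF assms(1)])

lemma lc_lf:
  assumes "vspace V" "lf V \<phi>" "\<And>i. i < n \<Longrightarrow> b i \<in> carrier V"
  shows "\<phi> (lc V b c n) = (\<Sum>i<n. c i * \<phi> (b i))"
  using assms(3)
  by (induction n)
     (auto simp: vs_facts[OF assms(1)] lf_add[OF assms(2)] lf_smult[OF assms(2)] lc_in[OF assms(1)]
        lf_zero[OF assms(1,2)])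

lemma frame_lc:
  assumes "vspace V" "frame V n b \<beta>" "i < n"
  shows "\<beta> i (lc V b c n) = c i"
proof -
  have "\<beta> i (lc V b c n) = (\<Sum>j<n. c j * \<beta> i (b j))"
    by (rule lc_lf) (use assms in \<open>auto simp: frame_def\<close>)
  also have "\<dots> = (\<Sum>j<n. if i = j then c j else 0)"
    by (rule sum.cong) (use assms in \<open>auto simp: frame_def\<close>)
  finally show ?thesis using assms(3) by simp
qed

lemma frame_eqI:
  assumes V: "vspace V" and f: "frame V n b \<beta>" and u: "u \<in> carrier V" and v: "v \<in> carrier V"
    and eq: "\<And>i. i < n \<Longrightarrow> \<beta> i u = \<beta> i v"
  shows "u = v"
proof -
  note facts = vs_facts[OF V]
  let ?d = "u \<oplus>\<^bsub>V\<^esub> (- 1) \<odot>\<^bsub>V\<^esub> v"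
  have "\<beta> i ?d = 0" if "i < n" for i
    using f eq[OF that] that u v by (auto simp: frame_def lf_def facts)
  then have d: "?d = \<zero>\<^bsub>V\<^esub>"
    using f u v by (auto simp: frame_def facts)
  have "?d \<oplus>\<^bsub>V\<^esub> v = u \<oplus>\<^bsub>V\<^esub> ((- 1) \<odot>\<^bsub>V\<^esub> v \<oplus>\<^bsub>V\<^esub> 1 \<odot>\<^bsub>V\<^esub> v)"
    using u v by (simp add: facts(2-4) vs_one[OF V])
  also have "\<dots> = u"
    using u v by (simp only: vs_ldistr[OF V v, symmetric]) (simp add: facts)
  finally show "u = v" using d v by (simp add: facts)
qed

lemma frame_expand:
  assumes "vspace V" "frame V n b \<beta>" "v \<in> carrier V"
  shows "lc V b (\<lambda>i. \<beta> i v) n = v"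
  by (rule frame_eqI[OF assms(1,2)])
     (use assms in \<open>auto simp: frame_lc frame_def intro!: lc_in\<close>)

text \<open>The coordinates of a frame give an isomorphism with the space of vectors of length n,
  whose dimension is known. As a consequence the length of a frame depends only on the
  space.\<close>

lemma has_dim_imp:
  fixes V :: "('k::field, 'v) module"
  assumes V: "vspace V" and "has_dim V n"
  shows has_dim_fin_dim: "vectorspace.fin_dim class_ring V"
    and has_dim_dim: "vectorspace.dim class_ring V = n"
proof -
  obtain b \<beta> where f: "frame V n b \<beta>" using assms by (auto simp: has_dim_def)
  have b: "b i \<in> carrier V" if "i < n" for i using f that by (auto simp: frame_def)
  let ?N = "module_vec TYPE('k) n"
  let ?S = "\<lambda>w. lc V b (($) w) n"
  have car: "carrier ?N = carrier_vec n" "add ?N = (+)" "smult ?N = (\<cdot>\<^sub>v)"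
    by (simp_all add: module_vec_simps)
  have \<beta>: "lf V (\<beta> i)" if "i < n" for i using f that by (auto simp: frame_def)
  have lcI: "lc V b c n \<in> carrier V" for c by (rule lc_in[OF V b])
  have S: "linear_map class_ring ?N V ?S"
  proof (rule linear_mapI[OF vec_vs V])
    fix v assume "v \<in> carrier ?N"
    show "?S v \<in> carrier V" using b by (rule lc_in[OF V])
  next
    fix u v assume uv: "u \<in> carrier ?N" "v \<in> carrier ?N"
    show "?S (u \<oplus>\<^bsub>?N\<^esub> v) = ?S u \<oplus>\<^bsub>V\<^esub> ?S v"
      by (rule frame_eqI[OF V f])
         (use uv b in \<open>auto simp: frame_lc[OF V f] lf_add[OF \<beta>] car lcI vs_add[OF V] vs_smult[OF V]\<close>)
  next
    fix c v assume v: "v \<in> carrier ?N"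
    show "?S (c \<odot>\<^bsub>?N\<^esub> v) = c \<odot>\<^bsub>V\<^esub> ?S v"
      by (rule frame_eqI[OF V f])
         (use v b in \<open>auto simp: frame_lc[OF V f] lf_smult[OF \<beta>] car lcI vs_add[OF V] vs_smult[OF V]\<close>)
  qed
  have inj: "inj_on ?S (carrier ?N)"
  proof (rule inj_onI)
    fix u v assume uv: "u \<in> carrier ?N" "v \<in> carrier ?N" "?S u = ?S v"
    have "u $ i = v $ i" if "i < n" for i
      using frame_lc[OF V f that, of "($) u"] frame_lc[OF V f that, of "($) v"] uv(3) by simp
    then show "u = v" using uv by (auto simp: car)
  qed
  have surj: "?S ` carrier ?N = carrier V"
  proof
    show "?S ` carrier ?N \<subseteq> carrier V" using linear_map_in[OF S] by auto
    show "carrier V \<subseteq> ?S ` carrier ?N"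
    proof
      fix v assume v: "v \<in> carrier V"
      let ?w = "vec n (\<lambda>i. \<beta> i v)"
      have "?S ?w = v"
        by (rule frame_eqI[OF V f])
           (use v b in \<open>auto simp: frame_lc[OF V f] intro!: lc_in[OF V]\<close>)
      moreover have "?w \<in> carrier ?N" by (simp add: car)
      ultimately show "v \<in> ?S ` carrier ?N" by (metis imageI)
    qed
  qed
  show "vectorspace.fin_dim class_ring V"
    by (rule linear_map.surj_fin_dim[OF S vec_space.fin_dim surj])
  show "vectorspace.dim class_ring V = n"
    using linear_map.dim_eq[OF S vec_space.fin_dim inj surj] by (simp add: vec_space.dim_is_n)
qed

text \<open>Induction over a finite generating set. A generator outside the span so far adds a line,
  and the coefficient of that generator is a functional whose kernel is the old span, so
  \<open>has_dim_step\<close> applies.\<close>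

lemma fin_dim_imp_has_dim:
  fixes V :: "('k::field, 'v) module"
  assumes V: "vspace V" and fd: "vectorspace.fin_dim class_ring V"
  shows "has_dim V (vectorspace.dim class_ring V)"
proof -
  interpret vectorspace class_ring V by fact
  note facts = vs_facts[OF V]
  have span_sub: "sub (span A) V" if "A \<subseteq> carrier V" for A
    using span_is_submodule[OF that] by (auto simp: sub_def submodule_def)
  have "\<exists>n. has_dim (V\<lparr>carrier := span A\<rparr>) n" if "finite A" "A \<subseteq> carrier V" for A
    using that
  proof (induction A)
    case empty
    have "has_dim (V\<lparr>carrier := span {}\<rparr>) 0"
      by (subst has_dim_0[OF vs_sub[OF V]]) (auto simp: span_empty sub_def facts)
    then show ?case by blast
  next
    case (insert a A)
    then have a: "a \<in> carrier V" and A: "A \<subseteq> carrier V" by auto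
    obtain n where n: "has_dim (V\<lparr>carrier := span A\<rparr>) n" using insert A by auto
    let ?U = "span A" and ?W = "span (insert a A)"
    have U: "sub ?U V" and W: "sub ?W V" using span_sub a A by auto
    show ?case
    proof (cases "a \<in> ?U")
      case True
      then have "span A = ?W" using already_in_span[OF A True] by simp
      then show ?thesis using n by auto
    next
      case False
      \<comment> \<open>The sums u + c a form a submodule that contains all generators, so they
        exhaust the new span.\<close>
      let ?T = "{u \<oplus>\<^bsub>V\<^esub> c \<odot>\<^bsub>V\<^esub> a |u c. u \<in> ?U}"
      have T: "\<exists>c. \<exists>u\<in>?U. v = u \<oplus>\<^bsub>V\<^esub> c \<odot>\<^bsub>V\<^esub> a" if "v \<in> ?W" for v
      proof -
        have TV: "?T \<subseteq> carrier V" using a sub_carrier[OF U] by (auto simp: facts)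
        have "submodule class_ring ?T V"
        proof (unfold_locales)
          show "?T \<subseteq> carrier V" by fact
          show "\<zero>\<^bsub>V\<^esub> \<in> ?T"
            using sub_zero[OF U] a by (auto intro!: exI[of _ "\<zero>\<^bsub>V\<^esub>"] exI[of _ 0] simp: facts)
          show "v \<oplus>\<^bsub>V\<^esub> w \<in> ?T" if vw: "v \<in> ?T" "w \<in> ?T" for v w
          proof -
            from vw obtain u c u' c' where *: "v = u \<oplus>\<^bsub>V\<^esub> c \<odot>\<^bsub>V\<^esub> a" "w = u' \<oplus>\<^bsub>V\<^esub> c' \<odot>\<^bsub>V\<^esub> a" "u \<in> ?U" "u' \<in> ?U"
              by auto
            have "v \<oplus>\<^bsub>V\<^esub> w = (u \<oplus>\<^bsub>V\<^esub> u') \<oplus>\<^bsub>V\<^esub> (c + c') \<odot>\<^bsub>V\<^esub> a"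
              using * a sub_carrier[OF U] by (simp add: vs_ldistr[OF V a] facts(2-6))
            then show ?thesis using sub_add[OF U *(3,4)] by blast
          qed
          show "k \<odot>\<^bsub>V\<^esub> v \<in> ?T" if "v \<in> ?T" for k v
          proof -
            from that obtain u c where *: "v = u \<oplus>\<^bsub>V\<^esub> c \<odot>\<^bsub>V\<^esub> a" "u \<in> ?U" by auto
            have "k \<odot>\<^bsub>V\<^esub> v = k \<odot>\<^bsub>V\<^esub> u \<oplus>\<^bsub>V\<^esub> (k * c) \<odot>\<^bsub>V\<^esub> a"
              using * a sub_carrier[OF U] by (simp add: facts)
            then show ?thesis using sub_smult[OF U *(2)] by blast
          qed
        qed
        moreover have "insert a A \<subseteq> ?T"
        proof -
          have "a \<in> ?T" using sub_zero[OF U] a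
            by (auto intro!: exI[of _ "\<zero>\<^bsub>V\<^esub>"] exI[of _ 1] simp: facts)
          moreover have "x \<in> ?T" if "x \<in> A" for x
          proof -
            have "x \<in> ?U" using in_own_span[OF A] that by auto
            moreover have "x = x \<oplus>\<^bsub>V\<^esub> 0 \<odot>\<^bsub>V\<^esub> a" using that A a by (auto simp: facts)
            ultimately show ?thesis by blast
          qed
          ultimately show ?thesis by blast
        qed
        ultimately have "?W \<subseteq> ?T" by (intro span_is_subset)
        then show ?thesis using that by blast
      qed
      \<comment> \<open>A relation with two different coefficients could be solved for
        \<open>a\<close>, which would put \<open>a\<close> into the old span.\<close>
      have uniq: "c = c' \<and> u = u'" if e: "u \<oplus>\<^bsub>V\<^esub> c \<odot>\<^bsub>V\<^esub> a = u' \<oplus>\<^bsub>V\<^esub> c' \<odot>\<^bsub>V\<^esub> a" and u: "u \<in> ?U" "u' \<in> ?U"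
        for c c' u u'
      proof -
        have uV: "u \<in> carrier V" "u' \<in> carrier V" using u sub_carrier[OF U] by auto
        have r: "x \<oplus>\<^bsub>V\<^esub> k \<odot>\<^bsub>V\<^esub> a \<oplus>\<^bsub>V\<^esub> (- h) \<odot>\<^bsub>V\<^esub> a = x \<oplus>\<^bsub>V\<^esub> (k - h) \<odot>\<^bsub>V\<^esub> a" if "x \<in> carrier V" for x k h
          using that a vs_ldistr[OF V a, of k "- h"] by (simp add: facts(2-4))
        have "c = c'"
        proof (rule ccontr)
          assume ne: "c \<noteq> c'"
          have "u \<oplus>\<^bsub>V\<^esub> (c - c') \<odot>\<^bsub>V\<^esub> a = u'"
            using r[OF uV(1), of c c'] r[OF uV(2), of c' c'] e uV a by (simp add: facts)
          then have "(- 1) \<odot>\<^bsub>V\<^esub> u \<oplus>\<^bsub>V\<^esub> (u \<oplus>\<^bsub>V\<^esub> (c - c') \<odot>\<^bsub>V\<^esub> a) \<in> ?U"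
            using u sub_add[OF U] sub_smult[OF U] by auto
          moreover have "(- 1) \<odot>\<^bsub>V\<^esub> u \<oplus>\<^bsub>V\<^esub> (u \<oplus>\<^bsub>V\<^esub> (c - c') \<odot>\<^bsub>V\<^esub> a) = (c - c') \<odot>\<^bsub>V\<^esub> a"
            using uV a vs_ldistr[OF V uV(1), of "-1" 1]
            by (simp add: facts(1-4) facts(7) vs_one[OF V] vs_zero_smult[OF V] flip: facts(4))
          ultimately have "(1 / (c - c')) \<odot>\<^bsub>V\<^esub> ((c - c') \<odot>\<^bsub>V\<^esub> a) \<in> ?U"
            using sub_smult[OF U] by auto
          then show False using False ne a by (simp add: facts)
        qed
        moreover have "u = u'"
          using r[OF uV(1), of c c'] r[OF uV(2), of c' c'] e uV a \<open>c = c'\<close> by (simp add: facts)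
        ultimately show ?thesis by simp
      qed
      \<comment> \<open>The coefficient function is merely chosen here; \<open>uniq\<close>
        determines its values (\<open>kI\<close>) and thereby makes it linear.\<close>
      obtain k where k: "\<And>v. v \<in> ?W \<Longrightarrow> \<exists>u\<in>?U. v = u \<oplus>\<^bsub>V\<^esub> k v \<odot>\<^bsub>V\<^esub> a"
        using T by metis
      have kI: "k (u \<oplus>\<^bsub>V\<^esub> c \<odot>\<^bsub>V\<^esub> a) = c" if "u \<in> ?U" "u \<oplus>\<^bsub>V\<^esub> c \<odot>\<^bsub>V\<^esub> a \<in> ?W" for u c
        using k[OF that(2)] uniq that(1) by metis
      let ?WV = "V\<lparr>carrier := ?W\<rparr>"
      have "lf ?WV k"
        unfolding lf_def
      proof (intro conjI ballI allI; simp)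
        fix v w assume vw: "v \<in> ?W" "w \<in> ?W"
        obtain u u' where u: "u \<in> ?U" "u' \<in> ?U" "v = u \<oplus>\<^bsub>V\<^esub> k v \<odot>\<^bsub>V\<^esub> a" "w = u' \<oplus>\<^bsub>V\<^esub> k w \<odot>\<^bsub>V\<^esub> a"
          using k vw by metis
        have "v \<oplus>\<^bsub>V\<^esub> w = (u \<oplus>\<^bsub>V\<^esub> k v \<odot>\<^bsub>V\<^esub> a) \<oplus>\<^bsub>V\<^esub> (u' \<oplus>\<^bsub>V\<^esub> k w \<odot>\<^bsub>V\<^esub> a)" using u by simp
        also have "\<dots> = (u \<oplus>\<^bsub>V\<^esub> u') \<oplus>\<^bsub>V\<^esub> (k v + k w) \<odot>\<^bsub>V\<^esub> a"
          using u(1,2) a sub_carrier[OF U] by (simp add: vs_ldistr[OF V a] facts(2-6))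
        finally show "k (v \<oplus>\<^bsub>V\<^esub> w) = k v + k w"
          using kI[OF sub_add[OF U u(1,2)]] sub_add[OF W vw] by metis
      next
        fix c v assume v: "v \<in> ?W"
        obtain u where u: "u \<in> ?U" "v = u \<oplus>\<^bsub>V\<^esub> k v \<odot>\<^bsub>V\<^esub> a" using k v by metis
        have "c \<odot>\<^bsub>V\<^esub> v = c \<odot>\<^bsub>V\<^esub> (u \<oplus>\<^bsub>V\<^esub> k v \<odot>\<^bsub>V\<^esub> a)" using u by simp
        also have "\<dots> = c \<odot>\<^bsub>V\<^esub> u \<oplus>\<^bsub>V\<^esub> (c * k v) \<odot>\<^bsub>V\<^esub> a"
          using u(1) a sub_carrier[OF U] by (simp add: facts)
        finally show "k (c \<odot>\<^bsub>V\<^esub> v) = c * k v"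
          using kI[OF sub_smult[OF U u(1)]] sub_smult[OF W v] by metis
      qed
      moreover have UW: "?U \<subseteq> ?W" using span_is_monotone[of A "insert a A"] by auto
      have aW: "a \<in> ?W" using in_own_span[of "insert a A"] a A by auto
      moreover have "k a = 1"
        using kI[OF sub_zero[OF U], of 1] a aW by (simp add: facts)
      moreover have "{v \<in> ?W. k v = 0} = ?U"
      proof -
        have "v \<in> ?U" if v: "v \<in> ?W" "k v = 0" for v
        proof -
          obtain u where "u \<in> ?U" "v = u \<oplus>\<^bsub>V\<^esub> 0 \<odot>\<^bsub>V\<^esub> a" using k[OF v(1)] v(2) by auto
          then show ?thesis using a sub_carrier[OF U] by (simp add: facts)
        qed
        moreover have "k u = 0" if "u \<in> ?U" for u
        proof -
          have "u \<oplus>\<^bsub>V\<^esub> 0 \<odot>\<^bsub>V\<^esub> a = u" using that sub_carrier[OF U] a by (simp add: facts)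
          then show ?thesis using kI[OF that, of 0] UW that by auto
        qed
        ultimately show ?thesis using UW by blast
      qed
      ultimately have "has_dim ?WV (Suc n)"
        by (intro has_dim_step[where \<phi> = k and r = a]) (use n vs_sub[OF V W] in simp_all)
      then show ?thesis by blast
    qed
  qed
  moreover obtain A where "finite A" "A \<subseteq> carrier V" "span A = carrier V"
    using fd unfolding fin_dim_def by blast
  ultimately obtain n where "has_dim V n" by fastforce
  then show ?thesis using has_dim_dim[OF V] by auto
qed

section \<open>Comparing the dimensions of two subspaces with a common projection\<close>

text \<open>Iterates \<open>has_dim_step\<close>, cutting with the last functional: duality puts the
  remaining vectors \<open>r i\<close> into its kernel.\<close>

lemma has_dim_glue:
  assumes "vspace V" "\<And>i. i < l \<Longrightarrow> lf V (\<phi> i) \<and> r i \<in> carrier V"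
    and "\<And>i j. i < l \<Longrightarrow> j < l \<Longrightarrow> \<phi> i (r j) = (if i = j then 1 else 0)"
    and "has_dim (V\<lparr>carrier := {v \<in> carrier V. \<forall>i<l. \<phi> i v = 0}\<rparr>) m"
  shows "has_dim V (m + l)"
  using assms
proof (induction l arbitrary: V)
  case 0
  then show ?case by simp
next
  case (Suc l)
  let ?K = "V\<lparr>carrier := {v \<in> carrier V. \<phi> l v = 0}\<rparr>"
  have l: "lf V (\<phi> l)" "r l \<in> carrier V" "\<phi> l (r l) = 1" using Suc.prems by auto
  have s: "sub {v \<in> carrier V. \<phi> l v = 0} V"
    using sub_ker[OF Suc.prems(1) sub_self[OF Suc.prems(1)] l(1)] by simp
  have K: "vspace ?K" by (rule vs_sub[OF Suc.prems(1) s])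
  have e: "{v \<in> carrier ?K. \<forall>i<l. \<phi> i v = 0} = {v \<in> carrier V. \<forall>i<Suc l. \<phi> i v = 0}"
    by (auto simp: less_Suc_eq)
  have "has_dim ?K (m + l)"
  proof (rule Suc.IH[OF K])
    fix i assume i: "i < l"
    then show "lf ?K (\<phi> i) \<and> r i \<in> carrier ?K"
      using Suc.prems(2)[of i] Suc.prems(3)[of l i] lf_sub[OF _ s] by auto
  next
    fix i j assume "i < l" "j < l"
    then show "\<phi> i (r j) = (if i = j then 1 else 0)" using Suc.prems(3) by auto
  next
    show "has_dim (?K\<lparr>carrier := {v \<in> carrier ?K. \<forall>i<l. \<phi> i v = 0}\<rparr>) m"
      using Suc.prems(4) unfolding e by simp
  qed
  then show ?case using has_dim_step[OF Suc.prems(1) l] by simp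
qed

text \<open>Each of R0 and R1 has the dimension of the common image under \<open>p\<close> plus that
  of its part over 0, and \<open>k\<close>, \<open>\<psi>\<close> are dual bases for the quotient of
  the two parts over 0. Spanning is expressed by \<open>gen\<close>, for functionals that vanish on
  the smaller part, because the pairing between morphisms provides exactly such an identity.
  Inclusion is required over 0 only, since the images of the two block matrices need not be
  nested.\<close>

lemma rank_difference:
  fixes W :: "('k::field, 'w) module" and X :: "('k, 'x) module"
  assumes W: "vspace W" "has_dim W N" and X: "has_dim X N'"
    and p: "linear_map class_ring W X p"
    and R0: "sub R0 W" and R1: "sub R1 W" and img: "p ` R0 = p ` R1"
    and K01: "\<And>v. v \<in> R0 \<Longrightarrow> p v = \<zero>\<^bsub>X\<^esub> \<Longrightarrow> v \<in> R1"
    and k: "\<And>i. i < n \<Longrightarrow> k i \<in> R1 \<and> p (k i) = \<zero>\<^bsub>X\<^esub>"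
    and \<psi>: "\<And>i. i < n \<Longrightarrow> lf W (\<psi> i) \<and> (\<forall>v\<in>R0. p v = \<zero>\<^bsub>X\<^esub> \<longrightarrow> \<psi> i v = 0)"
    and dual: "\<And>i j. i < n \<Longrightarrow> j < n \<Longrightarrow> \<psi> i (k j) = (if i = j then 1 else 0)"
    and gen: "\<And>\<chi> v. lf W \<chi> \<Longrightarrow> (\<And>u. u \<in> R0 \<Longrightarrow> p u = \<zero>\<^bsub>X\<^esub> \<Longrightarrow> \<chi> u = 0) \<Longrightarrow>
      v \<in> R1 \<Longrightarrow> p v = \<zero>\<^bsub>X\<^esub> \<Longrightarrow> \<chi> v = (\<Sum>i<n. \<chi> (k i) * \<psi> i v)"
  shows "vectorspace.dim class_ring (W\<lparr>carrier := R1\<rparr>) = vectorspace.dim class_ring (W\<lparr>carrier := R0\<rparr>) + n"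
proof -
  note pD = linear_mapD[OF p]
  have Xv: "vspace X" by (rule pD(2))
  let ?A = "p ` R0"
  have A: "sub ?A X"
    unfolding sub_def
  proof (intro conjI ballI allI)
    show "?A \<subseteq> carrier X" using pD(3) sub_carrier[OF R0] by auto
    show "\<zero>\<^bsub>X\<^esub> \<in> ?A" using linear_map_zero[OF p] sub_zero[OF R0] by (metis imageI)
    show "u \<oplus>\<^bsub>X\<^esub> v \<in> ?A" if uv: "u \<in> ?A" "v \<in> ?A" for u v
    proof -
      from uv obtain u' v' where *: "u' \<in> R0" "v' \<in> R0" "u = p u'" "v = p v'" by auto
      then have "u \<oplus>\<^bsub>X\<^esub> v = p (u' \<oplus>\<^bsub>W\<^esub> v')" using pD(4) sub_carrier[OF R0] by simp
      then show ?thesis using sub_add[OF R0 *(1,2)] by auto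
    qed
    show "c \<odot>\<^bsub>X\<^esub> u \<in> ?A" if u: "u \<in> ?A" for c u
    proof -
      from u obtain u' where *: "u' \<in> R0" "u = p u'" by auto
      then have "c \<odot>\<^bsub>X\<^esub> u = p (c \<odot>\<^bsub>W\<^esub> u')" using pD(5) sub_carrier[OF R0] by simp
      then show ?thesis using sub_smult[OF R0 *(1)] by auto
    qed
  qed
  \<comment> \<open>A frame of the common image. Its functionals pulled back along \<open>p\<close>,
    together with preimages of its vectors in either subspace, split off l dimensions from
    both.\<close>
  obtain l a \<alpha> where f: "frame (X\<lparr>carrier := ?A\<rparr>) l a \<alpha>"
    using has_dim_sub[OF Xv X A] by (auto simp: has_dim_def)
  have \<alpha>p: "lf (W\<lparr>carrier := R\<rparr>) (\<lambda>v. \<alpha> i (p v))" if "sub R W" "p ` R = ?A" "i < l" for R i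
  proof -
    have "lf (X\<lparr>carrier := ?A\<rparr>) (\<alpha> i)" using f that by (auto simp: frame_def)
    then have "lf (X\<lparr>carrier := p ` R\<rparr>) (\<alpha> i)" using that(2) by simp
    then show ?thesis using pD(4,5) sub_carrier[OF that(1)] by (simp add: lf_def)
  qed
  have lift: "\<exists>r. (\<forall>i<l. r i \<in> R \<and> p (r i) = a i)" if "p ` R = ?A" for R
  proof -
    have "\<forall>i<l. \<exists>r. r \<in> R \<and> p r = a i"
    proof (intro allI impI)
      fix i assume "i < l"
      then have "a i \<in> p ` R" using f that by (auto simp: frame_def)
      then show "\<exists>r. r \<in> R \<and> p r = a i" by auto
    qed
    then show ?thesis by metis
  qed
  have ker: "{v \<in> R. \<forall>i<l. \<alpha> i (p v) = 0} = {v \<in> R. p v = \<zero>\<^bsub>X\<^esub>}" if "p ` R = ?A" for R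
  proof -
    have "\<alpha> i \<zero>\<^bsub>X\<^esub> = 0" if "i < l" for i
      using lf_zero[OF vs_sub[OF Xv A], of "\<alpha> i"] f that by (auto simp: frame_def)
    moreover have "p v = \<zero>\<^bsub>X\<^esub>" if "v \<in> R" "\<forall>i<l. \<alpha> i (p v) = 0" for v
    proof -
      have "p v \<in> ?A" using that \<open>p ` R = ?A\<close> by auto
      then obtain w where w: "w \<in> R0" "p v = p w" by auto
      then have "\<forall>i<l. \<alpha> i (p w) = 0" using that(2) by metis
      moreover have "\<forall>w\<in>R0. (\<forall>i<l. \<alpha> i (p w) = 0) \<longrightarrow> p w = \<zero>\<^bsub>X\<^esub>"
        using f unfolding frame_def by simp
      ultimately show ?thesis using w by metis
    qed
    ultimately have "(\<forall>i<l. \<alpha> i (p v) = 0) \<longleftrightarrow> p v = \<zero>\<^bsub>X\<^esub>" if "v \<in> R" for v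
      using that by metis
    then show ?thesis by (intro Collect_cong conj_cong refl)
  qed
  have glue: "has_dim (W\<lparr>carrier := R\<rparr>) (m + l)"
    if R: "sub R W" and pR: "p ` R = ?A" and m: "has_dim (W\<lparr>carrier := {v \<in> R. p v = \<zero>\<^bsub>X\<^esub>}\<rparr>) m" for R m
  proof -
    obtain r where r: "\<forall>i<l. r i \<in> R \<and> p (r i) = a i" using lift[OF pR] by auto
    show ?thesis
    proof (rule has_dim_glue[where \<phi> = "\<lambda>i v. \<alpha> i (p v)" and r = r])
      show "vspace (W\<lparr>carrier := R\<rparr>)" by (rule vs_sub[OF W(1) R])
      show "lf (W\<lparr>carrier := R\<rparr>) (\<lambda>v. \<alpha> i (p v)) \<and> r i \<in> carrier (W\<lparr>carrier := R\<rparr>)" if "i < l" for i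
        using \<alpha>p[OF R pR that] r that by simp
      show "\<alpha> i (p (r j)) = (if i = j then 1 else 0)" if "i < l" "j < l" for i j
        using r f that by (auto simp: frame_def)
      show "has_dim (W\<lparr>carrier := R, carrier := {v \<in> carrier (W\<lparr>carrier := R\<rparr>). \<forall>i<l. \<alpha> i (p v) = 0}\<rparr>) m"
        using m ker[OF pR] by simp
    qed
  qed
  let ?K0 = "{v \<in> R0. p v = \<zero>\<^bsub>X\<^esub>}" and ?K1 = "{v \<in> R1. p v = \<zero>\<^bsub>X\<^esub>}"
  have K: "sub {v \<in> R. p v = \<zero>\<^bsub>X\<^esub>} W" if "sub R W" for R
    using that pD(4,5) linear_map_zero[OF p] sub_carrier[OF that]
    by (auto simp: sub_def vs_facts[OF Xv])
  have K0: "sub ?K0 W" and K1: "sub ?K1 W" using K R0 R1 by auto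
  obtain m where m: "has_dim (W\<lparr>carrier := ?K0\<rparr>) m" using has_dim_sub[OF W K0] by auto
  \<comment> \<open>A vector of the larger part on which all \<open>\<psi> i\<close> vanish must lie
    in the smaller part: a functional separating it would have value 1 there, whereas
    \<open>gen\<close> gives 0.\<close>
  have "{v \<in> ?K1. \<forall>i<n. \<psi> i v = 0} = ?K0"
  proof (intro equalityI subsetI)
    fix v assume v: "v \<in> {v \<in> ?K1. \<forall>i<n. \<psi> i v = 0}"
    show "v \<in> ?K0"
    proof (rule ccontr)
      assume "v \<notin> ?K0"
      then obtain \<chi> where \<chi>: "lf W \<chi>" "\<forall>u\<in>?K0. \<chi> u = 0" "\<chi> v = 1"
        using separation[OF W K0, of v] v sub_carrier[OF R1] by auto
      then have "\<chi> v = (\<Sum>i<n. \<chi> (k i) * \<psi> i v)" using gen[OF \<chi>(1), of v] v by auto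
      also have "\<dots> = 0" using v by simp
      finally show False using \<chi>(3) by simp
    qed
  qed (use K01 \<psi> in auto)
  then have "has_dim (W\<lparr>carrier := ?K1\<rparr>) (m + n)"
    by (intro has_dim_glue[where \<phi> = \<psi> and r = k])
       (use m k \<psi> dual lf_sub[OF _ K1] vs_sub[OF W(1) K1] in auto)
  then have "has_dim (W\<lparr>carrier := R1\<rparr>) (m + n + l)" by (intro glue[OF R1]) (use img in auto)
  moreover have "has_dim (W\<lparr>carrier := R0\<rparr>) (m + l)" using m by (intro glue[OF R0]) auto
  ultimately show ?thesis
    using has_dim_dim[OF vs_sub[OF W(1) R1]] has_dim_dim[OF vs_sub[OF W(1) R0]] by auto
qed

section \<open>Modules over the incidence algebra\<close>

lemma dsum_Nil:
  "carrier (dsum []) = {[]}" "add (dsum []) u v = []" "smult (dsum []) c v = []" "zero (dsum []) = []"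
  by (auto simp: dsum_def)

lemma dsum_Cons_mem:
  "v # vs \<in> carrier (dsum (V # Vs)) \<longleftrightarrow> v \<in> carrier V \<and> vs \<in> carrier (dsum Vs)"
  by (auto simp: dsum_def less_Suc_eq_0_disj)

lemma dsum_Cons_carrier:
  "carrier (dsum (V # Vs)) = {v # vs |v vs. v \<in> carrier V \<and> vs \<in> carrier (dsum Vs)}"
proof (intro equalityI subsetI)
  fix xs assume xs: "xs \<in> carrier (dsum (V # Vs))"
  then obtain v vs where "xs = v # vs" by (cases xs) (auto simp: dsum_def)
  then show "xs \<in> {v # vs |v vs. v \<in> carrier V \<and> vs \<in> carrier (dsum Vs)}"
    using xs dsum_Cons_mem[of v vs V Vs] by simp
qed (auto simp: dsum_Cons_mem)

lemma dsum_Cons: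
  "add (dsum (V # Vs)) (v # vs) (w # ws) = (v \<oplus>\<^bsub>V\<^esub> w) # (vs \<oplus>\<^bsub>dsum Vs\<^esub> ws)"
  "smult (dsum (V # Vs)) c (v # vs) = (c \<odot>\<^bsub>V\<^esub> v) # (c \<odot>\<^bsub>dsum Vs\<^esub> vs)"
  "zero (dsum (V # Vs)) = \<zero>\<^bsub>V\<^esub> # \<zero>\<^bsub>dsum Vs\<^esub>"
  by (simp_all add: dsum_def map_upt_Suc del: upt_Suc)

lemma vs_dsum:
  fixes Vs :: "('k::field, 'v) module list"
  assumes "\<And>V. V \<in> set Vs \<Longrightarrow> vspace V" shows "vspace (dsum Vs)"
  using assms
proof (induction Vs)
  case Nil
  show ?case by (rule vsI) (auto simp: dsum_Nil)
next
  case (Cons V Vs)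
  then have V: "vspace V" and Vs: "vspace (dsum Vs)" by auto
  show ?case
    by (rule vsI) (auto simp: dsum_Cons_carrier dsum_Cons vs_facts[OF V] vs_facts[OF Vs])
qed

lemma has_dim_dsum:
  fixes Vs :: "('k::field, 'v) module list"
  assumes "\<And>V. V \<in> set Vs \<Longrightarrow> vspace V \<and> (\<exists>n. has_dim V n)"
  shows "\<exists>n. has_dim (dsum Vs) n"
  using assms
proof (induction Vs)
  case Nil
  have "vspace (dsum ([] :: ('k, 'v) module list))" by (rule vs_dsum) simp
  then have "has_dim (dsum ([] :: ('k, 'v) module list)) 0" by (subst has_dim_0) (auto simp: dsum_Nil)
  then show ?case by blast
next
  case (Cons V Vs)
  have V: "vspace V" and Vs: "vspace (dsum Vs)" using Cons.prems by (auto intro: vs_dsum)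
  obtain n b \<beta> where f: "frame V n b \<beta>" using Cons.prems[of V] by (auto simp: has_dim_def)
  obtain m b' \<beta>' where f': "frame (dsum Vs) m b' \<beta>'" using Cons by (auto simp: has_dim_def)
  let ?b = "\<lambda>i. if i < n then b i # \<zero>\<^bsub>dsum Vs\<^esub> else \<zero>\<^bsub>V\<^esub> # b' (i - n)"
  let ?\<beta> = "\<lambda>i xs. if i < n then \<beta> i (hd xs) else \<beta>' (i - n) (tl xs)"
  have z: "\<beta> i \<zero>\<^bsub>V\<^esub> = 0" if "i < n" for i
    using f that by (intro lf_zero[OF V]) (auto simp: frame_def)
  have z': "\<beta>' i \<zero>\<^bsub>dsum Vs\<^esub> = 0" if "i < m" for i
    using f' that by (intro lf_zero[OF Vs]) (auto simp: frame_def)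
  have "frame (dsum (V # Vs)) (n + m) ?b ?\<beta>"
    unfolding frame_def
  proof (intro conjI allI impI ballI)
    fix i assume i: "i < n + m"
    show "?b i \<in> carrier (dsum (V # Vs))"
      using f f' i by (auto simp: frame_def dsum_Cons_mem vs_zero[OF V] vs_zero[OF Vs])
    have "lf V (\<beta> i)" if "i < n" using f that by (auto simp: frame_def)
    moreover have "lf (dsum Vs) (\<beta>' (i - n))" if "\<not> i < n" using f' i that by (auto simp: frame_def)
    ultimately show "lf (dsum (V # Vs)) (?\<beta> i)"
      by (cases "i < n") (auto simp: lf_def dsum_Cons_carrier dsum_Cons)
  next
    fix i j assume "i < n + m" "j < n + m"
    then show "?\<beta> i (?b j) = (if i = j then 1 else 0)"
      using f f' z z' by (auto simp: frame_def)
  next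
    fix v assume "v \<in> carrier (dsum (V # Vs))" and 0: "\<forall>i<n + m. ?\<beta> i v = 0"
    then obtain u us where u: "v = u # us" "u \<in> carrier V" "us \<in> carrier (dsum Vs)"
      by (auto simp: dsum_Cons_carrier)
    have "\<beta> i u = 0" if "i < n" for i using 0 that u(1) by (metis list.sel(1) trans_less_add1)
    moreover have "\<beta>' i us = 0" if "i < m" for i
      using 0[rule_format, of "n + i"] that u(1) by simp
    ultimately show "v = \<zero>\<^bsub>dsum (V # Vs)\<^esub>"
      using f f' u by (auto simp: frame_def dsum_Cons)
  qed
  then show ?case by (auto simp: has_dim_def)
qed

lemma dsum_append_mem:
  assumes "length us = length Us"
  shows "us @ vs \<in> carrier (dsum (Us @ Vs)) \<longleftrightarrow> us \<in> carrier (dsum Us) \<and> vs \<in> carrier (dsum Vs)"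
  using assms by (induction us Us rule: list_induct2) (auto simp: dsum_Cons_mem dsum_Nil)

lemma dsum_append_carrier:
  "carrier (dsum (Us @ Vs)) = {us @ vs |us vs. us \<in> carrier (dsum Us) \<and> vs \<in> carrier (dsum Vs)}"
proof (intro equalityI subsetI)
  fix xs assume xs: "xs \<in> carrier (dsum (Us @ Vs))"
  then have "length xs = length Us + length Vs" by (simp add: dsum_def)
  then show "xs \<in> {us @ vs |us vs. us \<in> carrier (dsum Us) \<and> vs \<in> carrier (dsum Vs)}"
    using xs dsum_append_mem[of "take (length Us) xs" Us "drop (length Us) xs" Vs]
    by (intro CollectI exI[of _ "take (length Us) xs"] exI[of _ "drop (length Us) xs"]) auto
next
  fix xs assume "xs \<in> {us @ vs |us vs. us \<in> carrier (dsum Us) \<and> vs \<in> carrier (dsum Vs)}"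
  then obtain us vs where u: "xs = us @ vs" "us \<in> carrier (dsum Us)" "vs \<in> carrier (dsum Vs)" by auto
  then have "length us = length Us" by (simp add: dsum_def)
  then show "xs \<in> carrier (dsum (Us @ Vs))" using u dsum_append_mem by auto
qed

lemma dsum_append:
  assumes "us \<in> carrier (dsum Us)"
  shows "us' \<in> carrier (dsum Us) \<Longrightarrow>
      add (dsum (Us @ Vs)) (us @ vs) (us' @ vs') = (us \<oplus>\<^bsub>dsum Us\<^esub> us') @ (vs \<oplus>\<^bsub>dsum Vs\<^esub> vs')"
    and "smult (dsum (Us @ Vs)) c (us @ vs) = (c \<odot>\<^bsub>dsum Us\<^esub> us) @ (c \<odot>\<^bsub>dsum Vs\<^esub> vs)"
  using assms
  by (induction Us arbitrary: us us') (auto simp: dsum_Nil dsum_Cons_carrier dsum_Cons)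

section \<open>Modules and morphisms, reduced to the generators of the incidence algebra\<close>

lemma A_hom_one: "x \<le> y \<Longrightarrow> (a :: 'k::field) \<in> A_hom x y"
  and A_hom_zero: "(0 :: 'k) \<in> A_hom x y"
  and A_hom_not_le: "\<not> x \<le> y \<Longrightarrow> (a :: 'k) \<in> A_hom x y \<Longrightarrow> a = 0"
  by (auto simp: A_hom_def line_def)

text \<open>By the scaling and zero laws a module is determined by the action of the scalar 1 for x
  \<le> y; the later statements are formulated for these generators.\<close>

lemma A_moduleD:
  fixes M :: "('p::order, 'k::field, 'v) rep"
  assumes "A_module M"
  shows A_module_vs: "vspace (ob M x)"
    and A_module_act: "a \<in> A_hom x y \<Longrightarrow> linear_map class_ring (ob M x) (ob M y) (act M x y a)"
    and A_module_id: "v \<in> carrier (ob M x) \<Longrightarrow> act M x x 1 v = v"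
    and A_module_comp: "x \<le> y \<Longrightarrow> y \<le> z \<Longrightarrow> v \<in> carrier (ob M x) \<Longrightarrow>
        act M x z 1 v = act M y z 1 (act M x y 1 v)"
    and A_module_scale: "x \<le> y \<Longrightarrow> v \<in> carrier (ob M x) \<Longrightarrow> act M x y a v = a \<odot>\<^bsub>ob M y\<^esub> act M x y 1 v"
    and A_module_zero: "v \<in> carrier (ob M x) \<Longrightarrow> act M x y 0 v = \<zero>\<^bsub>ob M y\<^esub>"
    and A_module_has_dim: "\<exists>n. has_dim (ob M x) n"
proof -
  show V: "vspace (ob M x)" for x using assms by (auto simp: A_module_def)
  have "vectorspace.fin_dim class_ring (ob M x)" using assms by (auto simp: A_module_def)
  then show "\<exists>n. has_dim (ob M x) n" using fin_dim_imp_has_dim[OF V] by blast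
  show act: "a \<in> A_hom x y \<Longrightarrow> linear_map class_ring (ob M x) (ob M y) (act M x y a)" for a x y
    using assms by (auto simp: A_module_def)
  show "v \<in> carrier (ob M x) \<Longrightarrow> act M x x 1 v = v" using assms by (auto simp: A_module_def)
  show "x \<le> y \<Longrightarrow> y \<le> z \<Longrightarrow> v \<in> carrier (ob M x) \<Longrightarrow>
        act M x z 1 v = act M y z 1 (act M x y 1 v)"
  proof -
    assume *: "x \<le> y" "y \<le> z" "v \<in> carrier (ob M x)"
    have "\<forall>a\<in>A_hom x y. \<forall>b\<in>A_hom y z. act M x z (b * a) v = act M y z b (act M x y a v)"
      using assms * by (auto simp: A_module_def)
    then have "act M x z (1 * 1) v = act M y z 1 (act M x y 1 v)"
      using * A_hom_one by blast
    then show ?thesis by simp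
  qed
  have sc: "act M x y (c * a) v = c \<odot>\<^bsub>ob M y\<^esub> act M x y a v"
    if "v \<in> carrier (ob M x)" "a \<in> A_hom x y" for v c a
    using assms that by (auto simp: A_module_def)
  show "act M x y a v = a \<odot>\<^bsub>ob M y\<^esub> act M x y 1 v" if "x \<le> y" "v \<in> carrier (ob M x)"
    using sc[OF that(2) A_hom_one[OF that(1)], of a 1] by simp
  show "act M x y 0 v = \<zero>\<^bsub>ob M y\<^esub>" if "v \<in> carrier (ob M x)"
    using sc[OF that A_hom_zero, of 0] vs_zero_smult[OF V] linear_map_in[OF act[OF A_hom_zero] that] by simp
qed

lemma A_module_act_in:
  "A_module M \<Longrightarrow> x \<le> y \<Longrightarrow> v \<in> carrier (ob M x) \<Longrightarrow> act M x y a v \<in> carrier (ob M y)"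
  by (rule linear_map_in[OF A_module_act]) (auto intro: A_hom_one)

text \<open>For x \<le> y the scalar comes out of the generator by linearity, and otherwise 0 is the
  only morphism.\<close>

lemma rep_homI:
  fixes M :: "('p::order, 'k::field, 'v) rep" and N :: "('p, 'k, 'w) rep"
  assumes M: "A_module M" and N: "A_module N"
    and lin: "\<And>x. linear_map class_ring (ob M x) (ob N x) (F x)"
    and comm: "\<And>x y v. x \<le> y \<Longrightarrow> v \<in> carrier (ob M x) \<Longrightarrow> F y (act M x y 1 v) = act N x y 1 (F x v)"
  shows "rep_hom M N F"
  unfolding rep_hom_def
proof (intro conjI allI ballI lin)
  fix x y :: 'p and a :: 'k and v assume a: "a \<in> A_hom x y" and v: "v \<in> carrier (ob M x)"
  show "F y (act M x y a v) = act N x y a (F x v)"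
  proof (cases "x \<le> y")
    case True
    then show ?thesis
      using v comm[OF True v] A_module_scale[OF M True v, of a]
        A_module_scale[OF N True linear_map_in[OF lin v], of a]
        linear_map_smult[OF lin A_module_act_in[OF M True v]]
      by simp
  next
    case False
    then have "a = 0" using a by (rule A_hom_not_le)
    then show ?thesis
      using v by (simp add: A_module_zero[OF M] A_module_zero[OF N] linear_map_in[OF lin] linear_map_zero[OF lin])
  qed
qed

lemma rep_homD:
  fixes M :: "('p::order, 'k::field, 'v) rep" and N :: "('p, 'k, 'w) rep"
  assumes "rep_hom M N F"
  shows rep_hom_linear: "linear_map class_ring (ob M x) (ob N x) (F x)"
    and rep_hom_in: "v \<in> carrier (ob M x) \<Longrightarrow> F x v \<in> carrier (ob N x)"
    and rep_hom_act: "x \<le> y \<Longrightarrow> v \<in> carrier (ob M x) \<Longrightarrow> F y (act M x y a v) = act N x y a (F x v)"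
  using assms linear_map_in[of "ob M x" "ob N x" "F x" v] A_hom_one[of x y a]
  by (auto simp: rep_hom_def)

lemma rep_iso_inverse:
  fixes M :: "('p::order, 'k::field, 'v) rep" and N :: "('p, 'k, 'w) rep"
  assumes M: "A_module M" and iso: "rep_iso M N"
  obtains F G where "rep_hom M N F" "rep_hom N M G"
    and "\<And>x v. v \<in> carrier (ob M x) \<Longrightarrow> G x (F x v) = v"
    and "\<And>x v. v \<in> carrier (ob N x) \<Longrightarrow> F x (G x v) = v"
proof -
  obtain F where F: "rep_hom M N F" and bij: "\<And>x. bij_betw (F x) (carrier (ob M x)) (carrier (ob N x))"
    using iso by (auto simp: rep_iso_def)
  let ?G = "\<lambda>x. inv_into (carrier (ob M x)) (F x)"
  note L = rep_hom_linear[OF F]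
  have GF: "?G x (F x v) = v" if "v \<in> carrier (ob M x)" for x v
    using bij that by (meson bij_betw_inv_into_left)
  have FG: "F x (?G x v) = v" if "v \<in> carrier (ob N x)" for x v
    using bij that by (meson bij_betw_inv_into_right)
  have Gin: "?G x v \<in> carrier (ob M x)" if "v \<in> carrier (ob N x)" for x v
    using bij that by (metis bij_betw_def inv_into_into)
  have "rep_hom N M ?G"
    unfolding rep_hom_def
  proof (intro conjI allI ballI)
    fix x show "linear_map class_ring (ob N x) (ob M x) (?G x)"
    proof (rule linear_mapI[OF linear_map_target[OF L] linear_map_source[OF L] Gin])
      fix u v assume uv: "u \<in> carrier (ob N x)" "v \<in> carrier (ob N x)"
      have "u \<oplus>\<^bsub>ob N x\<^esub> v = F x (?G x u \<oplus>\<^bsub>ob M x\<^esub> ?G x v)"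
        using uv by (simp add: linear_map_add[OF L] Gin FG)
      then show "?G x (u \<oplus>\<^bsub>ob N x\<^esub> v) = ?G x u \<oplus>\<^bsub>ob M x\<^esub> ?G x v"
        using uv GF[OF vs_add[OF linear_map_source[OF L] Gin Gin]] by simp
    next
      fix c v assume v: "v \<in> carrier (ob N x)"
      have "c \<odot>\<^bsub>ob N x\<^esub> v = F x (c \<odot>\<^bsub>ob M x\<^esub> ?G x v)"
        using v by (simp add: linear_map_smult[OF L] Gin FG)
      then show "?G x (c \<odot>\<^bsub>ob N x\<^esub> v) = c \<odot>\<^bsub>ob M x\<^esub> ?G x v"
        using v GF[OF vs_smult[OF linear_map_source[OF L] Gin]] by simp
    qed
  next
    fix x y :: 'p and a :: 'k and v assume a: "a \<in> A_hom x y" and v: "v \<in> carrier (ob N x)"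
    have "act M x y a (?G x v) \<in> carrier (ob M y)"
      by (rule linear_map_in[OF A_module_act[OF M a] Gin[OF v]])
    moreover have "act N x y a v = F y (act M x y a (?G x v))"
      using F a Gin[OF v] FG[OF v] unfolding rep_hom_def by auto
    ultimately show "?G y (act N x y a v) = act M x y a (?G x v)" using GF by simp
  qed
  then show thesis using that F GF FG by blast
qed

lemma A_module_dsum:
  fixes Ns :: "('p::order, 'k::field, 'v) rep list"
  assumes "\<And>N. N \<in> set Ns \<Longrightarrow> A_module N"
  shows "A_module (rep_dsum Ns)"
  using assms
proof (induction Ns)
  case Nil
  let ?D = "rep_dsum [] :: ('p, 'k, 'v list) rep"
  have o: "ob ?D x = dsum []" for x by (simp add: rep_dsum_def)
  have V: "vspace (dsum [] :: ('k, 'v list) module)" by (rule vs_dsum) simp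
  have "has_dim (dsum [] :: ('k, 'v list) module) 0" using V by (subst has_dim_0) (auto simp: dsum_Nil)
  note fd = has_dim_fin_dim[OF V this]
  show ?case unfolding A_module_def o
    by (auto intro!: linear_mapI V fd simp: dsum_Nil rep_dsum_def)
next
  case (Cons N Ns)
  let ?D = "rep_dsum Ns" and ?E = "rep_dsum (N # Ns)"
  have N: "A_module N" and D: "A_module ?D" using Cons by auto
  have oD: "ob ?D x = dsum (map (\<lambda>N. ob N x) Ns)" for x by (simp add: rep_dsum_def)
  have o: "ob ?E x = dsum (ob N x # map (\<lambda>N. ob N x) Ns)" for x by (simp add: rep_dsum_def)
  have V: "vspace (ob ?E x)" for x
    unfolding o by (rule vs_dsum) (use Cons.prems A_module_vs in auto)
  have "\<exists>n. has_dim (ob ?E x) n" for x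
    unfolding o by (rule has_dim_dsum) (use Cons.prems A_module_vs A_module_has_dim in \<open>simp; blast\<close>)
  then obtain n where n: "\<And>x. has_dim (ob ?E x) (n x)" by metis
  have c: "carrier (ob ?E x) = {v # vs |v vs. v \<in> carrier (ob N x) \<and> vs \<in> carrier (ob ?D x)}" for x
    by (simp add: o oD dsum_Cons_carrier)
  have ops: "add (ob ?E x) (v # vs) (w # ws) = (v \<oplus>\<^bsub>ob N x\<^esub> w) # (vs \<oplus>\<^bsub>ob ?D x\<^esub> ws)"
    "smult (ob ?E x) k (v # vs) = (k \<odot>\<^bsub>ob N x\<^esub> v) # (k \<odot>\<^bsub>ob ?D x\<^esub> vs)" for x v vs w ws k
    by (simp_all add: o oD dsum_Cons)
  have a: "act ?E x y a (v # vs) = act N x y a v # act ?D x y a vs" for x y a v vs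
    by (simp add: rep_dsum_def)
  note ND = N[unfolded A_module_def] D[unfolded A_module_def]
  show ?case unfolding A_module_def
  proof (intro conjI allI ballI V has_dim_fin_dim[OF V n])
    fix x y :: 'p and b :: 'k assume b: "b \<in> A_hom x y"
    note l = A_module_act[OF N b] A_module_act[OF D b]
    show "linear_map class_ring (ob ?E x) (ob ?E y) (act ?E x y b)"
      by (rule linear_mapI[OF V V])
        (auto simp: c ops a linear_mapD(3-)[OF l(1)] linear_mapD(3-)[OF l(2)])
  qed (use ND in \<open>auto simp: c ops a\<close>)
qed

lemma subrep:
  fixes N :: "('p::order, 'k::field, 'v) rep"
  assumes N: "A_module N" and U: "\<And>x. sub (U x) (ob N x)"
    and cl: "\<And>x y v. x \<le> y \<Longrightarrow> v \<in> U x \<Longrightarrow> act N x y 1 v \<in> U y"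
  shows "A_module \<lparr>ob = \<lambda>x. (ob N x)\<lparr>carrier := U x\<rparr>, act = act N\<rparr>"
proof -
  let ?U = "\<lparr>ob = \<lambda>x. (ob N x)\<lparr>carrier := U x\<rparr>, act = act N\<rparr>"
  have V: "vspace ((ob N x)\<lparr>carrier := U x\<rparr>)" for x by (rule vs_sub[OF A_module_vs[OF N] U])
  have fd: "vectorspace.fin_dim class_ring ((ob N x)\<lparr>carrier := U x\<rparr>)" for x
    using A_module_has_dim[OF N] has_dim_sub[OF A_module_vs[OF N] _ U] has_dim_fin_dim[OF V] by metis
  have in_N: "v \<in> carrier (ob N x)" if "v \<in> U x" for x v using sub_carrier[OF U that] .
  have cl': "act N x y a v \<in> U y" if "a \<in> A_hom x y" "v \<in> U x" for x y a v
  proof (cases "x \<le> y")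
    case True
    then show ?thesis
      using A_module_scale[OF N True in_N[OF that(2)], of a] sub_smult[OF U cl[OF True that(2)]] by simp
  next
    case False
    then show ?thesis
      using A_hom_not_le[OF False that(1)] A_module_zero[OF N in_N[OF that(2)]] sub_zero[OF U] by simp
  qed
  show ?thesis
    unfolding A_module_def rep.simps
  proof (intro conjI allI ballI V fd)
    fix x y :: 'p and a :: 'k assume a: "a \<in> A_hom x y"
    show "linear_map class_ring ((ob N x)\<lparr>carrier := U x\<rparr>) ((ob N y)\<lparr>carrier := U y\<rparr>) (act N x y a)"
      by (rule linear_mapI[OF V V])
        (auto simp: cl'[OF a] in_N linear_mapD(4-)[OF A_module_act[OF N a]])
  qed (use N in \<open>auto simp: A_module_def in_N\<close>)
qed

text \<open>The isomorphism sends v to (e v, v - e v), with addition as its inverse. Both summands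
  are submodules of N, so they have the underlying type of N and fit the definition of
  \<open>indecomposable\<close>.\<close>

lemma idempotent_splits:
  fixes N :: "('p::order, 'k::field, 'v) rep"
  assumes N: "A_module N" and e: "rep_hom N N e"
    and idem: "\<And>x v. v \<in> carrier (ob N x) \<Longrightarrow> e x (e x v) = e x v"
  defines "N1 \<equiv> \<lparr>ob = \<lambda>x. (ob N x)\<lparr>carrier := e x ` carrier (ob N x)\<rparr>, act = act N\<rparr>"
    and "N2 \<equiv> \<lparr>ob = \<lambda>x. (ob N x)\<lparr>carrier := {v \<in> carrier (ob N x). e x v = \<zero>\<^bsub>ob N x\<^esub>}\<rparr>, act = act N\<rparr>"
  shows "A_module N1" "A_module N2" "rep_iso N (rep_dsum [N1, N2])"
proof -
  note L = rep_hom_linear[OF e] and V = A_module_vs[OF N]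
  have s1: "sub (e x ` carrier (ob N x)) (ob N x)" for x
    unfolding sub_def
  proof (intro conjI ballI allI)
    show "e x ` carrier (ob N x) \<subseteq> carrier (ob N x)" using linear_map_in[OF L] by auto
    show "\<zero>\<^bsub>ob N x\<^esub> \<in> e x ` carrier (ob N x)"
      using linear_map_zero[OF L] vs_zero[OF V] by (metis imageI)
    fix u assume "u \<in> e x ` carrier (ob N x)"
    then obtain u' where u: "u' \<in> carrier (ob N x)" "u = e x u'" by auto
    show "c \<odot>\<^bsub>ob N x\<^esub> u \<in> e x ` carrier (ob N x)" for c
      using u vs_smult[OF V u(1)] linear_map_smult[OF L u(1), symmetric] by auto
    fix v assume "v \<in> e x ` carrier (ob N x)"
    then obtain v' where v: "v' \<in> carrier (ob N x)" "v = e x v'" by auto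
    show "u \<oplus>\<^bsub>ob N x\<^esub> v \<in> e x ` carrier (ob N x)"
      using u v vs_add[OF V u(1) v(1)] linear_map_add[OF L u(1) v(1), symmetric] by auto
  qed
  have s2: "sub {v \<in> carrier (ob N x). e x v = \<zero>\<^bsub>ob N x\<^esub>} (ob N x)" for x
    by (auto simp: sub_def vs_facts[OF V] linear_mapD(3-)[OF L] linear_map_zero[OF L])
  show N1: "A_module N1"
    unfolding N1_def by (rule subrep[OF N s1]) (auto simp: rep_hom_act[OF e, symmetric] intro!: A_module_act_in[OF N])
  show N2: "A_module N2"
    unfolding N2_def
    by (rule subrep[OF N s2])
       (auto simp: rep_hom_act[OF e] intro!: A_module_act_in[OF N] linear_map_zero[OF A_module_act[OF N A_hom_one]])
  let ?F = "\<lambda>x v. [e x v, v \<oplus>\<^bsub>ob N x\<^esub> (- 1) \<odot>\<^bsub>ob N x\<^esub> e x v]"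
  have D: "A_module (rep_dsum [N1, N2])" by (rule A_module_dsum) (use N1 N2 in auto)
  have oD: "ob (rep_dsum [N1, N2]) x = dsum [ob N1 x, ob N2 x]" for x by (simp add: rep_dsum_def)
  have cD: "carrier (dsum [ob N1 x, ob N2 x]) =
      {[u, v] |u v. u \<in> e x ` carrier (ob N x) \<and> v \<in> carrier (ob N x) \<and> e x v = \<zero>\<^bsub>ob N x\<^esub>}" for x
    by (auto simp: dsum_Cons_carrier dsum_Nil N1_def N2_def)
  have ein: "e x v \<in> carrier (ob N x)" if "v \<in> carrier (ob N x)" for x v using linear_map_in[OF L that] .
  have neg: "v \<oplus>\<^bsub>ob N x\<^esub> (- 1) \<odot>\<^bsub>ob N x\<^esub> v = \<zero>\<^bsub>ob N x\<^esub>" "(- 1) \<odot>\<^bsub>ob N x\<^esub> v \<oplus>\<^bsub>ob N x\<^esub> v = \<zero>\<^bsub>ob N x\<^esub>"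
    if "v \<in> carrier (ob N x)" for x v
    using vs_ldistr[OF V that, of 1 "-1"] vs_ldistr[OF V that, of "-1" 1] that by (simp_all add: vs_facts[OF V])
  have Fin: "?F x v \<in> carrier (dsum [ob N1 x, ob N2 x])" if v: "v \<in> carrier (ob N x)" for x v
    using v by (auto simp: cD linear_mapD(3-)[OF L] vs_add[OF V] vs_smult[OF V] ein idem neg)
  have inv: "e x v \<oplus>\<^bsub>ob N x\<^esub> (v \<oplus>\<^bsub>ob N x\<^esub> (- 1) \<odot>\<^bsub>ob N x\<^esub> e x v) = v" if v: "v \<in> carrier (ob N x)" for x v
    using v by (simp add: vs_lcomm[OF V ein[OF v] v vs_smult[OF V ein[OF v]]] neg ein vs_r_zero[OF V])
  have ops: "add (dsum [ob N1 x, ob N2 x]) [u, v] [u', v'] = [u \<oplus>\<^bsub>ob N x\<^esub> u', v \<oplus>\<^bsub>ob N x\<^esub> v']"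
     "smult (dsum [ob N1 x, ob N2 x]) k [u, v] = [k \<odot>\<^bsub>ob N x\<^esub> u, k \<odot>\<^bsub>ob N x\<^esub> v]" for x u v u' v' k
    by (simp_all add: dsum_Cons dsum_Nil N1_def N2_def)
  have hom: "rep_hom N (rep_dsum [N1, N2]) ?F"
  proof (rule rep_homI[OF N D])
    fix x
    have m: "(- 1) \<odot>\<^bsub>ob N x\<^esub> (u \<oplus>\<^bsub>ob N x\<^esub> v) = (- 1) \<odot>\<^bsub>ob N x\<^esub> u \<oplus>\<^bsub>ob N x\<^esub> (- 1) \<odot>\<^bsub>ob N x\<^esub> v"
      if "u \<in> carrier (ob N x)" "v \<in> carrier (ob N x)" for u v using vs_rdistr[OF V that] .
    show "linear_map class_ring (ob N x) (ob (rep_dsum [N1, N2]) x) (?F x)"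
    proof (rule linear_mapI[OF V A_module_vs[OF D]])
      show "?F x v \<in> carrier (ob (rep_dsum [N1, N2]) x)" if "v \<in> carrier (ob N x)" for v
        using Fin[OF that] unfolding oD .
      show "?F x (u \<oplus>\<^bsub>ob N x\<^esub> v) = ?F x u \<oplus>\<^bsub>ob (rep_dsum [N1, N2]) x\<^esub> ?F x v"
        if "u \<in> carrier (ob N x)" "v \<in> carrier (ob N x)" for u v
        unfolding oD ops using that by (simp add: linear_map_add[OF L] m ein vs_facts(2-6)[OF V])
      show "?F x (k \<odot>\<^bsub>ob N x\<^esub> v) = k \<odot>\<^bsub>ob (rep_dsum [N1, N2]) x\<^esub> ?F x v"
        if "v \<in> carrier (ob N x)" for k v
        unfolding oD ops using that by (simp add: linear_map_smult[OF L] ein vs_facts[OF V])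
    qed
  next
    fix x y v assume xy: "x \<le> y" and v: "v \<in> carrier (ob N x)"
    note La = A_module_act[OF N A_hom_one[OF xy, of 1]]
    show "?F y (act N x y 1 v) = act (rep_dsum [N1, N2]) x y 1 (?F x v)"
      using v by (simp add: rep_dsum_def N1_def N2_def rep_hom_act[OF e xy] linear_mapD(3-)[OF La] ein vs_facts[OF V])
  qed
  moreover have "bij_betw (?F x) (carrier (ob N x)) (carrier (ob (rep_dsum [N1, N2]) x))" for x
  proof (rule bij_betw_byWitness[where f' = "\<lambda>w. w ! 0 \<oplus>\<^bsub>ob N x\<^esub> w ! 1"])
    show "\<forall>v\<in>carrier (ob N x). ?F x v ! 0 \<oplus>\<^bsub>ob N x\<^esub> ?F x v ! 1 = v" using inv by simp
    show "?F x ` carrier (ob N x) \<subseteq> carrier (ob (rep_dsum [N1, N2]) x)" using Fin unfolding oD by blast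
    show "(\<lambda>w. w ! 0 \<oplus>\<^bsub>ob N x\<^esub> w ! 1) ` carrier (ob (rep_dsum [N1, N2]) x) \<subseteq> carrier (ob N x)"
      unfolding oD cD by (auto intro!: vs_add[OF V] ein)
    show "\<forall>w\<in>carrier (ob (rep_dsum [N1, N2]) x). ?F x (w ! 0 \<oplus>\<^bsub>ob N x\<^esub> w ! 1) = w"
    proof
      fix w assume "w \<in> carrier (ob (rep_dsum [N1, N2]) x)"
      then obtain u v where w: "w = [e x u, v]" "u \<in> carrier (ob N x)" "v \<in> carrier (ob N x)" "e x v = \<zero>\<^bsub>ob N x\<^esub>"
        unfolding oD cD by auto
      have "e x (e x u \<oplus>\<^bsub>ob N x\<^esub> v) = e x u"
        using w by (simp add: linear_map_add[OF L] ein idem vs_facts[OF V])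
      moreover have "e x u \<oplus>\<^bsub>ob N x\<^esub> v \<oplus>\<^bsub>ob N x\<^esub> (- 1) \<odot>\<^bsub>ob N x\<^esub> e x u = v"
        using w by (simp add: vs_comm[OF V[of x], of "e x u" v] vs_assoc[OF V] ein vs_smult[OF V] neg vs_r_zero[OF V])
      ultimately show "?F x (w ! 0 \<oplus>\<^bsub>ob N x\<^esub> w ! 1) = w" using w(1) by simp
    qed
  qed
  ultimately show "rep_iso N (rep_dsum [N1, N2])" unfolding rep_iso_def by blast
qed

section \<open>Multiplicity as the rank of a pairing\<close>

text \<open>
  \<open>interval_vec I M f\<close>: \<open>f\<close> is the image of the family of units under a morphism from the interval
  module to \<open>M\<close>. \<open>interval_covec I M \<phi>\<close>: \<open>\<phi>\<close> is a morphism from \<open>M\<close> to the interval module.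
\<close>

definition interval_vec :: "'p set \<Rightarrow> ('p::order, 'k::field, 'v) rep \<Rightarrow> ('p \<Rightarrow> 'v) \<Rightarrow> bool" where
  "interval_vec I M f \<longleftrightarrow> (\<forall>x\<in>I. f x \<in> carrier (ob M x)) \<and>
     (\<forall>x y. x \<in> I \<longrightarrow> x \<le> y \<longrightarrow> act M x y 1 (f x) = (if y \<in> I then f y else \<zero>\<^bsub>ob M y\<^esub>))"

definition interval_covec :: "'p set \<Rightarrow> ('p::order, 'k::field, 'v) rep \<Rightarrow> ('p \<Rightarrow> 'v \<Rightarrow> 'k) \<Rightarrow> bool" where
  "interval_covec I M \<phi> \<longleftrightarrow> (\<forall>x\<in>I. lf (ob M x) (\<phi> x)) \<and>
     (\<forall>x y. y \<in> I \<longrightarrow> x \<le> y \<longrightarrow>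
        (\<forall>v\<in>carrier (ob M x). \<phi> y (act M x y 1 v) = (if x \<in> I then \<phi> x v else 0)))"

text \<open>For comparable points naturality of both morphisms gives the equality, and connectedness
  of the interval carries it along a zigzag.\<close>

lemma pairing_const:
  assumes I: "interval I" and M: "A_module M"
    and f: "interval_vec I M f" and \<phi>: "interval_covec I M \<phi>"
    and xy: "x \<in> I" "y \<in> I"
  shows "\<phi> x (f x) = \<phi> y (f y)"
proof -
  have le: "\<phi> x (f x) = \<phi> y (f y)" if "x \<in> I" "y \<in> I" "x \<le> y" for x y
  proof -
    have "f y = act M x y 1 (f x)" using f that by (auto simp: interval_vec_def)
    moreover have "\<forall>v\<in>carrier (ob M x). \<phi> y (act M x y 1 v) = \<phi> x v"
      using \<phi> that by (auto simp: interval_covec_def)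
    moreover have "f x \<in> carrier (ob M x)" using f that by (auto simp: interval_vec_def)
    ultimately show ?thesis by simp
  qed
  have "\<forall>x\<in>I. \<forall>y\<in>I. (x, y) \<in> {(u, v). u \<in> I \<and> v \<in> I \<and> (u \<le> v \<or> v \<le> u)}\<^sup>*"
    using I unfolding interval_def by (elim conjE)
  from bspec[OF bspec[OF this xy(1)] xy(2)] show ?thesis
  proof (induction rule: rtrancl_induct)
    case (step y z)
    then have "y \<in> I" "z \<in> I" "y \<le> z \<or> z \<le> y" by auto
    then show ?case using step.IH le[of y z] le[of z y] by metis
  qed simp
qed

lemma interval_vec_hom:
  assumes "rep_hom M N F" "interval_vec I M f"
  shows "interval_vec I N (\<lambda>x. F x (f x))"
  using assms rep_hom_in[OF assms(1)] rep_hom_act[OF assms(1), symmetric]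
    linear_map_zero[OF rep_hom_linear[OF assms(1)]]
  by (auto simp: interval_vec_def)

lemma interval_covec_hom:
  assumes "rep_hom M N F" "interval_covec I N \<phi>"
  shows "interval_covec I M (\<lambda>x v. \<phi> x (F x v))"
  using assms rep_hom_in[OF assms(1)] rep_hom_act[OF assms(1)]
    linear_map_lf[OF rep_hom_linear[OF assms(1)]]
  by (auto simp: interval_covec_def)

text \<open>Says that the pairing of Hom(V_I, M) with Hom(M, V_I), evaluated at \<open>a\<close>,
  has rank d: it factors through two families that are dual to each other. The families need not
  span the Hom spaces, as the pairing may be degenerate. It is a relation in d, because uniqueness
  of d is obtained only later, from the rank formulas.\<close>

definition pairing_rank :: "'p set \<Rightarrow> 'p \<Rightarrow> ('p::order, 'k::field, 'v) rep \<Rightarrow> nat \<Rightarrow> bool" where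
  "pairing_rank I a M d \<longleftrightarrow> (\<exists>f \<phi>. (\<forall>i<d. interval_vec I M (f i) \<and> interval_covec I M (\<phi> i)) \<and>
     (\<forall>i<d. \<forall>j<d. \<phi> i a (f j a) = (if i = j then 1 else 0)) \<and>
     (\<forall>g \<chi>. interval_vec I M g \<longrightarrow> interval_covec I M \<chi> \<longrightarrow>
        \<chi> a (g a) = (\<Sum>i<d. \<chi> a (f i a) * \<phi> i a (g a))))"

lemma pairing_rank_iso:
  assumes M: "A_module M" and iso: "rep_iso M N" and a: "a \<in> I" and N: "pairing_rank I a N d"
  shows "pairing_rank I a M d"
proof -
  obtain F G where F: "rep_hom M N F" and G: "rep_hom N M G"
    and GF: "\<And>x v. v \<in> carrier (ob M x) \<Longrightarrow> G x (F x v) = v"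
    and FG: "\<And>x v. v \<in> carrier (ob N x) \<Longrightarrow> F x (G x v) = v"
    using rep_iso_inverse[OF M iso] by blast
  obtain f \<phi> where f: "\<And>i. i < d \<Longrightarrow> interval_vec I N (f i)"
    and \<phi>: "\<And>i. i < d \<Longrightarrow> interval_covec I N (\<phi> i)"
    and dual: "\<And>i j. i < d \<Longrightarrow> j < d \<Longrightarrow> \<phi> i a (f j a) = (if i = j then 1 else 0)"
    and gen: "\<And>g \<chi>. interval_vec I N g \<Longrightarrow> interval_covec I N \<chi> \<Longrightarrow>
        \<chi> a (g a) = (\<Sum>i<d. \<chi> a (f i a) * \<phi> i a (g a))"
    using N unfolding pairing_rank_def by blast
  let ?f = "\<lambda>i x. G x (f i x)" and ?\<phi> = "\<lambda>i x v. \<phi> i x (F x v)"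
  show ?thesis
    unfolding pairing_rank_def
  proof (intro exI[of _ ?f] exI[of _ ?\<phi>] conjI allI impI)
    fix i assume i: "i < d"
    show "interval_vec I M (?f i)" by (rule interval_vec_hom[OF G f[OF i]])
    show "interval_covec I M (?\<phi> i)" by (rule interval_covec_hom[OF F \<phi>[OF i]])
    fix j assume j: "j < d"
    have "f j a \<in> carrier (ob N a)" using f[OF j] a by (auto simp: interval_vec_def)
    then show "?\<phi> i a (?f j a) = (if i = j then 1 else 0)" using dual[OF i j] by (simp add: FG)
  next
    fix g \<chi> assume g: "interval_vec I M g" and \<chi>: "interval_covec I M \<chi>"
    have "g a \<in> carrier (ob M a)" using g a by (auto simp: interval_vec_def)
    then show "\<chi> a (g a) = (\<Sum>i<d. \<chi> a (?f i a) * ?\<phi> i a (g a))"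
      using gen[OF interval_vec_hom[OF F g] interval_covec_hom[OF G \<chi>]] by (simp add: GF)
  qed
qed

text \<open>The unit family and the identity are the witnesses: a functional on the one-dimensional
  space at \<open>a\<close> is multiplication by its value at 1.\<close>

lemma pairing_rank_interval:
  assumes "a \<in> I" shows "pairing_rank I a (interval_rep I :: ('p::order, 'k::field, 'k) rep) 1"
  unfolding pairing_rank_def
proof (intro exI[of _ "\<lambda>_ _. 1"] exI[of _ "\<lambda>_ _ v. v"] conjI allI impI)
  show "interval_vec I (interval_rep I :: ('p, 'k, 'k) rep) (\<lambda>_. 1)"
    by (auto simp: interval_vec_def interval_rep_def line_def)
  show "interval_covec I (interval_rep I :: ('p, 'k, 'k) rep) (\<lambda>_ v. v)"
    by (auto simp: interval_covec_def interval_rep_def line_def lf_def)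
next
  fix g and \<chi> :: "'p \<Rightarrow> 'k \<Rightarrow> 'k"
  assume "interval_covec I (interval_rep I :: ('p, 'k, 'k) rep) \<chi>"
  then have "lf (line True) (\<chi> a)" using assms by (auto simp: interval_covec_def interval_rep_def)
  then have "\<chi> a (g a * 1) = g a * \<chi> a 1"
    using lf_smult[of "line True" "\<chi> a" 1 "g a"] by (simp add: line_def)
  then show "\<chi> a (g a) = (\<Sum>i<1::nat. \<chi> a 1 * g a)" by simp
qed auto

lemma sum_lessThan_add: "sum f {..<m + n} = sum f {..<m} + (\<Sum>i<n::nat. f (m + i) :: 'a::comm_monoid_add)"
  by (induction n) (simp_all add: add.assoc)

text \<open>The families are united along the inclusions and projections of the two summands. Mixed
  terms vanish because a functional is then applied to 0.\<close>

lemma pairing_rank_Cons: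
  fixes N :: "('p::order, 'k::field, 'v) rep" and Ns :: "('p, 'k, 'v) rep list"
  assumes N: "A_module N" and Ns: "A_module (rep_dsum Ns)" and E: "A_module (rep_dsum (N # Ns))"
    and a: "a \<in> I"
    and 1: "pairing_rank I a N d" and 2: "pairing_rank I a (rep_dsum Ns) e"
  shows "pairing_rank I a (rep_dsum (N # Ns)) (d + e)"
proof -
  let ?D = "rep_dsum Ns" and ?E = "rep_dsum (N # Ns)"
  note V1 = A_module_vs[OF N] and V2 = A_module_vs[OF Ns] and VE = A_module_vs[OF E]
  have oD: "ob ?D x = dsum (map (\<lambda>N. ob N x) Ns)" for x by (simp add: rep_dsum_def)
  have o: "ob ?E x = dsum (ob N x # map (\<lambda>N. ob N x) Ns)" for x by (simp add: rep_dsum_def)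
  have c: "carrier (ob ?E x) = {v # vs |v vs. v \<in> carrier (ob N x) \<and> vs \<in> carrier (ob ?D x)}" for x
    by (simp add: o oD dsum_Cons_carrier)
  have ops: "add (ob ?E x) (v # vs) (w # ws) = (v \<oplus>\<^bsub>ob N x\<^esub> w) # (vs \<oplus>\<^bsub>ob ?D x\<^esub> ws)"
    "smult (ob ?E x) k (v # vs) = (k \<odot>\<^bsub>ob N x\<^esub> v) # (k \<odot>\<^bsub>ob ?D x\<^esub> vs)"  for x v vs w ws k
    by (simp_all add: o oD dsum_Cons)
  have ac: "act ?E x y a (v # vs) = act N x y a v # act ?D x y a vs" for x y a v vs
    by (simp add: rep_dsum_def)
  let ?e1 = "\<lambda>x v. v # \<zero>\<^bsub>ob ?D x\<^esub>" and ?e2 = "\<lambda>x vs. \<zero>\<^bsub>ob N x\<^esub> # vs"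
  have e1: "rep_hom N ?E ?e1"
    by (rule rep_homI[OF N E], rule linear_mapI[OF V1 VE])
       (auto simp: c ops ac vs_facts[OF V2] linear_map_zero[OF A_module_act[OF Ns A_hom_one]])
  have e2: "rep_hom ?D ?E ?e2"
    by (rule rep_homI[OF Ns E], rule linear_mapI[OF V2 VE])
       (auto simp: c ops ac vs_facts[OF V1] linear_map_zero[OF A_module_act[OF N A_hom_one]])
  have p1: "rep_hom ?E N (\<lambda>x. hd)"
    by (rule rep_homI[OF E N], rule linear_mapI[OF VE V1]) (auto simp: c ops ac)
  have p2: "rep_hom ?E ?D (\<lambda>x. tl)"
    by (rule rep_homI[OF E Ns], rule linear_mapI[OF VE V2]) (auto simp: c ops ac)
  obtain f \<phi> where f: "\<And>i. i < d \<Longrightarrow> interval_vec I N (f i)"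
    and \<phi>: "\<And>i. i < d \<Longrightarrow> interval_covec I N (\<phi> i)"
    and dual: "\<And>i j. i < d \<Longrightarrow> j < d \<Longrightarrow> \<phi> i a (f j a) = (if i = j then 1 else 0)"
    and gen: "\<And>g \<chi>. interval_vec I N g \<Longrightarrow> interval_covec I N \<chi> \<Longrightarrow>
        \<chi> a (g a) = (\<Sum>i<d. \<chi> a (f i a) * \<phi> i a (g a))"
    using 1 unfolding pairing_rank_def by blast
  obtain f' \<phi>' where f': "\<And>i. i < e \<Longrightarrow> interval_vec I ?D (f' i)"
    and \<phi>': "\<And>i. i < e \<Longrightarrow> interval_covec I ?D (\<phi>' i)"
    and dual': "\<And>i j. i < e \<Longrightarrow> j < e \<Longrightarrow> \<phi>' i a (f' j a) = (if i = j then 1 else 0)"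
    and gen': "\<And>g \<chi>. interval_vec I ?D g \<Longrightarrow> interval_covec I ?D \<chi> \<Longrightarrow>
        \<chi> a (g a) = (\<Sum>i<e. \<chi> a (f' i a) * \<phi>' i a (g a))"
    using 2 unfolding pairing_rank_def by blast
  let ?f = "\<lambda>i x. if i < d then ?e1 x (f i x) else ?e2 x (f' (i - d) x)"
  let ?\<phi> = "\<lambda>i x vs. if i < d then \<phi> i x (hd vs) else \<phi>' (i - d) x (tl vs)"
  have z: "\<phi> i a \<zero>\<^bsub>ob N a\<^esub> = 0" if "i < d" for i
    by (rule lf_zero[OF V1]) (use \<phi>[OF that] a in \<open>auto simp: interval_covec_def\<close>)
  have z': "\<phi>' i a \<zero>\<^bsub>ob ?D a\<^esub> = 0" if "i < e" for i
    by (rule lf_zero[OF V2]) (use \<phi>'[OF that] a in \<open>auto simp: interval_covec_def\<close>)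
  show ?thesis
    unfolding pairing_rank_def
  proof (intro exI[of _ ?f] exI[of _ ?\<phi>] conjI allI impI)
    fix i assume i: "i < d + e"
    show "interval_vec I ?E (?f i)"
    proof (cases "i < d")
      case True then show ?thesis using interval_vec_hom[OF e1 f[OF True]] by simp
    next
      case False
      then have "i - d < e" using i by simp
      then show ?thesis using interval_vec_hom[OF e2 f'[of "i - d"]] False by simp
    qed
    show "interval_covec I ?E (?\<phi> i)"
    proof (cases "i < d")
      case True then show ?thesis using interval_covec_hom[OF p1 \<phi>[OF True]] by simp
    next
      case False
      then have "i - d < e" using i by simp
      then show ?thesis using interval_covec_hom[OF p2 \<phi>'[of "i - d"]] False by simp
    qed
    fix j assume j: "j < d + e"
    show "?\<phi> i a (?f j a) = (if i = j then 1 else 0)"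
      using i j by (auto simp: dual dual' z z')
  next
    fix g \<chi> assume g: "interval_vec I ?E g" and \<chi>: "interval_covec I ?E \<chi>"
    have "g a \<in> carrier (ob ?E a)" using g a by (auto simp: interval_vec_def)
    then obtain v vs where v: "g a = v # vs" "v \<in> carrier (ob N a)" "vs \<in> carrier (ob ?D a)"
      by (auto simp: c)
    \<comment> \<open>Splitting the vector at \<open>a\<close> reduces the claim to the two given
      factorizations: the projections of \<open>g\<close> and the restrictions of
      \<open>\<chi>\<close> are again morphisms.\<close>
    have "g a = add (ob ?E a) (?e1 a v) (?e2 a vs)"
      using v by (simp add: ops vs_facts[OF V1] vs_facts[OF V2])
    then have "\<chi> a (g a) = \<chi> a (?e1 a v) + \<chi> a (?e2 a vs)"
      using \<chi> a v by (auto simp: interval_covec_def lf_def c vs_zero[OF V1] vs_zero[OF V2])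
    also have "\<chi> a (?e1 a v) = (\<Sum>i<d. \<chi> a (?e1 a (f i a)) * \<phi> i a v)"
      using gen[OF interval_vec_hom[OF p1 g] interval_covec_hom[OF e1 \<chi>]] v by simp
    also have "\<dots> = (\<Sum>i<d. \<chi> a (?f i a) * ?\<phi> i a (g a))"
      using v by (intro sum.cong) auto
    also have "\<chi> a (?e2 a vs) = (\<Sum>i<e. \<chi> a (?e2 a (f' i a)) * \<phi>' i a vs)"
      using gen'[OF interval_vec_hom[OF p2 g] interval_covec_hom[OF e2 \<chi>]] v by simp
    also have "\<dots> = (\<Sum>i<e. \<chi> a (?f (d + i) a) * ?\<phi> (d + i) a (g a))"
      using v by (intro sum.cong) auto
    also have "(\<Sum>i<d. \<chi> a (?f i a) * ?\<phi> i a (g a)) +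
        (\<Sum>i<e. \<chi> a (?f (d + i) a) * ?\<phi> (d + i) a (g a))
        = (\<Sum>i<d + e. \<chi> a (?f i a) * ?\<phi> i a (g a))"
      by (simp only: sum_lessThan_add)
    finally show "\<chi> a (g a) = (\<Sum>i<d + e. \<chi> a (?f i a) * ?\<phi> i a (g a))" .
  qed
qed

text \<open>The composite of \<open>\<phi>\<close> and \<open>f\<close>, divided by the constant
  pairing value, is an idempotent endomorphism whose image is spanned by \<open>f\<close>.
  Indecomposability forces its kernel to vanish, so \<open>\<phi>\<close> is injective; it is onto
  because \<open>f\<close> has a nonzero value under it at every point of I.\<close>

lemma indecomposable_pairing:
  fixes N :: "('p::order, 'k::field, 'v) rep"
  assumes I: "interval I" and N: "indecomposable N" and f: "interval_vec I N f"
    and \<phi>: "interval_covec I N \<phi>" and a: "a \<in> I" and ne: "\<phi> a (f a) \<noteq> 0"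
  shows "rep_iso N (interval_rep I :: ('p, 'k, 'k) rep)"
proof -
  have NA: "A_module N" using N by (simp add: indecomposable_def)
  note V = A_module_vs[OF NA]
  let ?l = "\<phi> a (f a)"
  have pf: "\<phi> x (f x) = ?l" if "x \<in> I" for x by (rule pairing_const[OF I NA f \<phi> that a])
  have fin: "f x \<in> carrier (ob N x)" if "x \<in> I" for x using f that by (auto simp: interval_vec_def)
  have lin: "lf (ob N x) (\<phi> x)" if "x \<in> I" for x using \<phi> that by (auto simp: interval_covec_def)
  \<comment> \<open>Zero outside I; the trivial kernel found below therefore also shows that N
    vanishes outside I.\<close>
  let ?e = "\<lambda>x v. if x \<in> I then (\<phi> x v / ?l) \<odot>\<^bsub>ob N x\<^esub> f x else \<zero>\<^bsub>ob N x\<^esub>"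
  have e: "rep_hom N N ?e"
  proof (rule rep_homI[OF NA NA], rule linear_mapI[OF V V])
    fix x u v assume "u \<in> carrier (ob N x)" "v \<in> carrier (ob N x)"
    then show "?e x (u \<oplus>\<^bsub>ob N x\<^esub> v) = ?e x u \<oplus>\<^bsub>ob N x\<^esub> ?e x v"
      by (auto simp: lf_add[OF lin] add_divide_distrib vs_ldistr[OF V fin] vs_facts(1,7)[OF V])
  next
    fix x y v assume xy: "x \<le> y" and v: "v \<in> carrier (ob N x)"
    note A = A_module_act[OF NA A_hom_one[OF xy, of 1]]
    have "act N x y 1 (f x) = (if y \<in> I then f y else \<zero>\<^bsub>ob N y\<^esub>)" if "x \<in> I"
      using f xy that by (auto simp: interval_vec_def)
    moreover have "\<phi> y (act N x y 1 v) = (if x \<in> I then \<phi> x v else 0)" if "y \<in> I"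
      using \<phi> xy that v by (auto simp: interval_covec_def)
    ultimately show "?e y (act N x y 1 v) = act N x y 1 (?e x v)"
      by (auto simp: linear_map_smult[OF A fin] linear_map_zero[OF A] vs_zero_smult[OF V fin] vs_smult_zero[OF V])
  qed (auto simp: fin vs_facts[OF V] lf_smult[OF lin])
  have idem: "?e x (?e x v) = ?e x v" if "v \<in> carrier (ob N x)" for x v
    using ne by (auto simp: lf_smult[OF lin fin] pf)
  let ?N1 = "\<lparr>ob = \<lambda>x. (ob N x)\<lparr>carrier := ?e x ` carrier (ob N x)\<rparr>, act = act N\<rparr>"
  let ?N2 = "\<lparr>ob = \<lambda>x. (ob N x)\<lparr>carrier := {v \<in> carrier (ob N x). ?e x v = \<zero>\<^bsub>ob N x\<^esub>}\<rparr>, act = act N\<rparr>"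
  have "rep_zero ?N1 \<or> rep_zero ?N2"
    using N idempotent_splits[OF NA e idem] unfolding indecomposable_def by blast
  moreover have "\<not> rep_zero ?N1"
  proof
    assume "rep_zero ?N1"
    then have "?e a ` carrier (ob N a) = {\<zero>\<^bsub>ob N a\<^esub>}" by (simp add: rep_zero_def)
    then have "?e a (f a) = \<zero>\<^bsub>ob N a\<^esub>" using fin[OF a] by blast
    then have "f a = \<zero>\<^bsub>ob N a\<^esub>" using a ne fin[OF a] by (simp add: vs_one[OF V])
    then show False using ne lf_zero[OF V lin[OF a]] by simp
  qed
  ultimately have ker: "v = \<zero>\<^bsub>ob N x\<^esub>" if "v \<in> carrier (ob N x)" "?e x v = \<zero>\<^bsub>ob N x\<^esub>" for x v
    using that unfolding rep_zero_def by auto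
  let ?F = "\<lambda>x v. if x \<in> I then \<phi> x v else 0"
  have vl: "vspace (line b :: ('k, 'k) module)" for b
    by (rule vsI) (auto simp: line_def algebra_simps split: if_splits)
  have hom: "rep_hom N (interval_rep I) ?F"
    unfolding rep_hom_def
  proof (intro conjI allI ballI)
    fix x
    show "linear_map class_ring (ob N x) (ob (interval_rep I) x) (?F x)"
      unfolding interval_rep_def rep.simps
      by (rule linear_mapI[OF V vl]) (auto simp: line_def lf_add[OF lin] lf_smult[OF lin])
  next
    fix x y :: 'p and b :: 'k and v assume b: "b \<in> A_hom x y" and v: "v \<in> carrier (ob N x)"
    show "?F y (act N x y b v) = act (interval_rep I) x y b (?F x v)"
    proof (cases "x \<le> y")
      case True
      then show ?thesis
        using \<phi> v A_module_scale[OF NA True v, of b]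
        by (auto simp: interval_rep_def interval_covec_def lf_smult[OF lin A_module_act_in[OF NA True v]])
    next
      case False
      then show ?thesis
        using A_hom_not_le[OF False b] v A_module_zero[OF NA v] lf_zero[OF V lin]
        by (auto simp: interval_rep_def)
    qed
  qed
  moreover have "bij_betw (?F x) (carrier (ob N x)) (carrier (ob (interval_rep I) x))" for x
  proof -
    \<comment> \<open>Equal values of \<open>\<phi>\<close> put the difference into the kernel of
      the idempotent, hence it is 0; outside I the idempotent is 0 and the same argument
      applies.\<close>
    have inj: "u = v" if uv: "u \<in> carrier (ob N x)" "v \<in> carrier (ob N x)" "?F x u = ?F x v" for u v
    proof -
      obtain n b \<beta> where fr: "frame (ob N x) n b \<beta>"
        using A_module_has_dim[OF NA, of x] unfolding has_dim_def by blast
      let ?d = "u \<oplus>\<^bsub>ob N x\<^esub> (- 1) \<odot>\<^bsub>ob N x\<^esub> v"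
      have e0: "?e x ?d = \<zero>\<^bsub>ob N x\<^esub>"
        using uv by (auto simp: lf_add[OF lin] lf_smult[OF lin] vs_facts[OF V] fin)
      have d: "?d = \<zero>\<^bsub>ob N x\<^esub>" by (rule ker[OF _ e0]) (use uv in \<open>simp add: vs_facts[OF V]\<close>)
      show "u = v"
      proof (rule frame_eqI[OF V fr uv(1,2)])
        fix i assume "i < n"
        then have l: "lf (ob N x) (\<beta> i)" using fr by (auto simp: frame_def)
        show "\<beta> i u = \<beta> i v"
          using arg_cong[OF d, of "\<beta> i"] uv
          by (simp add: lf_add[OF l] lf_smult[OF l] lf_zero[OF V l] vs_smult[OF V])
      qed
    qed
    have "c \<in> ?F x ` carrier (ob N x)" if c: "c \<in> carrier (ob (interval_rep I) x)" for c
    proof (cases "x \<in> I")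
      case True
      have m: "(c / ?l) \<odot>\<^bsub>ob N x\<^esub> f x \<in> carrier (ob N x)" by (rule vs_smult[OF V fin[OF True]])
      have e: "?F x ((c / ?l) \<odot>\<^bsub>ob N x\<^esub> f x) = c"
        using True ne by (simp add: lf_smult[OF lin fin] pf)
      show ?thesis by (rule image_eqI[where f = "?F x", OF e[symmetric] m])
    next
      case False
      then have "c = ?F x \<zero>\<^bsub>ob N x\<^esub>" using c by (simp add: interval_rep_def line_def)
      then show ?thesis by (rule image_eqI[where f = "?F x", OF _ vs_zero[OF V]])
    qed
    moreover have "?F x v \<in> carrier (ob (interval_rep I) x)" for v
      by (auto simp: interval_rep_def line_def)
    ultimately have "?F x ` carrier (ob N x) = carrier (ob (interval_rep I) x)" by blast
    moreover have "inj_on (?F x) (carrier (ob N x))" using inj by (rule inj_onI)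
    ultimately show ?thesis unfolding bij_betw_def by blast
  qed
  ultimately show ?thesis unfolding rep_iso_def by blast
qed

text \<open>The value 1 is transported along the isomorphism; in the other case the pairing is zero,
  and empty families serve.\<close>

lemma pairing_rank_indecomposable:
  fixes N :: "('p::order, 'k::field, 'v) rep"
  assumes I: "interval I" and N: "indecomposable N" and a: "a \<in> I"
  shows "pairing_rank I a N (if rep_iso N (interval_rep I :: ('p, 'k, 'k) rep) then 1 else 0)"
proof (cases "rep_iso N (interval_rep I :: ('p, 'k, 'k) rep)")
  case True
  then show ?thesis
    using pairing_rank_iso[OF _ True a pairing_rank_interval[OF a]] N by (simp add: indecomposable_def)
next
  case False
  then have "\<chi> a (g a) = 0" if "interval_vec I N g" "interval_covec I N \<chi>" for g \<chi>
    using indecomposable_pairing[OF I N that a] by blast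
  then show ?thesis using False by (auto simp: pairing_rank_def)
qed

lemma pairing_rank_decomposition:
  fixes Ns :: "('p::order, 'k::field, 'v) rep list"
  assumes I: "interval I" and a: "a \<in> I" and Ns: "\<forall>N\<in>set Ns. indecomposable N"
  shows "pairing_rank I a (rep_dsum Ns)
    (length (filter (\<lambda>N. rep_iso N (interval_rep I :: ('p, 'k, 'k) rep)) Ns))"
  using Ns
proof (induction Ns)
  case Nil
  have "\<chi> a (g a) = 0" if "interval_vec I (rep_dsum [] :: ('p, 'k, 'v list) rep) g"
    and "interval_covec I (rep_dsum [] :: ('p, 'k, 'v list) rep) \<chi>" for g \<chi>
  proof -
    have A: "A_module (rep_dsum [] :: ('p, 'k, 'v list) rep)" by (rule A_module_dsum) simp
    have "g a = zero (ob (rep_dsum [] :: ('p, 'k, 'v list) rep) a)"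
      using that(1) a by (auto simp: interval_vec_def rep_dsum_def dsum_Nil)
    then show ?thesis
      using lf_zero[OF A_module_vs[OF A]] that(2) a by (auto simp: interval_covec_def)
  qed
  then show ?case by (auto simp: pairing_rank_def)
next
  case (Cons N Ns)
  have A: "A_module N'" if "N' \<in> set (N # Ns)" for N' using Cons.prems that by (auto simp: indecomposable_def)
  have "pairing_rank I a (rep_dsum (N # Ns))
     ((if rep_iso N (interval_rep I :: ('p, 'k, 'k) rep) then 1 else 0) +
      length (filter (\<lambda>N. rep_iso N (interval_rep I :: ('p, 'k, 'k) rep)) Ns))"
    by (rule pairing_rank_Cons[OF _ _ _ a pairing_rank_indecomposable[OF I _ a]])
       (use Cons A in \<open>auto intro!: A_module_dsum\<close>)
  then show ?case by (cases "rep_iso N (interval_rep I :: ('p, 'k, 'k) rep)") simp_all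
qed

section \<open>Existence of decompositions into indecomposables\<close>

lemma dim_surj:
  fixes V :: "('k::field, 'v) module" and W :: "('k, 'w) module"
  assumes T: "linear_map class_ring V W T" and V: "has_dim V n" and surj: "T ` carrier V = carrier W"
  shows "vectorspace.dim class_ring W \<le> vectorspace.dim class_ring V"
    and "v \<in> carrier V \<Longrightarrow> T v = \<zero>\<^bsub>W\<^esub> \<Longrightarrow> v \<noteq> \<zero>\<^bsub>V\<^esub> \<Longrightarrow>
      vectorspace.dim class_ring W < vectorspace.dim class_ring V"
proof -
  note VV = linear_map_source[OF T] and WV = linear_map_target[OF T]
  let ?K = "{v \<in> carrier V. T v = \<zero>\<^bsub>W\<^esub>}"
  have mh: "mod_hom class_ring V W T" using T by (simp add: linear_map_def)
  have e: "vectorspace.dim class_ring W + vectorspace.dim class_ring (V\<lparr>carrier := ?K\<rparr>) = vectorspace.dim class_ring V"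
    using linear_map.rank_nullity[OF T has_dim_fin_dim[OF VV V]] surj
    unfolding mod_hom.im_def[OF mh] mod_hom.ker_def[OF mh] by simp
  then show "vectorspace.dim class_ring W \<le> vectorspace.dim class_ring V" by simp
  have K: "sub ?K V"
    by (auto simp: sub_def vs_facts[OF VV] vs_facts[OF WV] linear_mapD(3-)[OF T] linear_map_zero[OF T])
  obtain m where m: "has_dim (V\<lparr>carrier := ?K\<rparr>) m" using has_dim_sub[OF VV V K] by blast
  assume v: "v \<in> carrier V" "T v = \<zero>\<^bsub>W\<^esub>" "v \<noteq> \<zero>\<^bsub>V\<^esub>"
  have "m \<noteq> 0"
  proof
    assume "m = 0"
    then have "?K = {\<zero>\<^bsub>V\<^esub>}" using m has_dim_0[OF vs_sub[OF VV K]] by simp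
    then show False using v by blast
  qed
  then show "vectorspace.dim class_ring W < vectorspace.dim class_ring V"
    using e has_dim_dim[OF vs_sub[OF VV K] m] by simp
qed

text \<open>Induction on the total dimension over the finitely many points. In a decomposition with
  two nonzero summands both have smaller total dimension, and their decompositions are joined. The
  result has to be a flat list, whereas \<open>rep_dsum [N1, N2]\<close> is nested, so the
  isomorphism is assembled anew from concatenated components.\<close>

lemma decomposition_exists:
  fixes M :: "('p::{finite, order}, 'k::field, 'v) rep"
  assumes "A_module M"
  shows "\<exists>Ns :: ('p, 'k, 'v) rep list. (\<forall>N\<in>set Ns. indecomposable N) \<and> rep_iso M (rep_dsum Ns)"
  using assms
proof (induction "\<Sum>x\<in>UNIV. vectorspace.dim class_ring (ob M x)" arbitrary: M rule: less_induct)
  case less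
  note M = less.prems
  show ?case
  proof (cases "rep_zero M")
    case True
    have E: "A_module (rep_dsum [] :: ('p, 'k, 'v list) rep)" by (rule A_module_dsum) simp
    have "rep_hom M (rep_dsum [] :: ('p, 'k, 'v list) rep) (\<lambda>_ _. [])"
      by (rule rep_homI[OF M E], rule linear_mapI[OF A_module_vs[OF M] A_module_vs[OF E]])
         (auto simp: rep_dsum_def dsum_Nil)
    moreover have "bij_betw (\<lambda>_. []) (carrier (ob M x)) (carrier (ob (rep_dsum [] :: ('p, 'k, 'v list) rep) x))" for x
      using True by (auto simp: rep_zero_def rep_dsum_def dsum_Nil bij_betw_def)
    ultimately have "rep_iso M (rep_dsum [] :: ('p, 'k, 'v list) rep)" unfolding rep_iso_def by blast
    then show ?thesis by (intro exI[of _ "[]"]) simp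
  next
    case nz: False
    show ?thesis
    proof (cases "indecomposable M")
      case True
      have E: "A_module (rep_dsum [M])" by (rule A_module_dsum) (use M in auto)
      have "rep_hom M (rep_dsum [M]) (\<lambda>_ v. [v])"
        by (rule rep_homI[OF M E], rule linear_mapI[OF A_module_vs[OF M] A_module_vs[OF E]])
           (auto simp: rep_dsum_def dsum_Nil dsum_Cons dsum_Cons_mem)
      moreover have "bij_betw (\<lambda>v. [v]) (carrier (ob M x)) (carrier (ob (rep_dsum [M]) x))" for x
        by (auto simp: rep_dsum_def dsum_Nil bij_betw_def dsum_Cons_carrier inj_on_def)
      ultimately have "rep_iso M (rep_dsum [M])" unfolding rep_iso_def by blast
      then show ?thesis using True by (intro exI[of _ "[M]"]) simp
    next
      case False
      then obtain N1 N2 :: "('p, 'k, 'v) rep" where N: "A_module N1" "A_module N2"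
        and iso: "rep_iso M (rep_dsum [N1, N2])" and z: "\<not> rep_zero N1" "\<not> rep_zero N2"
        using M nz unfolding indecomposable_def by blast
      obtain F where F: "rep_hom M (rep_dsum [N1, N2]) F"
        and bij: "\<And>x. bij_betw (F x) (carrier (ob M x)) (carrier (ob (rep_dsum [N1, N2]) x))"
        using iso by (auto simp: rep_iso_def)
      have D: "A_module (rep_dsum [N1, N2])" by (rule A_module_dsum) (use N in auto)
      have oD: "ob (rep_dsum [N1, N2]) x = dsum [ob N1 x, ob N2 x]" for x by (simp add: rep_dsum_def)
      have cD: "carrier (dsum [ob N1 x, ob N2 x]) = {[u, v] |u v. u \<in> carrier (ob N1 x) \<and> v \<in> carrier (ob N2 x)}" for x
        by (auto simp: dsum_Cons_carrier dsum_Nil)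
      have Fx: "F x v = [F x v ! 0, F x v ! 1]" "F x v ! 0 \<in> carrier (ob N1 x)" "F x v ! 1 \<in> carrier (ob N2 x)"
        if "v \<in> carrier (ob M x)" for x v
        using rep_hom_in[OF F that] unfolding oD cD by auto
      have p: "linear_map class_ring (ob M x) (ob N1 x) (\<lambda>v. F x v ! 0)"
        "linear_map class_ring (ob M x) (ob N2 x) (\<lambda>v. F x v ! 1)" for x
      proof -
        note L = rep_hom_linear[OF F, of x, unfolded oD]
        have ops: "add (dsum [ob N1 x, ob N2 x]) w w' = [w ! 0 \<oplus>\<^bsub>ob N1 x\<^esub> w' ! 0, w ! 1 \<oplus>\<^bsub>ob N2 x\<^esub> w' ! 1]"
          "smult (dsum [ob N1 x, ob N2 x]) c w = [c \<odot>\<^bsub>ob N1 x\<^esub> w ! 0, c \<odot>\<^bsub>ob N2 x\<^esub> w ! 1]" for w w' c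
          by (simp_all add: dsum_def)
        show "linear_map class_ring (ob M x) (ob N1 x) (\<lambda>v. F x v ! 0)"
          by (rule linear_mapI[OF A_module_vs[OF M] A_module_vs[OF N(1)]])
             (simp_all add: Fx(2) linear_map_add[OF L] linear_map_smult[OF L] ops)
        show "linear_map class_ring (ob M x) (ob N2 x) (\<lambda>v. F x v ! 1)"
          by (rule linear_mapI[OF A_module_vs[OF M] A_module_vs[OF N(2)]])
             (simp_all add: Fx(3)[simplified] linear_map_add[OF L] linear_map_smult[OF L] ops)
      qed
      have FI: "\<exists>w\<in>carrier (ob M x). F x w = [u, v]" if "u \<in> carrier (ob N1 x)" "v \<in> carrier (ob N2 x)" for x u v
      proof -
        have "[u, v] \<in> F x ` carrier (ob M x)"
          using bij[of x] that unfolding oD cD bij_betw_def by blast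
        then show ?thesis by force
      qed
      obtain n where n: "\<And>x. has_dim (ob M x) (n x)" using A_module_has_dim[OF M] by metis
      have surj: "(\<lambda>v. F x v ! 0) ` carrier (ob M x) = carrier (ob N1 x)"
        "(\<lambda>v. F x v ! 1) ` carrier (ob M x) = carrier (ob N2 x)" for x
      proof -
        have "u \<in> (\<lambda>v. F x v ! 0) ` carrier (ob M x)" if u: "u \<in> carrier (ob N1 x)" for u
        proof -
          obtain w where "w \<in> carrier (ob M x)" "F x w = [u, \<zero>\<^bsub>ob N2 x\<^esub>]"
            using FI[OF u vs_zero[OF A_module_vs[OF N(2)]]] by blast
          then show ?thesis by (intro image_eqI[of _ _ w]) auto
        qed
        moreover have "u \<in> (\<lambda>v. F x v ! 1) ` carrier (ob M x)" if u: "u \<in> carrier (ob N2 x)" for u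
        proof -
          obtain w where "w \<in> carrier (ob M x)" "F x w = [\<zero>\<^bsub>ob N1 x\<^esub>, u]"
            using FI[OF vs_zero[OF A_module_vs[OF N(1)]] u] by blast
          then show ?thesis by (intro image_eqI[of _ _ w]) auto
        qed
        ultimately show "(\<lambda>v. F x v ! 0) ` carrier (ob M x) = carrier (ob N1 x)"
          "(\<lambda>v. F x v ! 1) ` carrier (ob M x) = carrier (ob N2 x)" using Fx by blast+
      qed
      have F0: "F x \<zero>\<^bsub>ob M x\<^esub> = [\<zero>\<^bsub>ob N1 x\<^esub>, \<zero>\<^bsub>ob N2 x\<^esub>]" for x
        using linear_map_zero[OF rep_hom_linear[OF F, of x, unfolded oD]] by (simp add: dsum_Cons dsum_Nil)
      obtain x1 v1 where v1: "v1 \<in> carrier (ob N1 x1)" "v1 \<noteq> \<zero>\<^bsub>ob N1 x1\<^esub>"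
        using z(1) vs_zero[OF A_module_vs[OF N(1)]] unfolding rep_zero_def by blast
      obtain x2 v2 where v2: "v2 \<in> carrier (ob N2 x2)" "v2 \<noteq> \<zero>\<^bsub>ob N2 x2\<^esub>"
        using z(2) vs_zero[OF A_module_vs[OF N(2)]] unfolding rep_zero_def by blast
      obtain w1 where w1: "w1 \<in> carrier (ob M x1)" "F x1 w1 = [v1, \<zero>\<^bsub>ob N2 x1\<^esub>]"
        using FI[OF v1(1) vs_zero[OF A_module_vs[OF N(2)]]] by blast
      obtain w2 where w2: "w2 \<in> carrier (ob M x2)" "F x2 w2 = [\<zero>\<^bsub>ob N1 x2\<^esub>, v2]"
        using FI[OF vs_zero[OF A_module_vs[OF N(1)]] v2(1)] by blast
      have "w1 \<noteq> \<zero>\<^bsub>ob M x1\<^esub>" "w2 \<noteq> \<zero>\<^bsub>ob M x2\<^esub>" using w1 w2 v1 v2 F0 by auto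
      \<comment> \<open>A nonzero vector of one summand, placed into M, is killed by the projection
        to the other; so each summand is strictly smaller than M at some point where the other one
        is nonzero.\<close>
      then have lt: "vectorspace.dim class_ring (ob N1 x2) < vectorspace.dim class_ring (ob M x2)"
        "vectorspace.dim class_ring (ob N2 x1) < vectorspace.dim class_ring (ob M x1)"
        using dim_surj(2)[OF p(1) n surj(1) w2(1)] dim_surj(2)[OF p(2) n surj(2) w1(1)] w1 w2 by auto
      have "(\<Sum>x\<in>UNIV. vectorspace.dim class_ring (ob N1 x)) < (\<Sum>x\<in>UNIV. vectorspace.dim class_ring (ob M x))"
        "(\<Sum>x\<in>UNIV. vectorspace.dim class_ring (ob N2 x)) < (\<Sum>x\<in>UNIV. vectorspace.dim class_ring (ob M x))"
        using dim_surj(1)[OF p(1) n surj(1)] dim_surj(1)[OF p(2) n surj(2)] lt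
        by (auto intro!: sum_strict_mono_ex1)
      then obtain Ns1 Ns2 :: "('p, 'k, 'v) rep list" where
        Ns: "\<forall>N\<in>set Ns1. indecomposable N" "\<forall>N\<in>set Ns2. indecomposable N"
        and i1: "rep_iso N1 (rep_dsum Ns1)" and i2: "rep_iso N2 (rep_dsum Ns2)"
        using less.hyps N by metis
      obtain G1 where G1: "rep_hom N1 (rep_dsum Ns1) G1"
        and b1: "\<And>x. bij_betw (G1 x) (carrier (ob N1 x)) (carrier (ob (rep_dsum Ns1) x))"
        using i1 by (auto simp: rep_iso_def)
      obtain G2 where G2: "rep_hom N2 (rep_dsum Ns2) G2"
        and b2: "\<And>x. bij_betw (G2 x) (carrier (ob N2 x)) (carrier (ob (rep_dsum Ns2) x))"
        using i2 by (auto simp: rep_iso_def)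
      let ?E = "rep_dsum (Ns1 @ Ns2)"
      have E: "A_module ?E" by (rule A_module_dsum) (use Ns in \<open>auto simp: indecomposable_def\<close>)
      have oE: "ob ?E x = dsum (map (\<lambda>N. ob N x) Ns1 @ map (\<lambda>N. ob N x) Ns2)" for x
        by (simp add: rep_dsum_def)
      have o1: "ob (rep_dsum Ns1) x = dsum (map (\<lambda>N. ob N x) Ns1)"
        "ob (rep_dsum Ns2) x = dsum (map (\<lambda>N. ob N x) Ns2)" for x by (simp_all add: rep_dsum_def)
      have cE: "carrier (ob ?E x) = {us @ vs |us vs. us \<in> carrier (ob (rep_dsum Ns1) x) \<and> vs \<in> carrier (ob (rep_dsum Ns2) x)}" for x
        unfolding oE o1 by (rule dsum_append_carrier)
      have opE: "add (ob ?E x) (us @ vs) (us' @ vs') = add (ob (rep_dsum Ns1) x) us us' @ add (ob (rep_dsum Ns2) x) vs vs'"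
        "smult (ob ?E x) k (us @ vs) = smult (ob (rep_dsum Ns1) x) k us @ smult (ob (rep_dsum Ns2) x) k vs"
        if "us \<in> carrier (ob (rep_dsum Ns1) x)" "us' \<in> carrier (ob (rep_dsum Ns1) x)" for x us vs us' vs' k
        using dsum_append(1)[OF that[unfolded o1]] dsum_append(2)[OF that(1)[unfolded o1]]
        unfolding oE o1 by blast+
      have len: "length us = length Ns1" if "us \<in> carrier (ob (rep_dsum Ns1) x)" for us x
        using that by (simp add: o1 dsum_def)
      have aE: "act ?E x y a (us @ vs) = act (rep_dsum Ns1) x y a us @ act (rep_dsum Ns2) x y a vs"
        if "us \<in> carrier (ob (rep_dsum Ns1) x)" for x y a us vs
        using len[OF that] by (simp add: rep_dsum_def)
      \<comment> \<open>All lists in the first factor have the length of \<open>Ns1\<close>; this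
        fixed length makes concatenation injective and compatible with the operations.\<close>
      let ?H = "\<lambda>x v. G1 x (F x v ! 0) @ G2 x (F x v ! 1)"
      have Gin: "G1 x (F x v ! 0) \<in> carrier (ob (rep_dsum Ns1) x)" "G2 x (F x v ! 1) \<in> carrier (ob (rep_dsum Ns2) x)"
        if "v \<in> carrier (ob M x)" for x v using rep_hom_in[OF G1] rep_hom_in[OF G2] Fx[OF that] by blast+
      have aF: "F y (act M x y 1 v) ! 0 = act N1 x y 1 (F x v ! 0)" "F y (act M x y 1 v) ! 1 = act N2 x y 1 (F x v ! 1)"
        if "x \<le> y" "v \<in> carrier (ob M x)" for x y v
      proof -
        have "F y (act M x y 1 v) = act (rep_dsum [N1, N2]) x y 1 [F x v ! 0, F x v ! 1]"
          using rep_hom_act[OF F that] Fx(1)[OF that(2)] by simp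
        then show "F y (act M x y 1 v) ! 0 = act N1 x y 1 (F x v ! 0)" "F y (act M x y 1 v) ! 1 = act N2 x y 1 (F x v ! 1)"
          by (simp_all add: rep_dsum_def)
      qed
      have "rep_hom M ?E ?H"
      proof (rule rep_homI[OF M E], rule linear_mapI[OF A_module_vs[OF M] A_module_vs[OF E]])
        fix x v assume v: "v \<in> carrier (ob M x)"
        show "?H x v \<in> carrier (ob ?E x)" using Gin[OF v] unfolding cE by blast
        show "?H x (c \<odot>\<^bsub>ob M x\<^esub> v) = c \<odot>\<^bsub>ob ?E x\<^esub> ?H x v" for c
          unfolding opE(2)[OF Gin(1)[OF v] Gin(1)[OF v]]
          using v by (simp add: linear_map_smult[OF p(1)] linear_map_smult[OF p(2), simplified]
            linear_map_smult[OF rep_hom_linear[OF G1]] linear_map_smult[OF rep_hom_linear[OF G2]] Fx(2) Fx(3)[simplified])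
        fix u assume u: "u \<in> carrier (ob M x)"
        show "?H x (v \<oplus>\<^bsub>ob M x\<^esub> u) = ?H x v \<oplus>\<^bsub>ob ?E x\<^esub> ?H x u"
          unfolding opE(1)[OF Gin(1)[OF v] Gin(1)[OF u]]
          using u v by (simp add: linear_map_add[OF p(1)] linear_map_add[OF p(2), simplified]
            linear_map_add[OF rep_hom_linear[OF G1]] linear_map_add[OF rep_hom_linear[OF G2]] Fx(2) Fx(3)[simplified])
      next
        fix x y v assume xy: "x \<le> y" and v: "v \<in> carrier (ob M x)"
        show "?H y (act M x y 1 v) = act ?E x y 1 (?H x v)"
          using aF[OF xy v] aE[OF Gin(1)[OF v]] rep_hom_act[OF G1 xy Fx(2)[OF v]] rep_hom_act[OF G2 xy Fx(3)[OF v]]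
          by simp
      qed
      moreover have "bij_betw (?H x) (carrier (ob M x)) (carrier (ob ?E x))" for x
        unfolding bij_betw_def
      proof
        show "inj_on (?H x) (carrier (ob M x))"
        proof (rule inj_onI)
          fix u v assume u: "u \<in> carrier (ob M x)" and v: "v \<in> carrier (ob M x)" and e: "?H x u = ?H x v"
          have "G1 x (F x u ! 0) = G1 x (F x v ! 0) \<and> G2 x (F x u ! 1) = G2 x (F x v ! 1)"
            using len[OF Gin(1)[OF u]] len[OF Gin(1)[OF v]] e by (intro append_eq_append_conv[THEN iffD1]) simp_all
          then have "F x u ! 0 = F x v ! 0" "F x u ! 1 = F x v ! 1"
            using inj_onD[OF bij_betw_imp_inj_on[OF b1] _ Fx(2)[OF u] Fx(2)[OF v]]
              inj_onD[OF bij_betw_imp_inj_on[OF b2] _ Fx(3)[OF u] Fx(3)[OF v]] by simp_all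
          then have "[F x u ! 0, F x u ! 1] = [F x v ! 0, F x v ! 1]" by simp
          then have "F x u = F x v" by (simp only: Fx(1)[OF u, symmetric] Fx(1)[OF v, symmetric])
          then show "u = v" by (rule inj_onD[OF bij_betw_imp_inj_on[OF bij] _ u v])
        qed
        have "us @ vs \<in> ?H x ` carrier (ob M x)"
          if us: "us \<in> carrier (ob (rep_dsum Ns1) x)" and vs: "vs \<in> carrier (ob (rep_dsum Ns2) x)" for us vs
        proof -
          obtain u v where uv: "u \<in> carrier (ob N1 x)" "us = G1 x u" "v \<in> carrier (ob N2 x)" "vs = G2 x v"
            using us vs unfolding bij_betw_imp_surj_on[OF b1, symmetric] bij_betw_imp_surj_on[OF b2, symmetric]
            by blast
          obtain w where "w \<in> carrier (ob M x)" "F x w = [u, v]" using FI[OF uv(1) uv(3)] by blast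
          then show ?thesis using uv by (intro image_eqI[of _ _ w]) auto
        qed
        moreover have "?H x v \<in> carrier (ob ?E x)" if "v \<in> carrier (ob M x)" for v
          using Gin[OF that] unfolding cE by blast
        ultimately show "?H x ` carrier (ob M x) = carrier (ob ?E x)" unfolding cE by blast
      qed
      ultimately have "rep_iso M ?E" unfolding rep_iso_def by blast
      then show ?thesis using Ns by (intro exI[of _ "Ns1 @ Ns2"]) auto
    qed
  qed
qed

section \<open>Relations between minimal and between maximal elements\<close>

lemma finite_sc_below:
  fixes U :: "'p::{finite, order} set"
  assumes "x \<in> U" shows "\<exists>a\<in>sc U. a \<le> x"
proof -
  obtain a where "a \<in> U" "a \<le> x" "\<And>b. b \<in> U \<Longrightarrow> b \<le> a \<Longrightarrow> a = b"
    using finite_has_minimal2[of U x] assms by auto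
  then show ?thesis by (auto simp: sc_def)
qed

lemma finite_sk_above:
  fixes U :: "'p::{finite, order} set"
  assumes "x \<in> U" shows "\<exists>b\<in>sk U. x \<le> b"
proof -
  obtain a where "a \<in> U" "x \<le> a" "\<And>b. b \<in> U \<Longrightarrow> a \<le> b \<Longrightarrow> a = b"
    using finite_has_maximal2[of U x] assms by auto
  then show ?thesis by (auto simp: sk_def)
qed

text \<open>Which of the two comes first is left open, as swapping them only changes the sign of a
  row of \<open>g1\<close> or a column of \<open>g2\<close>.\<close>

lemma lo_hi:
  assumes r: "linear_order_on A r" and uv: "u \<in> A" "v \<in> A" "u \<noteq> v"
  shows "lo r {u, v} = u \<and> hi r {u, v} = v \<or> lo r {u, v} = v \<and> hi r {u, v} = u"
proof -
  have refl: "\<And>x. x \<in> A \<Longrightarrow> (x, x) \<in> r" and anti: "\<And>x y. (x, y) \<in> r \<Longrightarrow> (y, x) \<in> r \<Longrightarrow> x = y"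
    and total: "\<And>x y. x \<in> A \<Longrightarrow> y \<in> A \<Longrightarrow> x \<noteq> y \<Longrightarrow> (x, y) \<in> r \<or> (y, x) \<in> r"
    using r by (auto simp: linear_order_on_def partial_order_on_def preorder_on_def refl_on_def antisym_def total_on_def)
  have "lo r {u, v} = u \<and> hi r {u, v} = v" if "(u, v) \<in> r"
    unfolding lo_def hi_def
    by (intro conjI the_equality) (use that uv refl anti in blast)+
  moreover have "lo r {u, v} = v \<and> hi r {u, v} = u" if "(v, u) \<in> r"
    unfolding lo_def hi_def
    by (intro conjI the_equality) (use that uv refl anti in blast)+
  ultimately show ?thesis using total[OF uv] by blast
qed

text \<open>
  The properties of \<open>sc1 r I\<close> and \<open>sc1_circ \<phi> I\<close> on which the argument rests: the indices are pairs of
  minimal elements with a common upper bound, and they connect the minimal elements below any \<open>x\<close>.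
\<close>

definition connecting_up :: "'p::order set \<Rightarrow> ('p \<times> 'p) set \<Rightarrow> ('p set \<times> 'p) set \<Rightarrow> bool" where
  "connecting_up I r L \<longleftrightarrow>
     (\<forall>aa c. (aa, c) \<in> L \<longrightarrow> lo r aa \<in> sc I \<and> hi r aa \<in> sc I \<and> lo r aa \<noteq> hi r aa \<and> lo r aa \<le> c \<and> hi r aa \<le> c) \<and>
     (\<forall>x P a a'. (\<forall>aa c. (aa, c) \<in> L \<longrightarrow> c \<le> x \<longrightarrow> P (lo r aa) = P (hi r aa)) \<longrightarrow>
        a \<in> sc I \<longrightarrow> a' \<in> sc I \<longrightarrow> a \<le> x \<longrightarrow> a' \<le> x \<longrightarrow> P a \<longrightarrow> P a')"

definition connecting_down :: "'p::order set \<Rightarrow> ('p \<times> 'p) set \<Rightarrow> ('p set \<times> 'p) set \<Rightarrow> bool" where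
  "connecting_down I r L \<longleftrightarrow>
     (\<forall>bb d. (bb, d) \<in> L \<longrightarrow> lo r bb \<in> sk I \<and> hi r bb \<in> sk I \<and> lo r bb \<noteq> hi r bb \<and> d \<le> lo r bb \<and> d \<le> hi r bb) \<and>
     (\<forall>x P b b'. (\<forall>bb d. (bb, d) \<in> L \<longrightarrow> x \<le> d \<longrightarrow> P (lo r bb) = P (hi r bb)) \<longrightarrow>
        b \<in> sk I \<longrightarrow> b' \<in> sk I \<longrightarrow> x \<le> b \<longrightarrow> x \<le> b' \<longrightarrow> P b \<longrightarrow> P b')"

text \<open>Predicates take the place of paths: the pairs with bound c \<le> x are the edges of a
  graph on the minimal elements below x, and its connectedness is used by propagating a property
  along the edges.\<close>

lemma connecting_up_propagate:
  assumes "connecting_up I r L" "\<And>aa c. (aa, c) \<in> L \<Longrightarrow> c \<le> x \<Longrightarrow> P (lo r aa) = P (hi r aa)"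
    and "a \<in> sc I" "a' \<in> sc I" "a \<le> x" "a' \<le> x" "P a"
  shows "P a'"
  using assms(1)[unfolded connecting_up_def, THEN conjunct2, rule_format, of x P a a'] assms(2-) by blast

lemma connecting_down_propagate:
  assumes "connecting_down I r L" "\<And>bb d. (bb, d) \<in> L \<Longrightarrow> x \<le> d \<Longrightarrow> P (lo r bb) = P (hi r bb)"
    and "b \<in> sk I" "b' \<in> sk I" "x \<le> b" "x \<le> b'" "P b"
  shows "P b'"
  using assms(1)[unfolded connecting_down_def, THEN conjunct2, rule_format, of x P b b'] assms(2-) by blast

text \<open>x itself is a common upper bound of two minimal elements below x, so some minimal common
  upper bound lies below x: the two are joined by a single edge.\<close>

lemma connecting_up_sc1:
  fixes I :: "'p::{finite, order} set"
  assumes r: "linear_order_on (sc I) r"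
  shows "connecting_up I r (sc1 r I)"
  unfolding connecting_up_def
proof (intro conjI allI impI)
  fix aa c assume "(aa, c) \<in> sc1 r I"
  then obtain u v where uv: "aa = {u, v}" "u \<noteq> v" "u \<in> sc I" "v \<in> sc I"
    and c: "c \<in> sc (up (lo r aa) \<inter> up (hi r aa))"
    unfolding sc1_def by (auto simp: card_2_iff)
  show "lo r aa \<in> sc I" "hi r aa \<in> sc I" "lo r aa \<noteq> hi r aa"
    using lo_hi[OF r uv(3,4,2)] uv by auto
  show "lo r aa \<le> c" "hi r aa \<le> c" using c by (auto simp: sc_def up_def)
next
  fix x P a a'
  assume conn: "\<forall>aa c. (aa, c) \<in> sc1 r I \<longrightarrow> c \<le> x \<longrightarrow> P (lo r aa) = P (hi r aa)"
    and a: "a \<in> sc I" "a' \<in> sc I" "a \<le> x" "a' \<le> x" "P a"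
  show "P a'"
  proof (cases "a = a'")
    case False
    let ?aa = "{a, a'}"
    have lh: "lo r ?aa = a \<and> hi r ?aa = a' \<or> lo r ?aa = a' \<and> hi r ?aa = a"
      by (rule lo_hi[OF r a(1,2) False])
    then have "x \<in> up (lo r ?aa) \<inter> up (hi r ?aa)" using a by (auto simp: up_def)
    then obtain c where "c \<in> sc (up (lo r ?aa) \<inter> up (hi r ?aa))" "c \<le> x"
      using finite_sc_below by blast
    moreover from this have "(?aa, c) \<in> sc1 r I" using a False by (auto simp: sc1_def)
    ultimately have "P (lo r ?aa) = P (hi r ?aa)" using conn by blast
    then show ?thesis using lh a(5) by auto
  qed (use a in simp)
qed

lemma connecting_down_sk1:
  fixes I :: "'p::{finite, order} set"
  assumes r: "linear_order_on (sk I) r"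
  shows "connecting_down I r (sk1 r I)"
  unfolding connecting_down_def
proof (intro conjI allI impI)
  fix bb d assume "(bb, d) \<in> sk1 r I"
  then obtain u v where uv: "bb = {u, v}" "u \<noteq> v" "u \<in> sk I" "v \<in> sk I"
    and d: "d \<in> sk (down (lo r bb) \<inter> down (hi r bb))"
    unfolding sk1_def by (auto simp: card_2_iff)
  show "lo r bb \<in> sk I" "hi r bb \<in> sk I" "lo r bb \<noteq> hi r bb"
    using lo_hi[OF r uv(3,4,2)] uv by auto
  show "d \<le> lo r bb" "d \<le> hi r bb" using d by (auto simp: sk_def down_def)
next
  fix x P b b'
  assume conn: "\<forall>bb d. (bb, d) \<in> sk1 r I \<longrightarrow> x \<le> d \<longrightarrow> P (lo r bb) = P (hi r bb)"
    and b: "b \<in> sk I" "b' \<in> sk I" "x \<le> b" "x \<le> b'" "P b"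
  show "P b'"
  proof (cases "b = b'")
    case False
    let ?bb = "{b, b'}"
    have lh: "lo r ?bb = b \<and> hi r ?bb = b' \<or> lo r ?bb = b' \<and> hi r ?bb = b"
      by (rule lo_hi[OF r b(1,2) False])
    then have "x \<in> down (lo r ?bb) \<inter> down (hi r ?bb)" using b by (auto simp: down_def)
    then obtain d where "d \<in> sk (down (lo r ?bb) \<inter> down (hi r ?bb))" "x \<le> d"
      using finite_sk_above by blast
    moreover from this have "(?bb, d) \<in> sk1 r I" using b False by (auto simp: sk1_def)
    ultimately have "P (lo r ?bb) = P (hi r ?bb)" using conn by blast
    then show ?thesis using lh b(5) by auto
  qed (use b in simp)
qed

section \<open>The grid: joins, meets and antichains\<close>

lemma grid_chart_point:
  assumes "grid_chart m n \<phi>" "1 \<le> i" "i \<le> m" "1 \<le> j" "j \<le> n"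
  shows "\<exists>x. \<phi> x = (i, j)"
proof -
  have "(i, j) \<in> \<phi> ` UNIV" using assms by (auto simp: grid_chart_def bij_betw_def)
  then show ?thesis by auto
qed

lemma grid_chart_bounds:
  assumes "grid_chart m n \<phi>"
  shows "1 \<le> fst (\<phi> x)" "fst (\<phi> x) \<le> m" "1 \<le> snd (\<phi> x)" "snd (\<phi> x) \<le> n"
proof -
  have "\<phi> x \<in> {1..m} \<times> {1..n}" using assms unfolding grid_chart_def bij_betw_def by blast
  then show "1 \<le> fst (\<phi> x)" "fst (\<phi> x) \<le> m" "1 \<le> snd (\<phi> x)" "snd (\<phi> x) \<le> n"
    by (auto simp: mem_Times_iff)
qed

lemma grid_join:
  fixes a b :: "'p::order" and \<phi> :: "'p \<Rightarrow> nat \<times> nat"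
  assumes g: "grid_chart m n \<phi>"
  shows "a \<le> join a b" "b \<le> join a b" "a \<le> z \<Longrightarrow> b \<le> z \<Longrightarrow> join a b \<le> z"
proof -
  note le = g[unfolded grid_chart_def, THEN conjunct2, rule_format]
  obtain c where c: "\<phi> c = (max (fst (\<phi> a)) (fst (\<phi> b)), max (snd (\<phi> a)) (snd (\<phi> b)))"
    using grid_chart_point[OF g] grid_chart_bounds[OF g, of a] grid_chart_bounds[OF g, of b]
    by (metis (no_types, lifting) max.bounded_iff max.coboundedI1)
  have c': "a \<le> c" "b \<le> c" "\<And>z. a \<le> z \<Longrightarrow> b \<le> z \<Longrightarrow> c \<le> z"
    using c le by auto
  have "join a b = c"
    unfolding join_def by (rule the_equality) (use c' in \<open>blast intro: order_antisym\<close>)+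
  then show "a \<le> join a b" "b \<le> join a b" "a \<le> z \<Longrightarrow> b \<le> z \<Longrightarrow> join a b \<le> z"
    using c' by auto
qed

lemma grid_meet:
  fixes a b :: "'p::order" and \<phi> :: "'p \<Rightarrow> nat \<times> nat"
  assumes g: "grid_chart m n \<phi>"
  shows "meet a b \<le> a" "meet a b \<le> b" "z \<le> a \<Longrightarrow> z \<le> b \<Longrightarrow> z \<le> meet a b"
proof -
  note le = g[unfolded grid_chart_def, THEN conjunct2, rule_format]
  obtain c where c: "\<phi> c = (min (fst (\<phi> a)) (fst (\<phi> b)), min (snd (\<phi> a)) (snd (\<phi> b)))"
    using grid_chart_point[OF g] grid_chart_bounds[OF g, of a] grid_chart_bounds[OF g, of b]
    by (metis (no_types, lifting) min.bounded_iff min.coboundedI1)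
  have c': "c \<le> a" "c \<le> b" "\<And>z. z \<le> a \<Longrightarrow> z \<le> b \<Longrightarrow> z \<le> c"
    using c le by auto
  have "meet a b = c"
    unfolding meet_def by (rule the_equality) (use c' in \<open>blast intro: order_antisym\<close>)+
  then show "meet a b \<le> a" "meet a b \<le> b" "z \<le> a \<Longrightarrow> z \<le> b \<Longrightarrow> z \<le> meet a b"
    using c' by auto
qed

text \<open>Incomparability reverses the order of the first coordinates: antichains in the grid are
  descending staircases, which is why relations between neighbours suffice there.\<close>

lemma grid_antichain:
  assumes g: "grid_chart m n \<phi>" and A: "\<forall>x\<in>A. \<forall>y\<in>A. x \<le> y \<longrightarrow> x = y"
    and uv: "u \<in> A" "v \<in> A" "snd (\<phi> u) \<le> snd (\<phi> v)" "u \<noteq> v"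
  shows "snd (\<phi> u) < snd (\<phi> v)" "fst (\<phi> v) < fst (\<phi> u)"
proof -
  note le = g[unfolded grid_chart_def, THEN conjunct2, rule_format]
  have "\<not> u \<le> v" "\<not> v \<le> u" using A uv by blast+
  then show "snd (\<phi> u) < snd (\<phi> v)" "fst (\<phi> v) < fst (\<phi> u)" using uv le by auto
qed

text \<open>Walks from u to v through immediate successors, by induction on the distance of the
  second coordinates. \<open>Q\<close> will be the condition of lying below (or above) x, and
  \<open>between\<close> says that the intermediate steps of the staircase inherit it from the
  ends.\<close>

lemma consecutive_induct:
  fixes A :: "'p::{finite, order} set"
  assumes g: "grid_chart m n \<phi>" and A: "\<forall>x\<in>A. \<forall>y\<in>A. x \<le> y \<longrightarrow> x = y"
    and step: "\<And>u w. consecutive \<phi> A u w \<Longrightarrow> Q u \<Longrightarrow> Q w \<Longrightarrow> P u = P w"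
    and between: "\<And>u w v. u \<in> A \<Longrightarrow> w \<in> A \<Longrightarrow> v \<in> A \<Longrightarrow> Q u \<Longrightarrow> Q v \<Longrightarrow>
      snd (\<phi> u) \<le> snd (\<phi> w) \<Longrightarrow> snd (\<phi> w) \<le> snd (\<phi> v) \<Longrightarrow>
      fst (\<phi> w) \<le> fst (\<phi> u) \<Longrightarrow> fst (\<phi> v) \<le> fst (\<phi> w) \<Longrightarrow> Q w"
    and uv: "u \<in> A" "v \<in> A" "Q u" "Q v" "snd (\<phi> u) \<le> snd (\<phi> v)"
  shows "P u = P v"
  using uv
proof (induction "snd (\<phi> v) - snd (\<phi> u)" arbitrary: u rule: less_induct)
  case less
  note anti = grid_antichain[OF g A]
  show ?case
  proof (cases "u = v")
    case False
    \<comment> \<open>An element of least second coordinate in this set is consecutive to u; it is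
      the next step of the walk.\<close>
    let ?B = "{w \<in> A. snd (\<phi> u) < snd (\<phi> w)}"
    have lt: "snd (\<phi> u) < snd (\<phi> v)" using anti(1) less.prems False by blast
    then have "v \<in> ?B" using less.prems by auto
    then obtain w where w: "w \<in> ?B" "\<And>z. z \<in> ?B \<Longrightarrow> snd (\<phi> w) \<le> snd (\<phi> z)"
      using ex_has_least_nat[of "\<lambda>w. w \<in> ?B" v "\<lambda>w. snd (\<phi> w)"] by blast
    have wv: "snd (\<phi> w) \<le> snd (\<phi> v)" using w(2) \<open>v \<in> ?B\<close> by blast
    have f1: "fst (\<phi> w) \<le> fst (\<phi> u)" using anti(2)[of u w] w(1) less.prems by fastforce
    have f2: "fst (\<phi> v) \<le> fst (\<phi> w)" using anti(2)[of w v] w(1) wv less.prems by (cases "w = v") auto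
    have Qw: "Q w" by (rule between[of u w v]) (use w less.prems wv f1 f2 in auto)
    have "consecutive \<phi> A u w" using w less.prems by (auto simp: consecutive_def not_less[symmetric])
    then have "P u = P w" using step Qw less.prems by blast
    also have "P w = P v"
      by (rule less.hyps) (use w wv lt less.prems Qw in auto)
    finally show ?thesis .
  qed simp
qed

text \<open>If both ends of a stretch of the staircase lie below x, then so does every step in
  between, since its coordinates are bounded by those of the ends; the joins of neighbours are then
  below x as well.\<close>

lemma connecting_up_circ:
  fixes I :: "'p::{finite, order} set"
  assumes r: "linear_order_on (sc I) r" and g: "grid_chart m n \<phi>"
  shows "connecting_up I r (sc1_circ \<phi> I)"
  unfolding connecting_up_def
proof (intro conjI allI impI)
  fix aa c assume "(aa, c) \<in> sc1_circ \<phi> I"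
  then obtain u v where uv: "aa = {u, v}" "c = join u v" "consecutive \<phi> (sc I) u v"
    unfolding sc1_circ_def by auto
  then have *: "u \<in> sc I" "v \<in> sc I" "u \<noteq> v" by (auto simp: consecutive_def)
  show "lo r aa \<in> sc I" "hi r aa \<in> sc I" "lo r aa \<noteq> hi r aa" "lo r aa \<le> c" "hi r aa \<le> c"
    using lo_hi[OF r *] uv * grid_join[OF g] by auto
next
  fix x P a a'
  assume conn: "\<forall>aa c. (aa, c) \<in> sc1_circ \<phi> I \<longrightarrow> c \<le> x \<longrightarrow> P (lo r aa) = P (hi r aa)"
    and a: "a \<in> sc I" "a' \<in> sc I" "a \<le> x" "a' \<le> x" "P a"
  note le = g[unfolded grid_chart_def, THEN conjunct2, rule_format]
  have A: "\<forall>u\<in>sc I. \<forall>v\<in>sc I. u \<le> v \<longrightarrow> u = v" by (auto simp: sc_def)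
  have step: "P u = P w" if "consecutive \<phi> (sc I) u w" "u \<le> x" "w \<le> x" for u w
  proof -
    have "({u, w}, join u w) \<in> sc1_circ \<phi> I" using that by (auto simp: sc1_circ_def)
    moreover have "join u w \<le> x" using grid_join(3)[OF g] that by blast
    ultimately have "P (lo r {u, w}) = P (hi r {u, w})" using conn by blast
    moreover have "u \<in> sc I" "w \<in> sc I" "u \<noteq> w" using that by (auto simp: consecutive_def)
    note lo_hi[OF r this]
    ultimately show ?thesis by auto
  qed
  have "P u = P v" if "u \<in> sc I" "v \<in> sc I" "u \<le> x" "v \<le> x" "snd (\<phi> u) \<le> snd (\<phi> v)" for u v
    by (rule consecutive_induct[OF g A, where Q = "\<lambda>w. w \<le> x"]) (use that step le in auto)
  then show "P a'" using a by (metis nat_le_linear)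
qed

lemma connecting_down_circ:
  fixes I :: "'p::{finite, order} set"
  assumes r: "linear_order_on (sk I) r" and g: "grid_chart m n \<phi>"
  shows "connecting_down I r (sk1_circ \<phi> I)"
  unfolding connecting_down_def
proof (intro conjI allI impI)
  fix bb d assume "(bb, d) \<in> sk1_circ \<phi> I"
  then obtain u v where uv: "bb = {u, v}" "d = meet u v" "consecutive \<phi> (sk I) u v"
    unfolding sk1_circ_def by auto
  then have *: "u \<in> sk I" "v \<in> sk I" "u \<noteq> v" by (auto simp: consecutive_def)
  show "lo r bb \<in> sk I" "hi r bb \<in> sk I" "lo r bb \<noteq> hi r bb" "d \<le> lo r bb" "d \<le> hi r bb"
    using lo_hi[OF r *] uv * grid_meet[OF g] by auto
next
  fix x P b b'
  assume conn: "\<forall>bb d. (bb, d) \<in> sk1_circ \<phi> I \<longrightarrow> x \<le> d \<longrightarrow> P (lo r bb) = P (hi r bb)"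
    and b: "b \<in> sk I" "b' \<in> sk I" "x \<le> b" "x \<le> b'" "P b"
  note le = g[unfolded grid_chart_def, THEN conjunct2, rule_format]
  have A: "\<forall>u\<in>sk I. \<forall>v\<in>sk I. u \<le> v \<longrightarrow> u = v" by (auto simp: sk_def)
  have step: "P u = P w" if "consecutive \<phi> (sk I) u w" "x \<le> u" "x \<le> w" for u w
  proof -
    have "({u, w}, meet u w) \<in> sk1_circ \<phi> I" using that by (auto simp: sk1_circ_def)
    moreover have "x \<le> meet u w" using grid_meet(3)[OF g] that by blast
    ultimately have "P (lo r {u, w}) = P (hi r {u, w})" using conn by blast
    moreover have "u \<in> sk I" "w \<in> sk I" "u \<noteq> w" using that by (auto simp: consecutive_def)
    note lo_hi[OF r this]
    ultimately show ?thesis by auto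
  qed
  have "P u = P v" if "u \<in> sk I" "v \<in> sk I" "x \<le> u" "x \<le> v" "snd (\<phi> u) \<le> snd (\<phi> v)" for u v
    by (rule consecutive_induct[OF g A, where Q = "\<lambda>w. x \<le> w"]) (use that step le in auto)
  then show "P b'" using b by (metis nat_le_linear)
qed

section \<open>Morphisms from and to the interval module, read off at minimal and maximal
  elements\<close>

lemma interval_vec_sc:
  assumes f: "interval_vec I M f" and a: "a \<in> sc I" "a' \<in> sc I" "a \<le> x" "a' \<le> x"
  shows "act M a x 1 (f a) = act M a' x 1 (f a')"
  using assms by (auto simp: interval_vec_def sc_def)

text \<open>The value at x is transported from any minimal element below x; the relations in
  \<open>L\<close> make the result independent of the choice. Outside I the transported vector must
  vanish, and by the same independence one condition for each minimal element of
  \<open>Up_out I\<close>, through its chosen \<open>c\<close>, is enough.\<close>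

lemma interval_vec_extend:
  fixes I :: "'p::{finite, order} set" and M :: "('p, 'k::field, 'v) rep"
  assumes M: "A_module M" and L: "connecting_up I r L" and c: "choice_up I c"
    and m: "\<And>a. a \<in> sc I \<Longrightarrow> m a \<in> carrier (ob M a)"
    and rel: "\<And>aa z. (aa, z) \<in> L \<Longrightarrow> act M (lo r aa) z 1 (m (lo r aa)) = act M (hi r aa) z 1 (m (hi r aa))"
    and out: "\<And>a. a \<in> sc (Up_out I) \<Longrightarrow> act M (c a) a 1 (m (c a)) = \<zero>\<^bsub>ob M a\<^esub>"
  shows "\<exists>f. interval_vec I M f \<and> (\<forall>a\<in>sc I. f a = m a)"
proof -
  have scI: "a \<in> I" if "a \<in> sc I" for a using that by (simp add: sc_def)
  have eq: "act M a x 1 (m a) = act M a' x 1 (m a')" if a: "a \<in> sc I" "a' \<in> sc I" "a \<le> x" "a' \<le> x" for a a' x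
  proof -
    \<comment> \<open>The property propagated along the edges: the transport to x from u agrees with
      the one from the fixed \<open>a\<close>.\<close>
    let ?P = "\<lambda>u. act M a x 1 (m a) = act M u x 1 (m u)"
    have "?P (lo r aa) = ?P (hi r aa)" if "(aa, z) \<in> L" "z \<le> x" for aa z
    proof -
      have l: "lo r aa \<in> sc I" "hi r aa \<in> sc I" "lo r aa \<le> z" "hi r aa \<le> z"
        using L that unfolding connecting_up_def by blast+
      have "act M (lo r aa) x 1 (m (lo r aa)) = act M (hi r aa) x 1 (m (hi r aa))"
        unfolding A_module_comp[OF M l(3) that(2) m[OF l(1)]] A_module_comp[OF M l(4) that(2) m[OF l(2)]]
          rel[OF that(1)] ..
      then show ?thesis by simp
    qed
    then show "?P a'" by (rule connecting_up_propagate[OF L, where P = ?P, OF _ a refl])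
  qed
  \<comment> \<open>An arbitrary minimal element below x; \<open>eq\<close> removes the dependence
    on this choice.\<close>
  define s where "s x = (SOME a. a \<in> sc I \<and> a \<le> x)" for x
  have s: "s x \<in> sc I" "s x \<le> x" if "x \<in> I" for x
  proof -
    have "\<exists>a. a \<in> sc I \<and> a \<le> x" using finite_sc_below[OF that] by blast
    then have "s x \<in> sc I \<and> s x \<le> x" unfolding s_def by (rule someI_ex)
    then show "s x \<in> sc I" "s x \<le> x" by auto
  qed
  let ?f = "\<lambda>x. act M (s x) x 1 (m (s x))"
  have "interval_vec I M ?f"
    unfolding interval_vec_def
  proof (intro conjI ballI allI impI)
    fix x assume "x \<in> I"
    then show "?f x \<in> carrier (ob M x)" using A_module_act_in[OF M] s m by blast
  next
    fix x y assume xy: "x \<in> I" "x \<le> y"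
    have *: "act M x y 1 (?f x) = act M (s x) y 1 (m (s x))"
      using A_module_comp[OF M s(2)[OF xy(1)] xy(2) m[OF s(1)[OF xy(1)]]] by simp
    have le: "s x \<le> y" using s(2)[OF xy(1)] xy(2) by simp
    show "act M x y 1 (?f x) = (if y \<in> I then ?f y else \<zero>\<^bsub>ob M y\<^esub>)"
    proof (cases "y \<in> I")
      case True
      then show ?thesis using * eq[OF s(1)[OF xy(1)] s(1)[OF True] le s(2)[OF True]] by simp
    next
      case False
      then have "y \<in> Up_out I" using xy by (auto simp: Up_out_def up_def)
      \<comment> \<open>The transport to y may be rerouted through \<open>c a'\<close> and then
        \<open>a'\<close>, where it is already 0.\<close>
      then obtain a' where a': "a' \<in> sc (Up_out I)" "a' \<le> y" using finite_sc_below by blast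
      have c': "c a' \<in> sc I" "c a' \<le> a'" using c a' by (auto simp: choice_up_def)
      have "act M (s x) y 1 (m (s x)) = act M (c a') y 1 (m (c a'))"
        by (rule eq[OF s(1)[OF xy(1)] c'(1) le]) (use c' a' in simp)
      also have "\<dots> = act M a' y 1 \<zero>\<^bsub>ob M a'\<^esub>"
        using A_module_comp[OF M c'(2) a'(2) m[OF c'(1)]] out[OF a'(1)] by simp
      also have "\<dots> = \<zero>\<^bsub>ob M y\<^esub>"
        by (rule linear_map_zero[OF A_module_act[OF M A_hom_one[OF a'(2)]]])
      finally show ?thesis using * False by simp
    qed
  qed
  moreover have "?f a = m a" if "a \<in> sc I" for a
    using eq[OF s(1)[OF scI[OF that]] that s(2)[OF scI[OF that]]] A_module_id[OF M m[OF that]] by simp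
  ultimately show ?thesis by blast
qed

lemma interval_vec_relations:
  assumes f: "interval_vec I M f" and L: "connecting_up I r L" and c: "choice_up I c"
  shows "(aa, z) \<in> L \<Longrightarrow> act M (lo r aa) z 1 (f (lo r aa)) = act M (hi r aa) z 1 (f (hi r aa))"
    and "a \<in> sc (Up_out I) \<Longrightarrow> act M (c a) a 1 (f (c a)) = \<zero>\<^bsub>ob M a\<^esub>"
proof -
  show "act M (lo r aa) z 1 (f (lo r aa)) = act M (hi r aa) z 1 (f (hi r aa))" if "(aa, z) \<in> L"
    by (rule interval_vec_sc[OF f]) (use L that in \<open>unfold connecting_up_def, blast+\<close>)
  show "act M (c a) a 1 (f (c a)) = \<zero>\<^bsub>ob M a\<^esub>" if "a \<in> sc (Up_out I)"
  proof -
    have "c a \<in> I" "c a \<le> a" "a \<notin> I" using c that by (auto simp: choice_up_def sc_def Up_out_def)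
    then show ?thesis using f by (auto simp: interval_vec_def)
  qed
qed

lemma interval_covec_relations:
  assumes \<phi>: "interval_covec I M \<phi>" and L: "connecting_down I r L" and d: "choice_down I d"
  shows "(bb, z) \<in> L \<Longrightarrow> v \<in> carrier (ob M z) \<Longrightarrow>
      \<phi> (lo r bb) (act M z (lo r bb) 1 v) = \<phi> (hi r bb) (act M z (hi r bb) 1 v)"
    and "b \<in> sk (Down_out I) \<Longrightarrow> v \<in> carrier (ob M b) \<Longrightarrow> \<phi> (d b) (act M b (d b) 1 v) = 0"
proof -
  have e: "\<phi> y (act M x y 1 v) = (if x \<in> I then \<phi> x v else 0)" if "y \<in> I" "x \<le> y" "v \<in> carrier (ob M x)" for x y v
    using \<phi> that unfolding interval_covec_def by blast
  show "\<phi> (lo r bb) (act M z (lo r bb) 1 v) = \<phi> (hi r bb) (act M z (hi r bb) 1 v)"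
    if "(bb, z) \<in> L" "v \<in> carrier (ob M z)"
  proof -
    have "lo r bb \<in> sk I" "hi r bb \<in> sk I" "z \<le> lo r bb" "z \<le> hi r bb"
      using L that unfolding connecting_down_def by blast+
    then show ?thesis using e[OF _ _ that(2)] by (simp add: sk_def)
  qed
  show "\<phi> (d b) (act M b (d b) 1 v) = 0" if "b \<in> sk (Down_out I)" "v \<in> carrier (ob M b)"
  proof -
    have "d b \<in> I" "b \<le> d b" "b \<notin> I" using d that by (auto simp: choice_down_def sk_def Down_out_def)
    then show ?thesis using e[OF _ _ that(2)] by simp
  qed
qed

text \<open>Dual to \<open>interval_vec_extend\<close>: the functional at x is pulled back from any
  maximal element above x. The relations are now identities between functionals, hence demanded for
  all vectors at the index.\<close>

lemma interval_covec_extend: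
  fixes I :: "'p::{finite, order} set" and M :: "('p, 'k::field, 'v) rep"
  assumes M: "A_module M" and L: "connecting_down I r L" and d: "choice_down I d"
    and \<mu>: "\<And>b. b \<in> sk I \<Longrightarrow> lf (ob M b) (\<mu> b)"
    and rel: "\<And>bb z v. (bb, z) \<in> L \<Longrightarrow> v \<in> carrier (ob M z) \<Longrightarrow>
      \<mu> (lo r bb) (act M z (lo r bb) 1 v) = \<mu> (hi r bb) (act M z (hi r bb) 1 v)"
    and out: "\<And>b v. b \<in> sk (Down_out I) \<Longrightarrow> v \<in> carrier (ob M b) \<Longrightarrow> \<mu> (d b) (act M b (d b) 1 v) = 0"
  shows "\<exists>\<phi>. interval_covec I M \<phi> \<and> (\<forall>b\<in>sk I. \<forall>v\<in>carrier (ob M b). \<phi> b v = \<mu> b v)"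
proof -
  have skI: "b \<in> I" if "b \<in> sk I" for b using that by (simp add: sk_def)
  have eq: "\<mu> b (act M x b 1 v) = \<mu> b' (act M x b' 1 v)"
    if b: "b \<in> sk I" "b' \<in> sk I" "x \<le> b" "x \<le> b'" and v: "v \<in> carrier (ob M x)" for b b' x v
  proof -
    let ?P = "\<lambda>u. \<mu> b (act M x b 1 v) = \<mu> u (act M x u 1 v)"
    have "?P (lo r bb) = ?P (hi r bb)" if "(bb, z) \<in> L" "x \<le> z" for bb z
    proof -
      have l: "z \<le> lo r bb" "z \<le> hi r bb"
        using L that unfolding connecting_down_def by blast+
      have "\<mu> (lo r bb) (act M x (lo r bb) 1 v) = \<mu> (hi r bb) (act M x (hi r bb) 1 v)"
        unfolding A_module_comp[OF M that(2) l(1) v] A_module_comp[OF M that(2) l(2) v]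
        by (rule rel[OF that(1) A_module_act_in[OF M that(2) v]])
      then show ?thesis by simp
    qed
    then show "?P b'" by (rule connecting_down_propagate[OF L, where P = ?P, OF _ b refl])
  qed
  define s where "s x = (SOME b. b \<in> sk I \<and> x \<le> b)" for x
  have s: "s x \<in> sk I" "x \<le> s x" if "x \<in> I" for x
  proof -
    have "\<exists>b. b \<in> sk I \<and> x \<le> b" using finite_sk_above[OF that] by blast
    then have "s x \<in> sk I \<and> x \<le> s x" unfolding s_def by (rule someI_ex)
    then show "s x \<in> sk I" "x \<le> s x" by auto
  qed
  let ?\<phi> = "\<lambda>x v. \<mu> (s x) (act M x (s x) 1 v)"
  have "interval_covec I M ?\<phi>"
    unfolding interval_covec_def
  proof (intro conjI ballI allI impI)
    fix x assume "x \<in> I"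
    then show "lf (ob M x) (?\<phi> x)"
      by (intro linear_map_lf[OF A_module_act[OF M A_hom_one] \<mu>] s)
  next
    fix x y v assume xy: "y \<in> I" "x \<le> y" and v: "v \<in> carrier (ob M x)"
    have *: "?\<phi> y (act M x y 1 v) = \<mu> (s y) (act M x (s y) 1 v)"
      using A_module_comp[OF M xy(2) s(2)[OF xy(1)] v] by simp
    have le: "x \<le> s y" using s(2)[OF xy(1)] xy(2) by simp
    show "?\<phi> y (act M x y 1 v) = (if x \<in> I then ?\<phi> x v else 0)"
    proof (cases "x \<in> I")
      case True
      then show ?thesis using * eq[OF s(1)[OF xy(1)] s(1)[OF True] le s(2)[OF True] v] by simp
    next
      case False
      then have "x \<in> Down_out I" using xy by (auto simp: Down_out_def down_def)
      then obtain b' where b': "b' \<in> sk (Down_out I)" "x \<le> b'" using finite_sk_above by blast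
      have d': "d b' \<in> sk I" "b' \<le> d b'" using d b' by (auto simp: choice_down_def)
      have "\<mu> (s y) (act M x (s y) 1 v) = \<mu> (d b') (act M x (d b') 1 v)"
        by (rule eq[OF s(1)[OF xy(1)] d'(1) le _ v]) (use d' b' in simp)
      also have "\<dots> = 0"
        using A_module_comp[OF M b'(2) d'(2) v] out[OF b'(1) A_module_act_in[OF M b'(2) v]] by simp
      finally show ?thesis using * False by simp
    qed
  qed
  moreover have "?\<phi> b v = \<mu> b v" if "b \<in> sk I" "v \<in> carrier (ob M b)" for b v
    using eq[OF s(1)[OF skI[OF that(1)]] that(1) s(2)[OF skI[OF that(1)]] order_refl that(2)]
      A_module_id[OF M that(2)] by simp
  ultimately show ?thesis by blast
qed

section \<open>The additive hull and block matrices\<close>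

lemma A_hom_iff: "(a :: 'k::field) \<in> A_hom x y \<longleftrightarrow> x \<le> y \<or> a = 0"
  by (auto simp: A_hom_def line_def)

lemma hull_homI:
  assumes "\<alpha> \<in> carrier_mat (length y) (length x)"
    and "\<And>j i. j < length y \<Longrightarrow> i < length x \<Longrightarrow> \<alpha> $$ (j, i) \<noteq> 0 \<Longrightarrow> x ! i \<le> y ! j"
  shows "\<alpha> \<in> hull_hom x y"
  using assms by (fastforce simp: hull_hom_def A_hom_iff)

lemma hull_homD:
  assumes "\<alpha> \<in> hull_hom x y"
  shows hull_hom_carrier: "\<alpha> \<in> carrier_mat (length y) (length x)"
    and hull_hom_dim: "dim_row \<alpha> = length y" "dim_col \<alpha> = length x"
    and hull_hom_le: "\<And>j i. j < length y \<Longrightarrow> i < length x \<Longrightarrow> \<alpha> $$ (j, i) \<noteq> 0 \<Longrightarrow> x ! i \<le> y ! j"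
  using assms by (auto simp: hull_hom_def A_hom_iff)

lemma hull_hom_mult:
  fixes g h :: "'k::field mat"
  assumes g: "g \<in> hull_hom x y" and h: "h \<in> hull_hom y w"
  shows "h * g \<in> hull_hom x w"
proof (rule hull_homI)
  show "h * g \<in> carrier_mat (length w) (length x)" using hull_hom_carrier[OF g] hull_hom_carrier[OF h] by auto
  fix j i assume ji: "j < length w" "i < length x" and "(h * g) $$ (j, i) \<noteq> 0"
  then have "(\<Sum>k\<in>{0..<length y}. h $$ (j, k) * g $$ (k, i)) \<noteq> 0"
    using hull_hom_dim[OF g] hull_hom_dim[OF h] by (simp add: scalar_prod_def)
  then obtain k where "k < length y" "h $$ (j, k) * g $$ (k, i) \<noteq> 0" 
    by (meson atLeastLessThan_iff sum.neutral)
  then show "x ! i \<le> w ! j"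
    using hull_hom_le[OF g, of k i] hull_hom_le[OF h, of j k] ji by (auto intro: order_trans)
qed

lemma hull_hom_add: "\<alpha> \<in> hull_hom x y \<Longrightarrow> \<beta> \<in> hull_hom x y \<Longrightarrow> \<alpha> + \<beta> \<in> hull_hom x y"
  and hull_hom_smult: "\<alpha> \<in> hull_hom x y \<Longrightarrow> c \<cdot>\<^sub>m \<alpha> \<in> hull_hom x y"
  and hull_hom_zero: "0\<^sub>m (length y) (length x) \<in> hull_hom x y"
  for \<alpha> :: "'k::field mat"
  by (auto simp: hull_hom_def A_hom_iff; metis add.right_neutral)+

lemma hull_space_simps [simp]:
  "carrier (hull_space x y) = hull_hom x y" "add (hull_space x y) = (+)"
  "smult (hull_space x y) = (\<cdot>\<^sub>m)" "zero (hull_space x y) = 0\<^sub>m (length y) (length x)"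
  by (simp_all add: hull_space_def module_mat_simps)

lemma has_dim_module_mat: "has_dim (module_mat TYPE('k::field) nr nc) (nr * nc)"
proof -
  \<comment> \<open>Index i stands for the matrix position (i div nc, i mod nc); i < nr * nc forces
    nc to be positive, so both parts are in range.\<close>
  let ?b = "\<lambda>i. mat nr nc (\<lambda>(r, c). if r = i div nc \<and> c = i mod nc then 1 else 0 :: 'k)"
  let ?\<beta> = "\<lambda>i v. v $$ (i div nc, i mod nc) :: 'k"
  have dm: "i div nc < nr" "i mod nc < nc" if "i < nr * nc" for i
    using that less_mult_imp_div_less[of i nr nc] by (auto intro!: mod_less_divisor gr0I)
  have "frame (module_mat TYPE('k) nr nc) (nr * nc) ?b ?\<beta>"
    unfolding frame_def
  proof (intro conjI allI impI ballI)
    fix i assume i: "i < nr * nc"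
    show "?b i \<in> carrier (module_mat TYPE('k) nr nc)" by (simp add: module_mat_simps)
    show "lf (module_mat TYPE('k) nr nc) (?\<beta> i)"
      using dm[OF i] by (auto simp: lf_def module_mat_simps)
    fix j assume j: "j < nr * nc"
    have "i = j" if "i div nc = j div nc" "i mod nc = j mod nc"
      using that by (metis div_mult_mod_eq)
    then show "?\<beta> i (?b j) = (if i = j then 1 else 0)" using dm[OF i] by auto
  next
    fix v assume v: "v \<in> carrier (module_mat TYPE('k) nr nc)" and z: "\<forall>i<nr * nc. ?\<beta> i v = 0"
    have "v $$ (r, c) = 0" if "r < nr" "c < nc" for r c
    proof -
      have "r * nc + c < nr * nc"
      proof -
        have "r * nc + c < Suc r * nc" using that by simp
        also have "\<dots> \<le> nr * nc" using that by (intro mult_right_mono) auto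
        finally show ?thesis .
      qed
      moreover have "(r * nc + c) div nc = r" "(r * nc + c) mod nc = c" using that by auto
      ultimately show ?thesis using z by metis
    qed
    then show "v = \<zero>\<^bsub>module_mat TYPE('k) nr nc\<^esub>" using v by (auto simp: module_mat_simps)
  qed
  then show ?thesis by (auto simp: has_dim_def)
qed

lemma sub_hull_hom: "sub (hull_hom x y) (module_mat TYPE('k::field) (length y) (length x))"
  by (auto simp: sub_def module_mat_simps hull_hom_add hull_hom_smult hull_hom_zero hull_hom_carrier)

lemma vs_hull_space: "vspace (hull_space x y :: ('k::field, 'k mat) module)"
  unfolding hull_space_def by (rule vs_sub[OF matrix_vs sub_hull_hom])

lemma has_dim_hull_space: "\<exists>n. has_dim (hull_space x y :: ('k::field, 'k mat) module) n"
  unfolding hull_space_def using has_dim_sub[OF matrix_vs has_dim_module_mat sub_hull_hom] by blast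

lemma linear_hull_left:
  fixes g :: "'k::field mat"
  assumes g: "g \<in> hull_hom y w"
  shows "linear_map class_ring (hull_space x y) (hull_space x w) (\<lambda>\<beta>. g * \<beta>)"
proof (rule linear_mapI[OF vs_hull_space vs_hull_space]; simp)
  show "\<beta> \<in> hull_hom x y \<Longrightarrow> g * \<beta> \<in> hull_hom x w" for \<beta> by (rule hull_hom_mult[OF _ g])
  show "\<beta> \<in> hull_hom x y \<Longrightarrow> \<beta>' \<in> hull_hom x y \<Longrightarrow> g * (\<beta> + \<beta>') = g * \<beta> + g * \<beta>'" for \<beta> \<beta>'
    by (rule mult_add_distrib_mat[OF hull_hom_carrier[OF g] hull_hom_carrier hull_hom_carrier])
  show "\<beta> \<in> hull_hom x y \<Longrightarrow> g * (c \<cdot>\<^sub>m \<beta>) = c \<cdot>\<^sub>m (g * \<beta>)" for \<beta> c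
    by (rule mult_smult_distrib[OF hull_hom_carrier[OF g] hull_hom_carrier])
qed

lemma linear_hull_right:
  fixes g :: "'k::field mat"
  assumes g: "g \<in> hull_hom x y"
  shows "linear_map class_ring (hull_space y w) (hull_space x w) (\<lambda>\<beta>. \<beta> * g)"
proof (rule linear_mapI[OF vs_hull_space vs_hull_space]; simp)
  show "\<beta> \<in> hull_hom y w \<Longrightarrow> \<beta> * g \<in> hull_hom x w" for \<beta> by (rule hull_hom_mult[OF g])
  show "\<beta> \<in> hull_hom y w \<Longrightarrow> \<beta>' \<in> hull_hom y w \<Longrightarrow> (\<beta> + \<beta>') * g = \<beta> * g + \<beta>' * g" for \<beta> \<beta>'
    by (rule add_mult_distrib_mat[OF hull_hom_carrier hull_hom_carrier hull_hom_carrier[OF g]])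
  show "\<beta> \<in> hull_hom y w \<Longrightarrow> (c \<cdot>\<^sub>m \<beta>) * g = c \<cdot>\<^sub>m (\<beta> * g)" for \<beta> c
    by (rule mult_smult_assoc_mat[OF hull_hom_carrier hull_hom_carrier[OF g]])
qed

lemma linear_zero_map:
  assumes "vspace V" "vspace W" shows "linear_map class_ring V W (zero_map W)"
  by (rule linear_mapI[OF assms]) (auto simp: zero_map_def vs_facts[OF assms(2)])

lemma foldr_row_linear:
  fixes Vs :: "('k::field, 'v) module list" and W :: "('k, 'w) module"
  assumes W: "vspace W" and "length fs = length Vs"
    and "\<And>i. i < length Vs \<Longrightarrow> linear_map class_ring (Vs ! i) W (fs ! i)"
  shows "linear_map class_ring (dsum Vs) W (\<lambda>vs. foldr (\<lambda>(f, v) w. f v \<oplus>\<^bsub>W\<^esub> w) (zip fs vs) \<zero>\<^bsub>W\<^esub>)"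
  using assms(2,3)
proof (induction fs Vs rule: list_induct2)
  case Nil
  have "vspace (dsum [] :: ('k, 'v list) module)" by (rule vs_dsum) simp
  then show ?case by (intro linear_mapI W) (auto simp: dsum_Nil vs_facts[OF W])
next
  case (Cons f fs V Vs)
  let ?F = "\<lambda>vs. foldr (\<lambda>(f, v) w. f v \<oplus>\<^bsub>W\<^esub> w) (zip fs vs) \<zero>\<^bsub>W\<^esub>"
  have f: "linear_map class_ring V W f" using Cons.prems[of 0] by simp
  have "linear_map class_ring (Vs ! i) W (fs ! i)" if "i < length Vs" for i
    using Cons.prems[of "Suc i"] that by simp
  then have F: "linear_map class_ring (dsum Vs) W ?F" by (rule Cons.IH)
  note fD = linear_mapD[OF f] and FD = linear_mapD[OF F]
  have "vspace V'" if "V' \<in> set (V # Vs)" for V'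
    using that Cons.prems linear_map_source by (metis in_set_conv_nth)
  then have D: "vspace (dsum (V # Vs))" by (rule vs_dsum)
  show ?case
  proof (rule linear_mapI[OF D W])
    fix v assume "v \<in> carrier (dsum (V # Vs))"
    then obtain a as where v: "v = a # as" "a \<in> carrier V" "as \<in> carrier (dsum Vs)"
      by (auto simp: dsum_Cons_carrier)
    then show "foldr (\<lambda>(f, v) w. f v \<oplus>\<^bsub>W\<^esub> w) (zip (f # fs) v) \<zero>\<^bsub>W\<^esub> \<in> carrier W"
      using fD(3) FD(3) by (simp add: vs_add[OF W])
    show "foldr (\<lambda>(f, v) w. f v \<oplus>\<^bsub>W\<^esub> w) (zip (f # fs) (c \<odot>\<^bsub>dsum (V # Vs)\<^esub> v)) \<zero>\<^bsub>W\<^esub> =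
        c \<odot>\<^bsub>W\<^esub> foldr (\<lambda>(f, v) w. f v \<oplus>\<^bsub>W\<^esub> w) (zip (f # fs) v) \<zero>\<^bsub>W\<^esub>" for c
      using v fD(3,5) FD(3,5) by (simp add: dsum_Cons vs_rdistr[OF W])
    fix u assume "u \<in> carrier (dsum (V # Vs))"
    then obtain b bs where u: "u = b # bs" "b \<in> carrier V" "bs \<in> carrier (dsum Vs)"
      by (auto simp: dsum_Cons_carrier)
    show "foldr (\<lambda>(f, v) w. f v \<oplus>\<^bsub>W\<^esub> w) (zip (f # fs) (v \<oplus>\<^bsub>dsum (V # Vs)\<^esub> u)) \<zero>\<^bsub>W\<^esub> =
        foldr (\<lambda>(f, v) w. f v \<oplus>\<^bsub>W\<^esub> w) (zip (f # fs) v) \<zero>\<^bsub>W\<^esub> \<oplus>\<^bsub>W\<^esub>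
        foldr (\<lambda>(f, v) w. f v \<oplus>\<^bsub>W\<^esub> w) (zip (f # fs) u) \<zero>\<^bsub>W\<^esub>"
      using v u fD(3,4) FD(3,4) by (simp add: dsum_Cons vs_facts(2,4-6)[OF W])
  qed
qed

lemma block_map_linear:
  fixes Vs :: "('k::field, 'v) module list" and Ws :: "('k, 'w) module list"
  assumes Vs: "\<And>V. V \<in> set Vs \<Longrightarrow> vspace V" and "length T = length Ws"
    and "\<And>W. W \<in> set Ws \<Longrightarrow> vspace W"
    and "\<And>i. i < length Ws \<Longrightarrow> length (T ! i) = length Vs"
    and "\<And>i j. i < length Ws \<Longrightarrow> j < length Vs \<Longrightarrow> linear_map class_ring (Vs ! j) (Ws ! i) (T ! i ! j)"
  shows "linear_map class_ring (dsum Vs) (dsum Ws) (block_map Ws T)"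
  using assms(2-)
proof (induction T Ws rule: list_induct2)
  case Nil
  have "vspace (dsum [] :: ('k, 'w list) module)" by (rule vs_dsum) simp
  then show ?case by (intro linear_mapI vs_dsum Vs) (auto simp: dsum_Nil block_map_def)
next
  case (Cons row T W Ws)
  have W: "vspace W" using Cons.prems by simp
  have row: "linear_map class_ring (dsum Vs) W (\<lambda>vs. foldr (\<lambda>(f, v) w. f v \<oplus>\<^bsub>W\<^esub> w) (zip row vs) \<zero>\<^bsub>W\<^esub>)"
    by (rule foldr_row_linear[OF W]) (use Cons.prems(2,3)[of 0] in auto)
  have T: "linear_map class_ring (dsum Vs) (dsum Ws) (block_map Ws T)"
  proof (rule Cons.IH)
    show "W' \<in> set Ws \<Longrightarrow> vspace W'" for W' using Cons.prems(1) by simp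
    show "i < length Ws \<Longrightarrow> length (T ! i) = length Vs" for i using Cons.prems(2)[of "Suc i"] by simp
    show "i < length Ws \<Longrightarrow> j < length Vs \<Longrightarrow> linear_map class_ring (Vs ! j) (Ws ! i) (T ! i ! j)" for i j
      using Cons.prems(3)[of "Suc i" j] by simp
  qed
  have e: "block_map (W # Ws) (row # T) v = foldr (\<lambda>(f, v) w. f v \<oplus>\<^bsub>W\<^esub> w) (zip row v) \<zero>\<^bsub>W\<^esub> # block_map Ws T v" for v
    by (simp add: block_map_def)
  note R = linear_mapD[OF row] and TD = linear_mapD[OF T]
  show ?case
    by (rule linear_mapI[OF vs_dsum[OF Vs] vs_dsum])
       (use Cons.prems(1) R(3-) TD(3-) in \<open>auto simp: e dsum_Cons dsum_Cons_mem\<close>)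
qed

lemma sub_image:
  fixes V :: "('k::field, 'v) module" and W :: "('k, 'w) module"
  assumes T: "linear_map class_ring V W T" shows "sub (T ` carrier V) W"
proof -
  note D = linear_mapD[OF T]
  show ?thesis
    unfolding sub_def
  proof (intro conjI ballI allI)
    show "T ` carrier V \<subseteq> carrier W" using D(3) by auto
    show "\<zero>\<^bsub>W\<^esub> \<in> T ` carrier V"
      by (rule image_eqI[where f = T, OF linear_map_zero[OF T, symmetric] vs_zero[OF D(1)]])
    fix u assume "u \<in> T ` carrier V"
    then obtain u' where u: "u' \<in> carrier V" "u = T u'" by auto
    show "c \<odot>\<^bsub>W\<^esub> u \<in> T ` carrier V" for c
      unfolding u(2) by (rule image_eqI[where f = T, OF D(5)[OF u(1), symmetric] vs_smult[OF D(1) u(1)]])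
    fix v assume "v \<in> T ` carrier V"
    then obtain v' where v: "v' \<in> carrier V" "v = T v'" by auto
    show "u \<oplus>\<^bsub>W\<^esub> v \<in> T ` carrier V"
      unfolding u(2) v(2) by (rule image_eqI[where f = T, OF D(4)[OF u(1) v(1), symmetric] vs_add[OF D(1) u(1) v(1)]])
  qed
qed

section \<open>Rows and columns as components of the spaces in the block matrices\<close>

text \<open>A row of a morphism from x to s belongs to P(x) at a point of s, and a column of a
  morphism from s to x belongs to P'(x) at such a point. This is how a presentation, which concerns
  P(x) or P'(x) pointwise, acts on the spaces in the block matrices. The operations
  \<open>put_row\<close> and \<open>put_col\<close> are the inclusions of the components.\<close>

definition get_row :: "nat \<Rightarrow> 'k mat \<Rightarrow> 'k mat" where
  "get_row k z = mat 1 (dim_col z) (\<lambda>(_, i). z $$ (k, i))"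

definition put_row :: "nat \<Rightarrow> nat \<Rightarrow> 'k::zero mat \<Rightarrow> 'k mat" where
  "put_row n k \<xi> = mat n (dim_col \<xi>) (\<lambda>(j, i). if j = k then \<xi> $$ (0, i) else 0)"

definition get_col :: "nat \<Rightarrow> 'k mat \<Rightarrow> 'k mat" where
  "get_col k z = mat (dim_row z) 1 (\<lambda>(i, _). z $$ (i, k))"

definition put_col :: "nat \<Rightarrow> nat \<Rightarrow> 'k::zero mat \<Rightarrow> 'k mat" where
  "put_col n k \<xi> = mat (dim_row \<xi>) n (\<lambda>(i, j). if j = k then \<xi> $$ (i, 0) else 0)"

lemma get_row_dim [simp]: "dim_row (get_row k z) = 1" "dim_col (get_row k z) = dim_col z"
  and put_row_dim [simp]: "dim_row (put_row n k \<xi>) = n" "dim_col (put_row n k \<xi>) = dim_col \<xi>"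
  and get_col_dim [simp]: "dim_row (get_col k z) = dim_row z" "dim_col (get_col k z) = 1"
  and put_col_dim [simp]: "dim_row (put_col n k \<xi>) = dim_row \<xi>" "dim_col (put_col n k \<xi>) = n"
  by (simp_all add: get_row_def put_row_def get_col_def put_col_def)

lemma get_row_hull: "z \<in> hull_hom x s \<Longrightarrow> k < length s \<Longrightarrow> get_row k z \<in> hull_hom x [s ! k]"
  and get_col_hull: "z \<in> hull_hom s x \<Longrightarrow> k < length s \<Longrightarrow> get_col k z \<in> hull_hom [s ! k] x"
  and put_row_hull: "\<xi> \<in> hull_hom x [s ! k] \<Longrightarrow> k < length s \<Longrightarrow> put_row (length s) k \<xi> \<in> hull_hom x s"
  and put_col_hull: "\<xi> \<in> hull_hom [s ! k] x \<Longrightarrow> k < length s \<Longrightarrow> put_col (length s) k \<xi> \<in> hull_hom s x"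
  for z :: "'k::field mat"
  by (auto simp: hull_hom_def A_hom_iff get_row_def get_col_def put_row_def put_col_def split: if_splits; blast)+

text \<open>Composition with a generator multiplies the entries by 1, so one matrix also represents
  the morphism transported along v \<le> w.\<close>

lemma hull_row_mono: "\<xi> \<in> hull_hom x [v] \<Longrightarrow> v \<le> w \<Longrightarrow> \<xi> \<in> hull_hom x [w]"
  and hull_col_mono: "\<xi> \<in> hull_hom [w] x \<Longrightarrow> v \<le> w \<Longrightarrow> \<xi> \<in> hull_hom [v] x"
  for \<xi> :: "'k::field mat"
  by (auto simp: hull_hom_def A_hom_iff intro: order_trans)

lemma get_put_row:
  "dim_row \<xi> = 1 \<Longrightarrow> j < n \<Longrightarrow> get_row j (put_row n k \<xi>) = (if j = k then \<xi> else 0\<^sub>m 1 (dim_col \<xi>))"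
  by (auto simp: get_row_def put_row_def)

lemma get_put_col:
  "dim_col \<xi> = 1 \<Longrightarrow> j < n \<Longrightarrow> get_col j (put_col n k \<xi>) = (if j = k then \<xi> else 0\<^sub>m (dim_row \<xi>) 1)"
  by (auto simp: get_col_def put_col_def)

lemma get_row_mult:
  "\<gamma> \<in> carrier_mat n l \<Longrightarrow> \<alpha> \<in> carrier_mat l m \<Longrightarrow> k < n \<Longrightarrow> get_row k (\<gamma> * \<alpha>) = get_row k \<gamma> * \<alpha>"
  by (rule eq_matI) (auto simp: get_row_def scalar_prod_def)

lemma get_col_mult:
  "\<gamma> \<in> carrier_mat l n \<Longrightarrow> \<alpha> \<in> carrier_mat m l \<Longrightarrow> k < n \<Longrightarrow> get_col k (\<alpha> * \<gamma>) = \<alpha> * get_col k \<gamma>"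
  by (rule eq_matI) (auto simp: get_col_def scalar_prod_def)

lemma put_row_mult:
  "\<gamma> \<in> carrier_mat 1 l \<Longrightarrow> \<alpha> \<in> carrier_mat l m \<Longrightarrow> put_row n k (\<gamma> * \<alpha>) = put_row n k \<gamma> * \<alpha>"
  for \<gamma> :: "'k::comm_ring_1 mat"
  by (rule eq_matI) (auto simp: put_row_def scalar_prod_def)

lemma put_col_mult:
  "\<gamma> \<in> carrier_mat l 1 \<Longrightarrow> \<alpha> \<in> carrier_mat m l \<Longrightarrow> put_col n k (\<alpha> * \<gamma>) = \<alpha> * put_col n k \<gamma>"
  for \<gamma> :: "'k::comm_ring_1 mat"
  by (rule eq_matI) (auto simp: put_col_def scalar_prod_def)

lemma hull_rows:
  fixes \<rho> :: "nat \<Rightarrow> 'k::field mat"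
  assumes "\<And>k. k < length s \<Longrightarrow> \<rho> k \<in> hull_hom x [s ! k]"
  obtains z where "z \<in> hull_hom x s" "\<And>k. k < length s \<Longrightarrow> get_row k z = \<rho> k"
proof
  let ?z = "mat (length s) (length x) (\<lambda>(k, i). \<rho> k $$ (0, i))"
  show "?z \<in> hull_hom x s" using assms by (auto simp: hull_hom_def A_hom_iff)
  show "get_row k ?z = \<rho> k" if "k < length s" for k
    using hull_hom_dim[OF assms[OF that]] that by (auto simp: get_row_def)
qed

lemma hull_cols:
  fixes \<rho> :: "nat \<Rightarrow> 'k::field mat"
  assumes "\<And>k. k < length s \<Longrightarrow> \<rho> k \<in> hull_hom [s ! k] x"
  obtains z where "z \<in> hull_hom s x" "\<And>k. k < length s \<Longrightarrow> get_col k z = \<rho> k"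
proof
  let ?z = "mat (length x) (length s) (\<lambda>(i, k). \<rho> k $$ (i, 0))"
  show "?z \<in> hull_hom s x" using assms by (auto simp: hull_hom_def A_hom_iff)
  show "get_col k ?z = \<rho> k" if "k < length s" for k
    using hull_hom_dim[OF assms[OF that]] that by (auto simp: get_col_def)
qed

lemma eq_rowI:
  assumes "z \<in> carrier_mat n m" "z' \<in> carrier_mat n m" "\<And>k. k < n \<Longrightarrow> get_row k z = get_row k z'"
  shows "z = z'"
proof (rule eq_matI)
  fix k i assume ki: "k < dim_row z'" "i < dim_col z'"
  have "get_row k z $$ (0, i) = get_row k z' $$ (0, i)" using assms(3)[of k] assms(1,2) ki by auto
  then show "z $$ (k, i) = z' $$ (k, i)" using ki assms(1,2) by (simp add: get_row_def)
qed (use assms in auto)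

lemma eq_colI:
  assumes "z \<in> carrier_mat m n" "z' \<in> carrier_mat m n" "\<And>k. k < n \<Longrightarrow> get_col k z = get_col k z'"
  shows "z = z'"
proof (rule eq_matI)
  fix i k assume ki: "k < dim_col z'" "i < dim_row z'"
  have "get_col k z $$ (i, 0) = get_col k z' $$ (i, 0)" using assms(3)[of k] assms(1,2) ki by auto
  then show "z $$ (i, k) = z' $$ (i, k)" using ki assms(1,2) by (simp add: get_col_def)
qed (use assms in auto)

text \<open>Additivity over the components, shown by truncating \<open>z\<close> after n rows, so
  that only scalars are summed.\<close>

lemma lf_rows:
  fixes \<Lambda> :: "'k::field mat \<Rightarrow> 'k"
  assumes l: "lf (hull_space x s) \<Lambda>" and z: "z \<in> hull_hom x s"
  shows "\<Lambda> z = (\<Sum>k<length s. \<Lambda> (put_row (length s) k (get_row k z)))"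
proof -
  let ?t = "\<lambda>n. mat (length s) (length x) (\<lambda>(k, i). if k < n then z $$ (k, i) else 0)"
  have t: "?t n \<in> hull_hom x s" for n using z by (auto simp: hull_hom_def A_hom_iff)
  have sum: "\<Lambda> (?t n) = (\<Sum>k<n. \<Lambda> (put_row (length s) k (get_row k z)))" if "n \<le> length s" for n
    using that
  proof (induction n)
    case 0
    have "?t 0 = \<zero>\<^bsub>hull_space x s\<^esub>" by auto
    then have "\<Lambda> (?t 0) = 0" using lf_zero[OF vs_hull_space l] by metis
    then show ?case by (simp only: lessThan_0 sum.empty)
  next
    case (Suc n)
    have "?t (Suc n) = ?t n + put_row (length s) n (get_row n z)"
      using hull_hom_dim[OF z] by (auto simp: put_row_def get_row_def less_Suc_eq)
    moreover have "put_row (length s) n (get_row n z) \<in> hull_hom x s"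
      using Suc.prems by (intro put_row_hull get_row_hull[OF z]) auto
    ultimately have "\<Lambda> (?t (Suc n)) = \<Lambda> (?t n) + \<Lambda> (put_row (length s) n (get_row n z))"
      using lf_add[OF l, of "?t n" "put_row (length s) n (get_row n z)"] t by simp
    then show ?case using Suc by simp
  qed
  have e: "?t (length s) = z" using hull_hom_dim[OF z] by auto
  show ?thesis using sum[OF order_refl] unfolding e .
qed

lemma lf_cols:
  fixes \<Lambda> :: "'k::field mat \<Rightarrow> 'k"
  assumes l: "lf (hull_space s x) \<Lambda>" and z: "z \<in> hull_hom s x"
  shows "\<Lambda> z = (\<Sum>k<length s. \<Lambda> (put_col (length s) k (get_col k z)))"
proof -
  let ?t = "\<lambda>n. mat (length x) (length s) (\<lambda>(i, k). if k < n then z $$ (i, k) else 0)"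
  have t: "?t n \<in> hull_hom s x" for n using z by (auto simp: hull_hom_def A_hom_iff)
  have sum: "\<Lambda> (?t n) = (\<Sum>k<n. \<Lambda> (put_col (length s) k (get_col k z)))" if "n \<le> length s" for n
    using that
  proof (induction n)
    case 0
    have "?t 0 = \<zero>\<^bsub>hull_space s x\<^esub>" by auto
    then have "\<Lambda> (?t 0) = 0" using lf_zero[OF vs_hull_space l] by metis
    then show ?case by (simp only: lessThan_0 sum.empty)
  next
    case (Suc n)
    have "?t (Suc n) = ?t n + put_col (length s) n (get_col n z)"
      using hull_hom_dim[OF z] by (auto simp: put_col_def get_col_def less_Suc_eq)
    moreover have "put_col (length s) n (get_col n z) \<in> hull_hom s x"
      using Suc.prems by (intro put_col_hull get_col_hull[OF z]) auto
    ultimately have "\<Lambda> (?t (Suc n)) = \<Lambda> (?t n) + \<Lambda> (put_col (length s) n (get_col n z))"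
      using lf_add[OF l, of "?t n" "put_col (length s) n (get_col n z)"] t by simp
    then show ?case using Suc by simp
  qed
  have e: "?t (length s) = z" using hull_hom_dim[OF z] by auto
  show ?thesis using sum[OF order_refl] unfolding e .
qed

text \<open>One of the two patterns in the rows of \<open>g1\<close> and the columns of
  \<open>g2\<close>: a choice map contributes a single 1, a pair of minimal or maximal elements
  contributes 1 and -1.\<close>

definition unit_entries :: "nat \<Rightarrow> nat \<Rightarrow> 'k::field" where
  "unit_entries p k = (if k = p then 1 else 0)"

definition diff_entries :: "nat \<Rightarrow> nat \<Rightarrow> nat \<Rightarrow> 'k::field" where
  "diff_entries p q k = (if k = p then 1 else if k = q then - 1 else 0)"

lemma sum_unit_entries: "p < n \<Longrightarrow> (\<Sum>k\<in>{0..<n}. unit_entries p k * f k) = f p"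
  and sum_diff_entries: "p < n \<Longrightarrow> q < n \<Longrightarrow> p \<noteq> q \<Longrightarrow> (\<Sum>k\<in>{0..<n}. diff_entries p q k * f k) = f p - f q"
proof -
  show u: "p < n \<Longrightarrow> (\<Sum>k\<in>{0..<n}. unit_entries p k * f k) = f p" for p
  proof -
    assume p: "p < n"
    have "(\<Sum>k\<in>{0..<n}. unit_entries p k * f k) = (\<Sum>k\<in>{0..<n}. if k = p then f k else 0)"
      by (rule sum.cong) (auto simp: unit_entries_def)
    then show ?thesis using p by simp
  qed
  show "p < n \<Longrightarrow> q < n \<Longrightarrow> p \<noteq> q \<Longrightarrow> (\<Sum>k\<in>{0..<n}. diff_entries p q k * f k) = f p - f q"
  proof -
    assume pq: "p < n" "q < n" "p \<noteq> q"
    have "(\<Sum>k\<in>{0..<n}. diff_entries p q k * f k) = (\<Sum>k\<in>{0..<n}. unit_entries p k * f k - unit_entries q k * f k)"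
      by (rule sum.cong) (use pq in \<open>auto simp: unit_entries_def diff_entries_def\<close>)
    then show ?thesis using u pq by (simp add: sum_subtractf)
  qed
qed

lemma get_row_unit:
  fixes G z :: "'k::field mat"
  assumes "G \<in> carrier_mat a n" "z \<in> carrier_mat n m" "j < a" "p < n"
    and "\<And>k. k < n \<Longrightarrow> G $$ (j, k) = unit_entries p k"
  shows "get_row j (G * z) = get_row p z"
  using assms by (intro eq_matI) (auto simp: get_row_def scalar_prod_def sum_unit_entries)

lemma get_row_diff:
  fixes G z :: "'k::field mat"
  assumes "G \<in> carrier_mat a n" "z \<in> carrier_mat n m" "j < a" "p < n" "q < n" "p \<noteq> q"
    and "\<And>k. k < n \<Longrightarrow> G $$ (j, k) = diff_entries p q k"
  shows "get_row j (G * z) = get_row p z + (- 1) \<cdot>\<^sub>m get_row q z"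
  using assms by (intro eq_matI) (auto simp: get_row_def scalar_prod_def sum_diff_entries)

lemma get_col_unit:
  fixes G z :: "'k::field mat"
  assumes "G \<in> carrier_mat n a" "z \<in> carrier_mat m n" "j < a" "p < n"
    and "\<And>k. k < n \<Longrightarrow> G $$ (k, j) = unit_entries p k"
  shows "get_col j (z * G) = get_col p z"
  using assms by (intro eq_matI) (auto simp: get_col_def scalar_prod_def sum_unit_entries mult.commute[of _ "unit_entries _ _"])

lemma get_col_diff:
  fixes G z :: "'k::field mat"
  assumes "G \<in> carrier_mat n a" "z \<in> carrier_mat m n" "j < a" "p < n" "q < n" "p \<noteq> q"
    and "\<And>k. k < n \<Longrightarrow> G $$ (k, j) = diff_entries p q k"
  shows "get_col j (z * G) = get_col p z + (- 1) \<cdot>\<^sub>m get_col q z"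
  using assms by (intro eq_matI) (auto simp: get_col_def scalar_prod_def sum_diff_entries mult.commute[of _ "diff_entries _ _ _"])

lemma mult_put_row:
  fixes G \<xi> :: "'k::field mat"
  assumes "G \<in> carrier_mat a n" "j < n"
  shows "G * put_row n j \<xi> = mat a (dim_col \<xi>) (\<lambda>(k, i). G $$ (k, j) * \<xi> $$ (0, i))"
proof (rule eq_matI)
  fix k i assume ki: "k < dim_row (mat a (dim_col \<xi>) (\<lambda>(k, i). G $$ (k, j) * \<xi> $$ (0, i)))"
    "i < dim_col (mat a (dim_col \<xi>) (\<lambda>(k, i). G $$ (k, j) * \<xi> $$ (0, i)))"
  have "(G * put_row n j \<xi>) $$ (k, i) = (\<Sum>l\<in>{0..<n}. G $$ (k, l) * (if l = j then \<xi> $$ (0, i) else 0))"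
    using assms ki by (simp add: scalar_prod_def put_row_def)
  also have "\<dots> = (\<Sum>l\<in>{0..<n}. if l = j then G $$ (k, j) * \<xi> $$ (0, i) else 0)"
    by (rule sum.cong) auto
  finally show "(G * put_row n j \<xi>) $$ (k, i) = mat a (dim_col \<xi>) (\<lambda>(k, i). G $$ (k, j) * \<xi> $$ (0, i)) $$ (k, i)"
    using assms ki by simp
qed (use assms in auto)

lemma put_col_mult_mat:
  fixes G \<xi> :: "'k::field mat"
  assumes "G \<in> carrier_mat n a" "j < n"
  shows "put_col n j \<xi> * G = mat (dim_row \<xi>) a (\<lambda>(i, k). G $$ (j, k) * \<xi> $$ (i, 0))"
proof (rule eq_matI)
  fix i k assume ki: "i < dim_row (mat (dim_row \<xi>) a (\<lambda>(i, k). G $$ (j, k) * \<xi> $$ (i, 0)))"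
    "k < dim_col (mat (dim_row \<xi>) a (\<lambda>(i, k). G $$ (j, k) * \<xi> $$ (i, 0)))"
  have "(put_col n j \<xi> * G) $$ (i, k) = (\<Sum>l\<in>{0..<n}. (if l = j then \<xi> $$ (i, 0) else 0) * G $$ (l, k))"
    using assms ki by (simp add: scalar_prod_def put_col_def)
  also have "\<dots> = (\<Sum>l\<in>{0..<n}. if l = j then G $$ (j, k) * \<xi> $$ (i, 0) else 0)"
    by (rule sum.cong) auto
  finally show "(put_col n j \<xi> * G) $$ (i, k) = mat (dim_row \<xi>) a (\<lambda>(i, k). G $$ (j, k) * \<xi> $$ (i, 0)) $$ (i, k)"
    using assms ki by simp
qed (use assms in auto)

lemma mult_put_row_unit:
  fixes G \<xi> :: "'k::field mat"
  assumes "G \<in> carrier_mat a n" "j < n" "\<And>k. k < a \<Longrightarrow> G $$ (k, j) = unit_entries p k"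
  shows "G * put_row n j \<xi> = put_row a p \<xi>"
  unfolding mult_put_row[OF assms(1,2)]
  using assms(3) by (intro eq_matI) (auto simp: put_row_def unit_entries_def)

lemma mult_put_row_diff:
  fixes G \<xi> :: "'k::field mat"
  assumes "G \<in> carrier_mat a n" "j < n" "p \<noteq> q" "\<And>k. k < a \<Longrightarrow> G $$ (k, j) = diff_entries p q k"
  shows "G * put_row n j \<xi> = put_row a p \<xi> + (- 1) \<cdot>\<^sub>m put_row a q \<xi>"
  unfolding mult_put_row[OF assms(1,2)]
  using assms(3,4) by (intro eq_matI) (auto simp: put_row_def diff_entries_def)

lemma put_col_mult_unit:
  fixes G \<xi> :: "'k::field mat"
  assumes "G \<in> carrier_mat n a" "j < n" "\<And>k. k < a \<Longrightarrow> G $$ (j, k) = unit_entries p k"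
  shows "put_col n j \<xi> * G = put_col a p \<xi>"
  unfolding put_col_mult_mat[OF assms(1,2)]
  using assms(3) by (intro eq_matI) (auto simp: put_col_def unit_entries_def)

lemma put_col_mult_diff:
  fixes G \<xi> :: "'k::field mat"
  assumes "G \<in> carrier_mat n a" "j < n" "p \<noteq> q" "\<And>k. k < a \<Longrightarrow> G $$ (j, k) = diff_entries p q k"
  shows "put_col n j \<xi> * G = put_col a p \<xi> + (- 1) \<cdot>\<^sub>m put_col a q \<xi>"
  unfolding put_col_mult_mat[OF assms(1,2)]
  using assms(3,4) by (intro eq_matI) (auto simp: put_col_def diff_entries_def)

section \<open>Entries of the three morphisms\<close>

lemma g1_carrier: "g1 r c S L SU \<in> carrier_mat (length L + length SU) (length S)"
  and g2_carrier: "g2 r d KD K1 K \<in> carrier_mat (length K) (length KD + length K1)"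
  and g3_carrier: "g3 b a S K \<in> carrier_mat (length K) (length S)"
  by (simp_all add: g1_def g2_def g3_def)

lemma g1_hull: "(g1 r c S L SU :: 'k::field mat) \<in> hull_hom S (map snd L @ SU)"
  by (rule hull_homI)
     (auto simp: g1_def Let_def p_gen_def nth_append split: if_splits prod.splits)

lemma g2_hull: "(g2 r d KD K1 K :: 'k::field mat) \<in> hull_hom (KD @ map snd K1) K"
  by (rule hull_homI)
     (auto simp: g2_def Let_def p_gen_def nth_append split: if_splits prod.splits)

lemma g3_hull: "(g3 b a S K :: 'k::field mat) \<in> hull_hom S K"
  by (rule hull_homI) (auto simp: g3_def p_gen_def split: if_splits)

text \<open>The order relations make every \<open>p_gen\<close> that occurs equal to 1, and
  distinctness of S turns equality of points into equality of positions.\<close>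

lemma g1_entries_diff:
  assumes "distinct S" "j < length L" "L ! j = (aa, z)" "lo r aa \<le> z" "hi r aa \<le> z" "lo r aa \<noteq> hi r aa"
    and "p < length S" "S ! p = lo r aa" "q < length S" "S ! q = hi r aa" "k < length S"
  shows "g1 r c S L SU $$ (j, k) = diff_entries p q k"
  using assms nth_eq_iff_index_eq[OF assms(1,11,7)] nth_eq_iff_index_eq[OF assms(1,11,9)]
  by (auto simp: g1_def diff_entries_def p_gen_def)

lemma g1_entries_unit:
  assumes "distinct S" "j < length SU" "c (SU ! j) \<le> SU ! j"
    and "p < length S" "S ! p = c (SU ! j)" "k < length S"
  shows "g1 r c S L SU $$ (length L + j, k) = unit_entries p k"
  using assms nth_eq_iff_index_eq[OF assms(1,6,4)]
  by (auto simp: g1_def unit_entries_def p_gen_def)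

lemma g2_entries_diff:
  assumes "distinct K" "j < length K1" "K1 ! j = (bb, z)" "z \<le> lo r bb" "z \<le> hi r bb" "lo r bb \<noteq> hi r bb"
    and "p < length K" "K ! p = lo r bb" "q < length K" "K ! q = hi r bb" "k < length K"
  shows "g2 r d KD K1 K $$ (k, length KD + j) = diff_entries p q k"
  using assms nth_eq_iff_index_eq[OF assms(1,11,7)] nth_eq_iff_index_eq[OF assms(1,11,9)]
  by (auto simp: g2_def diff_entries_def p_gen_def)

lemma g2_entries_unit:
  assumes "distinct K" "j < length KD" "KD ! j \<le> d (KD ! j)"
    and "p < length K" "K ! p = d (KD ! j)" "k < length K"
  shows "g2 r d KD K1 K $$ (k, j) = unit_entries p k"
  using assms nth_eq_iff_index_eq[OF assms(1,6,4)]
  by (auto simp: g2_def unit_entries_def p_gen_def)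

text \<open>The only nonzero entry of \<open>g3\<close> is a 1, so it moves the component at
  \<open>a\<close> into the slot of \<open>b\<close> and forgets the others.\<close>

lemma g3_mult:
  fixes z :: "'k::field mat"
  assumes "distinct S" "distinct K" "p < length K" "K ! p = b" "q < length S" "S ! q = a" "a \<le> b"
    and z: "z \<in> carrier_mat (length S) m"
  shows "g3 b a S K * z = put_row (length K) p (get_row q z)"
proof (rule eq_matI)
  fix k i assume ki: "k < dim_row (put_row (length K) p (get_row q z))" "i < dim_col (put_row (length K) p (get_row q z))"
  have "(g3 b a S K * z) $$ (k, i) = (\<Sum>l\<in>{0..<length S}. (if k = p \<and> l = q then 1 else 0) * z $$ (l, i))"
    using ki z assms by (auto simp: g3_def scalar_prod_def p_gen_def nth_eq_iff_index_eq intro!: sum.cong)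
  also have "\<dots> = (\<Sum>l\<in>{0..<length S}. if l = q then (if k = p then z $$ (q, i) else 0) else 0)"
    by (rule sum.cong) auto
  finally show "(g3 b a S K * z) $$ (k, i) = put_row (length K) p (get_row q z) $$ (k, i)"
    using ki z assms by (simp add: put_row_def get_row_def)
qed (use z in \<open>auto simp: g3_def\<close>)

lemma mult_g3:
  fixes z :: "'k::field mat"
  assumes "distinct S" "distinct K" "p < length K" "K ! p = b" "q < length S" "S ! q = a" "a \<le> b"
    and z: "z \<in> carrier_mat m (length K)"
  shows "z * g3 b a S K = put_col (length S) q (get_col p z)"
proof (rule eq_matI)
  fix i k assume ki: "i < dim_row (put_col (length S) q (get_col p z))" "k < dim_col (put_col (length S) q (get_col p z))"
  have "(z * g3 b a S K) $$ (i, k) = (\<Sum>l\<in>{0..<length K}. z $$ (i, l) * (if l = p \<and> k = q then 1 else 0))"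
    using ki z assms by (auto simp: g3_def scalar_prod_def p_gen_def nth_eq_iff_index_eq intro!: sum.cong)
  also have "\<dots> = (\<Sum>l\<in>{0..<length K}. if l = p then (if k = q then z $$ (i, p) else 0) else 0)"
    by (rule sum.cong) auto
  finally show "(z * g3 b a S K) $$ (i, k) = put_col (length S) q (get_col p z) $$ (i, k)"
    using ki z assms by (simp add: put_col_def get_col_def)
qed (use z in \<open>auto simp: g3_def\<close>)

section \<open>Projective presentations\<close>

lemma vs_diff_eq_zero:
  assumes V: "vspace V" and uv: "u \<in> carrier V" "v \<in> carrier V"
  shows "u \<oplus>\<^bsub>V\<^esub> (- 1) \<odot>\<^bsub>V\<^esub> v = \<zero>\<^bsub>V\<^esub> \<longleftrightarrow> u = v"
proof
  have z: "(- 1) \<odot>\<^bsub>V\<^esub> v \<oplus>\<^bsub>V\<^esub> v = \<zero>\<^bsub>V\<^esub>" "v \<oplus>\<^bsub>V\<^esub> (- 1) \<odot>\<^bsub>V\<^esub> v = \<zero>\<^bsub>V\<^esub>"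
    using vs_ldistr[OF V uv(2), of "-1" 1] vs_ldistr[OF V uv(2), of 1 "-1"] uv(2) by (simp_all add: vs_facts[OF V])
  show "u \<oplus>\<^bsub>V\<^esub> (- 1) \<odot>\<^bsub>V\<^esub> v = \<zero>\<^bsub>V\<^esub>" if "u = v" using that z by simp
  assume e: "u \<oplus>\<^bsub>V\<^esub> (- 1) \<odot>\<^bsub>V\<^esub> v = \<zero>\<^bsub>V\<^esub>"
  have "u = u \<oplus>\<^bsub>V\<^esub> ((- 1) \<odot>\<^bsub>V\<^esub> v \<oplus>\<^bsub>V\<^esub> v)" using uv by (simp add: z vs_r_zero[OF V])
  also have "\<dots> = (u \<oplus>\<^bsub>V\<^esub> (- 1) \<odot>\<^bsub>V\<^esub> v) \<oplus>\<^bsub>V\<^esub> v"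
    using uv by (simp add: vs_assoc[OF V] vs_smult[OF V])
  finally show "u = v" using e uv by (simp add: vs_l_zero[OF V])
qed

lemma linear_get_row:
  assumes "k < length s"
  shows "linear_map class_ring (hull_space x s) (hull_space x [s ! k]) (get_row k :: 'k::field mat \<Rightarrow> _)"
proof (rule linear_mapI[OF vs_hull_space vs_hull_space])
  show "\<beta> \<in> carrier (hull_space x s) \<Longrightarrow> get_row k \<beta> \<in> carrier (hull_space x [s ! k])" for \<beta> :: "'k mat"
    using assms by (simp add: get_row_hull)
qed (use assms in \<open>auto simp: get_row_def hull_hom_dim intro!: eq_matI\<close>)

lemma linear_put_row:
  assumes "k < length s"
  shows "linear_map class_ring (hull_space x [s ! k]) (hull_space x s) (put_row (length s) k :: 'k::field mat \<Rightarrow> _)"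
proof (rule linear_mapI[OF vs_hull_space vs_hull_space])
  show "\<beta> \<in> carrier (hull_space x [s ! k]) \<Longrightarrow> put_row (length s) k \<beta> \<in> carrier (hull_space x s)" for \<beta> :: "'k mat"
    using assms by (simp add: put_row_hull)
qed (use assms in \<open>auto simp: put_row_def hull_hom_dim intro!: eq_matI\<close>)

lemma linear_get_col:
  assumes "k < length s"
  shows "linear_map class_ring (hull_space s x) (hull_space [s ! k] x) (get_col k :: 'k::field mat \<Rightarrow> _)"
proof (rule linear_mapI[OF vs_hull_space vs_hull_space])
  show "\<beta> \<in> carrier (hull_space s x) \<Longrightarrow> get_col k \<beta> \<in> carrier (hull_space [s ! k] x)" for \<beta> :: "'k mat"
    using assms by (simp add: get_col_hull)
qed (use assms in \<open>auto simp: get_col_def hull_hom_dim intro!: eq_matI\<close>)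

lemma linear_put_col:
  assumes "k < length s"
  shows "linear_map class_ring (hull_space [s ! k] x) (hull_space s x) (put_col (length s) k :: 'k::field mat \<Rightarrow> _)"
proof (rule linear_mapI[OF vs_hull_space vs_hull_space])
  show "\<beta> \<in> carrier (hull_space [s ! k] x) \<Longrightarrow> put_col (length s) k \<beta> \<in> carrier (hull_space s x)" for \<beta> :: "'k mat"
    using assms by (simp add: put_col_hull)
qed (use assms in \<open>auto simp: put_col_def hull_hom_dim intro!: eq_matI\<close>)

section \<open>The data common to both formulas\<close>

text \<open>Of the relation lists \<open>S1\<close> and \<open>K1\<close> only the connecting
  property is demanded, which treats the general case and the grid at once. The abbreviations
  \<open>tt\<close> and \<open>uu\<close> below are the target of g1 and the source of g2.\<close>

locale interval_setting =
  fixes I :: "'p::{finite, order} set" and M :: "('p, 'k::field, 'v) rep"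
    and r_sc r_sk :: "('p \<times> 'p) set" and c d :: "'p \<Rightarrow> 'p" and a0 b0 :: 'p
    and S SU K KD :: "'p list" and S1 K1 :: "('p set \<times> 'p) list"
  assumes I: "interval I" and M: "A_module M"
    and c: "choice_up I c" and d: "choice_down I d"
    and b0: "b0 \<in> sk I" and a0: "a0 \<in> sc I" and ab0: "a0 \<le> b0"
    and S: "lists_set S (sc I)" and SU: "lists_set SU (sc (Up_out I))"
    and K: "lists_set K (sk I)" and KD: "lists_set KD (sk (Down_out I))"
    and S1: "connecting_up I r_sc (set S1)" and K1: "connecting_down I r_sk (set K1)"
begin

abbreviation "tt \<equiv> map snd S1 @ SU"
abbreviation "uu \<equiv> KD @ map snd K1"
abbreviation "G1 \<equiv> g1 r_sc c S S1 SU :: 'k mat"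
abbreviation "G2 \<equiv> g2 r_sk d KD K1 K :: 'k mat"
abbreviation "G3 \<equiv> g3 b0 a0 S K :: 'k mat"

lemma dist: "distinct S" "distinct K"
  using S K by (auto simp: lists_set_def)

lemma G_carrier: "G1 \<in> carrier_mat (length tt) (length S)" "G2 \<in> carrier_mat (length K) (length uu)"
  "G3 \<in> carrier_mat (length K) (length S)"
  using g1_carrier g2_carrier g3_carrier by simp_all

lemma S_nth: "k < length S \<Longrightarrow> S ! k \<in> sc I" and K_nth: "k < length K \<Longrightarrow> K ! k \<in> sk I"
  using S K nth_mem unfolding lists_set_def by blast+

lemma S_index: "a \<in> sc I \<Longrightarrow> \<exists>p<length S. S ! p = a" and K_index: "b \<in> sk I \<Longrightarrow> \<exists>p<length K. K ! p = b"
  using S K unfolding lists_set_def by (metis in_set_conv_nth)+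

lemma G1_rel:
  assumes j: "j < length S1" "S1 ! j = (aa, z)"
  obtains p q where "p < length S" "q < length S" "p \<noteq> q" "S ! p = lo r_sc aa" "S ! q = hi r_sc aa"
    "S ! p \<le> z" "S ! q \<le> z" "j < length tt" "tt ! j = z" "\<And>k. k < length S \<Longrightarrow> G1 $$ (j, k) = diff_entries p q k"
proof -
  have "(aa, z) \<in> set S1" using j nth_mem by metis
  then have *: "lo r_sc aa \<in> sc I" "hi r_sc aa \<in> sc I" "lo r_sc aa \<noteq> hi r_sc aa" "lo r_sc aa \<le> z" "hi r_sc aa \<le> z"
    using S1 unfolding connecting_up_def by blast+
  obtain p q where pq: "p < length S" "S ! p = lo r_sc aa" "q < length S" "S ! q = hi r_sc aa"
    using S_index[OF *(1)] S_index[OF *(2)] by blast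
  show thesis
    by (rule that[of p q])
       (use pq * j g1_entries_diff[OF dist(1) j *(4,5,3) pq] in \<open>auto simp: nth_append\<close>)
qed

lemma G1_out:
  assumes j: "j < length SU"
  obtains p where "p < length S" "S ! p = c (SU ! j)" "S ! p \<le> SU ! j" "length S1 + j < length tt"
    "tt ! (length S1 + j) = SU ! j" "\<And>k. k < length S \<Longrightarrow> G1 $$ (length S1 + j, k) = unit_entries p k"
proof -
  have "SU ! j \<in> sc (Up_out I)" using SU j nth_mem unfolding lists_set_def by blast
  then have *: "c (SU ! j) \<in> sc I" "c (SU ! j) \<le> SU ! j" using c by (auto simp: choice_up_def)
  obtain p where p: "p < length S" "S ! p = c (SU ! j)" using S_index[OF *(1)] by blast
  show thesis
    by (rule that[of p]) (use p * j g1_entries_unit[where c = c, OF dist(1) j *(2) p] in \<open>auto simp: nth_append\<close>)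
qed

lemma G1_cases:
  assumes j: "j < length tt"
  obtains (rel) aa z where "j < length S1" "S1 ! j = (aa, z)"
  | (out) i where "i < length SU" "j = length S1 + i"
proof (cases "j < length S1")
  case True then show thesis using rel by (metis surj_pair)
next
  case False then show thesis using out[of "j - length S1"] j by auto
qed

lemma G2_rel:
  assumes j: "j < length K1" "K1 ! j = (bb, z)"
  obtains p q where "p < length K" "q < length K" "p \<noteq> q" "K ! p = lo r_sk bb" "K ! q = hi r_sk bb"
    "z \<le> K ! p" "z \<le> K ! q" "length KD + j < length uu" "uu ! (length KD + j) = z"
    "\<And>k. k < length K \<Longrightarrow> G2 $$ (k, length KD + j) = diff_entries p q k"
proof -
  have "(bb, z) \<in> set K1" using j nth_mem by metis
  then have *: "lo r_sk bb \<in> sk I" "hi r_sk bb \<in> sk I" "lo r_sk bb \<noteq> hi r_sk bb" "z \<le> lo r_sk bb" "z \<le> hi r_sk bb"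
    using K1 unfolding connecting_down_def by blast+
  obtain p q where pq: "p < length K" "K ! p = lo r_sk bb" "q < length K" "K ! q = hi r_sk bb"
    using K_index[OF *(1)] K_index[OF *(2)] by blast
  show thesis
    by (rule that[of p q])
       (use pq * j g2_entries_diff[OF dist(2) j *(4,5,3) pq] in \<open>auto simp: nth_append\<close>)
qed

lemma G2_out:
  assumes j: "j < length KD"
  obtains p where "p < length K" "K ! p = d (KD ! j)" "KD ! j \<le> K ! p" "j < length uu"
    "uu ! j = KD ! j" "\<And>k. k < length K \<Longrightarrow> G2 $$ (k, j) = unit_entries p k"
proof -
  have "KD ! j \<in> sk (Down_out I)" using KD j nth_mem unfolding lists_set_def by blast
  then have *: "d (KD ! j) \<in> sk I" "KD ! j \<le> d (KD ! j)" using d by (auto simp: choice_down_def)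
  obtain p where p: "p < length K" "K ! p = d (KD ! j)" using K_index[OF *(1)] by blast
  show thesis
    by (rule that[of p]) (use p * j g2_entries_unit[where d = d, OF dist(2) j *(2) p] in \<open>auto simp: nth_append\<close>)
qed

lemma G2_cases:
  assumes j: "j < length uu"
  obtains (rel) i bb z where "i < length K1" "K1 ! i = (bb, z)" "j = length KD + i"
  | (out) "j < length KD"
proof (cases "j < length KD")
  case True then show thesis using out by simp
next
  case False
  obtain bb z where "K1 ! (j - length KD) = (bb, z)" by (metis surj_pair)
  then show thesis using rel[of "j - length KD" bb z] False j by simp
qed

lemma a0_index: obtains p where "p < length S" "S ! p = a0"
  using S_index[OF a0] by blast

lemma b0_index: obtains q where "q < length K" "K ! q = b0"
  using K_index[OF b0] by blast

text \<open>The right-hand side spells out M(g1) m = 0 row by row. It speaks of positions in S,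
  where the matrices live, whereas the extension lemma speaks of points; \<open>ix\<close>
  translates between the two.\<close>

lemma vec_kernel:
  assumes m: "\<And>k. k < length S \<Longrightarrow> m k \<in> carrier (ob M (S ! k))"
  shows "(\<exists>f. interval_vec I M f \<and> (\<forall>k<length S. f (S ! k) = m k)) \<longleftrightarrow>
    (\<forall>aa z p q. (aa, z) \<in> set S1 \<longrightarrow> p < length S \<longrightarrow> q < length S \<longrightarrow> S ! p = lo r_sc aa \<longrightarrow> S ! q = hi r_sc aa \<longrightarrow>
      act M (S ! p) z 1 (m p) = act M (S ! q) z 1 (m q)) \<and>
    (\<forall>z p. z \<in> set SU \<longrightarrow> p < length S \<longrightarrow> S ! p = c z \<longrightarrow> act M (S ! p) z 1 (m p) = \<zero>\<^bsub>ob M z\<^esub>)"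
  (is "?L \<longleftrightarrow> ?R")
proof
  assume ?L
  then obtain f where f: "interval_vec I M f" "\<And>k. k < length S \<Longrightarrow> f (S ! k) = m k" by blast
  note r = interval_vec_relations[OF f(1) S1 c]
  show ?R
  proof (intro conjI allI impI)
    fix aa z p q assume *: "(aa, z) \<in> set S1" "p < length S" "q < length S" "S ! p = lo r_sc aa" "S ! q = hi r_sc aa"
    show "act M (S ! p) z 1 (m p) = act M (S ! q) z 1 (m q)"
      using r(1)[OF *(1)] unfolding *(4,5)[symmetric] f(2)[OF *(2)] f(2)[OF *(3)] .
  next
    fix z p assume *: "z \<in> set SU" "p < length S" "S ! p = c z"
    have "z \<in> sc (Up_out I)" using SU * by (auto simp: lists_set_def)
    from r(2)[OF this] show "act M (S ! p) z 1 (m p) = \<zero>\<^bsub>ob M z\<^esub>"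
      unfolding *(3)[symmetric] f(2)[OF *(2)] .
  qed
next
  assume R: ?R
  obtain ix where ix: "\<And>a. a \<in> sc I \<Longrightarrow> ix a < length S \<and> S ! ix a = a" using S_index by metis
  have "\<exists>f. interval_vec I M f \<and> (\<forall>a\<in>sc I. f a = m (ix a))"
  proof (rule interval_vec_extend[OF M S1 c])
    show "m (ix a) \<in> carrier (ob M a)" if "a \<in> sc I" for a using m[of "ix a"] ix[OF that] by simp
  next
    fix aa z assume l: "(aa, z) \<in> set S1"
    then have *: "lo r_sc aa \<in> sc I" "hi r_sc aa \<in> sc I" using S1 unfolding connecting_up_def by blast+
    show "act M (lo r_sc aa) z 1 (m (ix (lo r_sc aa))) = act M (hi r_sc aa) z 1 (m (ix (hi r_sc aa)))"
      using R[THEN conjunct1, rule_format, OF l, of "ix (lo r_sc aa)" "ix (hi r_sc aa)"] ix[OF *(1)] ix[OF *(2)] by simp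
  next
    fix a assume a: "a \<in> sc (Up_out I)"
    then have *: "c a \<in> sc I" "a \<in> set SU" using c SU by (auto simp: choice_up_def lists_set_def)
    show "act M (c a) a 1 (m (ix (c a))) = \<zero>\<^bsub>ob M a\<^esub>"
      using R[THEN conjunct2, rule_format, OF *(2), of "ix (c a)"] ix[OF *(1)] by simp
  qed
  moreover have "ix (S ! k) = k" if "k < length S" for k
    using ix[OF S_nth[OF that]] nth_eq_iff_index_eq[OF dist(1), of "ix (S ! k)" k] that by simp
  ultimately show ?L using S_nth by (metis (no_types, lifting))
qed

lemma covec_kernel:
  assumes \<mu>: "\<And>k. k < length K \<Longrightarrow> lf (ob M (K ! k)) (\<mu> k)"
  shows "(\<exists>\<phi>. interval_covec I M \<phi> \<and> (\<forall>k<length K. \<forall>v\<in>carrier (ob M (K ! k)). \<phi> (K ! k) v = \<mu> k v)) \<longleftrightarrow>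
    (\<forall>bb z p q. (bb, z) \<in> set K1 \<longrightarrow> p < length K \<longrightarrow> q < length K \<longrightarrow> K ! p = lo r_sk bb \<longrightarrow> K ! q = hi r_sk bb \<longrightarrow>
      (\<forall>v\<in>carrier (ob M z). \<mu> p (act M z (K ! p) 1 v) = \<mu> q (act M z (K ! q) 1 v))) \<and>
    (\<forall>z p. z \<in> set KD \<longrightarrow> p < length K \<longrightarrow> K ! p = d z \<longrightarrow> (\<forall>v\<in>carrier (ob M z). \<mu> p (act M z (K ! p) 1 v) = 0))"
  (is "?L \<longleftrightarrow> ?R")
proof
  assume ?L
  then obtain \<phi> where \<phi>: "interval_covec I M \<phi>"
    "\<And>k v. k < length K \<Longrightarrow> v \<in> carrier (ob M (K ! k)) \<Longrightarrow> \<phi> (K ! k) v = \<mu> k v" by blast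
  note r = interval_covec_relations[OF \<phi>(1) K1 d]
  show ?R
  proof (intro conjI allI impI ballI)
    fix bb z p q v assume *: "(bb, z) \<in> set K1" "p < length K" "q < length K" "K ! p = lo r_sk bb" "K ! q = hi r_sk bb"
      and v: "v \<in> carrier (ob M z)"
    have "z \<le> K ! p" "z \<le> K ! q" using K1 * unfolding connecting_down_def by metis+
    then have i: "act M z (K ! p) 1 v \<in> carrier (ob M (K ! p))" "act M z (K ! q) 1 v \<in> carrier (ob M (K ! q))"
      using A_module_act_in[OF M _ v] by blast+
    show "\<mu> p (act M z (K ! p) 1 v) = \<mu> q (act M z (K ! q) 1 v)"
      using r(1)[OF *(1) v] unfolding *(4,5)[symmetric] \<phi>(2)[OF *(2) i(1)] \<phi>(2)[OF *(3) i(2)] .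
  next
    fix z p v assume *: "z \<in> set KD" "p < length K" "K ! p = d z" and v: "v \<in> carrier (ob M z)"
    have z: "z \<in> sk (Down_out I)" using KD * by (auto simp: lists_set_def)
    then have "z \<le> K ! p" using d *(3) by (simp add: choice_down_def)
    then have i: "act M z (K ! p) 1 v \<in> carrier (ob M (K ! p))" using A_module_act_in[OF M _ v] by blast
    from r(2)[OF z v] show "\<mu> p (act M z (K ! p) 1 v) = 0" unfolding *(3)[symmetric] \<phi>(2)[OF *(2) i] .
  qed
next
  assume R: ?R
  obtain ix where ix: "\<And>b. b \<in> sk I \<Longrightarrow> ix b < length K \<and> K ! ix b = b" using K_index by metis
  have "\<exists>\<phi>. interval_covec I M \<phi> \<and> (\<forall>b\<in>sk I. \<forall>v\<in>carrier (ob M b). \<phi> b v = \<mu> (ix b) v)"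
  proof (rule interval_covec_extend[OF M K1 d])
    show "lf (ob M b) (\<mu> (ix b))" if "b \<in> sk I" for b using \<mu>[of "ix b"] ix[OF that] by simp
  next
    fix bb z v assume l: "(bb, z) \<in> set K1" and v: "v \<in> carrier (ob M z)"
    then have *: "lo r_sk bb \<in> sk I" "hi r_sk bb \<in> sk I" using K1 unfolding connecting_down_def by blast+
    show "\<mu> (ix (lo r_sk bb)) (act M z (lo r_sk bb) 1 v) = \<mu> (ix (hi r_sk bb)) (act M z (hi r_sk bb) 1 v)"
      using R[THEN conjunct1, rule_format, OF l, of "ix (lo r_sk bb)" "ix (hi r_sk bb)" v] v ix[OF *(1)] ix[OF *(2)] by simp
  next
    fix b v assume b: "b \<in> sk (Down_out I)" and v: "v \<in> carrier (ob M b)"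
    then have *: "d b \<in> sk I" "b \<in> set KD" using d KD by (auto simp: choice_down_def lists_set_def)
    show "\<mu> (ix (d b)) (act M b (d b) 1 v) = 0"
      using R[THEN conjunct2, rule_format, OF *(2), of "ix (d b)" v] v ix[OF *(1)] by simp
  qed
  moreover have "ix (K ! k) = k" if "k < length K" for k
    using ix[OF K_nth[OF that]] nth_eq_iff_index_eq[OF dist(2), of "ix (K ! k)" k] that by simp
  ultimately show ?L using K_nth by (metis (no_types, lifting))
qed

end

section \<open>Lifting along a projective presentation\<close>

locale projective_setting =
  interval_setting I M r_sc r_sk c d a0 b0 S SU K KD S1 K1
  for I :: "'p::{finite, order} set" and M :: "('p, 'k::field, 'v) rep" and r_sc r_sk c d a0 b0 S SU K KD S1 K1 +
  fixes x y :: "'p list" and \<alpha> :: "'k mat" and \<pi> :: "'p \<Rightarrow> 'k mat \<Rightarrow> 'v"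
  assumes \<alpha>: "\<alpha> \<in> hull_hom x y" and \<pi>: "rep_hom (P_rep x) M \<pi>"
    and ker: "\<And>v. P_trans \<alpha> ` carrier (ob (P_rep y :: ('p, 'k, 'k mat) rep) v)
      = {\<beta> \<in> carrier (ob (P_rep x) v). \<pi> v \<beta> = \<zero>\<^bsub>ob M v\<^esub>}"
    and surj: "\<And>v. \<pi> v ` carrier (ob (P_rep x) v) = carrier (ob M v)"
begin

lemma pi_linear: "linear_map class_ring (hull_space x [v]) (ob M v) (\<pi> v)"
  using rep_hom_linear[OF \<pi>, of v] by (simp add: P_rep_def P_space_def)

lemma pi_in: "\<xi> \<in> hull_hom x [v] \<Longrightarrow> \<pi> v \<xi> \<in> carrier (ob M v)"
  using linear_map_in[OF pi_linear, of \<xi> v] by simp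

lemma pi_zero_iff: "\<xi> \<in> hull_hom x [v] \<Longrightarrow> \<pi> v \<xi> = \<zero>\<^bsub>ob M v\<^esub> \<longleftrightarrow> (\<exists>\<gamma>\<in>hull_hom y [v]. \<xi> = \<gamma> * \<alpha>)"
  using ker[of v] by (auto simp: P_rep_def P_space_def P_trans_def)

lemma pi_surj: "m \<in> carrier (ob M v) \<Longrightarrow> \<exists>\<xi>\<in>hull_hom x [v]. \<pi> v \<xi> = m"
  using surj[of v, symmetric] by (auto simp: P_rep_def P_space_def)

lemma pi_act:
  assumes vw: "v \<le> w" and \<xi>: "\<xi> \<in> hull_hom x [v]"
  shows "\<pi> w \<xi> = act M v w 1 (\<pi> v \<xi>)"
proof -
  have "single 1 * \<xi> = \<xi>"
    using hull_hom_carrier[OF \<xi>] by (intro eq_matI) (auto simp: single_def scalar_prod_def)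
  then show ?thesis
    using rep_hom_act[OF \<pi> vw, of \<xi> 1] \<xi> by (simp add: P_rep_def P_space_def P_act_def)
qed

lemma pi_diff:
  assumes "v \<le> z" "w \<le> z" "\<xi> \<in> hull_hom x [v]" "\<zeta> \<in> hull_hom x [w]"
  shows "\<pi> z (\<xi> + (- 1) \<cdot>\<^sub>m \<zeta>) = \<zero>\<^bsub>ob M z\<^esub> \<longleftrightarrow> act M v z 1 (\<pi> v \<xi>) = act M w z 1 (\<pi> w \<zeta>)"
proof -
  have h: "\<xi> \<in> hull_hom x [z]" "\<zeta> \<in> hull_hom x [z]" using assms hull_row_mono by blast+
  have "\<pi> z (\<xi> + (- 1) \<cdot>\<^sub>m \<zeta>) = \<pi> z \<xi> \<oplus>\<^bsub>ob M z\<^esub> (- 1) \<odot>\<^bsub>ob M z\<^esub> \<pi> z \<zeta>"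
    using linear_map_add[OF pi_linear, of \<xi> z "(- 1) \<cdot>\<^sub>m \<zeta>"] linear_map_smult[OF pi_linear, of \<zeta> z "- 1"] h
    by (simp add: hull_hom_smult)
  then show ?thesis
    using vs_diff_eq_zero[OF A_module_vs[OF M] pi_in[OF h(1)] pi_in[OF h(2)]] pi_act assms by simp
qed

text \<open>Row k of \<open>z\<close> is an element of P(x) at the k-th point of s, so exactness at
  that point gives row k of \<gamma>; the rows are then assembled into one morphism from y to
  s.\<close>

lemma row_kernel:
  assumes "z \<in> hull_hom x s"
  shows "(\<exists>\<gamma>\<in>hull_hom y s. z = \<gamma> * \<alpha>) \<longleftrightarrow> (\<forall>k<length s. \<pi> (s ! k) (get_row k z) = \<zero>\<^bsub>ob M (s ! k)\<^esub>)"
proof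
  assume "\<exists>\<gamma>\<in>hull_hom y s. z = \<gamma> * \<alpha>"
  then obtain \<gamma> where \<gamma>: "\<gamma> \<in> hull_hom y s" "z = \<gamma> * \<alpha>" by blast
  show "\<forall>k<length s. \<pi> (s ! k) (get_row k z) = \<zero>\<^bsub>ob M (s ! k)\<^esub>"
  proof (intro allI impI)
    fix k assume k: "k < length s"
    have "get_row k z = get_row k \<gamma> * \<alpha>"
      unfolding \<gamma>(2) by (rule get_row_mult[OF hull_hom_carrier[OF \<gamma>(1)] hull_hom_carrier[OF \<alpha>] k])
    then show "\<pi> (s ! k) (get_row k z) = \<zero>\<^bsub>ob M (s ! k)\<^esub>"
      using pi_zero_iff[OF get_row_hull[OF assms k]] get_row_hull[OF \<gamma>(1) k] by blast
  qed
next
  assume 0: "\<forall>k<length s. \<pi> (s ! k) (get_row k z) = \<zero>\<^bsub>ob M (s ! k)\<^esub>"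
  have "\<forall>k<length s. \<exists>\<gamma>. \<gamma> \<in> hull_hom y [s ! k] \<and> get_row k z = \<gamma> * \<alpha>"
    using 0 pi_zero_iff[OF get_row_hull[OF assms]] by blast
  then obtain \<rho> where \<rho>: "\<And>k. k < length s \<Longrightarrow> \<rho> k \<in> hull_hom y [s ! k]"
    "\<And>k. k < length s \<Longrightarrow> get_row k z = \<rho> k * \<alpha>" by metis
  obtain \<gamma> where \<gamma>: "\<gamma> \<in> hull_hom y s" "\<And>k. k < length s \<Longrightarrow> get_row k \<gamma> = \<rho> k"
    by (rule hull_rows[of s \<rho> y]) (use \<rho> in auto)
  have "z = \<gamma> * \<alpha>"
  proof (rule eq_rowI[OF hull_hom_carrier[OF assms] hull_hom_carrier[OF hull_hom_mult[OF \<alpha> \<gamma>(1)]]])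
    fix k assume k: "k < length s"
    show "get_row k z = get_row k (\<gamma> * \<alpha>)"
      using get_row_mult[OF hull_hom_carrier[OF \<gamma>(1)] hull_hom_carrier[OF \<alpha>] k] \<rho>(2)[OF k] \<gamma>(2)[OF k] by simp
  qed
  then show "\<exists>\<gamma>\<in>hull_hom y s. z = \<gamma> * \<alpha>" using \<gamma>(1) by blast
qed

text \<open>Under \<pi> the rows of G1 z become the differences and the single transports that make
  up M(g1), applied to the family given by the rows of \<open>z\<close>. So being a multiple of
  \<alpha> says that this family satisfies the relations of a morphism from V_I.\<close>

lemma G1_kernel:
  assumes z: "z \<in> hull_hom x S"
  shows "(\<exists>\<gamma>\<in>hull_hom y tt. G1 * z = \<gamma> * \<alpha>) \<longleftrightarrow>
    (\<exists>f. interval_vec I M f \<and> (\<forall>k<length S. f (S ! k) = \<pi> (S ! k) (get_row k z)))"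
proof -
  let ?m = "\<lambda>k. \<pi> (S ! k) (get_row k z)"
  note row = get_row_hull[OF z] and zc = hull_hom_carrier[OF z]
  have rel: "\<pi> (tt ! j) (get_row j (G1 * z)) = \<zero>\<^bsub>ob M (tt ! j)\<^esub> \<longleftrightarrow>
      (\<forall>p q. p < length S \<longrightarrow> q < length S \<longrightarrow> S ! p = lo r_sc aa \<longrightarrow> S ! q = hi r_sc aa \<longrightarrow>
        act M (S ! p) w 1 (?m p) = act M (S ! q) w 1 (?m q))"
    if j: "j < length S1" "S1 ! j = (aa, w)" for j aa w
  proof -
    obtain p q where pq: "p < length S" "q < length S" "p \<noteq> q" "S ! p = lo r_sc aa" "S ! q = hi r_sc aa"
      "S ! p \<le> w" "S ! q \<le> w" "j < length tt" "tt ! j = w"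
      and e: "\<And>k. k < length S \<Longrightarrow> G1 $$ (j, k) = diff_entries p q k"
      using G1_rel[OF j] by metis
    have "get_row j (G1 * z) = get_row p z + (- 1) \<cdot>\<^sub>m get_row q z"
      by (rule get_row_diff[OF G_carrier(1) zc pq(8,1,2,3) e])
    then have "\<pi> (tt ! j) (get_row j (G1 * z)) = \<zero>\<^bsub>ob M (tt ! j)\<^esub> \<longleftrightarrow>
        act M (S ! p) w 1 (?m p) = act M (S ! q) w 1 (?m q)"
      using pi_diff[OF pq(6,7) row[OF pq(1)] row[OF pq(2)]] pq(9) by simp
    moreover have "p' = p" if "p' < length S" "S ! p' = lo r_sc aa" for p'
      using nth_eq_iff_index_eq[OF dist(1) that(1) pq(1)] that pq by simp
    moreover have "q' = q" if "q' < length S" "S ! q' = hi r_sc aa" for q'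
      using nth_eq_iff_index_eq[OF dist(1) that(1) pq(2)] that pq by simp
    ultimately show ?thesis using pq(1,2,4,5) by blast
  qed
  have out: "\<pi> (tt ! (length S1 + j)) (get_row (length S1 + j) (G1 * z)) = \<zero>\<^bsub>ob M (tt ! (length S1 + j))\<^esub> \<longleftrightarrow>
      (\<forall>p. p < length S \<longrightarrow> S ! p = c (SU ! j) \<longrightarrow> act M (S ! p) (SU ! j) 1 (?m p) = \<zero>\<^bsub>ob M (SU ! j)\<^esub>)"
    if j: "j < length SU" for j
  proof -
    obtain p where p: "p < length S" "S ! p = c (SU ! j)" "S ! p \<le> SU ! j" "length S1 + j < length tt"
      "tt ! (length S1 + j) = SU ! j" and e: "\<And>k. k < length S \<Longrightarrow> G1 $$ (length S1 + j, k) = unit_entries p k"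
      using G1_out[OF j] by metis
    have "get_row (length S1 + j) (G1 * z) = get_row p z"
      by (rule get_row_unit[OF G_carrier(1) zc p(4,1) e])
    then have "\<pi> (tt ! (length S1 + j)) (get_row (length S1 + j) (G1 * z)) = \<zero>\<^bsub>ob M (tt ! (length S1 + j))\<^esub> \<longleftrightarrow>
        act M (S ! p) (SU ! j) 1 (?m p) = \<zero>\<^bsub>ob M (SU ! j)\<^esub>"
      using pi_act[OF p(3) row[OF p(1)]] p(5) by simp
    moreover have "p' = p" if "p' < length S" "S ! p' = c (SU ! j)" for p'
      using nth_eq_iff_index_eq[OF dist(1) that(1) p(1)] that p by simp
    ultimately show ?thesis using p(1,2) by blast
  qed
  let ?Z = "\<lambda>j. \<pi> (tt ! j) (get_row j (G1 * z)) = \<zero>\<^bsub>ob M (tt ! j)\<^esub>"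
  have "(\<exists>\<gamma>\<in>hull_hom y tt. G1 * z = \<gamma> * \<alpha>) \<longleftrightarrow> (\<forall>j<length tt. ?Z j)"
    by (rule row_kernel[OF hull_hom_mult[OF z g1_hull]])
  also have "\<dots> \<longleftrightarrow> (\<forall>j<length S1. ?Z j) \<and> (\<forall>j<length SU. ?Z (length S1 + j))"
  proof (intro iffI conjI allI impI)
    assume "(\<forall>j<length S1. ?Z j) \<and> (\<forall>j<length SU. ?Z (length S1 + j))"
    then show "?Z j" if "j < length tt" for j
      using G1_cases[OF that] by metis
  qed auto
  also have "(\<forall>j<length S1. ?Z j) \<longleftrightarrow> (\<forall>aa w. (aa, w) \<in> set S1 \<longrightarrow>
      (\<forall>p q. p < length S \<longrightarrow> q < length S \<longrightarrow> S ! p = lo r_sc aa \<longrightarrow> S ! q = hi r_sc aa \<longrightarrow>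
        act M (S ! p) w 1 (?m p) = act M (S ! q) w 1 (?m q)))" (is "_ \<longleftrightarrow> (\<forall>aa w. _ \<longrightarrow> ?R aa w)")
  proof (intro iffI allI impI)
    fix aa w assume "\<forall>j<length S1. ?Z j" "(aa, w) \<in> set S1"
    then obtain j where "j < length S1" "S1 ! j = (aa, w)" "?Z j" by (metis in_set_conv_nth)
    then show "act M (S ! p) w 1 (?m p) = act M (S ! q) w 1 (?m q)"
      if "p < length S" "q < length S" "S ! p = lo r_sc aa" "S ! q = hi r_sc aa" for p q
      using rel that by blast
  next
    fix j assume R: "\<forall>aa w. (aa, w) \<in> set S1 \<longrightarrow> ?R aa w" and j: "j < length S1"
    obtain aa w where "S1 ! j = (aa, w)" by (metis surj_pair)
    moreover from this have "(aa, w) \<in> set S1" using j nth_mem by metis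
    ultimately show "?Z j" using rel[OF j] R by blast
  qed
  also have "(\<forall>j<length SU. ?Z (length S1 + j)) \<longleftrightarrow> (\<forall>w. w \<in> set SU \<longrightarrow>
      (\<forall>p. p < length S \<longrightarrow> S ! p = c w \<longrightarrow> act M (S ! p) w 1 (?m p) = \<zero>\<^bsub>ob M w\<^esub>))"
    using out by (metis in_set_conv_nth)
  finally show ?thesis
    using vec_kernel[of ?m] pi_in row by blast
qed

text \<open>A covector, pulled back along \<pi>, as a functional on P'(sk(I))(x); only its
  components at maximal elements enter.\<close>

definition Psi :: "('p \<Rightarrow> 'v \<Rightarrow> 'k) \<Rightarrow> 'k mat \<Rightarrow> 'k" where
  "Psi \<phi> \<omega> = (\<Sum>k<length K. \<phi> (K ! k) (\<pi> (K ! k) (get_row k \<omega>)))"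

lemma covec_lf: "interval_covec I M \<phi> \<Longrightarrow> k < length K \<Longrightarrow> lf (ob M (K ! k)) (\<phi> (K ! k))"
  using K_nth by (auto simp: interval_covec_def sk_def)

lemma Psi_lf:
  assumes "interval_covec I M \<phi>" shows "lf (hull_space x K) (Psi \<phi>)"
  unfolding Psi_def
  by (intro lf_sum linear_map_lf[OF linear_get_row] linear_map_lf[OF pi_linear] covec_lf[OF assms])

lemma Psi_put_row:
  assumes \<phi>: "interval_covec I M \<phi>" and k: "k < length K" and \<xi>: "\<xi> \<in> hull_hom x [K ! k]"
  shows "Psi \<phi> (put_row (length K) k \<xi>) = \<phi> (K ! k) (\<pi> (K ! k) \<xi>)"
proof -
  have z: "\<phi> (K ! l) (\<pi> (K ! l) (0\<^sub>m (Suc 0) (length x))) = 0" if "l < length K" for l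
    using linear_map_zero[OF pi_linear, of "K ! l"] lf_zero[OF A_module_vs[OF M] covec_lf[OF \<phi> that]] by simp
  have "Psi \<phi> (put_row (length K) k \<xi>) = (\<Sum>l<length K. if l = k then \<phi> (K ! k) (\<pi> (K ! k) \<xi>) else 0)"
    unfolding Psi_def
    by (rule sum.cong) (use z hull_hom_dim[OF \<xi>] in \<open>auto simp: get_put_row\<close>)
  then show ?thesis using k by simp
qed

lemma G2_put_rel:
  assumes j: "j < length K1" "K1 ! j = (bb, z)" and pq: "p < length K" "q < length K" "K ! p = lo r_sk bb" "K ! q = hi r_sk bb"
  shows "G2 * put_row (length uu) (length KD + j) \<xi> = put_row (length K) p \<xi> + (- 1) \<cdot>\<^sub>m put_row (length K) q \<xi>"
    and "z \<le> K ! p" "z \<le> K ! q" "length KD + j < length uu" "uu ! (length KD + j) = z"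
proof -
  obtain p' q' where *: "p' < length K" "q' < length K" "p' \<noteq> q'" "K ! p' = lo r_sk bb" "K ! q' = hi r_sk bb"
    "z \<le> K ! p'" "z \<le> K ! q'" "length KD + j < length uu" "uu ! (length KD + j) = z"
    and e: "\<And>k. k < length K \<Longrightarrow> G2 $$ (k, length KD + j) = diff_entries p' q' k"
    using G2_rel[OF j] by metis
  have "p = p'" "q = q'"
    using nth_eq_iff_index_eq[OF dist(2) pq(1) *(1)] nth_eq_iff_index_eq[OF dist(2) pq(2) *(2)] pq * by auto
  then show "G2 * put_row (length uu) (length KD + j) \<xi> = put_row (length K) p \<xi> + (- 1) \<cdot>\<^sub>m put_row (length K) q \<xi>"
    "z \<le> K ! p" "z \<le> K ! q" "length KD + j < length uu" "uu ! (length KD + j) = z"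
    using mult_put_row_diff[OF G_carrier(2) *(8,3) e] * by auto
qed

lemma G2_put_out:
  assumes j: "j < length KD" and p: "p < length K" "K ! p = d (KD ! j)"
  shows "G2 * put_row (length uu) j \<xi> = put_row (length K) p \<xi>"
    and "KD ! j \<le> K ! p" "j < length uu" "uu ! j = KD ! j"
proof -
  obtain p' where *: "p' < length K" "K ! p' = d (KD ! j)" "KD ! j \<le> K ! p'" "j < length uu" "uu ! j = KD ! j"
    and e: "\<And>k. k < length K \<Longrightarrow> G2 $$ (k, j) = unit_entries p' k"
    using G2_out[OF j] by metis
  have "p = p'" using nth_eq_iff_index_eq[OF dist(2) p(1) *(1)] p * by auto
  then show "G2 * put_row (length uu) j \<xi> = put_row (length K) p \<xi>" "KD ! j \<le> K ! p" "j < length uu" "uu ! j = KD ! j"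
    using mult_put_row_unit[OF G_carrier(2) *(4) e] * by auto
qed

text \<open>By linearity a single row in \<open>uu\<close> suffices. G2 places it at two maximal
  elements with opposite signs, or at the chosen maximal element above a point of
  \<open>Down_out I\<close>; the covector relations then give 0. The summand \<delta> \<alpha> dies
  already under \<pi>.\<close>

lemma Psi_vanishes:
  assumes \<phi>: "interval_covec I M \<phi>" and z: "z \<in> hull_hom x uu" and \<delta>: "\<delta> \<in> hull_hom y K"
  shows "Psi \<phi> (G2 * z + \<delta> * \<alpha>) = 0"
proof -
  note l = Psi_lf[OF \<phi>] and rels = interval_covec_relations[OF \<phi> K1 d]
  have G2h: "G2 \<in> hull_hom uu K" by (rule g2_hull)
  have put: "Psi \<phi> (G2 * put_row (length uu) j \<xi>) = 0" if j: "j < length uu" and \<xi>: "\<xi> \<in> hull_hom x [uu ! j]" for j \<xi>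
    using j
  proof (cases rule: G2_cases)
    case (rel i bb w)
    have bb: "(bb, w) \<in> set K1" using rel nth_mem by metis
    obtain p q where pq: "p < length K" "q < length K" "K ! p = lo r_sk bb" "K ! q = hi r_sk bb"
      using G2_rel[OF rel(1,2)] by metis
    note P = G2_put_rel[OF rel(1,2) pq]
    have \<xi>w: "\<xi> \<in> hull_hom x [w]" using \<xi> P(5) rel(3) by simp
    then have h: "\<xi> \<in> hull_hom x [K ! p]" "\<xi> \<in> hull_hom x [K ! q]" using P(2,3) hull_row_mono by blast+
    have "Psi \<phi> (G2 * put_row (length uu) j \<xi>) = Psi \<phi> (put_row (length K) p \<xi>) + (- 1) * Psi \<phi> (put_row (length K) q \<xi>)"
      unfolding rel(3) P(1)
      using lf_add[OF l, of "put_row (length K) p \<xi>" "(- 1) \<cdot>\<^sub>m put_row (length K) q \<xi>"]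
        lf_smult[OF l, of "put_row (length K) q \<xi>" "- 1"] put_row_hull[OF h(1) pq(1)] put_row_hull[OF h(2) pq(2)]
      by (simp add: hull_hom_smult)
    also have "\<dots> = \<phi> (K ! p) (act M w (K ! p) 1 (\<pi> w \<xi>)) - \<phi> (K ! q) (act M w (K ! q) 1 (\<pi> w \<xi>))"
      using Psi_put_row[OF \<phi>] pq h pi_act[OF P(2) \<xi>w] pi_act[OF P(3) \<xi>w] by simp
    also have "\<dots> = 0" using rels(1)[OF bb pi_in[OF \<xi>w]] pq by simp
    finally show ?thesis .
  next
    case out
    obtain p where p: "p < length K" "K ! p = d (KD ! j)" using G2_out[OF out] by metis
    note P = G2_put_out[OF out p]
    have \<xi>w: "\<xi> \<in> hull_hom x [KD ! j]" using \<xi> P(4) by simp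
    have h: "\<xi> \<in> hull_hom x [K ! p]" using \<xi>w P(2) hull_row_mono by blast
    have "KD ! j \<in> sk (Down_out I)" using KD out nth_mem unfolding lists_set_def by blast
    then show ?thesis
      unfolding P(1) using Psi_put_row[OF \<phi> p(1) h] pi_act[OF P(2) \<xi>w] rels(2)[OF _ pi_in[OF \<xi>w]] p(2) by simp
  qed
  have "lf (hull_space x uu) (\<lambda>z. Psi \<phi> (G2 * z))" by (rule linear_map_lf[OF linear_hull_left[OF G2h] l])
  from lf_rows[OF this z] have "Psi \<phi> (G2 * z) = 0"
    using put get_row_hull[OF z] by simp
  moreover have "Psi \<phi> (\<delta> * \<alpha>) = 0"
  proof -
    have "\<pi> (K ! k) (get_row k (\<delta> * \<alpha>)) = \<zero>\<^bsub>ob M (K ! k)\<^esub>" if "k < length K" for k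
      using row_kernel[OF hull_hom_mult[OF \<alpha> \<delta>]] \<delta> that by blast
    then show ?thesis
      unfolding Psi_def using lf_zero[OF A_module_vs[OF M] covec_lf[OF \<phi>]] by simp
  qed
  ultimately show ?thesis
    using lf_add[OF l, of "G2 * z" "\<delta> * \<alpha>"] hull_hom_mult[OF z G2h] hull_hom_mult[OF \<alpha> \<delta>] by simp
qed

text \<open>Converse of \<open>Psi_vanishes\<close>: vanishing on multiples of \<alpha> lets every
  component descend along \<pi> to a functional on M, and vanishing on the image of G2 gives the
  relations under which these functionals extend to a covector.\<close>

lemma covec_of_functional:
  assumes \<chi>: "lf (hull_space x K) \<chi>"
    and van: "\<And>z \<delta>. z \<in> hull_hom x uu \<Longrightarrow> \<delta> \<in> hull_hom y K \<Longrightarrow> \<chi> (G2 * z + \<delta> * \<alpha>) = 0"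
  shows "\<exists>\<phi>. interval_covec I M \<phi> \<and>
    (\<forall>k<length K. \<forall>\<xi>\<in>hull_hom x [K ! k]. \<chi> (put_row (length K) k \<xi>) = \<phi> (K ! k) (\<pi> (K ! k) \<xi>))"
proof -
  let ?E = "put_row (length K)"
  have G2h: "G2 \<in> hull_hom uu K" by (rule g2_hull)
  have van1: "\<chi> (G2 * z) = 0" if "z \<in> hull_hom x uu" for z
  proof -
    have "0\<^sub>m (length K) (length y) * \<alpha> = 0\<^sub>m (length K) (length x)"
      using hull_hom_carrier[OF \<alpha>] by simp
    then show ?thesis
      using van[OF that hull_hom_zero[of K y]] hull_hom_carrier[OF hull_hom_mult[OF that G2h]] by simp
  qed
  have van2: "\<chi> (\<delta> * \<alpha>) = 0" if "\<delta> \<in> hull_hom y K" for \<delta>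
  proof -
    have "G2 * 0\<^sub>m (length uu) (length x) = 0\<^sub>m (length K) (length x)"
      using G_carrier(2) by simp
    then show ?thesis
      using van[OF hull_hom_zero[of uu x] that] hull_hom_carrier[OF hull_hom_mult[OF \<alpha> that]] by simp
  qed
  have \<chi>E: "lf (hull_space x [K ! k]) (\<lambda>\<xi>. \<chi> (?E k \<xi>))" if "k < length K" for k
    by (rule linear_map_lf[OF linear_put_row[OF that] \<chi>])
  \<comment> \<open>Two lifts of the same vector differ by a multiple of \<alpha>, on which
    \<open>\<chi>\<close> vanishes after inclusion of the row.\<close>
  have well: "\<chi> (?E k \<xi>) = \<chi> (?E k \<zeta>)"
    if k: "k < length K" and h: "\<xi> \<in> hull_hom x [K ! k]" "\<zeta> \<in> hull_hom x [K ! k]" and e: "\<pi> (K ! k) \<xi> = \<pi> (K ! k) \<zeta>" for k \<xi> \<zeta>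
  proof -
    have D: "\<xi> + (- 1) \<cdot>\<^sub>m \<zeta> \<in> hull_hom x [K ! k]" using h by (simp add: hull_hom_add hull_hom_smult)
    have "\<pi> (K ! k) (\<xi> + (- 1) \<cdot>\<^sub>m \<zeta>) = \<zero>\<^bsub>ob M (K ! k)\<^esub>"
      using pi_diff[OF order_refl order_refl h] e by simp
    then obtain \<gamma> where \<gamma>: "\<gamma> \<in> hull_hom y [K ! k]" "\<xi> + (- 1) \<cdot>\<^sub>m \<zeta> = \<gamma> * \<alpha>"
      using pi_zero_iff[OF D] by blast
    have "?E k (\<gamma> * \<alpha>) = ?E k \<gamma> * \<alpha>"
      by (rule put_row_mult[of _ "length y" _ "length x"]) (use hull_hom_carrier[OF \<gamma>(1)] hull_hom_carrier[OF \<alpha>] in auto)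
    then have "\<chi> (?E k (\<xi> + (- 1) \<cdot>\<^sub>m \<zeta>)) = 0"
      using van2[OF put_row_hull[OF \<gamma>(1) k]] \<gamma>(2) by simp
    then show ?thesis
      using lf_add[OF \<chi>E[OF k], of \<xi> "(- 1) \<cdot>\<^sub>m \<zeta>"] lf_smult[OF \<chi>E[OF k], of \<zeta> "- 1"] h
      by (simp add: hull_hom_smult)
  qed
  \<comment> \<open>An arbitrary section of \<pi>, which may fail to be linear; its composite with
    \<open>\<chi>\<close> is linear because of \<open>well\<close>.\<close>
  define \<sigma> where "\<sigma> v m = (SOME \<xi>. \<xi> \<in> hull_hom x [v] \<and> \<pi> v \<xi> = m)" for v m
  have \<sigma>: "\<sigma> v m \<in> hull_hom x [v] \<and> \<pi> v (\<sigma> v m) = m" if "m \<in> carrier (ob M v)" for v m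
    unfolding \<sigma>_def by (rule someI_ex) (use pi_surj[OF that] in blast)
  let ?\<mu> = "\<lambda>k m. \<chi> (?E k (\<sigma> (K ! k) m))"
  have \<mu>\<pi>: "?\<mu> k (\<pi> (K ! k) \<xi>) = \<chi> (?E k \<xi>)" if "k < length K" "\<xi> \<in> hull_hom x [K ! k]" for k \<xi>
    using \<sigma>[OF pi_in[OF that(2)]] well[OF that(1) _ that(2)] by blast
  have \<mu>: "lf (ob M (K ! k)) (?\<mu> k)" if k: "k < length K" for k
    unfolding lf_def
  proof (intro conjI ballI allI)
    fix m m' assume m: "m \<in> carrier (ob M (K ! k))" "m' \<in> carrier (ob M (K ! k))"
    obtain \<xi> \<xi>' where \<xi>: "\<xi> \<in> hull_hom x [K ! k]" "\<pi> (K ! k) \<xi> = m" "\<xi>' \<in> hull_hom x [K ! k]" "\<pi> (K ! k) \<xi>' = m'"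
      using \<sigma>[OF m(1)] \<sigma>[OF m(2)] by blast
    have "m \<oplus>\<^bsub>ob M (K ! k)\<^esub> m' = \<pi> (K ! k) (\<xi> + \<xi>')"
      using linear_map_add[OF pi_linear, of \<xi> "K ! k" \<xi>'] \<xi> by simp
    then show "?\<mu> k (m \<oplus>\<^bsub>ob M (K ! k)\<^esub> m') = ?\<mu> k m + ?\<mu> k m'"
      using \<mu>\<pi>[OF k \<xi>(1)] \<mu>\<pi>[OF k \<xi>(3)] \<mu>\<pi>[OF k hull_hom_add[OF \<xi>(1,3)]] lf_add[OF \<chi>E[OF k], of \<xi> \<xi>'] \<xi> by simp
  next
    fix e m assume m: "m \<in> carrier (ob M (K ! k))"
    obtain \<xi> where \<xi>: "\<xi> \<in> hull_hom x [K ! k]" "\<pi> (K ! k) \<xi> = m" using \<sigma>[OF m] by blast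
    have "e \<odot>\<^bsub>ob M (K ! k)\<^esub> m = \<pi> (K ! k) (e \<cdot>\<^sub>m \<xi>)"
      using linear_map_smult[OF pi_linear, of \<xi> "K ! k" e] \<xi> by simp
    then show "?\<mu> k (e \<odot>\<^bsub>ob M (K ! k)\<^esub> m) = e * ?\<mu> k m"
      using \<mu>\<pi>[OF k \<xi>(1)] \<mu>\<pi>[OF k hull_hom_smult[OF \<xi>(1), of e]] lf_smult[OF \<chi>E[OF k], of \<xi> e] \<xi> by simp
  qed
  have "\<exists>\<phi>. interval_covec I M \<phi> \<and> (\<forall>k<length K. \<forall>v\<in>carrier (ob M (K ! k)). \<phi> (K ! k) v = ?\<mu> k v)"
  proof (rule covec_kernel[where \<mu> = ?\<mu>, OF \<mu>, THEN iffD2], assumption, intro conjI allI impI ballI)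
    fix bb w p q m assume bb: "(bb, w) \<in> set K1" and pq: "p < length K" "q < length K" "K ! p = lo r_sk bb" "K ! q = hi r_sk bb"
      and m: "m \<in> carrier (ob M w)"
    obtain j where j: "j < length K1" "K1 ! j = (bb, w)" using bb by (metis in_set_conv_nth)
    note P = G2_put_rel[OF j pq]
    obtain \<xi> where \<xi>: "\<xi> \<in> hull_hom x [w]" "\<pi> w \<xi> = m" using \<sigma>[OF m] by blast
    then have h: "\<xi> \<in> hull_hom x [K ! p]" "\<xi> \<in> hull_hom x [K ! q]" using P(2,3) hull_row_mono by blast+
    have "\<xi> \<in> hull_hom x [uu ! (length KD + j)]" unfolding P(5) by (rule \<xi>(1))
    from van1[OF put_row_hull[OF this P(4)]]
    have "\<chi> (?E p \<xi>) = \<chi> (?E q \<xi>)"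
      unfolding P(1)
      using lf_add[OF \<chi>, of "?E p \<xi>" "(- 1) \<cdot>\<^sub>m ?E q \<xi>"] lf_smult[OF \<chi>, of "?E q \<xi>" "- 1"]
        put_row_hull[OF h(1) pq(1)] put_row_hull[OF h(2) pq(2)] by (simp add: hull_hom_smult)
    then show "?\<mu> p (act M w (K ! p) 1 m) = ?\<mu> q (act M w (K ! q) 1 m)"
      using \<mu>\<pi>[OF pq(1) h(1)] \<mu>\<pi>[OF pq(2) h(2)] pi_act[OF P(2) \<xi>(1)] pi_act[OF P(3) \<xi>(1)] \<xi>(2) by simp
  next
    fix w p m assume w: "w \<in> set KD" and p: "p < length K" "K ! p = d w" and m: "m \<in> carrier (ob M w)"
    obtain j where j: "j < length KD" "KD ! j = w" using w by (metis in_set_conv_nth)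
    note P = G2_put_out[OF j(1) p(1), unfolded j(2), OF p(2)]
    obtain \<xi> where \<xi>: "\<xi> \<in> hull_hom x [w]" "\<pi> w \<xi> = m" using \<sigma>[OF m] by blast
    then have h: "\<xi> \<in> hull_hom x [K ! p]" using P(2) hull_row_mono by blast
    have "\<xi> \<in> hull_hom x [uu ! j]" unfolding P(4) by (rule \<xi>(1))
    from van1[OF put_row_hull[OF this P(3)]] have "\<chi> (?E p \<xi>) = 0" unfolding P(1) .
    then show "?\<mu> p (act M w (K ! p) 1 m) = 0"
      using \<mu>\<pi>[OF p(1) h] pi_act[OF P(2) \<xi>(1)] \<xi>(2) by simp
  qed
  then obtain \<phi> where \<phi>: "interval_covec I M \<phi>"
    "\<And>k v. k < length K \<Longrightarrow> v \<in> carrier (ob M (K ! k)) \<Longrightarrow> \<phi> (K ! k) v = ?\<mu> k v" by blast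
  have "\<chi> (?E k \<xi>) = \<phi> (K ! k) (\<pi> (K ! k) \<xi>)" if "k < length K" "\<xi> \<in> hull_hom x [K ! k]" for k \<xi>
    using \<phi>(2)[OF that(1) pi_in[OF that(2)]] \<mu>\<pi>[OF that] by simp
  then show ?thesis using \<phi>(1) by blast
qed

text \<open>\<open>rank_difference\<close> with \<open>p\<close> the first component. Lifts
  \<open>zz i\<close> of the morphisms f i give the vectors (0, G3 zz i) of the larger image, and
  \<open>Psi (\<phi> i)\<close> gives the dual functionals. For \<open>gen\<close>, a functional
  that vanishes on the smaller part comes from a covector by \<open>covec_of_functional\<close>, an
  element of the larger part comes from a morphism V_I to M by \<open>G1_kernel\<close>, and the
  factorization of the pairing applies to these two.\<close>

lemma rank_proj_difference:
  assumes n: "pairing_rank I a0 M n"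
  shows "rank_proj S tt uu K x y \<alpha> G1 (P'_trans G3) G2
    = rank_proj S tt uu K x y \<alpha> G1 (zero_map (P'_space K x)) G2 + n"
proof -
  let ?A = "hull_space x tt :: ('k, 'k mat) module" and ?B = "hull_space x K :: ('k, 'k mat) module"
  let ?Vs = "[hull_space x S, hull_space x uu, hull_space y tt, hull_space y K] :: ('k, 'k mat) module list"
  let ?W = "dsum [?A, ?B]"
  let ?T = "\<lambda>T. [[P'_trans G1, zero_map ?A, P'_act \<alpha>, zero_map ?A], [T, P'_trans G2, zero_map ?B, P'_act \<alpha>]]"
  let ?R = "\<lambda>T. block_map [?A, ?B] (?T T) ` carrier (dsum ?Vs)"
  note h = g1_hull[of r_sc c S S1 SU] g2_hull[of r_sk d KD K1 K] g3_hull[of b0 a0 S K]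
  have W: "vspace ?W" by (rule vs_dsum) (use vs_hull_space in auto)
  obtain N where N: "has_dim ?W N"
    using has_dim_dsum[of "[?A, ?B]"] vs_hull_space has_dim_hull_space by fastforce
  obtain N' where N': "has_dim ?A N'" using has_dim_hull_space by blast
  have cW: "carrier ?W = {[\<tau>, \<omega>] |\<tau> \<omega>. \<tau> \<in> hull_hom x tt \<and> \<omega> \<in> hull_hom x K}"
    by (auto simp: dsum_Cons_carrier dsum_Nil)
  have opW: "add ?W [u, v] [u', v'] = [u + u', v + v']" "smult ?W e [u, v] = [e \<cdot>\<^sub>m u, e \<cdot>\<^sub>m v]" for u v u' v' e
    by (simp_all add: dsum_Cons dsum_Nil)
  have cV: "carrier (dsum ?Vs) = {[z, z', \<gamma>, \<delta>] |z z' \<gamma> \<delta>. z \<in> hull_hom x S \<and> z' \<in> hull_hom x uu \<and> \<gamma> \<in> hull_hom y tt \<and> \<delta> \<in> hull_hom y K}"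
    by (auto simp: dsum_Cons_carrier dsum_Nil)
  \<comment> \<open>The summand from \<open>T\<close> is kept apart, so that the two block maps
    differ visibly in one term.\<close>
  have bm: "block_map [?A, ?B] (?T T) [z, z', \<gamma>, \<delta>] = [G1 * z + \<gamma> * \<alpha>, T z + (G2 * z' + \<delta> * \<alpha>)]"
    if "z \<in> hull_hom x S" "z' \<in> hull_hom x uu" "\<gamma> \<in> hull_hom y tt" "\<delta> \<in> hull_hom y K" for T z z' \<gamma> \<delta>
    using hull_hom_carrier[OF hull_hom_mult[OF that(2) h(2)]] hull_hom_carrier[OF hull_hom_mult[OF \<alpha> that(3)]]
      hull_hom_carrier[OF hull_hom_mult[OF \<alpha> that(4)]]
    by (simp add: block_map_def zero_map_def P'_trans_def P'_act_def)
  have lin: "linear_map class_ring (dsum ?Vs) ?W (block_map [?A, ?B] (?T T))"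
    if T: "linear_map class_ring (hull_space x S) ?B T" for T
  proof (rule block_map_linear)
    fix i j assume "i < length [?A, ?B]" "j < length ?Vs"
    then consider "i = 0" "j = 0" | "i = 0" "j = 1" | "i = 0" "j = 2" | "i = 0" "j = 3"
      | "i = 1" "j = 0" | "i = 1" "j = 1" | "i = 1" "j = 2" | "i = 1" "j = 3" by fastforce
    then show "linear_map class_ring (?Vs ! j) ([?A, ?B] ! i) (?T T ! i ! j)"
      by cases (use T in \<open>auto simp: P'_trans_def[abs_def] P'_act_def[abs_def]
          intro!: linear_hull_left h linear_hull_right \<alpha> linear_zero_map vs_hull_space\<close>)
  qed (use vs_hull_space in \<open>auto simp: less_Suc_eq\<close>)
  have T1: "linear_map class_ring (hull_space x S) ?B (P'_trans G3)"
    unfolding P'_trans_def[abs_def] by (rule linear_hull_left[OF h(3)])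
  have T0: "linear_map class_ring (hull_space x S) ?B (zero_map ?B)"
    by (intro linear_zero_map vs_hull_space)
  obtain p where p: "p < length S" "S ! p = a0" by (rule a0_index)
  obtain q where q: "q < length K" "K ! q = b0" by (rule b0_index)
  have G3: "G3 * z = put_row (length K) q (get_row p z)" if "z \<in> hull_hom x S" for z
    by (rule g3_mult[OF dist q p ab0 hull_hom_carrier[OF that]])
  have pr: "linear_map class_ring ?W ?A (\<lambda>w. w ! 0)"
    by (rule linear_mapI[OF W vs_hull_space]) (auto simp: cW opW)
  have R: "v \<in> ?R T \<longleftrightarrow> (\<exists>z\<in>hull_hom x S. \<exists>z'\<in>hull_hom x uu. \<exists>\<gamma>\<in>hull_hom y tt. \<exists>\<delta>\<in>hull_hom y K.
      v = [G1 * z + \<gamma> * \<alpha>, T z + (G2 * z' + \<delta> * \<alpha>)])" for v T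
    unfolding cV using bm by (auto simp: image_iff) (metis bm)+
  have z0: "0\<^sub>m (length S) (length x) \<in> hull_hom x S" "0\<^sub>m (length tt) (length y) \<in> hull_hom y tt"
    "0\<^sub>m (length uu) (length x) \<in> hull_hom x uu" "0\<^sub>m (length K) (length y) \<in> hull_hom y K"
    by (rule hull_hom_zero)+
  obtain f \<phi> where f: "\<And>i. i < n \<Longrightarrow> interval_vec I M (f i)"
    and \<phi>: "\<And>i. i < n \<Longrightarrow> interval_covec I M (\<phi> i)"
    and dual: "\<And>i j. i < n \<Longrightarrow> j < n \<Longrightarrow> \<phi> i a0 (f j a0) = (if i = j then 1 else 0)"
    and gen: "\<And>g \<chi>. interval_vec I M g \<Longrightarrow> interval_covec I M \<chi> \<Longrightarrow>
        \<chi> a0 (g a0) = (\<Sum>i<n. \<chi> a0 (f i a0) * \<phi> i a0 (g a0))"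
    using n unfolding pairing_rank_def by blast
  have dims: "dim_row \<alpha> = length y" "dim_col \<alpha> = length x" using hull_hom_dim[OF \<alpha>] by auto
  have zero_mult: "G1 * 0\<^sub>m (length S) (length x) = 0\<^sub>m (length tt) (length x)"
    "0\<^sub>m (length tt) (length y) * \<alpha> = 0\<^sub>m (length tt) (length x)"
    "G3 * 0\<^sub>m (length S) (length x) = 0\<^sub>m (length K) (length x)"
    "G2 * 0\<^sub>m (length uu) (length x) = 0\<^sub>m (length K) (length x)"
    "0\<^sub>m (length K) (length y) * \<alpha> = 0\<^sub>m (length K) (length x)"
    using G_carrier hull_hom_carrier[OF \<alpha>] by auto
  have cB: "\<omega> \<in> carrier_mat (length K) (length x)" if "\<omega> \<in> hull_hom x K" for \<omega> :: "'k mat"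
    using hull_hom_carrier[OF that] .
  have GB: "G2 * z' + \<delta> * \<alpha> \<in> hull_hom x K" if "z' \<in> hull_hom x uu" "\<delta> \<in> hull_hom y K" for z' \<delta>
    by (intro hull_hom_add hull_hom_mult[OF that(1) h(2)] hull_hom_mult[OF \<alpha> that(2)])
  have G3B: "G3 * z \<in> hull_hom x K" if "z \<in> hull_hom x S" for z by (rule hull_hom_mult[OF that h(3)])
  \<comment> \<open>With first and third source components 0 the block \<open>T\<close> contributes
    nothing, so whatever G2 and \<alpha> produce in the second row lies over 0 in both
    images.\<close>
  have RT0: "[0\<^sub>m (length tt) (length x), G2 * z' + \<delta> * \<alpha>] \<in> ?R T"
    if "T (0\<^sub>m (length S) (length x)) = 0\<^sub>m (length K) (length x)" "z' \<in> hull_hom x uu" "\<delta> \<in> hull_hom y K" for T z' \<delta>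
    unfolding R
    by (intro bexI[OF _ z0(1)] bexI[OF _ that(2)] bexI[OF _ z0(2)] bexI[OF _ that(3)])
       (use that cB[OF GB[OF that(2,3)]] zero_mult in simp)
  \<comment> \<open>The sign is absorbed into \<gamma>: the block matrix adds \<gamma> \<alpha>,
    whereas \<open>G1_kernel\<close> asks for an equality.\<close>
  have neg: "\<exists>\<gamma>'\<in>hull_hom y tt. G1 * z = \<gamma>' * \<alpha>"
    if "z \<in> hull_hom x S" "\<gamma> \<in> hull_hom y tt" "G1 * z + \<gamma> * \<alpha> = 0\<^sub>m (length tt) (length x)" for z \<gamma>
  proof -
    have m: "(- 1) \<cdot>\<^sub>m \<gamma> * \<alpha> = (- 1) \<cdot>\<^sub>m (\<gamma> * \<alpha>)"
      by (rule mult_smult_assoc_mat[OF hull_hom_carrier[OF that(2)] hull_hom_carrier[OF \<alpha>]])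
    have "(- 1) \<cdot>\<^sub>m ((- 1) \<cdot>\<^sub>m (\<gamma> * \<alpha>)) = \<gamma> * \<alpha>" by (rule eq_matI) auto
    then have "G1 * z \<oplus>\<^bsub>?A\<^esub> (- 1) \<odot>\<^bsub>?A\<^esub> (((- 1) \<cdot>\<^sub>m \<gamma>) * \<alpha>) = \<zero>\<^bsub>?A\<^esub>"
      using that(3) m by simp
    then have "G1 * z = ((- 1) \<cdot>\<^sub>m \<gamma>) * \<alpha>"
      using vs_diff_eq_zero[OF vs_hull_space, of "G1 * z" x tt "((- 1) \<cdot>\<^sub>m \<gamma>) * \<alpha>"]
        hull_hom_mult[OF that(1) h(1)] hull_hom_mult[OF \<alpha> hull_hom_smult[OF that(2)]] by simp
    then show ?thesis using hull_hom_smult[OF that(2)] by blast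
  qed
  \<comment> \<open>Each f i is lifted through \<pi> at every minimal element and the rows are
    combined; since f i is a morphism, \<open>G1_kernel\<close> makes G1 of the lift a multiple of
    \<alpha>.\<close>
  have "\<exists>z. z \<in> hull_hom x S \<and> (\<exists>\<gamma>\<in>hull_hom y tt. G1 * z = \<gamma> * \<alpha>) \<and>
      (\<forall>k<length S. f i (S ! k) = \<pi> (S ! k) (get_row k z))" if i: "i < n" for i
  proof -
    have "\<exists>\<xi>. \<xi> \<in> hull_hom x [S ! k] \<and> \<pi> (S ! k) \<xi> = f i (S ! k)" if "k < length S" for k
      using pi_surj[of "f i (S ! k)" "S ! k"] f[OF i] S_nth[OF that] by (auto simp: interval_vec_def sc_def)
    then obtain \<rho> where \<rho>: "\<And>k. k < length S \<Longrightarrow> \<rho> k \<in> hull_hom x [S ! k]"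
      "\<And>k. k < length S \<Longrightarrow> \<pi> (S ! k) (\<rho> k) = f i (S ! k)" by metis
    obtain z where z: "z \<in> hull_hom x S" "\<And>k. k < length S \<Longrightarrow> get_row k z = \<rho> k"
      by (rule hull_rows[of S \<rho> x]) (use \<rho> in auto)
    then have "\<forall>k<length S. f i (S ! k) = \<pi> (S ! k) (get_row k z)" using \<rho> by simp
    then show ?thesis using G1_kernel[OF z(1)] f[OF i] z(1) by blast
  qed
  then obtain zz where zz: "\<And>i. i < n \<Longrightarrow> zz i \<in> hull_hom x S"
    "\<And>i. i < n \<Longrightarrow> \<exists>\<gamma>\<in>hull_hom y tt. G1 * zz i = \<gamma> * \<alpha>"
    "\<And>i k. i < n \<Longrightarrow> k < length S \<Longrightarrow> f i (S ! k) = \<pi> (S ! k) (get_row k (zz i))" by metis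
  \<comment> \<open>Here a0 \<le> b0 does its work: the row at \<open>a0\<close> is read as an
    element at \<open>b0\<close>, and by naturality of the covector its value there equals the value
    at \<open>a0\<close>.\<close>
  have G3_value: "\<chi> (G3 * z) = \<theta> a0 (g a0)"
    if z: "z \<in> hull_hom x S" and g: "\<forall>k<length S. g (S ! k) = \<pi> (S ! k) (get_row k z)"
      and \<theta>: "interval_covec I M \<theta>"
      and \<chi>: "\<And>\<xi>. \<xi> \<in> hull_hom x [b0] \<Longrightarrow> \<chi> (put_row (length K) q \<xi>) = \<theta> b0 (\<pi> b0 \<xi>)" for \<chi> :: "'k mat \<Rightarrow> 'k" and z g \<theta>
  proof -
    have r: "get_row p z \<in> hull_hom x [a0]" using get_row_hull[OF z p(1)] p(2) by simp
    have "\<chi> (G3 * z) = \<theta> b0 (act M a0 b0 1 (\<pi> a0 (get_row p z)))"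
      unfolding G3[OF z] using \<chi>[OF hull_row_mono[OF r ab0]] pi_act[OF ab0 r] by simp
    also have "\<dots> = \<theta> a0 (\<pi> a0 (get_row p z))"
      using \<theta> pi_in[OF r] a0 b0 ab0 unfolding interval_covec_def sc_def sk_def by simp
    also have "\<pi> a0 (get_row p z) = g a0" using g p by auto
    finally show ?thesis .
  qed
  have Psi_G3: "Psi \<theta> (G3 * z + (G2 * z' + \<delta> * \<alpha>)) = \<theta> a0 (g a0)"
    if z: "z \<in> hull_hom x S" and g: "\<forall>k<length S. g (S ! k) = \<pi> (S ! k) (get_row k z)"
      and \<theta>: "interval_covec I M \<theta>" and z': "z' \<in> hull_hom x uu" "\<delta> \<in> hull_hom y K" for z g \<theta> z' \<delta>
  proof -
    have "Psi \<theta> (G3 * z) = \<theta> a0 (g a0)"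
      by (rule G3_value[OF z g \<theta>]) (use Psi_put_row[OF \<theta> q(1)] q(2) in simp)
    then show ?thesis
      using lf_add[OF Psi_lf[OF \<theta>], of "G3 * z" "G2 * z' + \<delta> * \<alpha>"] G3B[OF z] GB[OF z'] Psi_vanishes[OF \<theta> z'] by simp
  qed
  have A0: "\<zero>\<^bsub>?A\<^esub> = 0\<^sub>m (length tt) (length x)" by simp
  have zm: "zero_map ?B (z :: 'k mat) = 0\<^sub>m (length K) (length x)" for z by (simp add: zero_map_def)
  let ?k = "\<lambda>i. [0\<^sub>m (length tt) (length x), G3 * zz i]"
  let ?\<psi> = "\<lambda>i w. Psi (\<phi> i) (w ! 1)"
  have fr: "\<forall>k<length S. f i (S ! k) = \<pi> (S ! k) (get_row k (zz i))" if "i < n" for i using zz(3)[OF that] by blast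
  have "vectorspace.dim class_ring (?W\<lparr>carrier := ?R (P'_trans G3)\<rparr>) =
      vectorspace.dim class_ring (?W\<lparr>carrier := ?R (zero_map ?B)\<rparr>) + n"
  proof (rule rank_difference[OF W N N' pr sub_image[OF lin[OF T0]] sub_image[OF lin[OF T1]], where k = ?k and \<psi> = ?\<psi>])
    \<comment> \<open>The block \<open>T\<close> acts in the second row only, hence the first
      components do not depend on it.\<close>
    have img: "(\<lambda>w. w ! 0) ` ?R T = {G1 * z + \<gamma> * \<alpha> |z \<gamma>. z \<in> hull_hom x S \<and> \<gamma> \<in> hull_hom y tt}" for T
    proof (intro equalityI subsetI)
      fix v assume "v \<in> (\<lambda>w. w ! 0) ` ?R T"
      then obtain w where w: "w \<in> ?R T" "v = w ! 0" by blast
      from w(1) obtain z z' \<gamma> \<delta> where "z \<in> hull_hom x S" "\<gamma> \<in> hull_hom y tt"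
        "w = [G1 * z + \<gamma> * \<alpha>, T z + (G2 * z' + \<delta> * \<alpha>)]"
        unfolding R by blast
      then show "v \<in> {G1 * z + \<gamma> * \<alpha> |z \<gamma>. z \<in> hull_hom x S \<and> \<gamma> \<in> hull_hom y tt}"
        using w(2) by (intro CollectI exI[of _ z] exI[of _ \<gamma>]) simp
    next
      fix v assume "v \<in> {G1 * z + \<gamma> * \<alpha> |z \<gamma>. z \<in> hull_hom x S \<and> \<gamma> \<in> hull_hom y tt}"
      then obtain z \<gamma> where z: "z \<in> hull_hom x S" "\<gamma> \<in> hull_hom y tt" "v = G1 * z + \<gamma> * \<alpha>" by blast
      have "[v, T z + (G2 * 0\<^sub>m (length uu) (length x) + 0\<^sub>m (length K) (length y) * \<alpha>)] \<in> ?R T"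
        unfolding R z(3) using z(1,2) z0(3,4) by blast
      then show "v \<in> (\<lambda>w. w ! 0) ` ?R T" by (rule image_eqI[rotated]) simp
    qed
    show "(\<lambda>w. w ! 0) ` ?R (zero_map ?B) = (\<lambda>w. w ! 0) ` ?R (P'_trans G3)" unfolding img ..
  next
    fix v assume v: "v \<in> ?R (zero_map ?B)" "v ! 0 = \<zero>\<^bsub>?A\<^esub>"
    then obtain z z' \<gamma> \<delta> where z: "z' \<in> hull_hom x uu" "\<delta> \<in> hull_hom y K"
      "v = [G1 * z + \<gamma> * \<alpha>, 0\<^sub>m (length K) (length x) + (G2 * z' + \<delta> * \<alpha>)]"
      unfolding R zm by blast
    then have "v = [0\<^sub>m (length tt) (length x), G2 * z' + \<delta> * \<alpha>]"
      using v(2) cB[OF GB[OF z(1,2)]] by simp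
    then show "v \<in> ?R (P'_trans G3)" using RT0[OF _ z(1,2)] zero_mult by (simp add: P'_trans_def)
  next
    fix i assume i: "i < n"
    obtain \<gamma> where \<gamma>: "\<gamma> \<in> hull_hom y tt" "G1 * zz i = \<gamma> * \<alpha>" using zz(2)[OF i] by blast
    have m: "(- 1) \<cdot>\<^sub>m \<gamma> * \<alpha> = (- 1) \<cdot>\<^sub>m (\<gamma> * \<alpha>)"
      by (rule mult_smult_assoc_mat[OF hull_hom_carrier[OF \<gamma>(1)] hull_hom_carrier[OF \<alpha>]])
    \<comment> \<open>Minus \<gamma> as third source component cancels the first row.\<close>
    have "G1 * zz i + (- 1) \<cdot>\<^sub>m \<gamma> * \<alpha> = 0\<^sub>m (length tt) (length x)"
      using vs_diff_eq_zero[OF vs_hull_space, of "\<gamma> * \<alpha>" x tt "\<gamma> * \<alpha>"] hull_hom_mult[OF \<alpha> \<gamma>(1)] \<gamma>(2) m by simp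
    moreover have "G3 * zz i + (G2 * 0\<^sub>m (length uu) (length x) + 0\<^sub>m (length K) (length y) * \<alpha>) = G3 * zz i"
      using cB[OF G3B[OF zz(1)[OF i]]] zero_mult by simp
    ultimately have "?k i = [G1 * zz i + (- 1) \<cdot>\<^sub>m \<gamma> * \<alpha>,
        P'_trans G3 (zz i) + (G2 * 0\<^sub>m (length uu) (length x) + 0\<^sub>m (length K) (length y) * \<alpha>)]"
      by (simp add: P'_trans_def)
    then have "?k i \<in> ?R (P'_trans G3)"
      unfolding R using zz(1)[OF i] z0(3,4) hull_hom_smult[OF \<gamma>(1)] by blast
    then show "?k i \<in> ?R (P'_trans G3) \<and> ?k i ! 0 = \<zero>\<^bsub>?A\<^esub>" by simp
    show "lf ?W (?\<psi> i) \<and> (\<forall>v\<in>?R (zero_map ?B). v ! 0 = \<zero>\<^bsub>?A\<^esub> \<longrightarrow> ?\<psi> i v = 0)"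
    proof (intro conjI ballI impI)
      show "lf ?W (?\<psi> i)"
        using lf_add[OF Psi_lf[OF \<phi>[OF i]]] lf_smult[OF Psi_lf[OF \<phi>[OF i]]] by (auto simp: lf_def cW opW)
      fix v assume "v \<in> ?R (zero_map ?B)"
      then obtain z z' \<gamma> \<delta> where z: "z' \<in> hull_hom x uu" "\<delta> \<in> hull_hom y K"
        "v = [G1 * z + \<gamma> * \<alpha>, 0\<^sub>m (length K) (length x) + (G2 * z' + \<delta> * \<alpha>)]"
        unfolding R zm by blast
      then show "?\<psi> i v = 0" using Psi_vanishes[OF \<phi>[OF i] z(1,2)] cB[OF GB[OF z(1,2)]] by simp
    qed
    fix j assume j: "j < n"
    have "?\<psi> i (?k j) = Psi (\<phi> i) (G3 * zz j + (G2 * 0\<^sub>m (length uu) (length x) + 0\<^sub>m (length K) (length y) * \<alpha>))"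
      using cB[OF G3B[OF zz(1)[OF j]]] zero_mult by simp
    then show "?\<psi> i (?k j) = (if i = j then 1 else 0)"
      using Psi_G3[OF zz(1)[OF j] fr[OF j] \<phi>[OF i] z0(3,4)] dual[OF i j] by simp
  next
    fix \<chi> v assume \<chi>: "lf ?W \<chi>" and van: "\<And>u. u \<in> ?R (zero_map ?B) \<Longrightarrow> u ! 0 = \<zero>\<^bsub>?A\<^esub> \<Longrightarrow> \<chi> u = 0"
      and v: "v \<in> ?R (P'_trans G3)" "v ! 0 = \<zero>\<^bsub>?A\<^esub>"
    \<comment> \<open>Over 0 a functional sees only the second component; there it vanishes on the
      images of G2 and \<alpha>, as these lie in the smaller image by \<open>RT0\<close>.\<close>
    let ?\<chi> = "\<lambda>\<omega>. \<chi> [0\<^sub>m (length tt) (length x), \<omega>]"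
    have \<chi>': "lf (hull_space x K) ?\<chi>"
    proof -
      have zt: "0\<^sub>m (length tt) (length x) \<in> hull_hom x tt" by (rule hull_hom_zero)
      have "?\<chi> (u + u') = ?\<chi> u + ?\<chi> u'" if "u \<in> hull_hom x K" "u' \<in> hull_hom x K" for u u'
        using lf_add[OF \<chi>, of "[0\<^sub>m (length tt) (length x), u]" "[0\<^sub>m (length tt) (length x), u']"] that zt
        by (simp add: cW opW)
      moreover have "?\<chi> (e \<cdot>\<^sub>m u) = e * ?\<chi> u" if "u \<in> hull_hom x K" for u e
        using lf_smult[OF \<chi>, of "[0\<^sub>m (length tt) (length x), u]" e] that zt by (simp add: cW opW)
      ultimately show ?thesis by (simp add: lf_def)
    qed
    have van': "?\<chi> (G2 * z' + \<delta> * \<alpha>) = 0" if "z' \<in> hull_hom x uu" "\<delta> \<in> hull_hom y K" for z' \<delta>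
      by (rule van[OF RT0[OF zm that]]) simp
    obtain \<theta> where \<theta>: "interval_covec I M \<theta>"
      "\<And>k \<xi>. k < length K \<Longrightarrow> \<xi> \<in> hull_hom x [K ! k] \<Longrightarrow> ?\<chi> (put_row (length K) k \<xi>) = \<theta> (K ! k) (\<pi> (K ! k) \<xi>)"
      using covec_of_functional[OF \<chi>' van'] by blast
    have val: "?\<chi> (G3 * z) = \<theta> a0 (g a0)"
      if "z \<in> hull_hom x S" "\<forall>k<length S. g (S ! k) = \<pi> (S ! k) (get_row k z)" for z g
      by (rule G3_value[OF that \<theta>(1)]) (use \<theta>(2)[OF q(1)] q(2) in simp)
    obtain z z' \<gamma> \<delta> where z: "z \<in> hull_hom x S" "z' \<in> hull_hom x uu" "\<gamma> \<in> hull_hom y tt" "\<delta> \<in> hull_hom y K"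
      "v = [G1 * z + \<gamma> * \<alpha>, G3 * z + (G2 * z' + \<delta> * \<alpha>)]"
      using v(1) unfolding R P'_trans_def by blast
    have e0: "G1 * z + \<gamma> * \<alpha> = 0\<^sub>m (length tt) (length x)" using v(2) z(5) by simp
    obtain g where g: "interval_vec I M g" "\<forall>k<length S. g (S ! k) = \<pi> (S ! k) (get_row k z)"
      using neg[OF z(1,3) e0] G1_kernel[OF z(1)] by blast
    have "\<chi> v = ?\<chi> (G3 * z)"
      using lf_add[OF \<chi>', of "G3 * z" "G2 * z' + \<delta> * \<alpha>"] G3B[OF z(1)] GB[OF z(2,4)] van'[OF z(2,4)] z(5) e0 by simp
    also have "\<dots> = \<theta> a0 (g a0)" by (rule val[OF z(1) g(2)])
    also have "\<dots> = (\<Sum>i<n. \<theta> a0 (f i a0) * \<phi> i a0 (g a0))" by (rule gen[OF g(1) \<theta>(1)])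
    also have "\<dots> = (\<Sum>i<n. \<chi> (?k i) * ?\<psi> i v)"
    proof (rule sum.cong)
      fix i assume "i \<in> {..<n}"
      then have i: "i < n" by simp
      show "\<theta> a0 (f i a0) * \<phi> i a0 (g a0) = \<chi> (?k i) * ?\<psi> i v"
        using val[OF zz(1)[OF i] fr[OF i]] Psi_G3[OF z(1) g(2) \<phi>[OF i] z(2,4)] z(5) by simp
    qed simp
    finally show "\<chi> v = (\<Sum>i<n. \<chi> (?k i) * ?\<psi> i v)" .
  qed
  then show ?thesis
    by (simp only: rank_proj_def block_rank_def lin_rank_def Let_def P'_space_def)
qed

end

section \<open>Injective copresentations\<close>

text \<open>Induction on n: on the kernel of the last functional the others suffice, and the
  remaining coefficient corrects the difference along a vector where the last functional is
  1.\<close>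

lemma functional_combination:
  fixes V :: "('k::field, 'v) module"
  assumes "vspace V" "\<And>i. i < (n::nat) \<Longrightarrow> lf V (e i)" "lf V \<theta>"
    and "\<And>v. v \<in> carrier V \<Longrightarrow> (\<And>i. i < n \<Longrightarrow> e i v = 0) \<Longrightarrow> \<theta> v = 0"
  shows "\<exists>c. \<forall>v\<in>carrier V. \<theta> v = (\<Sum>i<n. c i * e i v)"
  using assms
proof (induction n arbitrary: V \<theta>)
  case 0
  then show ?case by simp
next
  case (Suc n)
  note V = Suc.prems(1)
  let ?V = "V\<lparr>carrier := {v \<in> carrier V. e n v = 0}\<rparr>"
  have en: "lf V (e n)" using Suc.prems(2) by simp
  have s: "sub {v \<in> carrier V. e n v = 0} V" by (rule sub_ker[OF V sub_self[OF V] en])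
  have "\<exists>c. \<forall>v\<in>carrier ?V. \<theta> v = (\<Sum>i<n. c i * e i v)"
  proof (rule Suc.IH[OF vs_sub[OF V s]])
    show "lf ?V (e i)" if "i < n" for i using Suc.prems(2)[of i] that lf_sub[OF _ s] by simp
    show "lf ?V \<theta>" by (rule lf_sub[OF Suc.prems(3) s])
    show "\<theta> v = 0" if "v \<in> carrier ?V" "\<And>i. i < n \<Longrightarrow> e i v = 0" for v
      using Suc.prems(4)[of v] that by (auto simp: less_Suc_eq)
  qed
  then obtain c where c: "\<And>v. v \<in> carrier V \<Longrightarrow> e n v = 0 \<Longrightarrow> \<theta> v = (\<Sum>i<n. c i * e i v)" by auto
  let ?\<theta> = "\<lambda>v. \<Sum>i<n. c i * e i v"
  have l: "lf V ?\<theta>" by (intro lf_sum lf_scale) (use Suc.prems(2) in simp)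
  show ?case
  proof (cases "\<forall>v\<in>carrier V. e n v = 0")
    case True
    then show ?thesis using c by (intro exI[of _ "\<lambda>i. if i < n then c i else 0"]) simp
  next
    case False
    then obtain u where u: "u \<in> carrier V" "e n u \<noteq> 0" by auto
    let ?r = "(1 / e n u) \<odot>\<^bsub>V\<^esub> u"
    have r: "?r \<in> carrier V" "e n ?r = 1" using u by (auto simp: vs_smult[OF V] lf_smult[OF en])
    \<comment> \<open>The last coefficient is the error of the shorter combination at
      \<open>?r\<close>. Both sides agree on the projection to the kernel of \<open>e n\<close>, and
      this error accounts for the rest.\<close>
    let ?c = "\<lambda>i. if i < n then c i else \<theta> ?r - ?\<theta> ?r"
    have "\<theta> v = (\<Sum>i<Suc n. ?c i * e i v)" if v: "v \<in> carrier V" for v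
    proof -
      have "proj V (e n) ?r v \<in> carrier V" "e n (proj V (e n) ?r v) = 0"
        using proj_in[OF V r(1) v] proj_lf[OF V r(1) en v] r(2) by simp_all
      then have "\<theta> (proj V (e n) ?r v) = ?\<theta> (proj V (e n) ?r v)" by (rule c)
      then have "\<theta> v - e n v * \<theta> ?r = ?\<theta> v - e n v * ?\<theta> ?r"
        unfolding proj_lf[OF V r(1) Suc.prems(3) v] proj_lf[OF V r(1) l v] .
      then show ?thesis by (simp add: algebra_simps)
    qed
    then show ?thesis by (intro exI[of _ ?c]) blast
  qed
qed

section \<open>Vectors of M as functionals, through an injective copresentation\<close>

locale injective_setting =
  interval_setting I M r_sc r_sk c d a0 b0 S SU K KD S1 K1
  for I :: "'p::{finite, order} set" and M :: "('p, 'k::field, 'v) rep" and r_sc r_sk c d a0 b0 S SU K KD S1 K1 +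
  fixes x y :: "'p list" and \<alpha> :: "'k mat" and \<iota> :: "'p \<Rightarrow> 'v \<Rightarrow> 'k mat \<Rightarrow> 'k"
  assumes \<alpha>: "\<alpha> \<in> hull_hom y x" and \<iota>: "rep_hom M (Q_rep x) \<iota>"
    and inj: "\<And>v. inj_on (\<iota> v) (carrier (ob M v))"
    and image: "\<And>v. \<iota> v ` carrier (ob M v)
      = {\<phi> \<in> carrier (ob (Q_rep x) v). Q_trans y \<alpha> v \<phi> = \<zero>\<^bsub>ob (Q_rep y) v\<^esub>}"
begin

lemma Q_ob: "ob (Q_rep u) v = dual_space (hull_space [v] u :: ('k, 'k mat) module)"
  by (simp add: Q_rep_def dual_rep_def P'_rep_def P'_space_def)

lemma dual_lf:
  fixes V :: "('k, 'w) module"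
  assumes V: "vspace V"
  shows "\<phi> \<in> carrier (dual_space V) \<longleftrightarrow> \<phi> \<in> extensional (carrier V) \<and> lf V \<phi>"
proof -
  have vl: "vspace (line True :: ('k, 'k) module)"
    by (rule vsI) (auto simp: line_def algebra_simps)
  have "linear_map class_ring V (line True) \<phi> \<longleftrightarrow> lf V \<phi>"
  proof
    assume "linear_map class_ring V (line True) \<phi>"
    from linear_mapD(4,5)[OF this] show "lf V \<phi>" by (simp add: lf_def line_def)
  next
    assume "lf V \<phi>"
    then show "linear_map class_ring V (line True) \<phi>"
      by (intro linear_mapI[OF V vl]) (simp_all add: lf_def line_def)
  qed
  then show ?thesis by (simp add: dual_space_def)
qed

lemma iota_mem: "m \<in> carrier (ob M v) \<Longrightarrow> \<iota> v m \<in> carrier (dual_space (hull_space [v] x))"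
  using rep_hom_in[OF \<iota>, of m v] unfolding Q_ob .

lemma iota_lf: "m \<in> carrier (ob M v) \<Longrightarrow> lf (hull_space [v] x) (\<iota> v m)"
  using iota_mem[of m v] dual_lf[OF vs_hull_space] by blast

lemma iota_at_lf:
  assumes \<beta>: "\<beta> \<in> hull_hom [v] x" shows "lf (ob M v) (\<lambda>m. \<iota> v m \<beta>)"
  using linear_map_add[OF rep_hom_linear[OF \<iota>, of v]] linear_map_smult[OF rep_hom_linear[OF \<iota>, of v]] \<beta>
  unfolding lf_def Q_ob by (simp add: dual_space_def)

lemma iota_inj:
  assumes "m \<in> carrier (ob M v)" "m' \<in> carrier (ob M v)" "\<And>\<beta>. \<beta> \<in> hull_hom [v] x \<Longrightarrow> \<iota> v m \<beta> = \<iota> v m' \<beta>"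
  shows "m = m'"
proof (rule inj_onD[OF inj _ assms(1,2)])
  have "\<iota> v m \<in> extensional (hull_hom [v] x)" "\<iota> v m' \<in> extensional (hull_hom [v] x)"
    using iota_mem[OF assms(1)] iota_mem[OF assms(2)] dual_lf[OF vs_hull_space] by auto
  then show "\<iota> v m = \<iota> v m'" using assms(3) by (rule extensionalityI)
qed

lemma Q_trans_zero:
  "Q_trans y \<alpha> v \<phi> = \<zero>\<^bsub>ob (Q_rep y) v\<^esub> \<longleftrightarrow> (\<forall>\<gamma>\<in>hull_hom [v] y. \<phi> (\<alpha> * \<gamma>) = 0)"
  by (auto simp: Q_trans_def dual_map_def P'_rep_def P'_space_def P'_trans_def Q_ob dual_space_def
      fun_eq_iff restrict_def)

lemma iota_kills: "m \<in> carrier (ob M v) \<Longrightarrow> \<gamma> \<in> hull_hom [v] y \<Longrightarrow> \<iota> v m (\<alpha> * \<gamma>) = 0"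
  using image[of v] Q_trans_zero[of v "\<iota> v m"] by blast

text \<open>Exactness at Q(x): the kernel of Q(\<alpha>) consists of the functionals that vanish on
  multiples of \<alpha>, and M is this kernel. Since \<open>dual_space\<close> contains extensional
  functions only, \<open>\<chi>\<close> is restricted first.\<close>

lemma iota_surj:
  assumes \<chi>: "lf (hull_space [v] x) \<chi>" and van: "\<And>\<gamma>. \<gamma> \<in> hull_hom [v] y \<Longrightarrow> \<chi> (\<alpha> * \<gamma>) = 0"
  shows "\<exists>m\<in>carrier (ob M v). \<forall>\<beta>\<in>hull_hom [v] x. \<iota> v m \<beta> = \<chi> \<beta>"
proof -
  let ?\<chi> = "restrict \<chi> (hull_hom [v] x)"
  have "lf (hull_space [v] x) ?\<chi>"
    using \<chi> by (simp add: lf_def hull_hom_add hull_hom_smult)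
  then have "?\<chi> \<in> carrier (ob (Q_rep x) v)"
    unfolding Q_ob dual_lf[OF vs_hull_space] by simp
  moreover have "Q_trans y \<alpha> v ?\<chi> = \<zero>\<^bsub>ob (Q_rep y) v\<^esub>"
    unfolding Q_trans_zero using van hull_hom_mult[OF _ \<alpha>] by simp
  ultimately have "?\<chi> \<in> \<iota> v ` carrier (ob M v)" unfolding image by blast
  then obtain m where "m \<in> carrier (ob M v)" "\<iota> v m = ?\<chi>" by auto
  then show ?thesis by (intro bexI[of _ m]) auto
qed

text \<open>The action on Q(x) is dual to precomposition with a generator, which leaves the matrix
  unchanged.\<close>

lemma iota_act:
  assumes vw: "v \<le> w" and m: "m \<in> carrier (ob M v)" and \<beta>: "\<beta> \<in> hull_hom [w] x"
  shows "\<iota> w (act M v w 1 m) \<beta> = \<iota> v m \<beta>"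
proof -
  have "\<beta> * single 1 = \<beta>"
    using hull_hom_carrier[OF \<beta>] by (intro eq_matI) (auto simp: single_def scalar_prod_def)
  then show ?thesis
    using rep_hom_act[OF \<iota> vw m, of 1] \<beta>
    by (simp add: Q_rep_def dual_rep_def dual_map_def P'_rep_def P'_space_def P'_act_def)
qed

lemma iota_diff:
  assumes m: "m \<in> carrier (ob M v)" and h: "\<xi> \<in> hull_hom [v] x" "\<zeta> \<in> hull_hom [v] x"
  shows "\<iota> v m (\<xi> + (- 1) \<cdot>\<^sub>m \<zeta>) = \<iota> v m \<xi> - \<iota> v m \<zeta>"
  using lf_add[OF iota_lf[OF m], of \<xi> "(- 1) \<cdot>\<^sub>m \<zeta>"] lf_smult[OF iota_lf[OF m], of \<zeta> "- 1"] h
  by (simp add: hull_hom_smult)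

text \<open>M is the annihilator of the image of \<alpha> at v, and in finite dimension the double
  annihilator of a subspace is the subspace: a functional separating \<xi> from the image would come
  from M.\<close>

lemma iota_separates:
  assumes \<xi>: "\<xi> \<in> hull_hom [v] x"
  shows "(\<exists>\<gamma>\<in>hull_hom [v] y. \<xi> = \<alpha> * \<gamma>) \<longleftrightarrow> (\<forall>m\<in>carrier (ob M v). \<iota> v m \<xi> = 0)"
proof
  show "\<forall>m\<in>carrier (ob M v). \<iota> v m \<xi> = 0" if "\<exists>\<gamma>\<in>hull_hom [v] y. \<xi> = \<alpha> * \<gamma>"
    using that iota_kills by blast
  assume 0: "\<forall>m\<in>carrier (ob M v). \<iota> v m \<xi> = 0"
  show "\<exists>\<gamma>\<in>hull_hom [v] y. \<xi> = \<alpha> * \<gamma>"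
  proof (rule ccontr)
    let ?U = "(\<lambda>\<gamma>. \<alpha> * \<gamma>) ` hull_hom [v] y"
    assume "\<not> (\<exists>\<gamma>\<in>hull_hom [v] y. \<xi> = \<alpha> * \<gamma>)"
    then have "\<xi> \<notin> ?U" by blast
    moreover have "sub ?U (hull_space [v] x)"
      using sub_image[OF linear_hull_left[OF \<alpha>, of "[v]"]] by simp
    moreover obtain n where "has_dim (hull_space [v] x :: ('k, 'k mat) module) n"
      using has_dim_hull_space by blast
    ultimately obtain \<chi> where \<chi>: "lf (hull_space [v] x) \<chi>" "\<forall>u\<in>?U. \<chi> u = 0" "\<chi> \<xi> = 1"
      using separation[OF vs_hull_space, of "[v]" x n ?U \<xi>] \<xi> by auto
    then obtain m where m: "m \<in> carrier (ob M v)" "\<forall>\<beta>\<in>hull_hom [v] x. \<iota> v m \<beta> = \<chi> \<beta>"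
      using iota_surj[OF \<chi>(1)] by blast
    have "\<iota> v m \<xi> = \<chi> \<xi>" by (rule bspec[OF m(2) \<xi>])
    moreover have "\<iota> v m \<xi> = 0" by (rule bspec[OF 0 m(1)])
    ultimately show False using \<chi>(3) by simp
  qed
qed

text \<open>Evaluations at the vectors of a frame of P'(x)(v) have zero common kernel on M because
  \<iota> is injective, so they generate all functionals on M, and a combination of evaluations is
  again an evaluation. This takes the place of lifting along \<pi> in the projective case.\<close>

lemma iota_reflexive:
  assumes \<theta>: "lf (ob M v) \<theta>"
  shows "\<exists>\<beta>\<in>hull_hom [v] x. \<forall>m\<in>carrier (ob M v). \<theta> m = \<iota> v m \<beta>"
proof -
  let ?H = "hull_space [v] x :: ('k, 'k mat) module"
  obtain n b \<beta> where f: "frame ?H n b \<beta>"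
    using has_dim_hull_space[of "[v]" x] unfolding has_dim_def by blast
  have b: "b i \<in> hull_hom [v] x" if "i < n" for i using f that by (auto simp: frame_def)
  have "\<exists>c. \<forall>m\<in>carrier (ob M v). \<theta> m = (\<Sum>i<n. c i * \<iota> v m (b i))"
  proof (rule functional_combination[OF A_module_vs[OF M] iota_at_lf[OF b] \<theta>])
    fix m assume m: "m \<in> carrier (ob M v)" and 0: "\<And>i. i < n \<Longrightarrow> \<iota> v m (b i) = 0"
    have "m = \<zero>\<^bsub>ob M v\<^esub>"
    proof (rule iota_inj[OF m vs_zero[OF A_module_vs[OF M]]])
      fix \<xi> :: "'k mat" assume \<xi>: "\<xi> \<in> hull_hom [v] x"
      have "\<iota> v m \<xi> = \<iota> v m (lc ?H b (\<lambda>i. \<beta> i \<xi>) n)"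
        using frame_expand[OF vs_hull_space f, of \<xi>] \<xi> by simp
      also have "\<dots> = (\<Sum>i<n. \<beta> i \<xi> * \<iota> v m (b i))"
        by (rule lc_lf[OF vs_hull_space iota_lf[OF m]]) (use b in simp)
      also have "\<dots> = 0" using 0 by simp
      finally show "\<iota> v m \<xi> = \<iota> v \<zero>\<^bsub>ob M v\<^esub> \<xi>"
        using lf_zero[OF A_module_vs[OF M] iota_at_lf[OF \<xi>]] by simp
    qed
    then show "\<theta> m = 0" using lf_zero[OF A_module_vs[OF M] \<theta>] by simp
  qed
  then obtain c where c: "\<And>m. m \<in> carrier (ob M v) \<Longrightarrow> \<theta> m = (\<Sum>i<n. c i * \<iota> v m (b i))" by blast
  have "lc ?H b c n \<in> hull_hom [v] x"
    using lc_in[OF vs_hull_space, of n b "[v]" x c] b by simp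
  moreover have "\<theta> m = \<iota> v m (lc ?H b c n)" if m: "m \<in> carrier (ob M v)" for m
    unfolding c[OF m] by (rule lc_lf[OF vs_hull_space iota_lf[OF m], symmetric]) (use b in simp)
  ultimately show ?thesis by blast
qed

text \<open>\<open>row_kernel\<close> for columns, with \<open>iota_separates\<close> in the role of
  exactness.\<close>

lemma col_kernel:
  assumes "z \<in> hull_hom s x"
  shows "(\<exists>\<gamma>\<in>hull_hom s y. z = \<alpha> * \<gamma>) \<longleftrightarrow>
    (\<forall>k<length s. \<forall>m\<in>carrier (ob M (s ! k)). \<iota> (s ! k) m (get_col k z) = 0)"
proof
  assume "\<exists>\<gamma>\<in>hull_hom s y. z = \<alpha> * \<gamma>"
  then obtain \<gamma> where \<gamma>: "\<gamma> \<in> hull_hom s y" "z = \<alpha> * \<gamma>" by blast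
  show "\<forall>k<length s. \<forall>m\<in>carrier (ob M (s ! k)). \<iota> (s ! k) m (get_col k z) = 0"
  proof (intro allI impI)
    fix k assume k: "k < length s"
    have "get_col k z = \<alpha> * get_col k \<gamma>"
      unfolding \<gamma>(2) by (rule get_col_mult[OF hull_hom_carrier[OF \<gamma>(1)] hull_hom_carrier[OF \<alpha>] k])
    then show "\<forall>m\<in>carrier (ob M (s ! k)). \<iota> (s ! k) m (get_col k z) = 0"
      using iota_separates[OF get_col_hull[OF assms k]] get_col_hull[OF \<gamma>(1) k] by blast
  qed
next
  assume 0: "\<forall>k<length s. \<forall>m\<in>carrier (ob M (s ! k)). \<iota> (s ! k) m (get_col k z) = 0"
  have "\<forall>k<length s. \<exists>\<gamma>. \<gamma> \<in> hull_hom [s ! k] y \<and> get_col k z = \<alpha> * \<gamma>"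
    using 0 iota_separates[OF get_col_hull[OF assms]] by blast
  then obtain \<rho> where \<rho>: "\<And>k. k < length s \<Longrightarrow> \<rho> k \<in> hull_hom [s ! k] y"
    "\<And>k. k < length s \<Longrightarrow> get_col k z = \<alpha> * \<rho> k" by metis
  obtain \<gamma> where \<gamma>: "\<gamma> \<in> hull_hom s y" "\<And>k. k < length s \<Longrightarrow> get_col k \<gamma> = \<rho> k"
    by (rule hull_cols[of s \<rho> y]) (use \<rho> in auto)
  have "z = \<alpha> * \<gamma>"
  proof (rule eq_colI[OF hull_hom_carrier[OF assms] hull_hom_carrier[OF hull_hom_mult[OF \<gamma>(1) \<alpha>]]])
    fix k assume k: "k < length s"
    show "get_col k z = get_col k (\<alpha> * \<gamma>)"
      using get_col_mult[OF hull_hom_carrier[OF \<gamma>(1)] hull_hom_carrier[OF \<alpha>] k] \<rho>(2)[OF k] \<gamma>(2)[OF k] by simp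
  qed
  then show "\<exists>\<gamma>\<in>hull_hom s y. z = \<alpha> * \<gamma>" using \<gamma>(1) by blast
qed

text \<open>The columns of a morphism from K to x represent functionals on M, and multiplication by
  G2 on the right forms their differences along the relations. Covectors thus play the part that
  vectors have in \<open>G1_kernel\<close>.\<close>

lemma G2_kernel:
  assumes z: "z \<in> hull_hom K x"
  shows "(\<exists>\<gamma>\<in>hull_hom uu y. z * G2 = \<alpha> * \<gamma>) \<longleftrightarrow>
    (\<exists>\<phi>. interval_covec I M \<phi> \<and> (\<forall>k<length K. \<forall>m\<in>carrier (ob M (K ! k)). \<phi> (K ! k) m = \<iota> (K ! k) m (get_col k z)))"
proof -
  let ?\<mu> = "\<lambda>k m. \<iota> (K ! k) m (get_col k z)"
  note col = get_col_hull[OF z] and zc = hull_hom_carrier[OF z]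
  let ?Z = "\<lambda>j. \<forall>m\<in>carrier (ob M (uu ! j)). \<iota> (uu ! j) m (get_col j (z * G2)) = 0"
  let ?R = "\<lambda>bb w. \<forall>p q. p < length K \<longrightarrow> q < length K \<longrightarrow> K ! p = lo r_sk bb \<longrightarrow> K ! q = hi r_sk bb \<longrightarrow>
        (\<forall>v\<in>carrier (ob M w). ?\<mu> p (act M w (K ! p) 1 v) = ?\<mu> q (act M w (K ! q) 1 v))"
  let ?O = "\<lambda>w. \<forall>p. p < length K \<longrightarrow> K ! p = d w \<longrightarrow> (\<forall>v\<in>carrier (ob M w). ?\<mu> p (act M w (K ! p) 1 v) = 0)"
  have rel: "?Z (length KD + j) \<longleftrightarrow> ?R bb w" if j: "j < length K1" "K1 ! j = (bb, w)" for j bb w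
  proof -
    obtain p q where pq: "p < length K" "q < length K" "p \<noteq> q" "K ! p = lo r_sk bb" "K ! q = hi r_sk bb"
      "w \<le> K ! p" "w \<le> K ! q" "length KD + j < length uu" "uu ! (length KD + j) = w"
      and e: "\<And>k. k < length K \<Longrightarrow> G2 $$ (k, length KD + j) = diff_entries p q k"
      using G2_rel[OF j] by metis
    have g: "get_col (length KD + j) (z * G2) = get_col p z + (- 1) \<cdot>\<^sub>m get_col q z"
      by (rule get_col_diff[OF G_carrier(2) zc pq(8,1,2,3) e])
    have h: "get_col p z \<in> hull_hom [w] x" "get_col q z \<in> hull_hom [w] x"
      using hull_col_mono[OF col[OF pq(1)] pq(6)] hull_col_mono[OF col[OF pq(2)] pq(7)] by auto
    have "\<iota> w m (get_col (length KD + j) (z * G2)) = ?\<mu> p (act M w (K ! p) 1 m) - ?\<mu> q (act M w (K ! q) 1 m)"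
      if m: "m \<in> carrier (ob M w)" for m
      unfolding g iota_diff[OF m h] using iota_act[OF pq(6) m col[OF pq(1)]] iota_act[OF pq(7) m col[OF pq(2)]] by simp
    then have "?Z (length KD + j) \<longleftrightarrow> (\<forall>v\<in>carrier (ob M w). ?\<mu> p (act M w (K ! p) 1 v) = ?\<mu> q (act M w (K ! q) 1 v))"
      unfolding pq(9) by simp
    moreover have "p' = p" if "p' < length K" "K ! p' = lo r_sk bb" for p'
      using nth_eq_iff_index_eq[OF dist(2) that(1) pq(1)] that pq by simp
    moreover have "q' = q" if "q' < length K" "K ! q' = hi r_sk bb" for q'
      using nth_eq_iff_index_eq[OF dist(2) that(1) pq(2)] that pq by simp
    ultimately show ?thesis using pq(1,2,4,5) by blast
  qed
  have out: "?Z j \<longleftrightarrow> ?O (KD ! j)" if j: "j < length KD" for j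
  proof -
    obtain p where p: "p < length K" "K ! p = d (KD ! j)" "KD ! j \<le> K ! p" "j < length uu"
      "uu ! j = KD ! j" and e: "\<And>k. k < length K \<Longrightarrow> G2 $$ (k, j) = unit_entries p k"
      using G2_out[OF j] by metis
    have g: "get_col j (z * G2) = get_col p z"
      by (rule get_col_unit[OF G_carrier(2) zc p(4,1) e])
    have "\<iota> (KD ! j) m (get_col j (z * G2)) = ?\<mu> p (act M (KD ! j) (K ! p) 1 m)" if "m \<in> carrier (ob M (KD ! j))" for m
      unfolding g using iota_act[OF p(3) that col[OF p(1)]] by simp
    then have "?Z j \<longleftrightarrow> (\<forall>v\<in>carrier (ob M (KD ! j)). ?\<mu> p (act M (KD ! j) (K ! p) 1 v) = 0)"
      unfolding p(5) by simp
    moreover have "p' = p" if "p' < length K" "K ! p' = d (KD ! j)" for p'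
      using nth_eq_iff_index_eq[OF dist(2) that(1) p(1)] that p by simp
    ultimately show ?thesis using p(1,2) by blast
  qed
  have "(\<exists>\<gamma>\<in>hull_hom uu y. z * G2 = \<alpha> * \<gamma>) \<longleftrightarrow> (\<forall>j<length uu. ?Z j)"
    by (rule col_kernel[OF hull_hom_mult[OF g2_hull z]])
  also have "\<dots> \<longleftrightarrow> (\<forall>j<length K1. ?Z (length KD + j)) \<and> (\<forall>j<length KD. ?Z j)"
  proof
    assume a: "\<forall>j<length uu. ?Z j"
    have "length KD + j < length uu" if "j < length K1" for j using that by simp
    then have "\<forall>j<length K1. ?Z (length KD + j)" using a by blast
    moreover have "j < length uu" if "j < length KD" for j using that by simp
    then have "\<forall>j<length KD. ?Z j" using a by blast
    ultimately show "(\<forall>j<length K1. ?Z (length KD + j)) \<and> (\<forall>j<length KD. ?Z j)" by blast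
  next
    assume r: "(\<forall>j<length K1. ?Z (length KD + j)) \<and> (\<forall>j<length KD. ?Z j)"
    show "\<forall>j<length uu. ?Z j"
    proof (intro allI impI)
      fix j assume "j < length uu"
      then show "?Z j" by (cases rule: G2_cases) (use r in blast)+
    qed
  qed
  also have "(\<forall>j<length K1. ?Z (length KD + j)) \<longleftrightarrow> (\<forall>bb w. (bb, w) \<in> set K1 \<longrightarrow> ?R bb w)"
  proof
    assume a: "\<forall>j<length K1. ?Z (length KD + j)"
    show "\<forall>bb w. (bb, w) \<in> set K1 \<longrightarrow> ?R bb w"
    proof (rule allI, rule allI, rule impI)
      fix bb w assume "(bb, w) \<in> set K1"
      then obtain j where j: "j < length K1" "K1 ! j = (bb, w)" by (metis in_set_conv_nth)
      have z: "?Z (length KD + j)" using a j(1) by blast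
      show "?R bb w" by (rule iffD1[OF rel[OF j] z])
    qed
  next
    assume a: "\<forall>bb w. (bb, w) \<in> set K1 \<longrightarrow> ?R bb w"
    show "\<forall>j<length K1. ?Z (length KD + j)"
    proof (intro allI impI)
      fix j assume j: "j < length K1"
      obtain bb w where bw: "K1 ! j = (bb, w)" by (metis surj_pair)
      then have "(bb, w) \<in> set K1" using j nth_mem by metis
      with a have "?R bb w" by blast
      then show "?Z (length KD + j)" by (rule iffD2[OF rel[OF j bw]])
    qed
  qed
  also have "(\<forall>j<length KD. ?Z j) \<longleftrightarrow> (\<forall>w. w \<in> set KD \<longrightarrow> ?O w)"
  proof -
    have "(\<forall>j<length KD. ?Z j) \<longleftrightarrow> (\<forall>j<length KD. ?O (KD ! j))" using out by blast
    also have "\<dots> \<longleftrightarrow> (\<forall>w\<in>set KD. ?O w)" by (rule all_set_conv_all_nth[symmetric])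
    finally show ?thesis by blast
  qed
  finally have e: "(\<exists>\<gamma>\<in>hull_hom uu y. z * G2 = \<alpha> * \<gamma>) \<longleftrightarrow>
    (\<forall>bb w. (bb, w) \<in> set K1 \<longrightarrow> ?R bb w) \<and> (\<forall>w. w \<in> set KD \<longrightarrow> ?O w)" .
  have lf: "lf (ob M (K ! k)) (?\<mu> k)" if "k < length K" for k
    by (rule iota_at_lf[OF col[OF that]])
  have "(\<exists>\<phi>. interval_covec I M \<phi> \<and> (\<forall>k<length K. \<forall>m\<in>carrier (ob M (K ! k)). \<phi> (K ! k) m = ?\<mu> k m)) \<longleftrightarrow>
    (\<forall>bb w p q. (bb, w) \<in> set K1 \<longrightarrow> p < length K \<longrightarrow> q < length K \<longrightarrow> K ! p = lo r_sk bb \<longrightarrow> K ! q = hi r_sk bb \<longrightarrow>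
      (\<forall>v\<in>carrier (ob M w). ?\<mu> p (act M w (K ! p) 1 v) = ?\<mu> q (act M w (K ! q) 1 v))) \<and>
    (\<forall>w p. w \<in> set KD \<longrightarrow> p < length K \<longrightarrow> K ! p = d w \<longrightarrow> (\<forall>v\<in>carrier (ob M w). ?\<mu> p (act M w (K ! p) 1 v) = 0))"
    by (rule covec_kernel[where \<mu> = ?\<mu>], rule lf)
  then show ?thesis unfolding e by blast
qed

text \<open>A morphism V_I to M, viewed through \<iota>, as a functional on P(sc(I))(x): the
  counterpart of \<open>Psi\<close> with vectors and covectors exchanged.\<close>

definition Phi :: "('p \<Rightarrow> 'v) \<Rightarrow> 'k mat \<Rightarrow> 'k" where
  "Phi f \<sigma> = (\<Sum>k<length S. \<iota> (S ! k) (f (S ! k)) (get_col k \<sigma>))"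

lemma vec_in: "interval_vec I M f \<Longrightarrow> k < length S \<Longrightarrow> f (S ! k) \<in> carrier (ob M (S ! k))"
  using S_nth by (auto simp: interval_vec_def sc_def)

lemma Phi_lf:
  assumes "interval_vec I M f" shows "lf (hull_space S x) (Phi f)"
  unfolding Phi_def
  by (intro lf_sum linear_map_lf[OF linear_get_col] iota_lf vec_in[OF assms])

lemma Phi_put_col:
  assumes f: "interval_vec I M f" and k: "k < length S" and \<xi>: "\<xi> \<in> hull_hom [S ! k] x"
  shows "Phi f (put_col (length S) k \<xi>) = \<iota> (S ! k) (f (S ! k)) \<xi>"
proof -
  have z: "\<iota> (S ! l) (f (S ! l)) (0\<^sub>m (length x) (Suc 0)) = 0" if "l < length S" for l
    using lf_zero[OF vs_hull_space iota_lf[OF vec_in[OF f that]]] by simp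
  have "Phi f (put_col (length S) k \<xi>) = (\<Sum>l<length S. if l = k then \<iota> (S ! k) (f (S ! k)) \<xi> else 0)"
    unfolding Phi_def
    by (rule sum.cong) (use z hull_hom_dim[OF \<xi>] in \<open>auto simp: get_put_col\<close>)
  then show ?thesis using k by simp
qed

lemma G1_put_rel:
  assumes j: "j < length S1" "S1 ! j = (aa, z)" and pq: "p < length S" "q < length S" "S ! p = lo r_sc aa" "S ! q = hi r_sc aa"
  shows "put_col (length tt) j \<xi> * G1 = put_col (length S) p \<xi> + (- 1) \<cdot>\<^sub>m put_col (length S) q \<xi>"
    and "S ! p \<le> z" "S ! q \<le> z" "j < length tt" "tt ! j = z"
proof -
  obtain p' q' where *: "p' < length S" "q' < length S" "p' \<noteq> q'" "S ! p' = lo r_sc aa" "S ! q' = hi r_sc aa"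
    "S ! p' \<le> z" "S ! q' \<le> z" "j < length tt" "tt ! j = z"
    and e: "\<And>k. k < length S \<Longrightarrow> G1 $$ (j, k) = diff_entries p' q' k"
    using G1_rel[OF j] by metis
  have "p = p'" "q = q'"
    using nth_eq_iff_index_eq[OF dist(1) pq(1) *(1)] nth_eq_iff_index_eq[OF dist(1) pq(2) *(2)] pq * by auto
  then show "put_col (length tt) j \<xi> * G1 = put_col (length S) p \<xi> + (- 1) \<cdot>\<^sub>m put_col (length S) q \<xi>"
    "S ! p \<le> z" "S ! q \<le> z" "j < length tt" "tt ! j = z"
    using put_col_mult_diff[OF G_carrier(1) *(8,3) e] * by auto
qed

lemma G1_put_out:
  assumes j: "j < length SU" and p: "p < length S" "S ! p = c (SU ! j)"
  shows "put_col (length tt) (length S1 + j) \<xi> * G1 = put_col (length S) p \<xi>"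
    and "S ! p \<le> SU ! j" "length S1 + j < length tt" "tt ! (length S1 + j) = SU ! j"
proof -
  obtain p' where *: "p' < length S" "S ! p' = c (SU ! j)" "S ! p' \<le> SU ! j" "length S1 + j < length tt"
    "tt ! (length S1 + j) = SU ! j" and e: "\<And>k. k < length S \<Longrightarrow> G1 $$ (length S1 + j, k) = unit_entries p' k"
    using G1_out[OF j] by metis
  have "p = p'" using nth_eq_iff_index_eq[OF dist(1) p(1) *(1)] p * by auto
  then show "put_col (length tt) (length S1 + j) \<xi> * G1 = put_col (length S) p \<xi>" "S ! p \<le> SU ! j"
    "length S1 + j < length tt" "tt ! (length S1 + j) = SU ! j"
    using put_col_mult_unit[OF G_carrier(1) *(4) e] * by auto
qed

lemma Phi_vanishes:
  assumes f: "interval_vec I M f" and z: "z \<in> hull_hom tt x" and \<delta>: "\<delta> \<in> hull_hom S y"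
  shows "Phi f (z * G1 + \<alpha> * \<delta>) = 0"
proof -
  note l = Phi_lf[OF f] and rels = interval_vec_relations[OF f S1 c]
  have G1h: "G1 \<in> hull_hom S tt" by (rule g1_hull)
  have put: "Phi f (put_col (length tt) j \<xi> * G1) = 0" if j: "j < length tt" and \<xi>: "\<xi> \<in> hull_hom [tt ! j] x" for j \<xi>
    using j
  proof (cases rule: G1_cases)
    case (rel aa w)
    have aa: "(aa, w) \<in> set S1" using rel nth_mem by metis
    obtain p q where pq: "p < length S" "q < length S" "S ! p = lo r_sc aa" "S ! q = hi r_sc aa"
      using G1_rel[OF rel] by metis
    note P = G1_put_rel[OF rel pq]
    have \<xi>w: "\<xi> \<in> hull_hom [w] x" using \<xi> P(5) by simp
    then have h: "\<xi> \<in> hull_hom [S ! p] x" "\<xi> \<in> hull_hom [S ! q] x" using P(2,3) hull_col_mono by blast+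
    have "Phi f (put_col (length tt) j \<xi> * G1) = Phi f (put_col (length S) p \<xi>) + (- 1) * Phi f (put_col (length S) q \<xi>)"
      unfolding P(1)
      using lf_add[OF l, of "put_col (length S) p \<xi>" "(- 1) \<cdot>\<^sub>m put_col (length S) q \<xi>"]
        lf_smult[OF l, of "put_col (length S) q \<xi>" "- 1"] put_col_hull[OF h(1) pq(1)] put_col_hull[OF h(2) pq(2)]
      by (simp add: hull_hom_smult)
    also have "\<dots> = \<iota> w (act M (S ! p) w 1 (f (S ! p))) \<xi> - \<iota> w (act M (S ! q) w 1 (f (S ! q))) \<xi>"
      using Phi_put_col[OF f] pq h iota_act[OF P(2) vec_in[OF f pq(1)] \<xi>w] iota_act[OF P(3) vec_in[OF f pq(2)] \<xi>w] by simp
    also have "\<dots> = 0" using rels(1)[OF aa] pq by simp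
    finally show ?thesis .
  next
    case (out i)
    obtain p where p: "p < length S" "S ! p = c (SU ! i)" using G1_out[OF out(1)] by metis
    note P = G1_put_out[OF out(1) p]
    have \<xi>w: "\<xi> \<in> hull_hom [SU ! i] x" using \<xi> P(4) out(2) by simp
    have h: "\<xi> \<in> hull_hom [S ! p] x" using \<xi>w P(2) hull_col_mono by blast
    have "SU ! i \<in> sc (Up_out I)" using SU out nth_mem unfolding lists_set_def by blast
    from rels(2)[OF this] have "\<iota> (SU ! i) (act M (S ! p) (SU ! i) 1 (f (S ! p))) \<xi> = 0"
      using lf_zero[OF A_module_vs[OF M] iota_at_lf[OF \<xi>w]] p(2) by simp
    then show ?thesis
      unfolding out(2) P(1) using Phi_put_col[OF f p(1) h] iota_act[OF P(2) vec_in[OF f p(1)] \<xi>w] by simp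
  qed
  have "lf (hull_space tt x) (\<lambda>z. Phi f (z * G1))" by (rule linear_map_lf[OF linear_hull_right[OF G1h] l])
  from lf_cols[OF this z] have "Phi f (z * G1) = 0"
    using put get_col_hull[OF z] by simp
  moreover have "Phi f (\<alpha> * \<delta>) = 0"
  proof -
    have "\<iota> (S ! k) (f (S ! k)) (get_col k (\<alpha> * \<delta>)) = 0" if "k < length S" for k
      using col_kernel[OF hull_hom_mult[OF \<delta> \<alpha>]] \<delta> that vec_in[OF f that] by blast
    then show ?thesis unfolding Phi_def by simp
  qed
  ultimately show ?thesis
    using lf_add[OF l, of "z * G1" "\<alpha> * \<delta>"] hull_hom_mult[OF G1h z] hull_hom_mult[OF \<delta> \<alpha>] by simp
qed

text \<open>Vanishing on the multiples of \<alpha> makes each component an element of M by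
  \<open>iota_surj\<close>. The relations between these elements are checked under \<iota>, that is
  against every \<xi>, and injectivity of \<iota> brings them back to M.\<close>

lemma vec_of_functional:
  assumes \<chi>: "lf (hull_space S x) \<chi>"
    and van: "\<And>z \<delta>. z \<in> hull_hom tt x \<Longrightarrow> \<delta> \<in> hull_hom S y \<Longrightarrow> \<chi> (z * G1 + \<alpha> * \<delta>) = 0"
  shows "\<exists>f. interval_vec I M f \<and>
    (\<forall>k<length S. \<forall>\<xi>\<in>hull_hom [S ! k] x. \<chi> (put_col (length S) k \<xi>) = \<iota> (S ! k) (f (S ! k)) \<xi>)"
proof -
  let ?E = "put_col (length S)"
  have G1h: "G1 \<in> hull_hom S tt" by (rule g1_hull)
  have van1: "\<chi> (z * G1) = 0" if "z \<in> hull_hom tt x" for z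
  proof -
    have "\<alpha> * 0\<^sub>m (length y) (length S) = 0\<^sub>m (length x) (length S)"
      using hull_hom_carrier[OF \<alpha>] by simp
    then show ?thesis
      using van[OF that hull_hom_zero[of y S]] hull_hom_carrier[OF hull_hom_mult[OF G1h that]] by simp
  qed
  have van2: "\<chi> (\<alpha> * \<delta>) = 0" if "\<delta> \<in> hull_hom S y" for \<delta>
  proof -
    have "0\<^sub>m (length x) (length tt) * G1 = 0\<^sub>m (length x) (length S)"
      using G_carrier(1) by simp
    then show ?thesis
      using van[OF hull_hom_zero[of x tt] that] hull_hom_carrier[OF hull_hom_mult[OF that \<alpha>]] by simp
  qed
  have "\<exists>m. m \<in> carrier (ob M (S ! k)) \<and> (\<forall>\<xi>\<in>hull_hom [S ! k] x. \<iota> (S ! k) m \<xi> = \<chi> (?E k \<xi>))" if k: "k < length S" for k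
  proof -
    have "\<chi> (?E k (\<alpha> * \<gamma>)) = 0" if \<gamma>: "\<gamma> \<in> hull_hom [S ! k] y" for \<gamma>
    proof -
      have "?E k (\<alpha> * \<gamma>) = \<alpha> * ?E k \<gamma>"
        by (rule put_col_mult[of _ "length y" _ "length x"]) (use hull_hom_carrier[OF \<gamma>] hull_hom_carrier[OF \<alpha>] in auto)
      then show ?thesis using van2[OF put_col_hull[OF \<gamma> k]] by simp
    qed
    then show ?thesis
      using iota_surj[OF linear_map_lf[OF linear_put_col[OF k] \<chi>]] by blast
  qed
  then obtain m where m: "\<And>k. k < length S \<Longrightarrow> m k \<in> carrier (ob M (S ! k))"
    "\<And>k \<xi>. k < length S \<Longrightarrow> \<xi> \<in> hull_hom [S ! k] x \<Longrightarrow> \<iota> (S ! k) (m k) \<xi> = \<chi> (?E k \<xi>)" by metis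
  have "\<exists>f. interval_vec I M f \<and> (\<forall>k<length S. f (S ! k) = m k)"
  proof (rule vec_kernel[where m = m, OF m(1), THEN iffD2], assumption, intro conjI allI impI)
    fix aa w p q assume aa: "(aa, w) \<in> set S1" and pq: "p < length S" "q < length S" "S ! p = lo r_sc aa" "S ! q = hi r_sc aa"
    obtain j where j: "j < length S1" "S1 ! j = (aa, w)" using aa by (metis in_set_conv_nth)
    note P = G1_put_rel[OF j pq]
    show "act M (S ! p) w 1 (m p) = act M (S ! q) w 1 (m q)"
    proof (rule iota_inj)
      show "act M (S ! p) w 1 (m p) \<in> carrier (ob M w)" "act M (S ! q) w 1 (m q) \<in> carrier (ob M w)"
        using A_module_act_in[OF M P(2) m(1)[OF pq(1)]] A_module_act_in[OF M P(3) m(1)[OF pq(2)]] by auto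
      fix \<xi> :: "'k mat" assume \<xi>: "\<xi> \<in> hull_hom [w] x"
      then have h: "\<xi> \<in> hull_hom [S ! p] x" "\<xi> \<in> hull_hom [S ! q] x" using P(2,3) hull_col_mono by blast+
      have "\<xi> \<in> hull_hom [tt ! j] x" unfolding P(5) by (rule \<xi>)
      from van1[OF put_col_hull[OF this P(4)]] have "\<chi> (?E p \<xi>) = \<chi> (?E q \<xi>)"
        unfolding P(1)
        using lf_add[OF \<chi>, of "?E p \<xi>" "(- 1) \<cdot>\<^sub>m ?E q \<xi>"] lf_smult[OF \<chi>, of "?E q \<xi>" "- 1"]
          put_col_hull[OF h(1) pq(1)] put_col_hull[OF h(2) pq(2)] by (simp add: hull_hom_smult)
      then show "\<iota> w (act M (S ! p) w 1 (m p)) \<xi> = \<iota> w (act M (S ! q) w 1 (m q)) \<xi>"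
        using iota_act[OF P(2) m(1)[OF pq(1)] \<xi>] iota_act[OF P(3) m(1)[OF pq(2)] \<xi>] m(2)[OF pq(1) h(1)] m(2)[OF pq(2) h(2)] by simp
    qed
  next
    fix w p assume w: "w \<in> set SU" and p: "p < length S" "S ! p = c w"
    obtain j where j: "j < length SU" "SU ! j = w" using w by (metis in_set_conv_nth)
    note P = G1_put_out[OF j(1) p(1), unfolded j(2), OF p(2)]
    show "act M (S ! p) w 1 (m p) = \<zero>\<^bsub>ob M w\<^esub>"
    proof (rule iota_inj[OF A_module_act_in[OF M P(2) m(1)[OF p(1)]] vs_zero[OF A_module_vs[OF M]]])
      fix \<xi> :: "'k mat" assume \<xi>: "\<xi> \<in> hull_hom [w] x"
      then have h: "\<xi> \<in> hull_hom [S ! p] x" using P(2) hull_col_mono by blast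
      have "\<xi> \<in> hull_hom [tt ! (length S1 + j)] x" unfolding P(4) by (rule \<xi>)
      from van1[OF put_col_hull[OF this P(3)]] have "\<chi> (?E p \<xi>) = 0" unfolding P(1) .
      then show "\<iota> w (act M (S ! p) w 1 (m p)) \<xi> = \<iota> w \<zero>\<^bsub>ob M w\<^esub> \<xi>"
        using iota_act[OF P(2) m(1)[OF p(1)] \<xi>] m(2)[OF p(1) h] lf_zero[OF A_module_vs[OF M] iota_at_lf[OF \<xi>]] by simp
    qed
  qed
  then obtain f where f: "interval_vec I M f" "\<And>k. k < length S \<Longrightarrow> f (S ! k) = m k" by blast
  have "\<chi> (?E k \<xi>) = \<iota> (S ! k) (f (S ! k)) \<xi>" if "k < length S" "\<xi> \<in> hull_hom [S ! k] x" for k \<xi>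
    using f(2)[OF that(1)] m(2)[OF that] by simp
  then show ?thesis using f(1) by blast
qed

text \<open>\<open>rank_difference\<close> with \<open>p\<close> the second component. The covectors
  \<open>\<phi> i\<close> are represented by matrices \<open>ww i\<close>, which exist by
  reflexivity and give the vectors (ww i G3, 0); the dual functionals are \<open>Phi (f i)\<close>.
  In comparison with the projective case vectors and covectors have changed places, and with them
  the two rows.\<close>

lemma rank_inj_difference:
  assumes n: "pairing_rank I a0 M n"
  shows "rank_inj S tt uu K x y \<alpha> G1 (P_trans G3) G2
    = rank_inj S tt uu K x y \<alpha> G1 (zero_map (P_space S x)) G2 + n"
proof -
  let ?A = "hull_space S x :: ('k, 'k mat) module" and ?B = "hull_space uu x :: ('k, 'k mat) module"
  let ?Vs = "[hull_space tt x, hull_space K x, hull_space S y, hull_space uu y] :: ('k, 'k mat) module list"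
  let ?W = "dsum [?A, ?B]"
  let ?T = "\<lambda>T. [[P_trans G1, T, P_act \<alpha>, zero_map ?A], [zero_map ?B, P_trans G2, zero_map ?B, P_act \<alpha>]]"
  let ?R = "\<lambda>T. block_map [?A, ?B] (?T T) ` carrier (dsum ?Vs)"
  note h = g1_hull[of r_sc c S S1 SU] g2_hull[of r_sk d KD K1 K] g3_hull[of b0 a0 S K]
  have W: "vspace ?W" by (rule vs_dsum) (use vs_hull_space in auto)
  obtain N where N: "has_dim ?W N"
    using has_dim_dsum[of "[?A, ?B]"] vs_hull_space has_dim_hull_space by fastforce
  obtain N' where N': "has_dim ?B N'" using has_dim_hull_space by blast
  have cW: "carrier ?W = {[\<sigma>, \<upsilon>] |\<sigma> \<upsilon>. \<sigma> \<in> hull_hom S x \<and> \<upsilon> \<in> hull_hom uu x}"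
    by (auto simp: dsum_Cons_carrier dsum_Nil)
  have opW: "add ?W [u, v] [u', v'] = [u + u', v + v']" "smult ?W e [u, v] = [e \<cdot>\<^sub>m u, e \<cdot>\<^sub>m v]" for u v u' v' e
    by (simp_all add: dsum_Cons dsum_Nil)
  have cV: "carrier (dsum ?Vs) = {[\<tau>, \<omega>, \<delta>, \<gamma>] |\<tau> \<omega> \<delta> \<gamma>. \<tau> \<in> hull_hom tt x \<and> \<omega> \<in> hull_hom K x \<and> \<delta> \<in> hull_hom S y \<and> \<gamma> \<in> hull_hom uu y}"
    by (auto simp: dsum_Cons_carrier dsum_Nil)
  have AC: "\<sigma> + \<sigma>' = \<sigma>' + \<sigma>" if "\<sigma> \<in> hull_hom S x" "\<sigma>' \<in> hull_hom S x" for \<sigma> \<sigma>' :: "'k mat"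
    using comm_add_mat[OF hull_hom_carrier[OF that(1)] hull_hom_carrier[OF that(2)]] .
  have G1S: "\<tau> * G1 \<in> hull_hom S x" if "\<tau> \<in> hull_hom tt x" for \<tau> by (rule hull_hom_mult[OF h(1) that])
  have \<alpha>S: "\<alpha> * \<delta> \<in> hull_hom S x" if "\<delta> \<in> hull_hom S y" for \<delta> by (rule hull_hom_mult[OF that \<alpha>])
  have G3S: "\<omega> * G3 \<in> hull_hom S x" if "\<omega> \<in> hull_hom K x" for \<omega> by (rule hull_hom_mult[OF h(3) that])
  \<comment> \<open>The block \<open>T\<close> stands second in its row; its summand is moved to the
    front so that the two block maps differ in the leading term only.\<close>
  have bm: "block_map [?A, ?B] (?T T) [\<tau>, \<omega>, \<delta>, \<gamma>] = [T \<omega> + (\<tau> * G1 + \<alpha> * \<delta>), \<omega> * G2 + \<alpha> * \<gamma>]"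
    if "\<tau> \<in> hull_hom tt x" "\<omega> \<in> hull_hom K x" "\<delta> \<in> hull_hom S y" "\<gamma> \<in> hull_hom uu y" "T \<omega> \<in> hull_hom S x" for T \<tau> \<omega> \<delta> \<gamma>
  proof -
    have "\<tau> * G1 + (T \<omega> + \<alpha> * \<delta>) = (\<tau> * G1 + T \<omega>) + \<alpha> * \<delta>"
      by (rule assoc_add_mat[symmetric, OF hull_hom_carrier hull_hom_carrier hull_hom_carrier, OF G1S[OF that(1)] that(5) \<alpha>S[OF that(3)]])
    also have "\<dots> = (T \<omega> + \<tau> * G1) + \<alpha> * \<delta>" using AC[OF G1S[OF that(1)] that(5)] by simp
    also have "\<dots> = T \<omega> + (\<tau> * G1 + \<alpha> * \<delta>)"
      by (rule assoc_add_mat[OF hull_hom_carrier hull_hom_carrier hull_hom_carrier, OF that(5) G1S[OF that(1)] \<alpha>S[OF that(3)]])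
    finally have e: "\<tau> * G1 + (T \<omega> + \<alpha> * \<delta>) = T \<omega> + (\<tau> * G1 + \<alpha> * \<delta>)" .
    show ?thesis
      using hull_hom_carrier[OF hull_hom_mult[OF h(2) that(2)]] hull_hom_carrier[OF \<alpha>S[OF that(3)]]
        hull_hom_carrier[OF hull_hom_mult[OF that(4) \<alpha>]] e
      by (simp add: block_map_def zero_map_def P_trans_def P_act_def)
  qed
  have lin: "linear_map class_ring (dsum ?Vs) ?W (block_map [?A, ?B] (?T T))"
    if T: "linear_map class_ring (hull_space K x) ?A T" for T
  proof (rule block_map_linear)
    fix i j assume "i < length [?A, ?B]" "j < length ?Vs"
    then consider "i = 0" "j = 0" | "i = 0" "j = 1" | "i = 0" "j = 2" | "i = 0" "j = 3"
      | "i = 1" "j = 0" | "i = 1" "j = 1" | "i = 1" "j = 2" | "i = 1" "j = 3" by fastforce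
    then show "linear_map class_ring (?Vs ! j) ([?A, ?B] ! i) (?T T ! i ! j)"
      by cases (use T in \<open>auto simp: P_trans_def[abs_def] P_act_def[abs_def]
          intro!: linear_hull_left h linear_hull_right \<alpha> linear_zero_map vs_hull_space\<close>)
  qed (use vs_hull_space in \<open>auto simp: less_Suc_eq\<close>)
  have T1: "linear_map class_ring (hull_space K x) ?A (P_trans G3)"
    unfolding P_trans_def[abs_def] by (rule linear_hull_right[OF h(3)])
  have T0: "linear_map class_ring (hull_space K x) ?A (zero_map ?A)"
    by (intro linear_zero_map vs_hull_space)
  obtain p where p: "p < length S" "S ! p = a0" by (rule a0_index)
  obtain q where q: "q < length K" "K ! q = b0" by (rule b0_index)
  have G3: "\<omega> * G3 = put_col (length S) p (get_col q \<omega>)" if "\<omega> \<in> hull_hom K x" for \<omega>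
    by (rule mult_g3[OF dist q p ab0 hull_hom_carrier[OF that]])
  have pr: "linear_map class_ring ?W ?B (\<lambda>w. w ! 1)"
    by (rule linear_mapI[OF W vs_hull_space]) (auto simp: cW opW)
  have R: "v \<in> ?R T \<longleftrightarrow> (\<exists>\<tau>\<in>hull_hom tt x. \<exists>\<omega>\<in>hull_hom K x. \<exists>\<delta>\<in>hull_hom S y. \<exists>\<gamma>\<in>hull_hom uu y.
      v = [T \<omega> + (\<tau> * G1 + \<alpha> * \<delta>), \<omega> * G2 + \<alpha> * \<gamma>])" if T: "linear_map class_ring (hull_space K x) ?A T" for v T
  proof -
    have Ti: "T \<omega> \<in> hull_hom S x" if "\<omega> \<in> hull_hom K x" for \<omega> using linear_map_in[OF T, of \<omega>] that by simp
    show ?thesis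
    proof
      assume "v \<in> ?R T"
      then obtain w where "w \<in> carrier (dsum ?Vs)" "v = block_map [?A, ?B] (?T T) w" by blast
      then obtain \<tau> \<omega> \<delta> \<gamma> where w: "\<tau> \<in> hull_hom tt x" "\<omega> \<in> hull_hom K x" "\<delta> \<in> hull_hom S y" "\<gamma> \<in> hull_hom uu y"
        "v = block_map [?A, ?B] (?T T) [\<tau>, \<omega>, \<delta>, \<gamma>]" unfolding cV by blast
      show "\<exists>\<tau>\<in>hull_hom tt x. \<exists>\<omega>\<in>hull_hom K x. \<exists>\<delta>\<in>hull_hom S y. \<exists>\<gamma>\<in>hull_hom uu y.
          v = [T \<omega> + (\<tau> * G1 + \<alpha> * \<delta>), \<omega> * G2 + \<alpha> * \<gamma>]"
        using w(5)[unfolded bm[where T = T, OF w(1-4) Ti[OF w(2)]]] w(1-4) by blast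
    next
      assume "\<exists>\<tau>\<in>hull_hom tt x. \<exists>\<omega>\<in>hull_hom K x. \<exists>\<delta>\<in>hull_hom S y. \<exists>\<gamma>\<in>hull_hom uu y.
          v = [T \<omega> + (\<tau> * G1 + \<alpha> * \<delta>), \<omega> * G2 + \<alpha> * \<gamma>]"
      then obtain \<tau> \<omega> \<delta> \<gamma> where w: "\<tau> \<in> hull_hom tt x" "\<omega> \<in> hull_hom K x" "\<delta> \<in> hull_hom S y" "\<gamma> \<in> hull_hom uu y"
        "v = [T \<omega> + (\<tau> * G1 + \<alpha> * \<delta>), \<omega> * G2 + \<alpha> * \<gamma>]" by blast
      have "[\<tau>, \<omega>, \<delta>, \<gamma>] \<in> carrier (dsum ?Vs)" unfolding cV using w(1-4) by blast
      then show "v \<in> ?R T" unfolding w(5) bm[where T = T, OF w(1-4) Ti[OF w(2)], symmetric] by (rule imageI)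
    qed
  qed
  note R0 = R[OF T0] and R1 = R[OF T1]
  have z0: "0\<^sub>m (length x) (length tt) \<in> hull_hom tt x" "0\<^sub>m (length x) (length K) \<in> hull_hom K x"
    "0\<^sub>m (length y) (length S) \<in> hull_hom S y" "0\<^sub>m (length y) (length uu) \<in> hull_hom uu y"
    by (rule hull_hom_zero)+
  obtain f \<phi> where f: "\<And>i. i < n \<Longrightarrow> interval_vec I M (f i)"
    and \<phi>: "\<And>i. i < n \<Longrightarrow> interval_covec I M (\<phi> i)"
    and dual: "\<And>i j. i < n \<Longrightarrow> j < n \<Longrightarrow> \<phi> i a0 (f j a0) = (if i = j then 1 else 0)"
    and gen: "\<And>g \<chi>. interval_vec I M g \<Longrightarrow> interval_covec I M \<chi> \<Longrightarrow>
        \<chi> a0 (g a0) = (\<Sum>i<n. \<chi> a0 (f i a0) * \<phi> i a0 (g a0))"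
    using n unfolding pairing_rank_def by blast
  have zero_mult: "0\<^sub>m (length x) (length tt) * G1 = 0\<^sub>m (length x) (length S)"
    "\<alpha> * 0\<^sub>m (length y) (length uu) = 0\<^sub>m (length x) (length uu)"
    "0\<^sub>m (length x) (length K) * G3 = 0\<^sub>m (length x) (length S)"
    "0\<^sub>m (length x) (length K) * G2 = 0\<^sub>m (length x) (length uu)"
    "\<alpha> * 0\<^sub>m (length y) (length S) = 0\<^sub>m (length x) (length S)"
    using G_carrier hull_hom_carrier[OF \<alpha>] by auto
  have cA: "\<sigma> \<in> carrier_mat (length x) (length S)" if "\<sigma> \<in> hull_hom S x" for \<sigma> :: "'k mat"
    using hull_hom_carrier[OF that] .
  have GA: "\<tau> * G1 + \<alpha> * \<delta> \<in> hull_hom S x" if "\<tau> \<in> hull_hom tt x" "\<delta> \<in> hull_hom S y" for \<tau> \<delta>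
    by (intro hull_hom_add G1S \<alpha>S that)
  \<comment> \<open>Since T 0 = 0, whatever G1 and \<alpha> produce in the first row lies over 0 in
    both images.\<close>
  have RT: "[\<tau> * G1 + \<alpha> * \<delta>, 0\<^sub>m (length x) (length uu)] \<in> ?R T"
    if T: "linear_map class_ring (hull_space K x) ?A T" and "\<tau> \<in> hull_hom tt x" "\<delta> \<in> hull_hom S y" for T \<tau> \<delta>
  proof -
    have "T (0\<^sub>m (length x) (length K)) = 0\<^sub>m (length x) (length S)" using linear_map_zero[OF T] by simp
    then have e: "[\<tau> * G1 + \<alpha> * \<delta>, 0\<^sub>m (length x) (length uu)] =
        [T (0\<^sub>m (length x) (length K)) + (\<tau> * G1 + \<alpha> * \<delta>), 0\<^sub>m (length x) (length K) * G2 + \<alpha> * 0\<^sub>m (length y) (length uu)]"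
      using cA[OF GA[OF that(2,3)]] zero_mult by simp
    show ?thesis unfolding R[OF T] e using that(2,3) z0(2,4) by blast
  qed
  have neg: "\<exists>\<gamma>'\<in>hull_hom uu y. \<omega> * G2 = \<alpha> * \<gamma>'"
    if "\<omega> \<in> hull_hom K x" "\<gamma> \<in> hull_hom uu y" "\<omega> * G2 + \<alpha> * \<gamma> = 0\<^sub>m (length x) (length uu)" for \<omega> \<gamma>
  proof -
    have m: "\<alpha> * ((- 1) \<cdot>\<^sub>m \<gamma>) = (- 1) \<cdot>\<^sub>m (\<alpha> * \<gamma>)"
      by (rule mult_smult_distrib[OF hull_hom_carrier[OF \<alpha>] hull_hom_carrier[OF that(2)]])
    have "(- 1) \<cdot>\<^sub>m ((- 1) \<cdot>\<^sub>m (\<alpha> * \<gamma>)) = \<alpha> * \<gamma>" by (rule eq_matI) auto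
    then have "\<omega> * G2 \<oplus>\<^bsub>?B\<^esub> (- 1) \<odot>\<^bsub>?B\<^esub> (\<alpha> * ((- 1) \<cdot>\<^sub>m \<gamma>)) = \<zero>\<^bsub>?B\<^esub>"
      using that(3) m by simp
    then have "\<omega> * G2 = \<alpha> * ((- 1) \<cdot>\<^sub>m \<gamma>)"
      using vs_diff_eq_zero[OF vs_hull_space, of "\<omega> * G2" uu x "\<alpha> * ((- 1) \<cdot>\<^sub>m \<gamma>)"]
        hull_hom_mult[OF h(2) that(1)] hull_hom_mult[OF hull_hom_smult[OF that(2)] \<alpha>] by simp
    then show ?thesis using hull_hom_smult[OF that(2)] by blast
  qed
  \<comment> \<open>By \<open>iota_reflexive\<close> every component of \<phi> i at a maximal
    element is evaluation at some column; \<open>G2_kernel\<close> applies since \<phi> i is a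
    morphism.\<close>
  have "\<exists>\<omega>. \<omega> \<in> hull_hom K x \<and> (\<exists>\<gamma>\<in>hull_hom uu y. \<omega> * G2 = \<alpha> * \<gamma>) \<and>
      (\<forall>k<length K. \<forall>m\<in>carrier (ob M (K ! k)). \<phi> i (K ! k) m = \<iota> (K ! k) m (get_col k \<omega>))" if i: "i < n" for i
  proof -
    have "\<exists>\<xi>. \<xi> \<in> hull_hom [K ! k] x \<and> (\<forall>m\<in>carrier (ob M (K ! k)). \<phi> i (K ! k) m = \<iota> (K ! k) m \<xi>)" if "k < length K" for k
      using iota_reflexive[of "K ! k" "\<phi> i (K ! k)"] \<phi>[OF i] K_nth[OF that] by (auto simp: interval_covec_def sk_def)
    then obtain \<rho> where \<rho>: "\<And>k. k < length K \<Longrightarrow> \<rho> k \<in> hull_hom [K ! k] x"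
      "\<And>k. k < length K \<Longrightarrow> \<forall>m\<in>carrier (ob M (K ! k)). \<phi> i (K ! k) m = \<iota> (K ! k) m (\<rho> k)" by metis
    obtain \<omega> where \<omega>: "\<omega> \<in> hull_hom K x" "\<And>k. k < length K \<Longrightarrow> get_col k \<omega> = \<rho> k"
      by (rule hull_cols[of K \<rho> x]) (use \<rho> in auto)
    then have "\<forall>k<length K. \<forall>m\<in>carrier (ob M (K ! k)). \<phi> i (K ! k) m = \<iota> (K ! k) m (get_col k \<omega>)" using \<rho> by simp
    then show ?thesis using G2_kernel[OF \<omega>(1)] \<phi>[OF i] \<omega>(1) by blast
  qed
  then obtain ww where ww: "\<And>i. i < n \<Longrightarrow> ww i \<in> hull_hom K x"
    "\<And>i. i < n \<Longrightarrow> \<exists>\<gamma>\<in>hull_hom uu y. ww i * G2 = \<alpha> * \<gamma>"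
    "\<And>i. i < n \<Longrightarrow> \<forall>k<length K. \<forall>m\<in>carrier (ob M (K ! k)). \<phi> i (K ! k) m = \<iota> (K ! k) m (get_col k (ww i))" by metis
  \<comment> \<open>G3 moves the column at \<open>b0\<close> to the slot of \<open>a0\<close>.
    Evaluated there on the vector of \<open>g\<close>, it is the covector at \<open>b0\<close> on
    the transported vector, hence the covector at \<open>a0\<close>.\<close>
  have G3_value: "\<chi> (\<omega> * G3) = \<theta> a0 (g a0)"
    if \<omega>: "\<omega> \<in> hull_hom K x" and \<theta>: "interval_covec I M \<theta>"
      and e: "\<forall>k<length K. \<forall>m\<in>carrier (ob M (K ! k)). \<theta> (K ! k) m = \<iota> (K ! k) m (get_col k \<omega>)"
      and g: "interval_vec I M g"
      and \<chi>: "\<And>\<xi>. \<xi> \<in> hull_hom [a0] x \<Longrightarrow> \<chi> (put_col (length S) p \<xi>) = \<iota> a0 (g a0) \<xi>" for \<chi> :: "'k mat \<Rightarrow> 'k" and \<omega> g \<theta>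
  proof -
    have r: "get_col q \<omega> \<in> hull_hom [b0] x" using get_col_hull[OF \<omega> q(1)] q(2) by simp
    have ga: "g a0 \<in> carrier (ob M a0)" using vec_in[OF g p(1)] p(2) by simp
    have gb: "act M a0 b0 1 (g a0) \<in> carrier (ob M b0)" by (rule A_module_act_in[OF M ab0 ga])
    have "\<chi> (\<omega> * G3) = \<iota> b0 (act M a0 b0 1 (g a0)) (get_col q \<omega>)"
      unfolding G3[OF \<omega>] using \<chi>[OF hull_col_mono[OF r ab0]] iota_act[OF ab0 ga r] by simp
    also have "\<dots> = \<theta> b0 (act M a0 b0 1 (g a0))"
      using e[rule_format, OF q(1), unfolded q(2), OF gb] by simp
    also have "\<dots> = \<theta> a0 (g a0)"
      using \<theta> ga a0 b0 ab0 unfolding interval_covec_def sc_def sk_def by simp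
    finally show ?thesis .
  qed
  have Phi_G3: "Phi g (\<omega> * G3 + (\<tau> * G1 + \<alpha> * \<delta>)) = \<theta> a0 (g a0)"
    if \<omega>: "\<omega> \<in> hull_hom K x" and \<theta>: "interval_covec I M \<theta>"
      and e: "\<forall>k<length K. \<forall>m\<in>carrier (ob M (K ! k)). \<theta> (K ! k) m = \<iota> (K ! k) m (get_col k \<omega>)"
      and g: "interval_vec I M g" and \<tau>: "\<tau> \<in> hull_hom tt x" "\<delta> \<in> hull_hom S y" for \<omega> g \<theta> \<tau> \<delta>
  proof -
    have "Phi g (\<omega> * G3) = \<theta> a0 (g a0)"
      by (rule G3_value[OF \<omega> \<theta> e g]) (use Phi_put_col[OF g p(1)] p(2) in simp)
    then show ?thesis
      using lf_add[OF Phi_lf[OF g], of "\<omega> * G3" "\<tau> * G1 + \<alpha> * \<delta>"] G3S[OF \<omega>] GA[OF \<tau>] Phi_vanishes[OF g \<tau>] by simp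
  qed
  have zm: "zero_map ?A (z :: 'k mat) = 0\<^sub>m (length x) (length S)" for z by (simp add: zero_map_def)
  let ?k = "\<lambda>i. [ww i * G3, 0\<^sub>m (length x) (length uu)]"
  let ?\<psi> = "\<lambda>i w. Phi (f i) (w ! 0)"
  have "vectorspace.dim class_ring (?W\<lparr>carrier := ?R (P_trans G3)\<rparr>) =
      vectorspace.dim class_ring (?W\<lparr>carrier := ?R (zero_map ?A)\<rparr>) + n"
  proof (rule rank_difference[OF W N N' pr sub_image[OF lin[OF T0]] sub_image[OF lin[OF T1]], where k = ?k and \<psi> = ?\<psi>])
    have img: "(\<lambda>w. w ! 1) ` ?R T = {\<omega> * G2 + \<alpha> * \<gamma> |\<omega> \<gamma>. \<omega> \<in> hull_hom K x \<and> \<gamma> \<in> hull_hom uu y}"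
      if T: "linear_map class_ring (hull_space K x) ?A T" for T
    proof (intro equalityI subsetI)
      fix v assume "v \<in> (\<lambda>w. w ! 1) ` ?R T"
      then obtain w where w: "w \<in> ?R T" "v = w ! 1" by blast
      from w(1) obtain \<tau> \<omega> \<delta> \<gamma> where "\<omega> \<in> hull_hom K x" "\<gamma> \<in> hull_hom uu y"
        "w = [T \<omega> + (\<tau> * G1 + \<alpha> * \<delta>), \<omega> * G2 + \<alpha> * \<gamma>]"
        unfolding R[OF T] by blast
      then show "v \<in> {\<omega> * G2 + \<alpha> * \<gamma> |\<omega> \<gamma>. \<omega> \<in> hull_hom K x \<and> \<gamma> \<in> hull_hom uu y}"
        using w(2) by (intro CollectI exI[of _ \<omega>] exI[of _ \<gamma>]) simp
    next
      fix v assume "v \<in> {\<omega> * G2 + \<alpha> * \<gamma> |\<omega> \<gamma>. \<omega> \<in> hull_hom K x \<and> \<gamma> \<in> hull_hom uu y}"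
      then obtain \<omega> \<gamma> where z: "\<omega> \<in> hull_hom K x" "\<gamma> \<in> hull_hom uu y" "v = \<omega> * G2 + \<alpha> * \<gamma>" by blast
      have "[T \<omega> + (0\<^sub>m (length x) (length tt) * G1 + \<alpha> * 0\<^sub>m (length y) (length S)), v] \<in> ?R T"
        unfolding R[OF T] z(3) using z(1,2) z0(1,3) by blast
      then show "v \<in> (\<lambda>w. w ! 1) ` ?R T" by (rule image_eqI[rotated]) simp
    qed
    show "(\<lambda>w. w ! 1) ` ?R (zero_map ?A) = (\<lambda>w. w ! 1) ` ?R (P_trans G3)"
      unfolding img[OF T0] img[OF T1] ..
  next
    fix v assume v: "v \<in> ?R (zero_map ?A)" "v ! 1 = \<zero>\<^bsub>?B\<^esub>"
    then obtain \<tau> \<omega> \<delta> \<gamma> where z: "\<tau> \<in> hull_hom tt x" "\<delta> \<in> hull_hom S y"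
      "v = [0\<^sub>m (length x) (length S) + (\<tau> * G1 + \<alpha> * \<delta>), \<omega> * G2 + \<alpha> * \<gamma>]"
      unfolding R0 zm by blast
    then have "v = [\<tau> * G1 + \<alpha> * \<delta>, 0\<^sub>m (length x) (length uu)]"
      using v(2) cA[OF GA[OF z(1,2)]] by simp
    then show "v \<in> ?R (P_trans G3)" using RT[OF T1 z(1,2)] by simp
  next
    fix i assume i: "i < n"
    obtain \<gamma> where \<gamma>: "\<gamma> \<in> hull_hom uu y" "ww i * G2 = \<alpha> * \<gamma>" using ww(2)[OF i] by blast
    have m: "\<alpha> * ((- 1) \<cdot>\<^sub>m \<gamma>) = (- 1) \<cdot>\<^sub>m (\<alpha> * \<gamma>)"
      by (rule mult_smult_distrib[OF hull_hom_carrier[OF \<alpha>] hull_hom_carrier[OF \<gamma>(1)]])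
    have "ww i * G2 + \<alpha> * ((- 1) \<cdot>\<^sub>m \<gamma>) = 0\<^sub>m (length x) (length uu)"
      using vs_diff_eq_zero[OF vs_hull_space, of "\<alpha> * \<gamma>" uu x "\<alpha> * \<gamma>"] hull_hom_mult[OF \<gamma>(1) \<alpha>] \<gamma>(2) m by simp
    moreover have "ww i * G3 + (0\<^sub>m (length x) (length tt) * G1 + \<alpha> * 0\<^sub>m (length y) (length S)) = ww i * G3"
      using cA[OF G3S[OF ww(1)[OF i]]] zero_mult by simp
    ultimately have "?k i = [P_trans G3 (ww i) + (0\<^sub>m (length x) (length tt) * G1 + \<alpha> * 0\<^sub>m (length y) (length S)),
        ww i * G2 + \<alpha> * ((- 1) \<cdot>\<^sub>m \<gamma>)]"
      by (simp add: P_trans_def)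
    then have "?k i \<in> ?R (P_trans G3)"
      unfolding R1 using ww(1)[OF i] z0(1,3) hull_hom_smult[OF \<gamma>(1)] by blast
    then show "?k i \<in> ?R (P_trans G3) \<and> ?k i ! 1 = \<zero>\<^bsub>?B\<^esub>" by simp
    show "lf ?W (?\<psi> i) \<and> (\<forall>v\<in>?R (zero_map ?A). v ! 1 = \<zero>\<^bsub>?B\<^esub> \<longrightarrow> ?\<psi> i v = 0)"
    proof (intro conjI ballI impI)
      show "lf ?W (?\<psi> i)"
        using lf_add[OF Phi_lf[OF f[OF i]]] lf_smult[OF Phi_lf[OF f[OF i]]] by (auto simp: lf_def cW opW)
      fix v assume "v \<in> ?R (zero_map ?A)"
      then obtain \<tau> \<omega> \<delta> \<gamma> where z: "\<tau> \<in> hull_hom tt x" "\<delta> \<in> hull_hom S y"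
        "v = [0\<^sub>m (length x) (length S) + (\<tau> * G1 + \<alpha> * \<delta>), \<omega> * G2 + \<alpha> * \<gamma>]"
        unfolding R0 zm by blast
      then show "?\<psi> i v = 0" using Phi_vanishes[OF f[OF i] z(1,2)] cA[OF GA[OF z(1,2)]] by simp
    qed
    fix j assume j: "j < n"
    \<comment> \<open>The value is that of \<phi> j on f i, with exchanged indices; the duality
      relation is symmetric in them.\<close>
    have "?\<psi> i (?k j) = Phi (f i) (ww j * G3 + (0\<^sub>m (length x) (length tt) * G1 + \<alpha> * 0\<^sub>m (length y) (length S)))"
      using cA[OF G3S[OF ww(1)[OF j]]] zero_mult by simp
    then show "?\<psi> i (?k j) = (if i = j then 1 else 0)"
      using Phi_G3[OF ww(1)[OF j] \<phi>[OF j] ww(3)[OF j] f[OF i] z0(1,3)] dual[OF j i] by simp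
  next
    fix \<chi> v assume \<chi>: "lf ?W \<chi>" and van: "\<And>u. u \<in> ?R (zero_map ?A) \<Longrightarrow> u ! 1 = \<zero>\<^bsub>?B\<^esub> \<Longrightarrow> \<chi> u = 0"
      and v: "v \<in> ?R (P_trans G3)" "v ! 1 = \<zero>\<^bsub>?B\<^esub>"
    let ?\<chi> = "\<lambda>\<sigma>. \<chi> [\<sigma>, 0\<^sub>m (length x) (length uu)]"
    have \<chi>': "lf (hull_space S x) ?\<chi>"
    proof -
      have zt: "0\<^sub>m (length x) (length uu) \<in> hull_hom uu x" by (rule hull_hom_zero)
      have "?\<chi> (u + u') = ?\<chi> u + ?\<chi> u'" if "u \<in> hull_hom S x" "u' \<in> hull_hom S x" for u u'
        using lf_add[OF \<chi>, of "[u, 0\<^sub>m (length x) (length uu)]" "[u', 0\<^sub>m (length x) (length uu)]"] that zt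
        by (simp add: cW opW)
      moreover have "?\<chi> (e \<cdot>\<^sub>m u) = e * ?\<chi> u" if "u \<in> hull_hom S x" for u e
        using lf_smult[OF \<chi>, of "[u, 0\<^sub>m (length x) (length uu)]" e] that zt by (simp add: cW opW)
      ultimately show ?thesis by (simp add: lf_def)
    qed
    have van': "?\<chi> (\<tau> * G1 + \<alpha> * \<delta>) = 0" if "\<tau> \<in> hull_hom tt x" "\<delta> \<in> hull_hom S y" for \<tau> \<delta>
      by (rule van[OF RT[OF T0 that]]) simp
    obtain g where g: "interval_vec I M g"
      "\<And>k \<xi>. k < length S \<Longrightarrow> \<xi> \<in> hull_hom [S ! k] x \<Longrightarrow> ?\<chi> (put_col (length S) k \<xi>) = \<iota> (S ! k) (g (S ! k)) \<xi>"
      using vec_of_functional[OF \<chi>' van'] by blast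
    have val: "?\<chi> (\<omega> * G3) = \<theta> a0 (g a0)"
      if "\<omega> \<in> hull_hom K x" "interval_covec I M \<theta>"
        "\<forall>k<length K. \<forall>m\<in>carrier (ob M (K ! k)). \<theta> (K ! k) m = \<iota> (K ! k) m (get_col k \<omega>)" for \<omega> \<theta>
      by (rule G3_value[OF that g(1)]) (use g(2)[OF p(1)] p(2) in simp)
    obtain \<tau> \<omega> \<delta> \<gamma> where z: "\<tau> \<in> hull_hom tt x" "\<omega> \<in> hull_hom K x" "\<delta> \<in> hull_hom S y" "\<gamma> \<in> hull_hom uu y"
      "v = [\<omega> * G3 + (\<tau> * G1 + \<alpha> * \<delta>), \<omega> * G2 + \<alpha> * \<gamma>]"
      using v(1) unfolding R1 P_trans_def by blast
    have e0: "\<omega> * G2 + \<alpha> * \<gamma> = 0\<^sub>m (length x) (length uu)" using v(2) z(5) by simp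
    obtain \<theta> where \<theta>: "interval_covec I M \<theta>"
      "\<forall>k<length K. \<forall>m\<in>carrier (ob M (K ! k)). \<theta> (K ! k) m = \<iota> (K ! k) m (get_col k \<omega>)"
      using neg[OF z(2,4) e0] G2_kernel[OF z(2)] by blast
    have "\<chi> v = ?\<chi> (\<omega> * G3)"
      using lf_add[OF \<chi>', of "\<omega> * G3" "\<tau> * G1 + \<alpha> * \<delta>"] G3S[OF z(2)] GA[OF z(1,3)] van'[OF z(1,3)] z(5) e0 by simp
    also have "\<dots> = \<theta> a0 (g a0)" by (rule val[OF z(2) \<theta>])
    also have "\<dots> = (\<Sum>i<n. \<theta> a0 (f i a0) * \<phi> i a0 (g a0))" by (rule gen[OF g(1) \<theta>(1)])
    also have "\<dots> = (\<Sum>i<n. \<chi> (?k i) * ?\<psi> i v)"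
    proof (rule sum.cong)
      fix i assume "i \<in> {..<n}"
      then have i: "i < n" by simp
      show "\<theta> a0 (f i a0) * \<phi> i a0 (g a0) = \<chi> (?k i) * ?\<psi> i v"
        using val[OF ww(1)[OF i] \<phi>[OF i] ww(3)[OF i]] Phi_G3[OF z(2) \<theta> f[OF i] z(1,3)] z(5) by simp
    qed simp
    finally show "\<chi> v = (\<Sum>i<n. \<chi> (?k i) * ?\<psi> i v)" .
  qed
  then show ?thesis
    by (simp only: rank_inj_def block_rank_def lin_rank_def Let_def P_space_def)
qed

end

section \<open>The multiplicity formulas\<close>

text \<open>The number of copies of V_I in any decomposition is a pairing rank of M, so uniqueness
  of the pairing rank singles out the value that \<open>mult_in\<close> describes. Uniqueness enters
  as an assumption, to be discharged by a rank formula.\<close>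

lemma pairing_rank_mult_in:
  fixes M :: "('p::{finite, order}, 'k::field, 'v) rep"
  assumes I: "interval I" and M: "A_module M" and a: "a \<in> I"
    and unique: "\<And>m n. pairing_rank I a M m \<Longrightarrow> pairing_rank I a M n \<Longrightarrow> m = n"
  shows "pairing_rank I a M (mult_in M (interval_rep I :: ('p, 'k, 'k) rep))"
proof -
  let ?count = "\<lambda>Ns :: ('p, 'k, 'v) rep list. length (filter (\<lambda>N. rep_iso N (interval_rep I :: ('p, 'k, 'k) rep)) Ns)"
  have count: "pairing_rank I a M (?count Ns)" if "\<forall>N\<in>set Ns. indecomposable N" "rep_iso M (rep_dsum Ns)"
    for Ns :: "('p, 'k, 'v) rep list"
    by (rule pairing_rank_iso[OF M that(2) a pairing_rank_decomposition[OF I a that(1)]])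
  obtain Ns :: "('p, 'k, 'v) rep list" where Ns: "\<forall>N\<in>set Ns. indecomposable N" "rep_iso M (rep_dsum Ns)"
    using decomposition_exists[OF M] by blast
  have "mult_in M (interval_rep I :: ('p, 'k, 'k) rep) = ?count Ns"
    unfolding mult_in_def
  proof (rule the_equality)
    show "\<exists>Ns' :: ('p, 'k, 'v) rep list. (\<forall>N\<in>set Ns'. indecomposable N) \<and> rep_iso M (rep_dsum Ns') \<and> ?count Ns = ?count Ns'"
      using Ns by blast
  next
    fix n
    assume "\<exists>Ns' :: ('p, 'k, 'v) rep list. (\<forall>N\<in>set Ns'. indecomposable N) \<and> rep_iso M (rep_dsum Ns') \<and> n = ?count Ns'"
    then obtain Ns' :: "('p, 'k, 'v) rep list" where Ns': "\<forall>N\<in>set Ns'. indecomposable N" "rep_iso M (rep_dsum Ns')"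
      and n: "n = ?count Ns'" by blast
    show "n = ?count Ns" unfolding n by (rule unique[OF count[OF Ns'] count[OF Ns]])
  qed
  then show ?thesis using count[OF Ns] by simp
qed

context projective_setting
begin

text \<open>\<open>rank_proj_difference\<close> serves twice: any two pairing ranks equal the same
  difference of ranks, which is the uniqueness, and for the multiplicity it is the formula
  itself.\<close>

lemma mult_in_rank_proj:
  "int (mult_in M (interval_rep I :: ('p, 'k, 'k) rep))
    = int (rank_proj S tt uu K x y \<alpha> G1 (P'_trans G3) G2)
    - int (rank_proj S tt uu K x y \<alpha> G1 (zero_map (P'_space K x)) G2)"
proof -
  have a: "a0 \<in> I" using a0 by (simp add: sc_def)
  have "m = n" if "pairing_rank I a0 M m" "pairing_rank I a0 M n" for m n
    using rank_proj_difference[OF that(1)] rank_proj_difference[OF that(2)] by linarith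
  from rank_proj_difference[OF pairing_rank_mult_in[OF I M a this]]
  show ?thesis by linarith
qed

end

context injective_setting
begin

lemma mult_in_rank_inj:
  "int (mult_in M (interval_rep I :: ('p, 'k, 'k) rep))
    = int (rank_inj S tt uu K x y \<alpha> G1 (P_trans G3) G2)
    - int (rank_inj S tt uu K x y \<alpha> G1 (zero_map (P_space S x)) G2)"
proof -
  have a: "a0 \<in> I" using a0 by (simp add: sc_def)
  have "m = n" if "pairing_rank I a0 M m" "pairing_rank I a0 M n" for m n
    using rank_inj_difference[OF that(1)] rank_inj_difference[OF that(2)] by linarith
  from rank_inj_difference[OF pairing_rank_mult_in[OF I M a this]]
  show ?thesis by linarith
qed

end

theorem mainTheorem4:
  fixes I :: "'p::{finite, order} set"
    and M :: "('p, 'k::field, 'v) rep"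
    and r_sc r_sk :: "('p \<times> 'p) set"
    and c d :: "'p \<Rightarrow> 'p"
    and a\<^sub>0 b\<^sub>0 :: 'p
    and S SU K KD :: "'p list"
    and S1 K1 :: "('p set \<times> 'p) list"
  assumes "interval I" and "A_module M"
    and "linear_order_on (sc I) r_sc" and "linear_order_on (sk I) r_sk"
    and "choice_up I c" and "choice_down I d"
    and "b\<^sub>0 \<in> sk I" and "a\<^sub>0 \<in> sc I" and "a\<^sub>0 \<le> b\<^sub>0"
    and "lists_set S (sc I)" and "lists_set S1 (sc1 r_sc I)" and "lists_set SU (sc (Up_out I))"
    and "lists_set K (sk I)" and "lists_set K1 (sk1 r_sk I)" and "lists_set KD (sk (Down_out I))"
  shows
   "(\<forall>x y \<alpha>. proj_presentation M x y \<alpha> \<longrightarrow>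
      (\<forall>L. L = S1 \<or> (\<exists>m n \<phi>. grid_chart m n \<phi> \<and> lists_set L (sc1_circ \<phi> I)) \<longrightarrow>
        (let s = S; t = map snd L @ SU; u = KD @ map snd K1; w = K;
             h1 = g1 r_sc c S L SU; h2 = g2 r_sk d KD K1 K; h3 = g3 b\<^sub>0 a\<^sub>0 S K
         in int (mult_in M (interval_rep I :: ('p, 'k, 'k) rep))
              = int (rank_proj s t u w x y \<alpha> h1 (P'_trans h3) h2)
              - int (rank_proj s t u w x y \<alpha> h1 (zero_map (P'_space w x)) h2)))) \<and>
    (\<forall>x' y' \<alpha>'. inj_copresentation M x' y' \<alpha>' \<longrightarrow>
      (\<forall>L. L = K1 \<or> (\<exists>m n \<phi>. grid_chart m n \<phi> \<and> lists_set L (sk1_circ \<phi> I)) \<longrightarrow>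
        (let s = S; t = map snd S1 @ SU; u = KD @ map snd L; w = K;
             h1 = g1 r_sc c S S1 SU; h2 = g2 r_sk d KD L K; h3 = g3 b\<^sub>0 a\<^sub>0 S K
         in int (mult_in M (interval_rep I :: ('p, 'k, 'k) rep))
              = int (rank_inj s t u w x' y' \<alpha>' h1 (P_trans h3) h2)
              - int (rank_inj s t u w x' y' \<alpha>' h1 (zero_map (P_space s x')) h2))))"
proof -
  \<comment> \<open>Stated for arbitrary connecting lists, since the first part varies the list
    belonging to g1 and the second part the one belonging to g2.\<close>
  have setting: "interval_setting I M r_sc r_sk c d a\<^sub>0 b\<^sub>0 S SU K KD T R"
    if "connecting_up I r_sc (set T)" "connecting_down I r_sk (set R)" for T R
    unfolding interval_setting_def using assms that by blast
  have up: "connecting_up I r_sc (set S1)" and down: "connecting_down I r_sk (set K1)"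
    using connecting_up_sc1[OF assms(3)] connecting_down_sk1[OF assms(4)] assms(11,14)
    by (simp_all add: lists_set_def)
  have up': "connecting_up I r_sc (set L)"
    if "L = S1 \<or> (\<exists>m n \<phi>. grid_chart m n \<phi> \<and> lists_set L (sc1_circ \<phi> I))" for L
    using that
  proof (elim disjE exE conjE)
    fix m n \<phi> assume g: "grid_chart m n \<phi>" and L: "lists_set L (sc1_circ \<phi> I)"
    show ?thesis using connecting_up_circ[OF assms(3) g] L by (simp add: lists_set_def)
  qed (simp add: up)
  have down': "connecting_down I r_sk (set L)"
    if "L = K1 \<or> (\<exists>m n \<phi>. grid_chart m n \<phi> \<and> lists_set L (sk1_circ \<phi> I))" for L
    using that
  proof (elim disjE exE conjE)
    fix m n \<phi> assume g: "grid_chart m n \<phi>" and L: "lists_set L (sk1_circ \<phi> I)"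
    show ?thesis using connecting_down_circ[OF assms(4) g] L by (simp add: lists_set_def)
  qed (simp add: down)
  have "\<exists>\<pi>. projective_setting I M r_sc r_sk c d a\<^sub>0 b\<^sub>0 S SU K KD L K1 x y \<alpha> \<pi>"
    if "proj_presentation M x y \<alpha>" "connecting_up I r_sc (set L)" for x y \<alpha> L
  proof -
    \<comment> \<open>The locale axioms are the clauses of \<open>proj_presentation\<close> with the
      quantifier over points distributed over the conjunction.\<close>
    have "\<exists>\<pi>. projective_setting_axioms M x y \<alpha> \<pi>"
      using that(1) by (simp only: proj_presentation_def projective_setting_axioms_def all_conj_distrib ex_simps conj_assoc simp_thms)
    then obtain \<pi> where "projective_setting_axioms M x y \<alpha> \<pi>" by (rule exE)
    then show ?thesis
      using setting[OF that(2) down] unfolding projective_setting_def by (intro exI conjI)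
  qed
  moreover have "\<exists>\<iota>. injective_setting I M r_sc r_sk c d a\<^sub>0 b\<^sub>0 S SU K KD S1 L x y \<alpha> \<iota>"
    if "inj_copresentation M x y \<alpha>" "connecting_down I r_sk (set L)" for x y \<alpha> L
  proof -
    have "\<exists>\<iota>. injective_setting_axioms M x y \<alpha> \<iota>"
      using that(1) by (simp only: inj_copresentation_def injective_setting_axioms_def all_conj_distrib ex_simps conj_assoc simp_thms)
    then obtain \<iota> where "injective_setting_axioms M x y \<alpha> \<iota>" by (rule exE)
    then show ?thesis
      using setting[OF up that(2)] unfolding injective_setting_def by (intro exI conjI)
  qed
  ultimately show ?thesis
    unfolding Let_def
  proof (intro conjI allI impI, goal_cases)
    case (1 x y \<alpha> L)
    then obtain \<pi> where "projective_setting I M r_sc r_sk c d a\<^sub>0 b\<^sub>0 S SU K KD L K1 x y \<alpha> \<pi>"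
      using up' by blast
    then show ?case by (rule projective_setting.mult_in_rank_proj)
  next
    case (2 x y \<alpha> L)
    then obtain \<iota> where "injective_setting I M r_sc r_sk c d a\<^sub>0 b\<^sub>0 S SU K KD S1 L x y \<alpha> \<iota>"
      using down' by blast
    then show ?case by (rule injective_setting.mult_in_rank_inj)
  qed
qed

end
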